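(* Let $d>6$ and assume that $( * )$ (defined in the context) holds. There exist $c,C>0$ such that, for every $n\geq 1$, $$\frac{c}{n^2}\leq \theta_n(p_c)\leq \frac{C}{n^2}.$$
   Context: Setting: $\mathcal E$ is a fixed edge set on $\mathbb Z^d$, either nearest-neighbour, $\mathcal E=\{\{x,y\}:\|x-y\|_1=1\}$, or spread-out with parameter $L\ge 1$, $\mathcal E=\{\{x,y\}: x\neq y,\ \|x-y\|_1\le L\}$. Write $x\sim y$ if $\{x,y\}\in\mathcal E$. $\mathbb P_p$ is Bernoulli bond percolation (each edge of $\mathcal E$ open independently with probability $p$), and $p_c:=\inf\{p:\mathbb P_p[0\leftrightarrow\infty]>0\}\in(0,1)$. $\tau_p(x,y):=\mathbb P_p[x\leftrightarrow y]$. $|\cdot|$ is the $\ell^\infty$ norm, $\Lambda_n:=\{y\in\mathbb Z^d:|y|\le n\}$, $\partial S:=\{x\in S:\exists y\notin S,\ x\sim y\}$. The one-arm probability is $\theta_n(p):=\mathbb P_p[0\leftrightarrow\partial\Lambda_n]$, the probability that there is an open path from $0$ to $\partial\Lambda_n$. Assumption $( * )$: there are constants $0<a\le b<\infty$ with $a(1\vee|x-y|)^{-(d-2)}\le\tau_{p_c}(x,y)\le b(1\vee|x-y|)^{-(d-2)}$ for all $x,y\in\mathbb Z^d$. *)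

theory Defs
  imports "HOL-Probability.Probability"
begin

text \<open>
  \<open>\<int>\<^sup>d\<close> is rendered as \<^typ>\<open>int ^ 'd\<close> with \<open>d = CARD('d)\<close>; an undirected edge is the
  two-element set of its endpoints.
\<close>

type_synonym 'd edge = "(int ^ 'd) set"

definition norm_l1 :: "int ^ 'd::finite \<Rightarrow> int" where
  "norm_l1 x = (\<Sum>i\<in>UNIV. \<bar>x $ i\<bar>)"

definition norm_linf :: "int ^ 'd::finite \<Rightarrow> int" where
  "norm_linf x = Max (range (\<lambda>i. \<bar>x $ i\<bar>))"

definition nearest_neighbour_edges :: "'d::finite edge set" where
  "nearest_neighbour_edges = {{x, y} | x y. norm_l1 (x - y) = 1}"

definition spread_out_edges :: "nat \<Rightarrow> 'd::finite edge set" where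
  "spread_out_edges L = {{x, y} | x y. x \<noteq> y \<and> norm_l1 (x - y) \<le> int L}"

definition adjacent :: "'d::finite edge set \<Rightarrow> int ^ 'd \<Rightarrow> int ^ 'd \<Rightarrow> bool" where
  "adjacent \<E> x y \<longleftrightarrow> {x, y} \<in> \<E>"

text \<open>
  A configuration \<open>\<omega>\<close> maps each edge to \<^term>\<open>True\<close> (open) or \<^term>\<open>False\<close> (closed).  Only its
  values on \<open>\<E>\<close> carry meaning: elements of the product space are \<^const>\<open>undefined\<close> elsewhere.
\<close>

definition percolation :: "'d::finite edge set \<Rightarrow> real \<Rightarrow> ('d edge \<Rightarrow> bool) measure" where
  "percolation \<E> p = PiM \<E> (\<lambda>_. measure_pmf (bernoulli_pmf p))"

definition open_adjacent ::
    "'d::finite edge set \<Rightarrow> ('d edge \<Rightarrow> bool) \<Rightarrow> int ^ 'd \<Rightarrow> int ^ 'd \<Rightarrow> bool" where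
  "open_adjacent \<E> \<omega> x y \<longleftrightarrow> adjacent \<E> x y \<and> \<omega> {x, y}"

definition connected_in ::
    "'d::finite edge set \<Rightarrow> ('d edge \<Rightarrow> bool) \<Rightarrow> int ^ 'd \<Rightarrow> int ^ 'd \<Rightarrow> bool" where
  "connected_in \<E> \<omega> x y \<longleftrightarrow> (open_adjacent \<E> \<omega>)\<^sup>*\<^sup>* x y"

definition cluster ::
    "'d::finite edge set \<Rightarrow> ('d edge \<Rightarrow> bool) \<Rightarrow> int ^ 'd \<Rightarrow> (int ^ 'd) set" where
  "cluster \<E> \<omega> x = {y. connected_in \<E> \<omega> x y}"

definition percolation_prob :: "'d::finite edge set \<Rightarrow> real \<Rightarrow> real" where
  "percolation_prob \<E> p =
     measure (percolation \<E> p) {\<omega> \<in> space (percolation \<E> p). infinite (cluster \<E> \<omega> 0)}"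

definition p_crit :: "'d::finite edge set \<Rightarrow> real" where
  "p_crit \<E> = Inf {p \<in> {0..1}. percolation_prob \<E> p > 0}"

definition two_point :: "'d::finite edge set \<Rightarrow> real \<Rightarrow> int ^ 'd \<Rightarrow> int ^ 'd \<Rightarrow> real" where
  "two_point \<E> p x y =
     measure (percolation \<E> p) {\<omega> \<in> space (percolation \<E> p). connected_in \<E> \<omega> x y}"

definition box :: "nat \<Rightarrow> (int ^ 'd::finite) set" where
  "box n = {y. norm_linf y \<le> int n}"

definition vertex_boundary :: "'d::finite edge set \<Rightarrow> (int ^ 'd) set \<Rightarrow> (int ^ 'd) set" where
  "vertex_boundary \<E> S = {x \<in> S. \<exists>y. y \<notin> S \<and> adjacent \<E> x y}"

definition one_arm :: "'d::finite edge set \<Rightarrow> nat \<Rightarrow> real \<Rightarrow> real" where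
  "one_arm \<E> n p =
     measure (percolation \<E> p)
       {\<omega> \<in> space (percolation \<E> p).
          \<exists>y \<in> vertex_boundary \<E> (box n). connected_in \<E> \<omega> 0 y}"

definition two_point_estimate :: "'d::finite edge set \<Rightarrow> bool" where
  "two_point_estimate \<E> \<longleftrightarrow>
     (\<exists>a b :: real. 0 < a \<and> a \<le> b \<and>
        (\<forall>x y.
           a * max 1 (real_of_int (norm_linf (x - y))) powi (- (int CARD('d) - 2))
             \<le> two_point \<E> (p_crit \<E>) x y \<and>
           two_point \<E> (p_crit \<E>) x y
             \<le> b * max 1 (real_of_int (norm_linf (x - y))) powi (- (int CARD('d) - 2))))"

text \<open>
  Since \<^const>\<open>measure\<close> is \<open>0\<close> on non-measurable sets, the three probabilities above are meaningful
  only because the events involved are measurable.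
\<close>

lemma connected_in_measurable:
  fixes \<E> :: "'d::finite edge set"
  shows "{\<omega> \<in> space (percolation \<E> p). connected_in \<E> \<omega> x y} \<in> sets (percolation \<E> p)"
proof -
  have step: "{\<omega> \<in> space (percolation \<E> p). open_adjacent \<E> \<omega> u v} \<in> sets (percolation \<E> p)"
    for u v
  proof (cases "{u, v} \<in> \<E>")
    case True
    then have "(\<lambda>\<omega>. \<omega> {u, v}) \<in> measurable (percolation \<E> p) (count_space UNIV)"
      unfolding percolation_def
      using measurable_component_singleton[of "{u, v}" \<E> "\<lambda>_. measure_pmf (bernoulli_pmf p)"]
      by (simp cong: measurable_cong_sets)
    then have "{\<omega> \<in> space (percolation \<E> p). \<omega> {u, v}} \<in> sets (percolation \<E> p)"
      by measurable
    with True show ?thesis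
      by (simp add: open_adjacent_def adjacent_def)
  qed (simp add: open_adjacent_def adjacent_def)
  have "{\<omega> \<in> space (percolation \<E> p). (open_adjacent \<E> \<omega> ^^ k) x y} \<in> sets (percolation \<E> p)"
    for k
  proof (induction k arbitrary: y)
    case (Suc k)
    have "{\<omega> \<in> space (percolation \<E> p). (open_adjacent \<E> \<omega> ^^ Suc k) x y} =
          (\<Union>z. {\<omega> \<in> space (percolation \<E> p). (open_adjacent \<E> \<omega> ^^ k) x z} \<inter>
               {\<omega> \<in> space (percolation \<E> p). open_adjacent \<E> \<omega> z y})"
      by auto
    then show ?case
      using Suc step by auto
  qed simp
  moreover have "{\<omega> \<in> space (percolation \<E> p). connected_in \<E> \<omega> x y} =
      (\<Union>k. {\<omega> \<in> space (percolation \<E> p). (open_adjacent \<E> \<omega> ^^ k) x y})"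
    by (auto simp: connected_in_def rtranclp_power)
  ultimately show ?thesis
    by auto
qed

lemma one_arm_measurable:
  fixes \<E> :: "'d::finite edge set"
  shows "{\<omega> \<in> space (percolation \<E> p). \<exists>y \<in> vertex_boundary \<E> (box n). connected_in \<E> \<omega> 0 y}
           \<in> sets (percolation \<E> p)"
proof -
  have "{\<omega> \<in> space (percolation \<E> p). \<exists>y \<in> vertex_boundary \<E> (box n). connected_in \<E> \<omega> 0 y} =
      (\<Union>y \<in> vertex_boundary \<E> (box n). {\<omega> \<in> space (percolation \<E> p). connected_in \<E> \<omega> 0 y})"
    by auto
  then show ?thesis
    using connected_in_measurable[of \<E> p 0] by (auto intro!: sets.countable_UN')
qed

lemma infinite_cluster_measurable:
  fixes \<E> :: "'d::finite edge set"
  shows "{\<omega> \<in> space (percolation \<E> p). infinite (cluster \<E> \<omega> 0)} \<in> sets (percolation \<E> p)"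
proof -
  let ?M = "percolation \<E> p"
  let ?D = "\<lambda>A. \<Union>y \<in> - A. {\<omega> \<in> space ?M. connected_in \<E> \<omega> 0 y}"
  have "countable {A :: (int ^ 'd) set. finite A}"
    using countable_Collect_finite_subset[of "UNIV :: (int ^ 'd) set"] by simp
  moreover have "?D A \<in> sets ?M" for A
    using connected_in_measurable[of \<E> p 0] by (intro sets.countable_UN') auto
  ultimately have "(\<Inter>A \<in> {A. finite A}. ?D A) \<in> sets ?M"
    by (intro sets.countable_INT') blast+
  moreover have "{\<omega> \<in> space ?M. infinite (cluster \<E> \<omega> 0)} = (\<Inter>A \<in> {A. finite A}. ?D A)"
  proof (intro set_eqI iffI)
    fix \<omega> assume \<omega>: "\<omega> \<in> {\<omega> \<in> space ?M. infinite (cluster \<E> \<omega> 0)}"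
    have "\<exists>y \<in> - A. connected_in \<E> \<omega> 0 y" if "finite A" for A
    proof -
      have "\<not> cluster \<E> \<omega> 0 \<subseteq> A"
        using \<omega> that finite_subset by blast
      then show ?thesis
        by (auto simp: cluster_def)
    qed
    with \<omega> show "\<omega> \<in> (\<Inter>A \<in> {A. finite A}. ?D A)"
      by blast
  next
    fix \<omega> assume *: "\<omega> \<in> (\<Inter>A \<in> {A. finite A}. ?D A)"
    then have "\<omega> \<in> ?D {}"
      by blast
    moreover have "infinite (cluster \<E> \<omega> 0)"
    proof
      assume "finite (cluster \<E> \<omega> 0)"
      with * have "\<omega> \<in> ?D (cluster \<E> \<omega> 0)"
        by blast
      then show False
        by (auto simp: cluster_def)
    qed
    ultimately show "\<omega> \<in> {\<omega> \<in> space ?M. infinite (cluster \<E> \<omega> 0)}"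
      by blast
  qed
  ultimately show ?thesis
    by simp
qed

end

theory Submission
  imports Defs
begin

text \<open>
  All inequalities (Harris, BK, Russo, and a Fisher-information bound for the derivative of \<open>sqrt (P(A))\<close>)
  are proved for finitely many edges; infinite volume enters through suprema of increasing events.
  The tree-graph inequality makes \<open>\<chi>(p) \<le> C / (p_c - p)\<close>.

  Let \<open>\<Phi>_k(p)\<close> be the expected number of boundary vertices of \<open>box k\<close> connected to \<open>0\<close> inside the box.
  Around most such vertices \<open>y\<close> the cluster of \<open>0\<close> is thin, since a large cluster splits into many
  disjoint large ones.  Hence a point just outside the box near \<open>y\<close> has a disjoint cluster with of order \<open>m\<^sup>2\<close>
  points within distance \<open>m\<close>, and opening a short path to it produces a pivotal edge.  This reverses the
  Simon inequality: up to a small error, \<open>\<Phi>_k(p)\<close> is at most \<open>C / m\<^sup>2\<close> times the sum of the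
  two-point function over the points at distance at most \<open>2 m\<close> from the boundary.  Summed over disjoint annuli and
  compared with \<open>\<chi>\<close>, it gives \<open>\<Phi>_k(p) \<le> \<alpha>\<close> for some \<open>k \<le> n\<close>, where \<open>p = p_c - K / n\<^sup>2\<close>
  and \<open>\<alpha>\<close> is as small as desired.

  The Simon inequality bounds \<open>arm p (2 n)\<close> by a small multiple of \<open>arm p (n / 2)\<close>, and the Fisher-information
  bound yields \<open>sqrt (arm p_c (2 n)) \<le> sqrt (arm p (2 n)) + C K / n\<close>; together they bound
  \<open>n * sqrt (arm p_c n)\<close> by induction.  The lower bound is a second-moment estimate.
\<close>

section \<open>Finite Bernoulli percolation\<close>

text \<open>The obstacle is conditioning: the cluster of \<open>0\<close> near a boundary vertex
  \<open>y\<close> is biased by the connection of \<open>0\<close> to \<open>y\<close>, so thinness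
  cannot be read off an unconditional estimate. The event is therefore confined to a box around
  \<open>y\<close>, where it is independent of the path up to its entrance, and the unknown outside
  is replaced by its worst case, a wiring of the rim. The wiring is rarely felt if the rim is far
  out, which takes some polynomial decay of the arm at \<open>pc\<close> beforehand; an exponent 1/3
  suffices, and the Fisher-information bound gives it through balls of the intrinsic metric.
  Independence costs a power of the scale (a sum over a layer of the box); it is beaten because
  large clusters are rarer than any fixed power of the scale.

  The square root is the natural quantity for the final induction: its derivative is at most of
  order \<open>n\<close>, the root of the expected number of edges revealed in a box, so moving
  \<open>p\<close> by \<open>K / n^2\<close> costs a multiple of \<open>K / n\<close>, exactly the
  size of the claimed bound. The factor gained from Simon's inequality only has to beat the ratio of
  the two scales.\<close>

definition bexp :: "real \<Rightarrow> 'e set \<Rightarrow> ('e set \<Rightarrow> real) \<Rightarrow> real" where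
  "bexp p E f = (\<Sum>\<xi>\<in>Pow E. p ^ card \<xi> * (1 - p) ^ card (E - \<xi>) * f \<xi>)"

definition bprob :: "real \<Rightarrow> 'e set \<Rightarrow> ('e set \<Rightarrow> bool) \<Rightarrow> real" where
  "bprob p E A = bexp p E (\<lambda>\<xi>. of_bool (A \<xi>))"

lemma bexp_empty [simp]: "bexp p {} f = f {}"
  by (simp add: bexp_def)

text \<open>The recursion behind all finite-volume inductions. A configuration is its set of open
  edges and the expectation is a polynomial in \<open>p\<close>, so one coin at a time can be split
  off without any measure theory.\<close>

lemma bexp_insert:
  assumes "finite E" "e \<notin> E"
  shows "bexp p (insert e E) f = (1 - p) * bexp p E f + p * bexp p E (\<lambda>\<xi>. f (insert e \<xi>))"
proof -
  have inj: "inj_on (insert e) (Pow E)"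
    using assms(2) by (auto simp: inj_on_def)
  have disj: "Pow E \<inter> insert e ` Pow E = {}"
    using assms(2) by auto
  have 1: "(\<Sum>\<xi>\<in>Pow E. p ^ card \<xi> * (1 - p) ^ card (insert e E - \<xi>) * f \<xi>) = (1 - p) * bexp p E f"
    unfolding bexp_def sum_distrib_left
  proof (rule sum.cong)
    fix \<xi> assume "\<xi> \<in> Pow E"
    then have "insert e E - \<xi> = insert e (E - \<xi>)" "e \<notin> E - \<xi>" using assms(2) by auto
    then have "card (insert e E - \<xi>) = Suc (card (E - \<xi>))" using assms(1) by simp
    then show "p ^ card \<xi> * (1 - p) ^ card (insert e E - \<xi>) * f \<xi> = (1 - p) * (p ^ card \<xi> * (1 - p) ^ card (E - \<xi>) * f \<xi>)"
      by simp
  qed simp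
  have 2: "(\<Sum>\<xi>\<in>insert e ` Pow E. p ^ card \<xi> * (1 - p) ^ card (insert e E - \<xi>) * f \<xi>)
     = p * bexp p E (\<lambda>\<xi>. f (insert e \<xi>))"
    unfolding bexp_def sum_distrib_left sum.reindex[OF inj] o_def
  proof (rule sum.cong)
    fix \<xi> assume w: "\<xi> \<in> Pow E"
    then have "insert e E - insert e \<xi> = E - \<xi>" using assms(2) by auto
    moreover have "card (insert e \<xi>) = Suc (card \<xi>)"
      using w assms by (meson PowD card_insert_disjoint finite_subset subsetD)
    ultimately show "p ^ card (insert e \<xi>) * (1 - p) ^ card (insert e E - insert e \<xi>) * f (insert e \<xi>)
       = p * (p ^ card \<xi> * (1 - p) ^ card (E - \<xi>) * f (insert e \<xi>))"
      by simp
  qed simp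
  show ?thesis
    unfolding bexp_def[of p "insert e E"] Pow_insert
    by (subst sum.union_disjoint) (use assms(1) disj 1 2 in auto)
qed

lemma bexp_cong: "(\<And>\<xi>. \<xi> \<subseteq> E \<Longrightarrow> f \<xi> = g \<xi>) \<Longrightarrow> bexp p E f = bexp p E g"
  by (auto simp: bexp_def intro!: sum.cong)

lemma bexp_add: "bexp p E (\<lambda>\<xi>. f \<xi> + g \<xi>) = bexp p E f + bexp p E g"
  by (simp add: bexp_def algebra_simps sum.distrib)

lemma bexp_diff: "bexp p E (\<lambda>\<xi>. f \<xi> - g \<xi>) = bexp p E f - bexp p E g"
  by (simp add: bexp_def algebra_simps sum_subtractf)

lemma bexp_cmult: "bexp p E (\<lambda>\<xi>. c * f \<xi>) = c * bexp p E f"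
  by (simp add: bexp_def sum_distrib_left mult.left_commute)

lemma bexp_sum: "bexp p E (\<lambda>\<xi>. \<Sum>i\<in>I. f i \<xi>) = (\<Sum>i\<in>I. bexp p E (f i))"
  unfolding bexp_def sum_distrib_left by (rule sum.swap)

lemma bexp_const [simp]: "finite E \<Longrightarrow> bexp p E (\<lambda>_. c) = c"
  by (induction E rule: finite_induct) (auto simp: bexp_insert algebra_simps)

lemma bexp_mono:
  assumes "0 \<le> p" "p \<le> 1" "\<And>\<xi>. \<xi> \<subseteq> E \<Longrightarrow> f \<xi> \<le> g \<xi>"
  shows "bexp p E f \<le> bexp p E g"
  unfolding bexp_def using assms by (intro sum_mono mult_left_mono) auto

lemma bexp_nonneg:
  assumes "0 \<le> p" "p \<le> 1" "\<And>\<xi>. \<xi> \<subseteq> E \<Longrightarrow> 0 \<le> f \<xi>"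
  shows "0 \<le> bexp p E f"
  unfolding bexp_def using assms by (intro sum_nonneg mult_nonneg_nonneg) auto

text \<open>The state of \<open>e\<close> in the configuration is forgotten and its coin tossed
  anew.\<close>

lemma bexp_resample:
  assumes "finite E" "e \<in> E"
  shows "bexp p E f = bexp p E (\<lambda>\<xi>. p * f (insert e \<xi>) + (1 - p) * f (\<xi> - {e}))"
proof -
  define E' where "E' = E - {e}"
  have E: "E = insert e E'" "e \<notin> E'" "finite E'" using assms by (auto simp: E'_def)
  have 1: "\<xi> - {e} = \<xi>" "insert e \<xi> - {e} = \<xi>" if "\<xi> \<subseteq> E'" for \<xi>
    using that E(2) by auto
  have "bexp p E' (\<lambda>\<xi>. p * f (insert e \<xi>) + (1 - p) * f (\<xi> - {e})) = p * bexp p E' (\<lambda>\<xi>. f (insert e \<xi>)) + (1 - p) * bexp p E' f"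
    unfolding bexp_cmult[symmetric] bexp_add[symmetric] by (rule bexp_cong) (simp only: 1)
  moreover have "bexp p E' (\<lambda>\<xi>. p * f (insert e (insert e \<xi>)) + (1 - p) * f (insert e \<xi> - {e})) = p * bexp p E' (\<lambda>\<xi>. f (insert e \<xi>)) + (1 - p) * bexp p E' f"
    unfolding bexp_cmult[symmetric] bexp_add[symmetric] by (rule bexp_cong) (simp only: 1 insert_absorb2)
  ultimately show ?thesis
    unfolding E(1) bexp_insert[OF E(3,2)] by (simp only: ) (simp add: algebra_simps)
qed

text \<open>Coins outside \<open>E'\<close> integrate out; this compares probabilities over
  different finite edge sets.\<close>

lemma bexp_local:
  assumes "finite E"
  shows "bexp p E (\<lambda>\<xi>. g (\<xi> \<inter> E')) = bexp p (E \<inter> E') g"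
  using assms
proof (induction E arbitrary: g rule: finite_induct)
  case (insert e E)
  show ?case
  proof (cases "e \<in> E'")
    case True
    have "bexp p E (\<lambda>\<xi>. g (insert e \<xi> \<inter> E')) = bexp p (E \<inter> E') (\<lambda>\<xi>. g (insert e \<xi>))"
      using insert.IH[of "\<lambda>\<xi>. g (insert e \<xi>)"] True by simp
    then show ?thesis
      using insert True by (simp add: bexp_insert)
  next
    case False
    then show ?thesis using insert by (simp add: bexp_insert algebra_simps)
  qed
qed simp

lemma bprob_local:
  assumes "finite E" "E' \<subseteq> E" "\<And>\<xi>. \<xi> \<subseteq> E \<Longrightarrow> A \<xi> = B (\<xi> \<inter> E')"
  shows "bprob p E A = bprob p E' B"
proof -
  have "bprob p E A = bexp p E (\<lambda>\<xi>. of_bool (B (\<xi> \<inter> E')))"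
    unfolding bprob_def by (rule bexp_cong) (use assms(3) in auto)
  also have "\<dots> = bprob p (E \<inter> E') B"
    unfolding bprob_def by (rule bexp_local[OF assms(1)])
  finally show ?thesis using assms(2) by (simp add: Int_absorb1)
qed

lemma bexp_indep:
  assumes "finite E" "E1 \<inter> E2 = {}"
  shows "bexp p E (\<lambda>\<xi>. f (\<xi> \<inter> E1) * g (\<xi> \<inter> E2)) =
    bexp p E (\<lambda>\<xi>. f (\<xi> \<inter> E1)) * bexp p E (\<lambda>\<xi>. g (\<xi> \<inter> E2))"
  using assms(1)
proof (induction E arbitrary: f g rule: finite_induct)
  case (insert e E)
  consider "e \<in> E1" "e \<notin> E2" | "e \<notin> E1" "e \<in> E2" | "e \<notin> E1" "e \<notin> E2" using assms(2) by auto
  then show ?case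
  proof cases
    case 1
    then show ?thesis
      using insert.IH[of f g] insert.IH[of "\<lambda>\<xi>. f (insert e \<xi>)" g] insert(1,2)
      by (simp add: bexp_insert) (simp add: algebra_simps)
  next
    case 2
    then show ?thesis
      using insert.IH[of f g] insert.IH[of f "\<lambda>\<xi>. g (insert e \<xi>)"] insert(1,2)
      by (simp add: bexp_insert) (simp add: algebra_simps)
  next
    case 3
    then show ?thesis
      using insert.IH[of f g] insert(1,2)
      by (simp add: bexp_insert) (simp add: algebra_simps)
  qed
qed simp

lemma bprob_indep:
  assumes "finite E" "E1 \<inter> E2 = {}"
    and "\<And>\<xi>. \<xi> \<subseteq> E \<Longrightarrow> A \<xi> = A (\<xi> \<inter> E1)" "\<And>\<xi>. \<xi> \<subseteq> E \<Longrightarrow> B \<xi> = B (\<xi> \<inter> E2)"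
  shows "bprob p E (\<lambda>\<xi>. A \<xi> \<and> B \<xi>) = bprob p E A * bprob p E B"
proof -
  have "bprob p E (\<lambda>\<xi>. A \<xi> \<and> B \<xi>) = bexp p E (\<lambda>\<xi>. of_bool (A (\<xi> \<inter> E1)) * of_bool (B (\<xi> \<inter> E2)))"
    unfolding bprob_def by (rule bexp_cong) (use assms(3,4) in auto)
  also have "\<dots> = bexp p E (\<lambda>\<xi>. of_bool (A (\<xi> \<inter> E1))) * bexp p E (\<lambda>\<xi>. of_bool (B (\<xi> \<inter> E2)))"
    by (rule bexp_indep[OF assms(1,2), of p "\<lambda>\<xi>. of_bool (A \<xi>)" "\<lambda>\<xi>. of_bool (B \<xi>)"])
  also have "\<dots> = bprob p E A * bprob p E B"
    unfolding bprob_def by (intro arg_cong2[where f = "(*)"] bexp_cong) (use assms(3,4) in auto)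
  finally show ?thesis .
qed

lemma bprob_mono:
  assumes "0 \<le> p" "p \<le> 1" "\<And>\<xi>. \<xi> \<subseteq> E \<Longrightarrow> A \<xi> \<Longrightarrow> B \<xi>"
  shows "bprob p E A \<le> bprob p E B"
  unfolding bprob_def using assms by (intro bexp_mono) auto

lemma bprob_nonneg: "0 \<le> p \<Longrightarrow> p \<le> 1 \<Longrightarrow> 0 \<le> bprob p E A"
  unfolding bprob_def by (intro bexp_nonneg) auto

lemma bprob_le_1: "0 \<le> p \<Longrightarrow> p \<le> 1 \<Longrightarrow> finite E \<Longrightarrow> bprob p E A \<le> 1"
  using bexp_mono[of p E "\<lambda>\<xi>. of_bool (A \<xi>)" "\<lambda>_. 1"] by (simp add: bprob_def)

lemma bprob_union_le:
  assumes "0 \<le> p" "p \<le> 1" "finite I" "\<And>\<xi>. \<xi> \<subseteq> E \<Longrightarrow> A \<xi> \<Longrightarrow> \<exists>i\<in>I. B i \<xi>"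
  shows "bprob p E A \<le> (\<Sum>i\<in>I. bprob p E (B i))"
  unfolding bprob_def bexp_sum[symmetric]
proof (rule bexp_mono[OF assms(1,2)])
  fix \<xi> assume w: "\<xi> \<subseteq> E"
  show "of_bool (A \<xi>) \<le> (\<Sum>i\<in>I. of_bool (B i \<xi>) :: real)"
  proof (cases "A \<xi>")
    case True
    then obtain i where i: "i \<in> I" "B i \<xi>" using assms(4) w by auto
    have "of_bool (B i \<xi>) \<le> (\<Sum>i\<in>I. of_bool (B i \<xi>) :: real)"
      using i(1) assms(3) by (intro member_le_sum) auto
    with i True show ?thesis by simp
  qed (auto intro!: sum_nonneg)
qed

lemma bprob_disj_le:
  assumes "0 \<le> p" "p \<le> 1" "\<And>\<xi>. \<xi> \<subseteq> E \<Longrightarrow> A \<xi> \<Longrightarrow> B \<xi> \<or> C \<xi>"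
  shows "bprob p E A \<le> bprob p E B + bprob p E C"
  unfolding bprob_def bexp_add[symmetric]
proof (rule bexp_mono[OF assms(1,2)])
  fix \<xi> assume "\<xi> \<subseteq> E"
  from assms(3)[OF this] show "of_bool (A \<xi>) \<le> of_bool (B \<xi>) + (of_bool (C \<xi>) :: real)"
    by (cases "A \<xi>") auto
qed

lemma markov_bprob:
  assumes "0 \<le> p" "p \<le> 1" "0 < c" "\<And>\<xi>. \<xi> \<subseteq> E \<Longrightarrow> 0 \<le> f \<xi>" "\<And>\<xi>. \<xi> \<subseteq> E \<Longrightarrow> A \<xi> \<Longrightarrow> c \<le> f \<xi>"
  shows "bprob p E A \<le> bexp p E f / c"
proof -
  have "c * bprob p E A \<le> bexp p E f"
    unfolding bprob_def bexp_cmult[symmetric] by (rule bexp_mono) (use assms in auto)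
  then show ?thesis using assms(3) by (simp add: field_simps)
qed

text \<open>The weights only count edges, so relabelling transports the law. Used for translations
  of the lattice.\<close>

lemma bexp_image:
  assumes "finite E" "inj h"
  shows "bexp p (h ` E) f = bexp p E (\<lambda>\<xi>. f (h ` \<xi>))"
  using assms(1)
proof (induction E arbitrary: f rule: finite_induct)
  case (insert e E)
  then have "h e \<notin> h ` E" using assms(2) by (auto dest: injD)
  with insert show ?case by (simp add: bexp_insert)
qed simp

section \<open>Increasing events: the Harris and BK inequalities\<close>

definition incr :: "('e set \<Rightarrow> bool) \<Rightarrow> bool" where
  "incr A \<longleftrightarrow> (\<forall>\<xi> \<eta>. \<xi> \<subseteq> \<eta> \<longrightarrow> A \<xi> \<longrightarrow> A \<eta>)"

lemma incrI: "(\<And>\<xi> \<eta>. \<xi> \<subseteq> \<eta> \<Longrightarrow> A \<xi> \<Longrightarrow> A \<eta>) \<Longrightarrow> incr A"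
  by (auto simp: incr_def)

lemma incrD: "incr A \<Longrightarrow> \<xi> \<subseteq> \<eta> \<Longrightarrow> A \<xi> \<Longrightarrow> A \<eta>"
  by (auto simp: incr_def)

lemma incr_insert: "incr A \<Longrightarrow> incr (\<lambda>\<xi>. A (insert e \<xi>))"
  by (rule incrI) (rule incrD[of A "insert e _"], auto)

lemma mono_insert:
  fixes f :: "'e set \<Rightarrow> real"
  assumes "mono f"
  shows "mono (\<lambda>\<xi>. f (insert e \<xi>))"
proof (rule monoI)
  fix x y :: "'e set" assume "x \<subseteq> y"
  then have "insert e x \<subseteq> insert e y" by auto
  then show "f (insert e x) \<le> f (insert e y)" by (rule monoD[OF assms])
qed

lemma mono_of_bool: "incr A \<Longrightarrow> mono (\<lambda>\<xi>. of_bool (A \<xi>) :: real)"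
  by (auto simp: mono_def of_bool_def dest: incrD)

text \<open>Conditioning on the last coin, the mean of the product of conditional means exceeds the
  product of the means by \<open>p (1 - p)\<close> times the product of the two increments, which
  are both nonnegative by monotonicity.\<close>

lemma harris:
  assumes "finite E" "0 \<le> p" "p \<le> 1" "mono f" "mono g"
  shows "bexp p E f * bexp p E g \<le> bexp p E (\<lambda>\<xi>. f \<xi> * g \<xi>)"
  using assms(1,4,5)
proof (induction E arbitrary: f g rule: finite_induct)
  case (insert e E)
  let ?f = "\<lambda>\<xi>. f (insert e \<xi>)" and ?g = "\<lambda>\<xi>. g (insert e \<xi>)"
  have m: "mono ?f" "mono ?g"
    using insert.prems by (auto intro: mono_insert)
  have le: "bexp p E f \<le> bexp p E ?f" "bexp p E g \<le> bexp p E ?g"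
    by (intro bexp_mono assms(2,3) monoD[OF insert.prems(1)] monoD[OF insert.prems(2)]; blast)+
  have "0 \<le> p * (1 - p) * ((bexp p E ?f - bexp p E f) * (bexp p E ?g - bexp p E g))"
    using le assms by (intro mult_nonneg_nonneg) auto
  then have "bexp p (insert e E) f * bexp p (insert e E) g
      \<le> (1 - p) * (bexp p E f * bexp p E g) + p * (bexp p E ?f * bexp p E ?g)"
    using insert(1,2) by (simp add: bexp_insert algebra_simps)
  also have "\<dots> \<le> (1 - p) * bexp p E (\<lambda>\<xi>. f \<xi> * g \<xi>) + p * bexp p E (\<lambda>\<xi>. ?f \<xi> * ?g \<xi>)"
    using insert.IH[OF insert.prems] insert.IH[OF m] assms by (intro add_mono mult_left_mono) auto
  finally show ?case using insert(1,2) by (simp add: bexp_insert)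
qed simp

lemma harris_prob:
  assumes "finite E" "0 \<le> p" "p \<le> 1" "incr A" "incr B"
  shows "bprob p E A * bprob p E B \<le> bprob p E (\<lambda>\<xi>. A \<xi> \<and> B \<xi>)"
proof -
  from harris[OF assms(1-3) mono_of_bool[OF assms(4)] mono_of_bool[OF assms(5)]] show ?thesis by (simp add: bprob_def of_bool_conj)
qed

text \<open>Witnesses consist of open edges only. For increasing events this is the usual disjoint
  occurrence, and it nests without side conditions.\<close>

definition disj_occ :: "('e set \<Rightarrow> bool) \<Rightarrow> ('e set \<Rightarrow> bool) \<Rightarrow> 'e set \<Rightarrow> bool" where
  "disj_occ A B \<xi> \<longleftrightarrow> (\<exists>\<xi>1 \<xi>2. \<xi>1 \<subseteq> \<xi> \<and> \<xi>2 \<subseteq> \<xi> \<and> \<xi>1 \<inter> \<xi>2 = {} \<and> A \<xi>1 \<and> B \<xi>2)"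

lemma incr_disj_occ: "incr (disj_occ A B)"
proof (rule incrI)
  fix \<xi> \<eta> assume "\<xi> \<subseteq> \<eta>" "disj_occ A B \<xi>"
  then obtain w1 w2 where "w1 \<subseteq> \<eta>" "w2 \<subseteq> \<eta>" "w1 \<inter> w2 = {}" "A w1" "B w2"
    unfolding disj_occ_def by (meson subset_trans)
  then show "disj_occ A B \<eta>" unfolding disj_occ_def by blast
qed

lemma disj_occI: "A u \<Longrightarrow> B v \<Longrightarrow> u \<subseteq> \<xi> \<Longrightarrow> v \<subseteq> \<xi> \<Longrightarrow> u \<inter> v = {} \<Longrightarrow> disj_occ A B \<xi>"
  unfolding disj_occ_def by blast

lemma disj_occ_mono:
  assumes "disj_occ A B \<xi>" "\<And>w. A w \<Longrightarrow> A' w" "\<And>w. B w \<Longrightarrow> B' w"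
  shows "disj_occ A' B' \<xi>"
  using assms unfolding disj_occ_def by blast

text \<open>The open edge \<open>e\<close> belongs to at most one of two disjoint witnesses, so it
  can be granted for free to one of the two events.\<close>

lemma disj_occ_insert:
  assumes "e \<notin> \<xi>" "incr A" "incr B"
  shows "disj_occ A B (insert e \<xi>) \<longleftrightarrow>
    disj_occ (\<lambda>\<xi>. A (insert e \<xi>)) B \<xi> \<or> disj_occ A (\<lambda>\<xi>. B (insert e \<xi>)) \<xi>"
proof
  assume "disj_occ A B (insert e \<xi>)"
  then obtain w1 w2 where w: "w1 \<subseteq> insert e \<xi>" "w2 \<subseteq> insert e \<xi>" "w1 \<inter> w2 = {}" "A w1" "B w2"
    by (auto simp: disj_occ_def)
  have mA: "A (insert e (w1 - {e}))" and mB: "B (insert e (w2 - {e}))"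
    using incrD[OF assms(2) _ w(4), of "insert e (w1 - {e})"] incrD[OF assms(3) _ w(5), of "insert e (w2 - {e})"] by auto
  show "disj_occ (\<lambda>\<xi>. A (insert e \<xi>)) B \<xi> \<or> disj_occ A (\<lambda>\<xi>. B (insert e \<xi>)) \<xi>"
  proof (cases "e \<in> w1")
    case True
    then have "w2 \<subseteq> \<xi>" "w1 - {e} \<subseteq> \<xi>" "(w1 - {e}) \<inter> w2 = {}" using w by auto
    with mA w(5) have "disj_occ (\<lambda>\<xi>. A (insert e \<xi>)) B \<xi>" by (intro disj_occI[where u = "w1 - {e}" and v = w2])
    then show ?thesis ..
  next
    case False
    then have "w1 \<subseteq> \<xi>" "w2 - {e} \<subseteq> \<xi>" "w1 \<inter> (w2 - {e}) = {}" using w by auto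
    with mB w(4) have "disj_occ A (\<lambda>\<xi>. B (insert e \<xi>)) \<xi>" by (intro disj_occI[where u = w1 and v = "w2 - {e}"])
    then show ?thesis ..
  qed
next
  assume "disj_occ (\<lambda>\<xi>. A (insert e \<xi>)) B \<xi> \<or> disj_occ A (\<lambda>\<xi>. B (insert e \<xi>)) \<xi>"
  then show "disj_occ A B (insert e \<xi>)"
  proof
    assume "disj_occ (\<lambda>\<xi>. A (insert e \<xi>)) B \<xi>"
    then obtain w1 w2 where w: "w1 \<subseteq> \<xi>" "w2 \<subseteq> \<xi>" "w1 \<inter> w2 = {}" "A (insert e w1)" "B w2"
      by (auto simp: disj_occ_def)
    then have "insert e w1 \<subseteq> insert e \<xi>" "w2 \<subseteq> insert e \<xi>" "insert e w1 \<inter> w2 = {}" using assms(1) by auto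
    then show ?thesis using w(4,5) by (intro disj_occI[where u = "insert e w1" and v = w2])
  next
    assume "disj_occ A (\<lambda>\<xi>. B (insert e \<xi>)) \<xi>"
    then obtain w1 w2 where w: "w1 \<subseteq> \<xi>" "w2 \<subseteq> \<xi>" "w1 \<inter> w2 = {}" "A w1" "B (insert e w2)"
      by (auto simp: disj_occ_def)
    then have "insert e w2 \<subseteq> insert e \<xi>" "w1 \<subseteq> insert e \<xi>" "w1 \<inter> insert e w2 = {}" using assms(1) by auto
    then show ?thesis using w(4,5) by (intro disj_occI[where u = w1 and v = "insert e w2"])
  qed
qed

text \<open>One edge at a time, the shared coin of \<open>e\<close> is compared with two independent coins; the pointwise
  inequality between the two averages is the whole content of the induction step.\<close>

lemma bk:
  assumes "finite E" "0 \<le> p" "p \<le> 1" "incr A" "incr B"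
  shows "bprob p E (disj_occ A B) \<le> bprob p E A * bprob p E B"
  using assms(1,4,5)
proof (induction E arbitrary: A B rule: finite_induct)
  case empty
  then show ?case by (auto simp: bprob_def disj_occ_def)
next
  case (insert e E)
  let ?A = "\<lambda>\<xi>. A (insert e \<xi>)" and ?B = "\<lambda>\<xi>. B (insert e \<xi>)"
  have m: "incr ?A" "incr ?B"
    using insert.prems by (auto intro: incr_insert)
  let ?c = "\<lambda>A B \<xi>. of_bool (disj_occ A B \<xi>) :: real"
  have "bprob p (insert e E) (disj_occ A B) =
      bexp p E (\<lambda>\<xi>. (1 - p) * ?c A B \<xi> + p * of_bool (disj_occ A B (insert e \<xi>)))"
    using insert(1,2) by (simp add: bprob_def bexp_insert bexp_add bexp_cmult)
  also have "\<dots> \<le> bexp p E (\<lambda>\<xi>. (1 - p)^2 * ?c A B \<xi> + p * (1 - p) * ?c ?A B \<xi>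
      + p * (1 - p) * ?c A ?B \<xi> + p^2 * ?c ?A ?B \<xi>)"
  proof (rule bexp_mono[OF assms(2,3)])
    fix \<xi> assume "\<xi> \<subseteq> E"
    then have e: "e \<notin> \<xi>" using insert(2) by auto
    have up: "A w \<Longrightarrow> ?A w" "B w \<Longrightarrow> ?B w" for w
      using insert.prems unfolding incr_def by (meson subset_insertI)+
    have "disj_occ A B \<xi> \<Longrightarrow> disj_occ ?A B \<xi>" "disj_occ A B \<xi> \<Longrightarrow> disj_occ A ?B \<xi>"
      "disj_occ ?A B \<xi> \<Longrightarrow> disj_occ ?A ?B \<xi>" "disj_occ A ?B \<xi> \<Longrightarrow> disj_occ ?A ?B \<xi>"
      using up by (auto elim!: disj_occ_mono)
    then show "(1 - p) * ?c A B \<xi> + p * of_bool (disj_occ A B (insert e \<xi>))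
      \<le> (1 - p)^2 * ?c A B \<xi> + p * (1 - p) * ?c ?A B \<xi> + p * (1 - p) * ?c A ?B \<xi> + p^2 * ?c ?A ?B \<xi>"
      unfolding disj_occ_insert[OF e insert.prems]
      using assms(2,3) mult_nonneg_nonneg[of p "1 - p"]
      by (cases "disj_occ A B \<xi>"; cases "disj_occ ?A B \<xi>"; cases "disj_occ A ?B \<xi>"; cases "disj_occ ?A ?B \<xi>")
        (auto simp: power2_eq_square algebra_simps)
  qed
  also have "\<dots> = (1 - p)^2 * bprob p E (disj_occ A B) + p * (1 - p) * bprob p E (disj_occ ?A B)
      + p * (1 - p) * bprob p E (disj_occ A ?B) + p^2 * bprob p E (disj_occ ?A ?B)"
    by (simp add: bprob_def bexp_add bexp_cmult)
  also have "\<dots> \<le> (1 - p)^2 * (bprob p E A * bprob p E B) + p * (1 - p) * (bprob p E ?A * bprob p E B)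
      + p * (1 - p) * (bprob p E A * bprob p E ?B) + p^2 * (bprob p E ?A * bprob p E ?B)"
    using insert.IH[OF insert.prems] insert.IH[OF m(1) insert.prems(2)]
      insert.IH[OF insert.prems(1) m(2)] insert.IH[OF m] assms
    by (intro add_mono mult_left_mono) auto
  also have "\<dots> = bprob p (insert e E) A * bprob p (insert e E) B"
    using insert(1,2) by (simp add: bprob_def bexp_insert power2_eq_square algebra_simps)
  finally show ?case .
qed

section \<open>Russo's formula, pivotal edges and finite energy\<close>

lemma russo:
  assumes "finite E"
  shows "((\<lambda>p. bexp p E f) has_real_derivative (\<Sum>e\<in>E. bexp p E (\<lambda>\<xi>. f (insert e \<xi>) - f (\<xi> - {e})))) (at p)"
  using assms
proof (induction E arbitrary: f rule: finite_induct)
  case (insert a E)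
  let ?g = "\<lambda>\<xi>. f (insert a \<xi>)"
  let ?d = "\<lambda>f e. bexp p E (\<lambda>\<xi>. f (insert e \<xi>) - f (\<xi> - {e}))"
  \<comment> \<open>The product rule separates the derivative of the coin of \<open>a\<close> from
    the inductive derivatives. As everything is polynomial, the formula holds for every real
    \<open>p\<close> and arbitrary \<open>f\<close>.\<close>
  have 1: "((\<lambda>p. (1 - p) * bexp p E f + p * bexp p E ?g) has_real_derivative
      (bexp p E ?g - bexp p E f + (1 - p) * (\<Sum>e\<in>E. ?d f e) + p * (\<Sum>e\<in>E. ?d ?g e))) (at p)"
    by (rule derivative_eq_intros insert.IH refl)+ (simp add: algebra_simps)
  have 2: "bexp p (insert a E) (\<lambda>\<xi>. f (insert a \<xi>) - f (\<xi> - {a})) = bexp p E ?g - bexp p E f"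
  proof -
    have "\<xi> - {a} = \<xi>" "insert a \<xi> - {a} = \<xi>" if "\<xi> \<subseteq> E" for \<xi>
      using that insert(2) by auto
    then have "bexp p E (\<lambda>\<xi>. f (insert a \<xi>) - f (\<xi> - {a})) = bexp p E (\<lambda>\<xi>. f (insert a \<xi>) - f \<xi>)"
      "bexp p E (\<lambda>\<xi>. f (insert a (insert a \<xi>)) - f (insert a \<xi> - {a})) = bexp p E (\<lambda>\<xi>. f (insert a \<xi>) - f \<xi>)"
      by (auto intro!: bexp_cong simp del: insert_Diff_single Diff_insert0)
    then show ?thesis using insert(1,2) by (simp add: bexp_insert bexp_diff algebra_simps)
  qed
  have 3: "bexp p (insert a E) (\<lambda>\<xi>. f (insert e \<xi>) - f (\<xi> - {e})) = (1 - p) * ?d f e + p * ?d ?g e"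
    if "e \<in> E" for e
  proof -
    have "e \<noteq> a" using that insert(2) by auto
    then have "insert a \<xi> - {e} = insert a (\<xi> - {e})" for \<xi> by auto
    then show ?thesis using insert(1,2) by (simp add: bexp_insert insert_commute)
  qed
  have "(\<Sum>e\<in>insert a E. bexp p (insert a E) (\<lambda>\<xi>. f (insert e \<xi>) - f (\<xi> - {e}))) =
     bexp p E ?g - bexp p E f + (1 - p) * (\<Sum>e\<in>E. ?d f e) + p * (\<Sum>e\<in>E. ?d ?g e)"
    using insert(1,2) by (simp add: 2 3 sum.distrib sum_distrib_left)
  then show ?case using 1 insert(1,2) by (simp add: bexp_insert)
qed simp

lemma bexp_mono_param:
  assumes "finite E" "mono f" "0 \<le> p" "p \<le> q" "q \<le> 1"
  shows "bexp p E f \<le> bexp q E f"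
proof (rule DERIV_nonneg_imp_nondecreasing[OF assms(4)])
  fix x assume "p \<le> x" "x \<le> q"
  then have x: "0 \<le> x" "x \<le> 1" using assms by auto
  have "0 \<le> (\<Sum>e\<in>E. bexp x E (\<lambda>\<xi>. f (insert e \<xi>) - f (\<xi> - {e})))"
    by (intro sum_nonneg bexp_nonneg x) (simp add: monoD[OF assms(2)] subset_insertI2)
  with russo[OF assms(1)] show "\<exists>y. ((\<lambda>p. bexp p E f) has_real_derivative y) (at x) \<and> 0 \<le> y" by blast
qed

lemma bprob_mono_param:
  assumes "finite E" "incr A" "0 \<le> p" "p \<le> q" "q \<le> 1"
  shows "bprob p E A \<le> bprob q E A"
  unfolding bprob_def by (rule bexp_mono_param[OF assms(1) mono_of_bool[OF assms(2)] assms(3-5)])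

lemma bprob_subset:
  assumes "finite E" "E' \<subseteq> E" "incr A" "0 \<le> p" "p \<le> 1"
  shows "bprob p E' A \<le> bprob p E A"
proof -
  have "bprob p E (\<lambda>\<xi>. A (\<xi> \<inter> E')) = bprob p E' A"
    using assms(1,2) by (intro bprob_local) auto
  moreover have "bprob p E (\<lambda>\<xi>. A (\<xi> \<inter> E')) \<le> bprob p E A"
    by (rule bprob_mono[OF assms(4,5)]) (use assms(3) in \<open>unfold incr_def, meson Int_lower1\<close>)
  ultimately show ?thesis by simp
qed

text \<open>The condition does not look at the state of \<open>e\<close>, so it is independent of
  the coin of \<open>e\<close>.\<close>

definition pivotal :: "('e set \<Rightarrow> bool) \<Rightarrow> 'e \<Rightarrow> 'e set \<Rightarrow> bool" where
  "pivotal A e \<xi> \<longleftrightarrow> A (insert e \<xi>) \<and> \<not> A (\<xi> - {e})"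

lemma russo_pivotal:
  assumes "finite E" "incr A"
  shows "((\<lambda>p. bprob p E A) has_real_derivative (\<Sum>e\<in>E. bprob p E (pivotal A e))) (at p)"
proof -
  have "bexp p E (\<lambda>\<xi>. of_bool (A (insert e \<xi>)) - of_bool (A (\<xi> - {e}))) = bprob p E (pivotal A e)" for e
    unfolding bprob_def
  proof (rule bexp_cong)
    fix \<xi>
    have "A (\<xi> - {e}) \<Longrightarrow> A (insert e \<xi>)"
      using assms(2) unfolding incr_def by (meson Diff_subset subset_insertI subset_trans)
    then show "of_bool (A (insert e \<xi>)) - of_bool (A (\<xi> - {e})) = (of_bool (pivotal A e \<xi>) :: real)"
      by (auto simp: pivotal_def)
  qed
  then show ?thesis using russo[OF assms(1), of "\<lambda>\<xi>. of_bool (A \<xi>)" p] by (simp add: bprob_def)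
qed

text \<open>Each edge of \<open>I\<close> is resampled in turn, and only the outcome "open" is kept;
  nonnegativity of \<open>f\<close> allows the rest to be dropped.\<close>

lemma finite_energy:
  assumes "finite E" "0 \<le> p" "p \<le> 1" "finite I" "I \<subseteq> E" "\<And>\<xi>. 0 \<le> f \<xi>"
  shows "p ^ card I * bexp p E (\<lambda>\<xi>. f (\<xi> \<union> I)) \<le> bexp p E f"
  using assms(4-6)
proof (induction I arbitrary: f rule: finite_induct)
  case (insert e I)
  have "p * bexp p E (\<lambda>\<xi>. f (insert e \<xi>)) \<le> bexp p E f"
    unfolding bexp_resample[OF assms(1), of e p f, OF subsetD[OF insert.prems(1) insertI1]] bexp_cmult[symmetric]
    by (rule bexp_mono[OF assms(2,3)]) (use assms(2,3) insert.prems(2) in auto)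
  moreover have "p ^ card I * bexp p E (\<lambda>\<xi>. f (insert e (\<xi> \<union> I))) \<le> bexp p E (\<lambda>\<xi>. f (insert e \<xi>))"
    using insert.IH[of "\<lambda>\<xi>. f (insert e \<xi>)"] insert.prems by auto
  ultimately have "p * (p ^ card I * bexp p E (\<lambda>\<xi>. f (insert e (\<xi> \<union> I)))) \<le> bexp p E f"
    using assms(2) mult_left_mono order_trans by blast
  then show ?case using insert(1,2) by (simp add: mult.assoc)
qed (simp add: insert_commute)

lemma bprob_finite_energy:
  assumes "finite E" "0 \<le> p" "p \<le> 1" "finite I" "I \<subseteq> E" "card I \<le> l"
  shows "p ^ l * bprob p E (\<lambda>\<xi>. A (\<xi> \<union> I)) \<le> bprob p E A"
proof -
  have "p ^ l \<le> p ^ card I" using assms by (intro power_decreasing) auto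
  then have "p ^ l * bprob p E (\<lambda>\<xi>. A (\<xi> \<union> I)) \<le> p ^ card I * bprob p E (\<lambda>\<xi>. A (\<xi> \<union> I))"
    by (intro mult_right_mono bprob_nonneg assms)
  also have "\<dots> \<le> bprob p E A" unfolding bprob_def by (rule finite_energy) (use assms in auto)
  finally show ?thesis .
qed

section \<open>Fisher information and square roots of probabilities\<close>

lemma bexp_cauchy_schwarz:
  assumes "0 \<le> p" "p \<le> 1"
  shows "(bexp p E (\<lambda>\<xi>. f \<xi> * g \<xi>))\<^sup>2 \<le> bexp p E (\<lambda>\<xi>. (f \<xi>)\<^sup>2) * bexp p E (\<lambda>\<xi>. (g \<xi>)\<^sup>2)"
proof -
  define w where "w \<xi> = sqrt (p ^ card \<xi> * (1 - p) ^ card (E - \<xi>))" for \<xi> :: "'a set"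
  have w: "p ^ card \<xi> * (1 - p) ^ card (E - \<xi>) = (w \<xi>)\<^sup>2" for \<xi>
    using assms by (simp add: w_def)
  have "(\<Sum>\<xi>\<in>Pow E. (w \<xi> * f \<xi>) * (w \<xi> * g \<xi>))\<^sup>2 \<le> (\<Sum>\<xi>\<in>Pow E. (w \<xi> * f \<xi>)\<^sup>2) * (\<Sum>\<xi>\<in>Pow E. (w \<xi> * g \<xi>)\<^sup>2)"
    by (rule Cauchy_Schwarz_ineq_sum)
  then show ?thesis unfolding bexp_def w by (simp add: power2_eq_square mult_ac)
qed

lemma disj_occ_join: "A a \<Longrightarrow> B b \<Longrightarrow> a \<inter> b = {} \<Longrightarrow> a \<union> b \<subseteq> \<xi> \<Longrightarrow> disj_occ A B \<xi>"
  by (rule disj_occI[of A a B b]) auto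

text \<open>The relation \<open>R e \<xi>\<close> reads "the exploration reveals \<open>e\<close>".  Its increments behave like a
  martingale although no order of exploration is chosen: the four values of \<open>R e * R f\<close>
  over the states of \<open>e\<close> and \<open>f\<close> have vanishing mixed difference.\<close>

lemma fisher_information:
  fixes A :: "'e set \<Rightarrow> bool" and R :: "'e \<Rightarrow> 'e set \<Rightarrow> bool"
  assumes E: "finite E" and p: "0 < p" "p < 1"
    and Rins: "\<And>e f \<xi>. \<not> R e \<xi> \<Longrightarrow> R f (insert e \<xi>) = R f \<xi>"
    and Rdel: "\<And>e f \<xi>. \<not> R e \<xi> \<Longrightarrow> R f (\<xi> - {e}) = R f \<xi>"
    and Ains: "\<And>e \<xi>. \<not> R e \<xi> \<Longrightarrow> A (insert e \<xi>) = A \<xi>"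
  shows "(\<Sum>e\<in>E. bexp p E (\<lambda>\<xi>. of_bool (A (insert e \<xi>)) - of_bool (A (\<xi> - {e}))))\<^sup>2
    \<le> bprob p E A * bexp p E (\<lambda>\<xi>. \<Sum>e\<in>E. of_bool (R e \<xi>)) / (p * (1 - p))"
proof -
  define \<zeta> where "\<zeta> e \<xi> = of_bool (e \<in> \<xi>) - p" for e :: 'e and \<xi>
  define r where "r e \<xi> = (of_bool (R e \<xi>) :: real)" for e \<xi>
  define a where "a \<xi> = (of_bool (A \<xi>) :: real)" for \<xi>
  \<comment> \<open>The score of the revealed edges. Its correlation with \<open>A\<close> is
    \<open>p * (1 - p)\<close> times the derivative of the probability, and its second moment is
    \<open>p * (1 - p)\<close> times the expected number of revealed edges; Cauchy-Schwarz compares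
    the two.\<close>
  define M where "M \<xi> = (\<Sum>e\<in>E. r e \<xi> * \<zeta> e \<xi>)" for \<xi>
  have \<zeta>: "\<zeta> e (insert e \<xi>) = 1 - p" "\<zeta> e (\<xi> - {e}) = - p" for e \<xi>
    by (auto simp: \<zeta>_def)
  have \<zeta>': "e \<noteq> f \<Longrightarrow> \<zeta> e (insert f \<xi>) = \<zeta> e \<xi>" "e \<noteq> f \<Longrightarrow> \<zeta> e (\<xi> - {f}) = \<zeta> e \<xi>" for e f \<xi>
    by (auto simp: \<zeta>_def)
  \<comment> \<open>Whether \<open>e\<close> is revealed does not depend on the state of
    \<open>e\<close> itself.\<close>
  have Rsame: "R e (insert e \<xi>) = R e (\<xi> - {e})" for e \<xi>
  proof (cases "R e (\<xi> - {e})")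
    case False
    then show ?thesis using Rins[of e "\<xi> - {e}" e] by simp
  next
    case True
    have "\<not> R e (insert e \<xi>) \<Longrightarrow> R e (insert e \<xi> - {e}) = R e (insert e \<xi>)" by (rule Rdel)
    with True show ?thesis by auto
  qed
  have Asame: "A (insert e \<xi>) = A (\<xi> - {e})" if "\<not> R e (\<xi> - {e})" for e \<xi>
    using Ains[OF that] by simp
  have step1: "p * (1 - p) * bexp p E (\<lambda>\<xi>. a (insert e \<xi>) - a (\<xi> - {e})) = bexp p E (\<lambda>\<xi>. a \<xi> * (r e \<xi> * \<zeta> e \<xi>))"
    if "e \<in> E" for e
  proof -
    have "bexp p E (\<lambda>\<xi>. a \<xi> * (r e \<xi> * \<zeta> e \<xi>)) = bexp p E (\<lambda>\<xi>.
        p * (a (insert e \<xi>) * (r e (insert e \<xi>) * \<zeta> e (insert e \<xi>))) +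
        (1 - p) * (a (\<xi> - {e}) * (r e (\<xi> - {e}) * \<zeta> e (\<xi> - {e}))))"
      by (rule bexp_resample[OF E that])
    also have "\<dots> = bexp p E (\<lambda>\<xi>. p * (1 - p) * (a (insert e \<xi>) - a (\<xi> - {e})))"
    proof (rule bexp_cong)
      fix \<xi>
      show "p * (a (insert e \<xi>) * (r e (insert e \<xi>) * \<zeta> e (insert e \<xi>))) +
        (1 - p) * (a (\<xi> - {e}) * (r e (\<xi> - {e}) * \<zeta> e (\<xi> - {e}))) = p * (1 - p) * (a (insert e \<xi>) - a (\<xi> - {e}))"
      proof (cases "R e (\<xi> - {e})")
        case True
        then show ?thesis by (simp add: \<zeta> r_def Rsame algebra_simps)
      next
        case False
        then show ?thesis using Asame[OF False] by (simp add: \<zeta> r_def a_def Rsame)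
      qed
    qed
    finally show ?thesis by (simp add: bexp_cmult)
  qed
  have cross: "bexp p E (\<lambda>\<xi>. (r e \<xi> * \<zeta> e \<xi>) * (r f \<xi> * \<zeta> f \<xi>)) = 0" if "e \<in> E" "f \<in> E" "e \<noteq> f" for e f
  proof -
    let ?g = "\<lambda>\<xi>. (r e \<xi> * \<zeta> e \<xi>) * (r f \<xi> * \<zeta> f \<xi>)"
    let ?h = "\<lambda>\<xi>. r e \<xi> * r f \<xi>"
    have "bexp p E ?g = bexp p E (\<lambda>\<xi>. p * ?g (insert e \<xi>) + (1 - p) * ?g (\<xi> - {e}))"
      by (rule bexp_resample[OF E that(1)])
    also have "\<dots> = bexp p E (\<lambda>\<xi>. p * (p * ?g (insert e (insert f \<xi>)) + (1 - p) * ?g (insert f \<xi> - {e}))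
        + (1 - p) * (p * ?g (insert e (\<xi> - {f})) + (1 - p) * ?g (\<xi> - {f} - {e})))"
      by (rule bexp_resample[OF E that(2)])
    also have "\<dots> = bexp p E (\<lambda>\<xi>. 0)"
    proof (rule bexp_cong)
      fix \<xi>
      define w where "w = \<xi> - {f} - {e}"
      have ins: "insert f \<xi> - {e} = insert f w" "insert e (insert f \<xi>) = insert e (insert f w)"
         "insert e (\<xi> - {f}) = insert e w" "\<xi> - {f} - {e} = w"
        using that(3) by (auto simp: w_def)
      have notin: "e \<notin> w" "f \<notin> w" by (auto simp: w_def)
      have del: "insert e (insert f w) - {e} = insert f w" "insert e (insert f w) - {f} = insert e w"
         "insert e w - {e} = w" "insert f w - {f} = w" using notin that(3) by auto
      have x: "\<zeta> e (insert e (insert f w)) = 1 - p" "\<zeta> f (insert e (insert f w)) = 1 - p"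
        "\<zeta> e (insert f w) = - p" "\<zeta> f (insert f w) = 1 - p" "\<zeta> e (insert e w) = 1 - p" "\<zeta> f (insert e w) = - p"
        "\<zeta> e w = - p" "\<zeta> f w = - p"
        using notin that(3) by (auto simp: \<zeta>_def)
      have e1: "R e (insert e w) = R e w" "R f (insert f w) = R f w"
        "R e (insert e (insert f w)) = R e (insert f w)" "R f (insert e (insert f w)) = R f (insert e w)"
        using Rsame[of e w] Rsame[of f w] Rsame[of e "insert e (insert f w)"] Rsame[of f "insert e (insert f w)"] notin del
        by (auto simp: insert_commute)
      have mixed: "?h (insert e (insert f w)) + ?h w = ?h (insert e w) + ?h (insert f w)"
        using e1 Rins[of e w e] Rins[of e w f] Rins[of f w e] Rins[of f w f]
          Rins[of e "insert f w" e] Rins[of e "insert f w" f] Rins[of f "insert e w" e] Rins[of f "insert e w" f]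
        by (cases "R e w"; cases "R f w"; cases "R f (insert e w)"; cases "R e (insert f w)")
           (simp_all add: r_def insert_commute)
      have "p * (p * ?g (insert e (insert f \<xi>)) + (1 - p) * ?g (insert f \<xi> - {e}))
        + (1 - p) * (p * ?g (insert e (\<xi> - {f})) + (1 - p) * ?g (\<xi> - {f} - {e}))
        = (p * (1 - p))\<^sup>2 * ((?h (insert e (insert f w)) + ?h w) - (?h (insert e w) + ?h (insert f w)))"
        unfolding ins x by (simp add: power2_eq_square algebra_simps)
      then show "p * (p * ?g (insert e (insert f \<xi>)) + (1 - p) * ?g (insert f \<xi> - {e}))
        + (1 - p) * (p * ?g (insert e (\<xi> - {f})) + (1 - p) * ?g (\<xi> - {f} - {e})) = 0"
        unfolding mixed by simp
    qed
    also have "\<dots> = 0" using E by simp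
    finally show ?thesis .
  qed
  have diag: "bexp p E (\<lambda>\<xi>. (r e \<xi> * \<zeta> e \<xi>) * (r e \<xi> * \<zeta> e \<xi>)) = p * (1 - p) * bexp p E (r e)" if "e \<in> E" for e
  proof -
    have "bexp p E (\<lambda>\<xi>. (r e \<xi> * \<zeta> e \<xi>) * (r e \<xi> * \<zeta> e \<xi>)) =
      bexp p E (\<lambda>\<xi>. p * ((r e (insert e \<xi>) * \<zeta> e (insert e \<xi>)) * (r e (insert e \<xi>) * \<zeta> e (insert e \<xi>)))
      + (1 - p) * ((r e (\<xi> - {e}) * \<zeta> e (\<xi> - {e})) * (r e (\<xi> - {e}) * \<zeta> e (\<xi> - {e}))))"
      by (rule bexp_resample[OF E that])
    also have "\<dots> = bexp p E (\<lambda>\<xi>. p * (1 - p) * (p * r e (insert e \<xi>) + (1 - p) * r e (\<xi> - {e})))"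
      by (rule bexp_cong) (simp add: \<zeta> r_def Rsame power2_eq_square algebra_simps)
    also have "\<dots> = p * (1 - p) * bexp p E (r e)"
      using bexp_resample[OF E that, of p "r e"] by (simp add: bexp_cmult)
    finally show ?thesis .
  qed
  have "bexp p E (\<lambda>\<xi>. (M \<xi>)\<^sup>2) = (\<Sum>e\<in>E. \<Sum>f\<in>E. bexp p E (\<lambda>\<xi>. (r e \<xi> * \<zeta> e \<xi>) * (r f \<xi> * \<zeta> f \<xi>)))"
    by (simp add: M_def power2_eq_square sum_product bexp_sum)
  also have "\<dots> = (\<Sum>e\<in>E. \<Sum>f\<in>E. if f = e then p * (1 - p) * bexp p E (r e) else 0)"
    by (intro sum.cong refl) (use cross diag in auto)
  also have "\<dots> = p * (1 - p) * bexp p E (\<lambda>\<xi>. \<Sum>e\<in>E. of_bool (R e \<xi>))"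
    unfolding bexp_sum sum_distrib_left r_def[symmetric] using E by (simp add: sum.delta del: sum_of_bool_eq)
  finally have var: "bexp p E (\<lambda>\<xi>. (M \<xi>)\<^sup>2) = p * (1 - p) * bexp p E (\<lambda>\<xi>. \<Sum>e\<in>E. of_bool (R e \<xi>))" .
  have "p * (1 - p) * (\<Sum>e\<in>E. bexp p E (\<lambda>\<xi>. a (insert e \<xi>) - a (\<xi> - {e}))) = (\<Sum>e\<in>E. bexp p E (\<lambda>\<xi>. a \<xi> * (r e \<xi> * \<zeta> e \<xi>)))"
    unfolding sum_distrib_left by (rule sum.cong) (use step1 in auto)
  also have "\<dots> = bexp p E (\<lambda>\<xi>. a \<xi> * M \<xi>)"
    by (simp add: M_def sum_distrib_left bexp_sum)
  finally have eq: "p * (1 - p) * (\<Sum>e\<in>E. bexp p E (\<lambda>\<xi>. a (insert e \<xi>) - a (\<xi> - {e}))) = bexp p E (\<lambda>\<xi>. a \<xi> * M \<xi>)" .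
  have pp: "p * (1 - p) > 0" using p by simp
  have "(p * (1 - p))\<^sup>2 * (\<Sum>e\<in>E. bexp p E (\<lambda>\<xi>. a (insert e \<xi>) - a (\<xi> - {e})))\<^sup>2 = (bexp p E (\<lambda>\<xi>. a \<xi> * M \<xi>))\<^sup>2"
    unfolding eq[symmetric] by (simp only: power_mult_distrib)
  also have "\<dots> \<le> bexp p E (\<lambda>\<xi>. (a \<xi>)\<^sup>2) * bexp p E (\<lambda>\<xi>. (M \<xi>)\<^sup>2)"
    using p by (intro bexp_cauchy_schwarz) auto
  also have "bexp p E (\<lambda>\<xi>. (a \<xi>)\<^sup>2) = bprob p E A"
    unfolding bprob_def by (rule bexp_cong) (simp add: a_def)
  finally have "(p * (1 - p)) * ((p * (1 - p)) * (\<Sum>e\<in>E. bexp p E (\<lambda>\<xi>. a (insert e \<xi>) - a (\<xi> - {e})))\<^sup>2)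
     \<le> (p * (1 - p)) * (bprob p E A * bexp p E (\<lambda>\<xi>. \<Sum>e\<in>E. of_bool (R e \<xi>)))"
    unfolding var by (simp add: power2_eq_square mult_ac)
  then have "(p * (1 - p)) * (\<Sum>e\<in>E. bexp p E (\<lambda>\<xi>. a (insert e \<xi>) - a (\<xi> - {e})))\<^sup>2
     \<le> bprob p E A * bexp p E (\<lambda>\<xi>. \<Sum>e\<in>E. of_bool (R e \<xi>))"
    using pp by (simp only: mult_le_cancel_left_pos)
  then show ?thesis unfolding a_def using pp by (simp add: pos_le_divide_eq mult_ac)
qed

text \<open>The square of the derivative is at most a constant times the probability itself, so the
  derivative of the square root is bounded even where the probability is tiny.\<close>

lemma sqrt_bprob_le:
  fixes A :: "'e set \<Rightarrow> bool" and R :: "'e \<Rightarrow> 'e set \<Rightarrow> bool"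
  assumes E: "finite E" and p: "0 < p" "p \<le> q" "q < 1"
    and Rins: "\<And>e f \<xi>. \<not> R e \<xi> \<Longrightarrow> R f (insert e \<xi>) = R f \<xi>"
    and Rdel: "\<And>e f \<xi>. \<not> R e \<xi> \<Longrightarrow> R f (\<xi> - {e}) = R f \<xi>"
    and Ains: "\<And>e \<xi>. \<not> R e \<xi> \<Longrightarrow> A (insert e \<xi>) = A \<xi>"
    and B: "\<And>s. p \<le> s \<Longrightarrow> s \<le> q \<Longrightarrow> bexp s E (\<lambda>\<xi>. \<Sum>e\<in>E. of_bool (R e \<xi>)) \<le> B"
  shows "sqrt (bprob q E A) \<le> sqrt (bprob p E A) + (q - p) * sqrt (B / (p * (1 - q)))"
proof (rule field_le_epsilon)
  fix \<epsilon> :: real assume \<epsilon>: "\<epsilon> > 0"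
  define D where "D s = (\<Sum>e\<in>E. bexp s E (\<lambda>\<xi>. of_bool (A (insert e \<xi>)) - of_bool (A (\<xi> - {e}))))" for s
  define f where "f s = bprob s E A" for s
  have der: "(f has_real_derivative D s) (at s)" for s
    unfolding D_def f_def[abs_def] bprob_def by (rule russo[OF E])
  define C where "C = sqrt (B / (p * (1 - q)))"
  have B0: "B \<ge> 0"
    using B[of p] bexp_nonneg[of p E "\<lambda>\<xi>. \<Sum>e\<in>E. of_bool (R e \<xi>)"] p by (force intro: sum_nonneg)
  have C0: "C \<ge> 0" using B0 p by (simp add: C_def)
  \<comment> \<open>The shift by the square of \<open>\<epsilon>\<close> keeps the square root
    differentiable where the probability vanishes; it costs at most \<open>\<epsilon>\<close> in the
    end.\<close>
  have "sqrt (f q + \<epsilon>\<^sup>2) - C * q \<le> sqrt (f p + \<epsilon>\<^sup>2) - C * p"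
  proof (rule DERIV_nonpos_imp_nonincreasing[OF p(2)])
    fix s assume s: "p \<le> s" "s \<le> q"
    have s01: "0 < s" "s < 1" using s p by auto
    have f0: "f s \<ge> 0" unfolding f_def using s01 by (intro bprob_nonneg) auto
    have pos: "f s + \<epsilon>\<^sup>2 > 0" using f0 \<epsilon> by (simp add: add_nonneg_pos)
    have d: "((\<lambda>s. sqrt (f s + \<epsilon>\<^sup>2) - C * s) has_real_derivative (D s * (inverse (sqrt (f s + \<epsilon>\<^sup>2)) / 2) - C)) (at s)"
    proof -
      have 1: "((\<lambda>s. f s + \<epsilon>\<^sup>2) has_real_derivative D s) (at s)"
        using DERIV_add[OF der DERIV_const[of "\<epsilon>\<^sup>2"]] by simp
      have 2: "((\<lambda>s. sqrt (f s + \<epsilon>\<^sup>2)) has_real_derivative (inverse (sqrt (f s + \<epsilon>\<^sup>2)) / 2 * D s)) (at s)"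
        by (rule DERIV_chain2[OF DERIV_real_sqrt[OF pos] 1])
      show ?thesis using DERIV_diff[OF 2 DERIV_cmult_Id[of C]] by (simp add: mult.commute)
    qed
    have "(D s)\<^sup>2 \<le> bprob s E A * bexp s E (\<lambda>\<xi>. \<Sum>e\<in>E. of_bool (R e \<xi>)) / (s * (1 - s))"
      unfolding D_def by (rule fisher_information[where R = R, OF E s01]) (fact Rins Rdel Ains)+
    also have "\<dots> \<le> f s * B / (p * (1 - q))"
      unfolding f_def using B[OF s] p s B0 bprob_nonneg[of s E A]
      by (intro frac_le mult_mono mult_left_mono mult_nonneg_nonneg) auto
    also have "\<dots> = f s * C\<^sup>2" using B0 p by (simp add: C_def)
    also have "\<dots> \<le> (f s + \<epsilon>\<^sup>2) * C\<^sup>2" by (intro mult_right_mono) auto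
    finally have "D s \<le> sqrt ((f s + \<epsilon>\<^sup>2) * C\<^sup>2)" by (rule real_le_rsqrt)
    also have "\<dots> = sqrt (f s + \<epsilon>\<^sup>2) * C"
      using C0 by (simp add: real_sqrt_mult)
    finally have "D s * (inverse (sqrt (f s + \<epsilon>\<^sup>2)) / 2) \<le> (sqrt (f s + \<epsilon>\<^sup>2) * C) * (inverse (sqrt (f s + \<epsilon>\<^sup>2)) / 2)"
      using pos by (intro mult_right_mono) auto
    also have "\<dots> = C / 2" using pos by simp
    also have "\<dots> \<le> C" using B0 p by (simp add: C_def)
    finally show "\<exists>y. ((\<lambda>s. sqrt (f s + \<epsilon>\<^sup>2) - C * s) has_real_derivative y) (at s) \<and> y \<le> 0"
      using d by auto
  qed
  moreover have "sqrt (f q) \<le> sqrt (f q + \<epsilon>\<^sup>2)" by simp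
  moreover have "sqrt (f p + \<epsilon>\<^sup>2) \<le> sqrt (f p) + \<epsilon>"
    using sqrt_add_le_add_sqrt[of "f p" "\<epsilon>\<^sup>2"] \<epsilon> bprob_nonneg[of p E A] p by (simp add: f_def)
  moreover have "(q - p) * C = C * q - C * p" by (simp add: algebra_simps)
  ultimately show "sqrt (bprob q E A) \<le> sqrt (bprob p E A) + (q - p) * sqrt (B / (p * (1 - q))) + \<epsilon>"
    unfolding f_def C_def[symmetric] by linarith
qed

section \<open>Connectivity\<close>

definition conn :: "'v set set \<Rightarrow> 'v \<Rightarrow> 'v \<Rightarrow> bool" where
  "conn \<xi> x y \<longleftrightarrow> (\<lambda>u v. {u, v} \<in> \<xi>)\<^sup>*\<^sup>* x y"

definition clu :: "'v set set \<Rightarrow> 'v set \<Rightarrow> 'v set" where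
  "clu \<xi> B = {y. \<exists>b\<in>B. conn \<xi> b y}"

lemma conn_refl [simp]: "conn \<xi> x x"
  by (simp add: conn_def)

lemma conn_edge: "{x, y} \<in> \<xi> \<Longrightarrow> conn \<xi> x y"
  by (auto simp: conn_def)

lemma conn_trans: "conn \<xi> x y \<Longrightarrow> conn \<xi> y z \<Longrightarrow> conn \<xi> x z"
  unfolding conn_def by (rule rtranclp_trans)

lemma conn_sym: "conn \<xi> x y \<Longrightarrow> conn \<xi> y x"
  unfolding conn_def
proof (induction rule: rtranclp_induct)
  case (step y z)
  have "{z, y} \<in> \<xi>" using step(2) by (simp add: insert_commute)
  then show ?case using step(3) by (meson converse_rtranclp_into_rtranclp)
qed simp

lemma conn_mono: "conn \<xi> x y \<Longrightarrow> \<xi> \<subseteq> \<eta> \<Longrightarrow> conn \<eta> x y"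
  unfolding conn_def by (erule rtranclp_mono[THEN predicate2D, rotated]) auto

lemma incr_conn: "incr (\<lambda>\<xi>. conn \<xi> x y)"
  by (rule incrI) (rule conn_mono)

lemma conn_induct [consumes 1, case_names refl step]:
  assumes "conn \<xi> x y" "P x" "\<And>y z. conn \<xi> x y \<Longrightarrow> {y, z} \<in> \<xi> \<Longrightarrow> P y \<Longrightarrow> P z"
  shows "P y"
  using assms unfolding conn_def by (rule rtranclp_induct)

lemma conn_in_Union: "conn \<xi> x y \<Longrightarrow> y = x \<or> y \<in> \<Union>\<xi>"
  by (induction rule: conn_induct) auto

section \<open>Self-avoiding paths and disjoint connections\<close>

fun pedges :: "'v list \<Rightarrow> 'v set set" where
  "pedges (x # y # zs) = insert {x, y} (pedges (y # zs))"
| "pedges _ = {}"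

lemma pedges_append: "pedges (as @ v # bs) = pedges (as @ [v]) \<union> pedges (v # bs)"
  by (induction as rule: pedges.induct) auto

lemma pedges_subset: "e \<in> pedges xs \<Longrightarrow> e \<subseteq> set xs"
  by (induction xs rule: pedges.induct) auto

lemma pedges_snoc_meets: "e \<in> pedges (cs @ [w]) \<Longrightarrow> e \<inter> set cs \<noteq> {}"
proof (induction cs)
  case (Cons c cs)
  then show ?case by (cases cs) auto
qed simp

text \<open>Every edge before \<open>v\<close> contains a vertex of \<open>as\<close>, and by
  distinctness no later edge does. This turns self-avoidance into the edge-disjointness that BK
  needs.\<close>

lemma pedges_disjoint:
  assumes "distinct (as @ v # bs)"
  shows "pedges (as @ [v]) \<inter> pedges (v # bs) = {}"
proof -
  have "e \<inter> set as \<noteq> {}" if "e \<in> pedges (as @ [v])" for e using pedges_snoc_meets[OF that] .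
  moreover have "e \<inter> set as = {}" if "e \<in> pedges (v # bs)" for e
    using pedges_subset[OF that] assms by auto
  ultimately show ?thesis by blast
qed

lemma finite_pedges [simp]: "finite (pedges xs)"
  by (induction xs rule: pedges.induct) auto

lemma path_conn: "pedges (x # xs) \<subseteq> \<xi> \<Longrightarrow> conn \<xi> x (last (x # xs))"
proof (induction xs arbitrary: x)
  case (Cons y xs)
  then have "{x, y} \<in> \<xi>" "conn \<xi> y (last (y # xs))" by auto
  then show ?case using conn_trans[OF conn_edge] by fastforce
qed simp

lemma path_conn': "xs \<noteq> [] \<Longrightarrow> pedges xs \<subseteq> \<xi> \<Longrightarrow> conn \<xi> (hd xs) (last xs)"
  by (cases xs) (auto simp del: last.simps intro: path_conn)

lemma conn_path:
  assumes "conn \<xi> x y"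
  obtains xs where "distinct xs" "xs \<noteq> []" "hd xs = x" "last xs = y" "pedges xs \<subseteq> \<xi>"
proof -
  have "\<exists>xs. distinct xs \<and> xs \<noteq> [] \<and> hd xs = x \<and> last xs = y \<and> pedges xs \<subseteq> \<xi>"
    using assms unfolding conn_def
  proof (induction rule: converse_rtranclp_induct)
    case base
    show ?case by (rule exI[of _ "[y]"]) auto
  next
    case (step x x')
    then obtain xs where xs: "distinct xs" "xs \<noteq> []" "hd xs = x'" "last xs = y" "pedges xs \<subseteq> \<xi>" by blast
    show ?case
    proof (cases "x \<in> set xs")
      \<comment> \<open>The loop at \<open>x\<close> is cut off, which keeps the vertices
        distinct.\<close>
      case True
      then obtain as bs where ab: "xs = as @ x # bs" by (meson split_list)
      have "pedges (x # bs) \<subseteq> \<xi>" using xs(5) pedges_append[of as x bs] ab by auto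
      then show ?thesis using xs ab by (intro exI[of _ "x # bs"]) auto
    next
      case False
      obtain zs where "xs = x' # zs" using xs(2,3) by (cases xs) auto
      then show ?thesis using xs False step(1) by (intro exI[of _ "x # xs"]) auto
    qed
  qed
  then show ?thesis using that by blast
qed

definition inside :: "'v set \<Rightarrow> 'v set set \<Rightarrow> 'v set set" where
  "inside S \<xi> = {e \<in> \<xi>. e \<subseteq> S}"

definition off :: "'v set \<Rightarrow> 'v set set \<Rightarrow> 'v set set" where
  "off T \<xi> = {e \<in> \<xi>. e \<inter> T = {}}"

text \<open>\<open>touch T\<close> and \<open>off T\<close> split a configuration: exploring a
  cluster that turns out to be \<open>T\<close> reveals the edges touching \<open>T\<close> and
  leaves the others fresh.\<close>

definition touch :: "'v set \<Rightarrow> 'v set set \<Rightarrow> 'v set set" where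
  "touch T \<xi> = {e \<in> \<xi>. e \<inter> T \<noteq> {}}"

text \<open>If removing \<open>T\<close> destroys the connection, a self-avoiding path visits some
  \<open>v\<close> in \<open>T\<close>; its two halves are disjoint witnesses.\<close>

lemma conn_through:
  assumes "conn \<xi> x y" "\<not> conn (off T \<xi>) x y"
  shows "\<exists>v\<in>T. disj_occ (\<lambda>\<xi>. conn \<xi> x v) (\<lambda>\<xi>. conn \<xi> v y) \<xi>"
proof -
  obtain xs where xs: "distinct xs" "xs \<noteq> []" "hd xs = x" "last xs = y" "pedges xs \<subseteq> \<xi>"
    using conn_path[OF assms(1)] by blast
  have "\<exists>v\<in>T. v \<in> set xs"
  proof (rule ccontr)
    assume "\<not> (\<exists>v\<in>T. v \<in> set xs)"
    then have "pedges xs \<subseteq> off T \<xi>" using xs(5) pedges_subset unfolding off_def by blast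
    then show False using path_conn'[OF xs(2)] xs(3,4) assms(2) by auto
  qed
  then obtain v as bs where v: "v \<in> T" "xs = as @ v # bs" by (meson split_list)
  have "conn (pedges (as @ [v])) x v"
    using path_conn'[of "as @ [v]" "pedges (as @ [v])"] xs(3) v(2) by (cases as) auto
  moreover have "conn (pedges (v # bs)) v y"
    using path_conn'[of "v # bs" "pedges (v # bs)"] xs(4) v(2) by auto
  ultimately have "disj_occ (\<lambda>\<xi>. conn \<xi> x v) (\<lambda>\<xi>. conn \<xi> v y) \<xi>"
    using pedges_disjoint[of as v bs] xs(1,5) pedges_append[of as v bs] v(2) by (metis disj_occ_join)
  with v(1) show ?thesis by blast
qed

text \<open>A self-avoiding path is cut at its first vertex outside \<open>S\<close>. The initial
  piece, the crossing edge and the remainder share no edge.\<close>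

lemma conn_first_exit:
  assumes "conn \<xi> x y" "x \<in> S" "y \<notin> S"
  shows "\<exists>u\<in>S. \<exists>v. v \<notin> S \<and> {u, v} \<in> \<xi> \<and> disj_occ (\<lambda>\<xi>. conn (inside S \<xi>) x u)
     (disj_occ (\<lambda>\<xi>. {u, v} \<in> \<xi>) (\<lambda>\<xi>. conn \<xi> v y)) \<xi>"
proof -
  obtain xs where xs: "distinct xs" "xs \<noteq> []" "hd xs = x" "last xs = y" "pedges xs \<subseteq> \<xi>"
    using conn_path[OF assms(1)] by blast
  define as where "as = takeWhile (\<lambda>z. z \<in> S) xs"
  define bs where "bs = dropWhile (\<lambda>z. z \<in> S) xs"
  have xsab: "xs = as @ bs" by (simp add: as_def bs_def)
  have "bs \<noteq> []"
  proof
    assume "bs = []"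
    then have "\<forall>z\<in>set xs. z \<in> S" by (simp add: bs_def)
    then show False using xs assms(3) last_in_set by blast
  qed
  then obtain v bs' where bs': "bs = v # bs'" by (cases bs) auto
  have v: "v \<notin> S" using hd_dropWhile[of "\<lambda>z. z \<in> S" xs] \<open>bs \<noteq> []\<close> bs' by (simp add: bs_def)
  have asS: "set as \<subseteq> S" using set_takeWhileD unfolding as_def by fastforce
  have "as \<noteq> []" using xs(2,3) assms(2) by (cases xs) (auto simp: as_def)
  then obtain as' u where as': "as = as' @ [u]" by (cases as rule: rev_cases) auto
  have xs': "xs = as' @ u # v # bs'" using xsab as' bs' by simp
  have pe: "pedges xs = pedges (as' @ [u]) \<union> insert {u, v} (pedges (v # bs'))"
    unfolding xs' pedges_append[of as' u "v # bs'"] by simp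
  have "conn (pedges (as' @ [u])) x u"
    using path_conn'[of "as' @ [u]" "pedges (as' @ [u])"] xs(3) xs' by (cases as') auto
  moreover have "inside S (pedges (as' @ [u])) = pedges (as' @ [u])"
    using asS as' pedges_subset unfolding inside_def by blast
  ultimately have 1: "conn (inside S (pedges (as' @ [u]))) x u" by simp
  have 2: "conn (pedges (v # bs')) v y"
    using path_conn'[of "v # bs'" "pedges (v # bs')"] xs(4) xs' by auto
  have d1: "pedges (as' @ [u]) \<inter> insert {u, v} (pedges (v # bs')) = {}"
    using pedges_disjoint[of as' u "v # bs'"] xs(1) xs' by auto
  have d2: "{u, v} \<notin> pedges (v # bs')"
    using pedges_subset[of "{u, v}" "v # bs'"] xs(1) xs' by auto
  have 3: "disj_occ (\<lambda>\<xi>. {u, v} \<in> \<xi>) (\<lambda>\<xi>. conn \<xi> v y) (insert {u, v} (pedges (v # bs')))"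
    by (rule disj_occ_join[where a = "{{u, v}}" and b = "pedges (v # bs')"]) (use 2 d2 in simp_all)
  have "disj_occ (\<lambda>\<xi>. conn (inside S \<xi>) x u)
     (disj_occ (\<lambda>\<xi>. {u, v} \<in> \<xi>) (\<lambda>\<xi>. conn \<xi> v y)) \<xi>"
    by (rule disj_occ_join[where a = "pedges (as' @ [u])" and b = "insert {u, v} (pedges (v # bs'))"])
      (fact 1, fact 3, fact d1, use pe xs(5) in simp)
  moreover have "u \<in> S" using asS as' by auto
  ultimately show ?thesis using v pe xs(5) by blast
qed

text \<open>Walking from \<open>v\<close> back towards \<open>o'\<close>, the first vertex on the
  path from \<open>o'\<close> to \<open>u\<close> is the branch point \<open>w\<close>. The walk up
  to there shares no edge with that path, and the path itself splits at \<open>w\<close>.\<close>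

lemma conn_tree:
  assumes "conn \<xi> o' u" "conn \<xi> o' v"
  shows "\<exists>w. (w = o' \<or> w \<in> \<Union>\<xi>) \<and> disj_occ (\<lambda>\<xi>. conn \<xi> o' w) (disj_occ (\<lambda>\<xi>. conn \<xi> w u) (\<lambda>\<xi>. conn \<xi> w v)) \<xi>"
proof -
  obtain xs where xs: "distinct xs" "xs \<noteq> []" "hd xs = o'" "last xs = u" "pedges xs \<subseteq> \<xi>"
    using conn_path[OF assms(1)] by blast
  obtain ys where ys: "distinct ys" "ys \<noteq> []" "hd ys = v" "last ys = o'" "pedges ys \<subseteq> \<xi>"
    using conn_path[OF conn_sym[OF assms(2)]] by blast
  define cs where "cs = takeWhile (\<lambda>z. z \<notin> set xs) ys"
  define ds where "ds = dropWhile (\<lambda>z. z \<notin> set xs) ys"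
  have "o' \<in> set xs" "o' \<in> set ys" using hd_in_set[OF xs(2)] last_in_set[OF ys(2)] xs(3) ys(4) by auto
  then have "ds \<noteq> []" unfolding ds_def by (auto simp: dropWhile_eq_Nil_conv)
  then obtain w ds' where ds': "ds = w # ds'" by (cases ds) auto
  have w: "w \<in> set xs" using hd_dropWhile[of "\<lambda>z. z \<notin> set xs" ys] \<open>ds \<noteq> []\<close> ds' by (simp add: ds_def)
  have ys': "ys = cs @ w # ds'" using ds' unfolding cs_def using takeWhile_dropWhile_id[of "\<lambda>z. z \<notin> set xs" ys] by (simp add: ds_def)
  have cs: "set cs \<inter> set xs = {}" using set_takeWhileD unfolding cs_def by fastforce
  obtain as bs where ab: "xs = as @ w # bs" using w by (meson split_list)
  have 1: "conn (pedges (as @ [w])) o' w"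
    using path_conn'[of "as @ [w]" "pedges (as @ [w])"] xs(3) ab by (cases as) auto
  have 2: "conn (pedges (w # bs)) w u"
    using path_conn'[of "w # bs" "pedges (w # bs)"] xs(4) ab by auto
  have 3: "conn (pedges (cs @ [w])) w v"
    by (rule conn_sym) (use path_conn'[of "cs @ [w]" "pedges (cs @ [w])"] ys(3) ys' in \<open>cases cs; simp\<close>)
  have sub: "pedges (cs @ [w]) \<subseteq> \<xi>" "pedges (as @ [w]) \<subseteq> \<xi>" "pedges (w # bs) \<subseteq> \<xi>"
    using xs(5) ys(5) pedges_append[of cs w ds'] pedges_append[of as w bs] ab ys' by auto
  have d: "pedges (cs @ [w]) \<inter> pedges xs = {}"
    using pedges_snoc_meets pedges_subset cs by fastforce
  have d': "pedges (cs @ [w]) \<inter> pedges (as @ [w]) = {}" "pedges (cs @ [w]) \<inter> pedges (w # bs) = {}"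
    using d pedges_append[of as w bs] ab by auto
  have "disj_occ (\<lambda>\<xi>. conn \<xi> w u) (\<lambda>\<xi>. conn \<xi> w v) (pedges (w # bs) \<union> pedges (cs @ [w]))"
    by (rule disj_occ_join[where a = "pedges (w # bs)" and b = "pedges (cs @ [w])"]) (fact 2, fact 3, use d' in auto)
  then have 4: "disj_occ (\<lambda>\<xi>. conn \<xi> w u) (\<lambda>\<xi>. conn \<xi> w v) (pedges (w # bs) \<union> pedges (cs @ [w]))" .
  have "disj_occ (\<lambda>\<xi>. conn \<xi> o' w) (disj_occ (\<lambda>\<xi>. conn \<xi> w u) (\<lambda>\<xi>. conn \<xi> w v)) \<xi>"
    by (rule disj_occ_join[where a = "pedges (as @ [w])" and b = "pedges (w # bs) \<union> pedges (cs @ [w])"])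
      (fact 1, fact 4, use d' sub pedges_disjoint[of as w bs] xs(1) ab in auto)
  moreover have "w = o' \<or> w \<in> \<Union>\<xi>"
    using conn_in_Union[OF 1] sub(2) by auto
  ultimately show ?thesis by blast
qed

text \<open>Every path of \<open>insert e \<xi>\<close> has to cross \<open>e\<close>; a
  self-avoiding one does so once, and its two remaining pieces lie in \<open>\<xi>\<close>.\<close>

lemma pivotal_conn:
  assumes "pivotal (\<lambda>\<xi>. conn \<xi> x y) e \<xi>"
  shows "\<exists>u v. e = {u, v} \<and> disj_occ (\<lambda>\<xi>. conn \<xi> x u) (\<lambda>\<xi>. conn \<xi> v y) \<xi>"
proof -
  have con: "conn (insert e \<xi>) x y" and ncon: "\<not> conn (\<xi> - {e}) x y"
    using assms by (auto simp: pivotal_def)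
  obtain xs where xs: "distinct xs" "xs \<noteq> []" "hd xs = x" "last xs = y" "pedges xs \<subseteq> insert e \<xi>"
    using conn_path[OF con] by blast
  have "e \<in> pedges xs"
  proof (rule ccontr)
    assume "e \<notin> pedges xs"
    then have "pedges xs \<subseteq> \<xi> - {e}" using xs(5) by auto
    then show False using path_conn'[OF xs(2)] xs(3,4) ncon by auto
  qed
  have split: "\<exists>as u v bs. zs = as @ u # v # bs \<and> e = {u, v}" if "e \<in> pedges zs" for zs
    using that
  proof (induction zs rule: pedges.induct)
    case (1 a b zs)
    show ?case
    proof (cases "e = {a, b}")
      case True
      then show ?thesis by (intro exI[of _ "[]"]) auto
    next
      case False
      then obtain as u v bs where "b # zs = as @ u # v # bs" "e = {u, v}" using 1 by auto
      then show ?thesis by (intro exI[of _ "a # as"]) auto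
    qed
  qed auto
  then obtain as u v bs where xs': "xs = as @ u # v # bs" and e: "e = {u, v}"
    using \<open>e \<in> pedges xs\<close> by blast
  have pe: "pedges xs = pedges (as @ [u]) \<union> insert {u, v} (pedges (v # bs))"
    unfolding xs' pedges_append[of as u "v # bs"] by simp
  have d1: "pedges (as @ [u]) \<inter> insert {u, v} (pedges (v # bs)) = {}"
    using pedges_disjoint[of as u "v # bs"] xs(1) xs' by auto
  have d2: "{u, v} \<notin> pedges (v # bs)"
    using pedges_subset[of "{u, v}" "v # bs"] xs(1) xs' by auto
  have "conn (pedges (as @ [u])) x u"
    using path_conn'[of "as @ [u]" "pedges (as @ [u])"] xs(3) xs' by (cases as) auto
  moreover have "conn (pedges (v # bs)) v y"
    using path_conn'[of "v # bs" "pedges (v # bs)"] xs(4) xs' by auto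
  ultimately have "disj_occ (\<lambda>\<xi>. conn \<xi> x u) (\<lambda>\<xi>. conn \<xi> v y) \<xi>"
    by (rule disj_occ_join[where a = "pedges (as @ [u])" and b = "pedges (v # bs)"]) (use d1 d2 pe xs(5) e in auto)
  with e show ?thesis by blast
qed

abbreviation tau :: "real \<Rightarrow> 'v set set \<Rightarrow> 'v \<Rightarrow> 'v \<Rightarrow> real" where
  "tau p F x y \<equiv> bprob p F (\<lambda>\<xi>. conn \<xi> x y)"

abbreviation tau_in :: "real \<Rightarrow> 'v set set \<Rightarrow> 'v set \<Rightarrow> 'v \<Rightarrow> 'v \<Rightarrow> real" where
  "tau_in p F S x y \<equiv> bprob p F (\<lambda>\<xi>. conn (inside S \<xi>) x y)"

section \<open>Exploring a cluster: decoupling and correlation inequalities\<close>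

lemma clu_mono: "\<xi> \<subseteq> \<eta> \<Longrightarrow> clu \<xi> B \<subseteq> clu \<eta> B"
  unfolding clu_def by (auto intro: conn_mono)

lemma finite_clu:
  assumes "finite B" "finite (\<Union>\<xi>)"
  shows "finite (clu \<xi> B)"
proof (rule finite_subset)
  show "clu \<xi> B \<subseteq> B \<union> \<Union>\<xi>" unfolding clu_def by (auto dest: conn_in_Union)
qed (use assms in auto)

lemma touch_subset [simp]: "touch T \<xi> \<subseteq> \<xi>" by (auto simp: touch_def)
lemma off_subset [simp]: "off T \<xi> \<subseteq> \<xi>" by (auto simp: off_def)
lemma inside_subset [simp]: "inside T \<xi> \<subseteq> \<xi>" by (auto simp: inside_def)
lemma inside_mono: "\<xi> \<subseteq> \<eta> \<Longrightarrow> inside S \<xi> \<subseteq> inside S \<eta>" by (auto simp: inside_def)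

lemma incr_conn_inside: "incr (\<lambda>\<xi>. conn (inside S \<xi>) x y)"
  by (rule incrI) (erule conn_mono, erule inside_mono)

text \<open>A path from \<open>B\<close> that stays in \<open>T\<close> uses only edges touching
  \<open>T\<close>. Hence the event that the cluster equals \<open>T\<close> is independent of the
  edges off \<open>T\<close>.\<close>

lemma clu_eq_iff_touch: "clu \<xi> B = T \<longleftrightarrow> clu (touch T \<xi>) B = T"
proof
  assume T: "clu \<xi> B = T"
  have "conn (touch T \<xi>) b y" if "b \<in> B" "conn \<xi> b y" for b y
    using that(2)
  proof (induction rule: conn_induct)
    case (step y z)
    then have "y \<in> T" using T that(1) by (auto simp: clu_def)
    then have "{y, z} \<in> touch T \<xi>" using step(2) by (auto simp: touch_def)
    then show ?case using conn_trans[OF step(3) conn_edge] by simp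
  qed simp
  then have "clu \<xi> B \<subseteq> clu (touch T \<xi>) B" by (auto simp: clu_def)
  then show "clu (touch T \<xi>) B = T" using T clu_mono[of "touch T \<xi>" \<xi> B] by auto
next
  assume T: "clu (touch T \<xi>) B = T"
  have "conn (touch T \<xi>) b y" if "b \<in> B" "conn \<xi> b y" for b y
    using that(2)
  proof (induction rule: conn_induct)
    case (step y z)
    then have "y \<in> T" using T that(1) by (auto simp: clu_def)
    then have "{y, z} \<in> touch T \<xi>" using step(2) by (auto simp: touch_def)
    then show ?case using conn_trans[OF step(3) conn_edge] by simp
  qed simp
  then have "clu \<xi> B \<subseteq> clu (touch T \<xi>) B" by (auto simp: clu_def)
  then show "clu \<xi> B = T" using T clu_mono[of "touch T \<xi>" \<xi> B] by auto
qed

text \<open>Spatial Markov property: given that the cluster is \<open>T\<close>, the edges off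
  \<open>T\<close> are distributed as before, so they may be replaced by an independent copy
  \<open>\<eta>\<close>. The proof sums over the finitely many values of the cluster.\<close>

lemma cluster_decoupling:
  fixes f :: "'v set set \<Rightarrow> real"
  assumes F: "finite F" and f: "\<And>\<xi>. \<xi> \<subseteq> F \<Longrightarrow> f \<xi> = f (touch (clu \<xi> B) \<xi>)"
  shows "bexp p F (\<lambda>\<xi>. f \<xi> * g (clu \<xi> B) (off (clu \<xi> B) \<xi>)) =
    bexp p F (\<lambda>\<xi>. f \<xi> * bexp p F (\<lambda>\<eta>. g (clu \<xi> B) (off (clu \<xi> B) \<eta>)))"
proof -
  define TT where "TT = (\<lambda>\<xi>. clu \<xi> B) ` Pow F"
  have fin: "finite TT" using F by (simp add: TT_def)
  let ?f = "\<lambda>T \<xi>. f \<xi> * of_bool (clu \<xi> B = T)"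
  have split: "f \<xi> * h (clu \<xi> B) = (\<Sum>T\<in>TT. ?f T \<xi> * h T)" if "\<xi> \<subseteq> F" for \<xi> and h :: "'v set \<Rightarrow> real"
  proof -
    have "(\<Sum>T\<in>TT. ?f T \<xi> * h T) = (\<Sum>T\<in>TT. if T = clu \<xi> B then f \<xi> * h T else 0)"
      by (rule sum.cong) auto
    also have "\<dots> = f \<xi> * h (clu \<xi> B)"
      using fin that by (subst sum.delta) (auto simp: TT_def)
    finally show ?thesis by simp
  qed
  have key: "bexp p F (\<lambda>\<xi>. ?f T \<xi> * g T (off T \<xi>)) = bexp p F (?f T) * bexp p F (\<lambda>\<xi>. g T (off T \<xi>))" for T
  proof -
    have 1: "?f T \<xi> = ?f T (\<xi> \<inter> touch T F)" if "\<xi> \<subseteq> F" for \<xi>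
    proof -
      have eq: "\<xi> \<inter> touch T F = touch T \<xi>" using that by (auto simp: touch_def)
      show ?thesis unfolding eq using clu_eq_iff_touch[of \<xi> B T] f[OF that] by auto
    qed
    have 2: "g T (off T \<xi>) = g T (off T (\<xi> \<inter> off T F))" if "\<xi> \<subseteq> F" for \<xi>
    proof -
      have "off T (\<xi> \<inter> off T F) = off T \<xi>" using that by (auto simp: off_def)
      then show ?thesis by simp
    qed
    have "bexp p F (\<lambda>\<xi>. ?f T \<xi> * g T (off T \<xi>)) = bexp p F (\<lambda>\<xi>. ?f T (\<xi> \<inter> touch T F) * g T (off T (\<xi> \<inter> off T F)))"
      by (rule bexp_cong) (simp only: 1[symmetric] 2[symmetric])
    also have "\<dots> = bexp p F (\<lambda>\<xi>. ?f T (\<xi> \<inter> touch T F)) * bexp p F (\<lambda>\<xi>. g T (off T (\<xi> \<inter> off T F)))"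
      by (rule bexp_indep[OF F, of "touch T F" "off T F" p "?f T" "\<lambda>\<xi>. g T (off T \<xi>)"]) (auto simp: touch_def off_def)
    also have "bexp p F (\<lambda>\<xi>. ?f T (\<xi> \<inter> touch T F)) = bexp p F (?f T)"
      by (rule bexp_cong) (simp only: 1[symmetric])
    also have "bexp p F (\<lambda>\<xi>. g T (off T (\<xi> \<inter> off T F))) = bexp p F (\<lambda>\<xi>. g T (off T \<xi>))"
      by (rule bexp_cong) (simp only: 2[symmetric])
    finally show ?thesis .
  qed
  have "bexp p F (\<lambda>\<xi>. f \<xi> * g (clu \<xi> B) (off (clu \<xi> B) \<xi>)) = bexp p F (\<lambda>\<xi>. \<Sum>T\<in>TT. ?f T \<xi> * g T (off T \<xi>))"
  proof (rule bexp_cong)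
    fix \<xi> assume "\<xi> \<subseteq> F"
    from split[OF this, of "\<lambda>T. g T (off T \<xi>)"]
    show "f \<xi> * g (clu \<xi> B) (off (clu \<xi> B) \<xi>) = (\<Sum>T\<in>TT. ?f T \<xi> * g T (off T \<xi>))" .
  qed
  also have "\<dots> = (\<Sum>T\<in>TT. bexp p F (?f T) * bexp p F (\<lambda>\<xi>. g T (off T \<xi>)))"
    unfolding bexp_sum key ..
  also have "\<dots> = bexp p F (\<lambda>\<xi>. \<Sum>T\<in>TT. ?f T \<xi> * bexp p F (\<lambda>\<xi>. g T (off T \<xi>)))"
    unfolding bexp_sum by (rule sum.cong) (simp_all add: bexp_cmult[symmetric] mult.commute)
  also have "\<dots> = bexp p F (\<lambda>\<xi>. f \<xi> * bexp p F (\<lambda>\<eta>. g (clu \<xi> B) (off (clu \<xi> B) \<eta>)))"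
  proof (rule bexp_cong)
    fix \<xi> assume "\<xi> \<subseteq> F"
    from split[OF this, of "\<lambda>T. bexp p F (\<lambda>\<eta>. g T (off T \<eta>))"]
    show "(\<Sum>T\<in>TT. ?f T \<xi> * bexp p F (\<lambda>\<xi>. g T (off T \<xi>))) = f \<xi> * bexp p F (\<lambda>\<eta>. g (clu \<xi> B) (off (clu \<xi> B) \<eta>))"
      by simp
  qed
  finally show ?thesis .
qed

text \<open>A connection lost by deleting \<open>T\<close> passes through some \<open>v\<close> in
  \<open>T\<close>, and BK bounds the loss by the sum over \<open>v\<close>.\<close>

lemma tau_off_ge:
  assumes "finite F" "0 \<le> p" "p \<le> 1" "finite T"
  shows "bprob p F (\<lambda>\<eta>. conn (off T \<eta>) z x \<and> x \<notin> T) \<ge> tau p F z x - (\<Sum>v\<in>T. tau p F z v * tau p F v x)"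
proof (cases "x \<in> T")
  case True
  \<comment> \<open>If \<open>x\<close> lies in \<open>T\<close>, the single term
    \<open>v = x\<close> already cancels the gain.\<close>
  have "tau p F x x = 1" using assms(1) by (simp add: bprob_def)
  then have "tau p F z x \<le> tau p F z x * tau p F x x" by simp
  also have "\<dots> \<le> (\<Sum>v\<in>T. tau p F z v * tau p F v x)"
    using True assms by (intro member_le_sum[of x T "\<lambda>v. tau p F z v * tau p F v x"]) (auto intro!: mult_nonneg_nonneg bprob_nonneg)
  finally have "tau p F z x - (\<Sum>v\<in>T. tau p F z v * tau p F v x) \<le> 0" by simp
  also have "0 \<le> bprob p F (\<lambda>\<eta>. conn (off T \<eta>) z x \<and> x \<notin> T)" by (rule bprob_nonneg[OF assms(2,3)])
  finally show ?thesis .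
next
  case False
  have "tau p F z x \<le> bprob p F (\<lambda>\<eta>. conn (off T \<eta>) z x) +
      bprob p F (\<lambda>\<eta>. \<exists>v\<in>T. disj_occ (\<lambda>\<xi>. conn \<xi> z v) (\<lambda>\<xi>. conn \<xi> v x) \<eta>)"
  proof (rule bprob_disj_le[OF assms(2,3)])
    fix \<xi> assume "conn \<xi> z x"
    from conn_through[OF this, of T]
    show "conn (off T \<xi>) z x \<or> (\<exists>v\<in>T. disj_occ (\<lambda>\<xi>. conn \<xi> z v) (\<lambda>\<xi>. conn \<xi> v x) \<xi>)" by blast
  qed
  also have "bprob p F (\<lambda>\<eta>. \<exists>v\<in>T. disj_occ (\<lambda>\<xi>. conn \<xi> z v) (\<lambda>\<xi>. conn \<xi> v x) \<eta>)
      \<le> (\<Sum>v\<in>T. bprob p F (disj_occ (\<lambda>\<xi>. conn \<xi> z v) (\<lambda>\<xi>. conn \<xi> v x)))"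
    by (rule bprob_union_le[OF assms(2,3,4)]) auto
  also have "\<dots> \<le> (\<Sum>v\<in>T. tau p F z v * tau p F v x)"
    by (intro sum_mono bk assms incr_conn)
  finally show ?thesis using False by simp
qed

text \<open>Expose the cluster of \<open>a\<close> and then connect \<open>z\<close> to
  \<open>x\<close> through the fresh edges off it. The sum over the cluster is the BK price for
  avoiding it, so the bound is useful when the cluster is thin as seen from
  \<open>z\<close>.\<close>

lemma disjoint_clusters_ge:
  assumes F: "finite F" "finite (\<Union>F)" and p: "0 \<le> p" "p \<le> 1"
    and A: "\<And>\<xi>. \<xi> \<subseteq> F \<Longrightarrow> A \<xi> = A (touch (clu \<xi> {a}) \<xi>)"
  shows "bprob p F (\<lambda>\<xi>. A \<xi> \<and> conn \<xi> z x \<and> \<not> conn \<xi> a x) \<ge>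
    bexp p F (\<lambda>\<xi>. of_bool (A \<xi>) * (tau p F z x - (\<Sum>v\<in>clu \<xi> {a}. tau p F z v * tau p F v x)))"
proof -
  let ?g = "\<lambda>T \<eta>. of_bool (conn \<eta> z x \<and> x \<notin> T) :: real"
  have fin: "finite (clu \<xi> {a})" if "\<xi> \<subseteq> F" for \<xi>
    using that F(2) by (intro finite_clu) (auto intro: finite_subset[OF Union_mono])
  have "bexp p F (\<lambda>\<xi>. of_bool (A \<xi>) * (tau p F z x - (\<Sum>v\<in>clu \<xi> {a}. tau p F z v * tau p F v x)))
     \<le> bexp p F (\<lambda>\<xi>. of_bool (A \<xi>) * bexp p F (\<lambda>\<eta>. ?g (clu \<xi> {a}) (off (clu \<xi> {a}) \<eta>)))"
  proof (rule bexp_mono[OF p], rule mult_left_mono)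
    fix \<xi> assume "\<xi> \<subseteq> F"
    from tau_off_ge[OF F(1) p fin[OF this], of z x]
    show "tau p F z x - (\<Sum>v\<in>clu \<xi> {a}. tau p F z v * tau p F v x)
      \<le> bexp p F (\<lambda>\<eta>. ?g (clu \<xi> {a}) (off (clu \<xi> {a}) \<eta>))" by (simp add: bprob_def)
  qed simp
  also have "\<dots> = bexp p F (\<lambda>\<xi>. of_bool (A \<xi>) * ?g (clu \<xi> {a}) (off (clu \<xi> {a}) \<xi>))"
    by (rule cluster_decoupling[OF F(1), where g = ?g, symmetric]) (use A in simp)
  also have "\<dots> \<le> bprob p F (\<lambda>\<xi>. A \<xi> \<and> conn \<xi> z x \<and> \<not> conn \<xi> a x)"
    unfolding bprob_def
  proof (rule bexp_mono[OF p])
    fix \<xi>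
    have "conn (off (clu \<xi> {a}) \<xi>) z x \<Longrightarrow> conn \<xi> z x" by (rule conn_mono[OF _ off_subset])
    then show "of_bool (A \<xi>) * ?g (clu \<xi> {a}) (off (clu \<xi> {a}) \<xi>) \<le> (of_bool (A \<xi> \<and> conn \<xi> z x \<and> \<not> conn \<xi> a x) :: real)"
      by (auto simp: clu_def)
  qed
  finally show ?thesis .
qed

lemma bk3:
  assumes "finite E" "0 \<le> p" "p \<le> 1" "incr A" "incr B" "incr C"
  shows "bprob p E (disj_occ A (disj_occ B C)) \<le> bprob p E A * (bprob p E B * bprob p E C)"
  using bk[OF assms(1-4) incr_disj_occ] mult_left_mono[OF bk[OF assms(1-3,5,6)] bprob_nonneg[OF assms(2,3)]]
  by (rule order_trans)

text \<open>The tree-graph inequality of Aizenman and Newman: a branch point \<open>w\<close> and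
  two applications of BK.\<close>

lemma tree_graph:
  assumes "finite F" "0 \<le> p" "p \<le> 1" "finite V" "a \<in> V" "\<Union>F \<subseteq> V"
  shows "bprob p F (\<lambda>\<xi>. conn \<xi> a u \<and> conn \<xi> a v) \<le> (\<Sum>w\<in>V. tau p F a w * (tau p F w u * tau p F w v))"
proof -
  have "bprob p F (\<lambda>\<xi>. conn \<xi> a u \<and> conn \<xi> a v)
    \<le> (\<Sum>w\<in>V. bprob p F (disj_occ (\<lambda>\<xi>. conn \<xi> a w) (disj_occ (\<lambda>\<xi>. conn \<xi> w u) (\<lambda>\<xi>. conn \<xi> w v))))"
  proof (rule bprob_union_le[OF assms(2-4)])
    fix \<xi> assume "\<xi> \<subseteq> F" "conn \<xi> a u \<and> conn \<xi> a v"
    then show "\<exists>w\<in>V. disj_occ (\<lambda>\<xi>. conn \<xi> a w) (disj_occ (\<lambda>\<xi>. conn \<xi> w u) (\<lambda>\<xi>. conn \<xi> w v)) \<xi>"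
      using conn_tree[of \<xi> a u v] assms(5,6) by blast
  qed
  also have "\<dots> \<le> (\<Sum>w\<in>V. tau p F a w * (tau p F w u * tau p F w v))"
    by (intro sum_mono bk3 assms incr_conn)
  finally show ?thesis .
qed

lemma bprob_edge: "finite F \<Longrightarrow> e \<in> F \<Longrightarrow> bprob p F (\<lambda>\<xi>. e \<in> \<xi>) = p"
  unfolding bprob_def using bexp_resample[of F e p "\<lambda>\<xi>. of_bool (e \<in> \<xi>)"] by simp

text \<open>First exit from \<open>S\<close> and BK; the first factor is restricted to
  \<open>S\<close>, as in Lieb's refinement of Simon's inequality. The target is a set so that both
  two-point functions and arms are covered.\<close>

lemma simon_lieb:
  assumes F: "finite F" and p: "0 \<le> p" "p \<le> 1" and S: "finite S" "a \<in> S" "Y \<inter> S = {}" and N: "finite N" "\<Union>F \<subseteq> N"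
  shows "bprob p F (\<lambda>\<xi>. \<exists>y\<in>Y. conn \<xi> a y) \<le>
    (\<Sum>u\<in>S. \<Sum>v\<in>{v \<in> N. v \<notin> S \<and> {u, v} \<in> F}. tau_in p F S a u * (p * bprob p F (\<lambda>\<xi>. \<exists>y\<in>Y. conn \<xi> v y)))"
proof -
  let ?I = "Sigma S (\<lambda>u. {v \<in> N. v \<notin> S \<and> {u, v} \<in> F})"
  let ?D = "\<lambda>(u, v). disj_occ (\<lambda>\<xi>. conn (inside S \<xi>) a u) (disj_occ (\<lambda>\<xi>. {u, v} \<in> \<xi>) (\<lambda>\<xi>. \<exists>y\<in>Y. conn \<xi> v y))"
  have inc: "incr (\<lambda>\<xi>. {u, v} \<in> \<xi>)" "incr (\<lambda>\<xi>. \<exists>y\<in>Y. conn \<xi> v y)" for u v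
    by (rule incrI, blast, rule incrI, blast intro: conn_mono)
  have "bprob p F (\<lambda>\<xi>. \<exists>y\<in>Y. conn \<xi> a y) \<le> (\<Sum>i\<in>?I. bprob p F (?D i))"
  proof (rule bprob_union_le[OF p])
    show "finite ?I" using S(1) N(1) by auto
    fix \<xi> assume w: "\<xi> \<subseteq> F" "\<exists>y\<in>Y. conn \<xi> a y"
    then obtain y where y: "y \<in> Y" "conn \<xi> a y" by auto
    obtain u v where uv: "u \<in> S" "v \<notin> S" "{u, v} \<in> \<xi>"
      "disj_occ (\<lambda>\<xi>. conn (inside S \<xi>) a u) (disj_occ (\<lambda>\<xi>. {u, v} \<in> \<xi>) (\<lambda>\<xi>. conn \<xi> v y)) \<xi>"
      using conn_first_exit[OF y(2) S(2)] S(3) y(1) by blast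
    have "?D (u, v) \<xi>"
      using uv(4) by (auto elim!: disj_occ_mono intro: bexI[OF _ y(1)])
    moreover have "(u, v) \<in> ?I" using uv w(1) N(2) by blast
    ultimately show "\<exists>i\<in>?I. ?D i \<xi>" by blast
  qed
  also have "\<dots> \<le> (\<Sum>(u, v)\<in>?I. tau_in p F S a u * (p * bprob p F (\<lambda>\<xi>. \<exists>y\<in>Y. conn \<xi> v y)))"
  proof (rule sum_mono)
    fix i assume "i \<in> ?I"
    then obtain u v where i: "i = (u, v)" "{u, v} \<in> F" by auto
    show "bprob p F (?D i) \<le> (case i of (u, v) \<Rightarrow> tau_in p F S a u * (p * bprob p F (\<lambda>\<xi>. \<exists>y\<in>Y. conn \<xi> v y)))"
      using bk3[OF F p incr_conn_inside[of S a u] inc(1)[of u v] inc(2)[of v]] bprob_edge[OF F i(2), of p] by (simp add: i(1))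
  qed
  finally show ?thesis
    using S(1) N(1) by (simp add: sum.Sigma)
qed

text \<open>With Russo's formula this is an upper bound for the derivative of the two-point
  function. Ordered pairs are summed because the path may cross the edge in either
  direction.\<close>

lemma pivotal_sum_le:
  assumes F: "finite F" and p: "0 \<le> p" "p \<le> 1" and V: "finite V" "\<Union>F \<subseteq> V"
  shows "(\<Sum>e\<in>F. bprob p F (pivotal (\<lambda>\<xi>. conn \<xi> x y) e)) \<le> (\<Sum>u\<in>V. \<Sum>v\<in>{v \<in> V. {u, v} \<in> F}. tau p F x u * tau p F v y)"
proof -
  let ?I = "Sigma V (\<lambda>u. {v \<in> V. {u, v} \<in> F})"
  let ?t = "\<lambda>(u, v). tau p F x u * tau p F v y"
  have fin: "finite ?I" using V(1) by auto
  have "(\<Sum>e\<in>F. bprob p F (pivotal (\<lambda>\<xi>. conn \<xi> x y) e)) \<le> (\<Sum>e\<in>F. \<Sum>i\<in>{i \<in> ?I. {fst i, snd i} = e}. ?t i)"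
  proof (rule sum_mono)
    fix e assume e: "e \<in> F"
    let ?J = "{i \<in> ?I. {fst i, snd i} = e}"
    have "bprob p F (pivotal (\<lambda>\<xi>. conn \<xi> x y) e) \<le> (\<Sum>i\<in>?J. bprob p F (\<lambda>\<xi>. disj_occ (\<lambda>\<xi>. conn \<xi> x (fst i)) (\<lambda>\<xi>. conn \<xi> (snd i) y) \<xi>))"
    proof (rule bprob_union_le[OF p])
      show "finite ?J" using fin by auto
      fix \<xi> assume pv: "pivotal (\<lambda>\<xi>. conn \<xi> x y) e \<xi>"
      obtain u v where uv: "e = {u, v}" "disj_occ (\<lambda>\<xi>. conn \<xi> x u) (\<lambda>\<xi>. conn \<xi> v y) \<xi>"
        using pivotal_conn[OF pv] by blast
      then have "(u, v) \<in> ?J" using e V(2) by auto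
      then show "\<exists>i\<in>?J. disj_occ (\<lambda>\<xi>. conn \<xi> x (fst i)) (\<lambda>\<xi>. conn \<xi> (snd i) y) \<xi>" by (rule bexI[rotated]) (simp add: uv(2))
    qed
    also have "\<dots> \<le> (\<Sum>i\<in>?J. ?t i)"
      by (rule sum_mono) (auto simp: case_prod_beta intro!: bk F p incr_conn)
    finally show "bprob p F (pivotal (\<lambda>\<xi>. conn \<xi> x y) e) \<le> (\<Sum>i\<in>?J. ?t i)" .
  qed
  also have "\<dots> = (\<Sum>i\<in>?I. ?t i)"
    by (rule sum.group[OF fin F]) auto
  also have "\<dots> = (\<Sum>u\<in>V. \<Sum>v\<in>{v \<in> V. {u, v} \<in> F}. tau p F x u * tau p F v y)"
    using V(1) by (subst sum.Sigma) auto
  finally show ?thesis .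
qed

section \<open>Opening paths to create pivotal edges\<close>

lemma pedges_take_Suc:
  assumes "Suc i < length vs"
  shows "pedges (take (Suc (Suc i)) vs) = insert {vs ! i, vs ! Suc i} (pedges (take (Suc i) vs))"
  using assms
proof (induction vs arbitrary: i rule: pedges.induct)
  case (1 x y zs)
  show ?case
  proof (cases i)
    case (Suc j)
    then show ?thesis using "1.IH"[of j] "1.prems" by auto
  qed simp
qed auto

lemma pedges_take_subset: "pedges (take k vs) \<subseteq> pedges vs"
proof (induction vs arbitrary: k rule: pedges.induct)
  case (1 x y zs)
  show ?case
  proof (cases k)
    case (Suc j)
    then show ?thesis using "1.IH"[of j] by (cases j) auto
  qed simp
next
  case ("2_2" v)
  then show ?case by (cases k) auto
qed auto

text \<open>Opening the edges of a path between two disjoint clusters one after the other: the edge that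
  creates the connection is pivotal at that moment.\<close>

lemma open_path_pivotal:
  assumes "vs \<noteq> []" "conn \<xi> a (hd vs)" "conn \<xi> (last vs) x" "\<not> conn \<xi> a x"
  shows "\<exists>i. Suc i < length vs \<and> pivotal (\<lambda>\<xi>. conn \<xi> a x) {vs ! i, vs ! Suc i} (\<xi> \<union> pedges (take (Suc (Suc i)) vs))"
proof -
  let ?P = "\<lambda>k. conn (\<xi> \<union> pedges (take k vs)) a x"
  have full: "?P (length vs)"
  proof -
    have "conn (\<xi> \<union> pedges vs) (hd vs) (last vs)" by (rule path_conn'[OF assms(1)]) auto
    moreover have "conn (\<xi> \<union> pedges vs) a (hd vs)" "conn (\<xi> \<union> pedges vs) (last vs) x"
      by (rule conn_mono[OF assms(2)], simp, rule conn_mono[OF assms(3)], simp)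
    ultimately have "conn (\<xi> \<union> pedges vs) a x" by (blast intro: conn_trans)
    then show ?thesis by simp
  qed
  \<comment> \<open>\<open>k\<close> counts vertices, so the last opened edge is the one between the
    positions \<open>k - 2\<close> and \<open>k - 1\<close>; prefixes of length 0 and 1 open
    nothing.\<close>
  define k where "k = (LEAST k. ?P k)"
  have k: "?P k" unfolding k_def using full by (rule LeastI)
  have kle: "k \<le> length vs" unfolding k_def using full by (rule Least_le)
  have least: "\<not> ?P j" if "j < k" for j using not_less_Least[of j ?P] that by (simp add: k_def)
  have "\<not> ?P 0" "\<not> ?P (Suc 0)" using assms(1,4) by (cases vs; simp)+
  then obtain i where i: "k = Suc (Suc i)" using k by (metis not0_implies_Suc)
  have len: "Suc i < length vs" using kle i by simp
  let ?e = "{vs ! i, vs ! Suc i}"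
  let ?\<eta> = "\<xi> \<union> pedges (take (Suc (Suc i)) vs)"
  have eta: "?\<eta> = insert ?e (\<xi> \<union> pedges (take (Suc i) vs))" using pedges_take_Suc[OF len] by auto
  have "?\<eta> - {?e} \<subseteq> \<xi> \<union> pedges (take (Suc i) vs)" unfolding eta by auto
  then have "\<not> conn (?\<eta> - {?e}) a x" using least[of "Suc i"] i conn_mono[of "?\<eta> - {?e}" a x] by blast
  moreover have "insert ?e ?\<eta> = ?\<eta>" unfolding eta by auto
  ultimately show ?thesis using k i len unfolding pivotal_def by auto
qed

lemma conn_take:
  assumes "j < k" "j < length vs"
  shows "conn (pedges (take k vs)) (hd vs) (vs ! j)"
proof -
  let ?ws = "take (Suc j) vs"
  have ne: "?ws \<noteq> []" using assms by (cases vs) auto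
  have "conn (pedges ?ws) (hd ?ws) (last ?ws)" by (rule path_conn'[OF ne]) simp
  moreover have "last ?ws = vs ! j" using assms(2) by (simp add: last_conv_nth take_Suc_conv_app_nth)
  moreover have "hd ?ws = hd vs" using ne by (cases vs) auto
  moreover have "?ws = take (Suc j) (take k vs)" using assms(1) by (simp add: min_def)
  ultimately show ?thesis using pedges_take_subset[of "Suc j" "take k vs"] by (simp add: conn_mono)
qed

text \<open>Two pivotal edges, each reached from \<open>a\<close> by a path inside \<open>S\<close> followed by a path of edges leaving \<open>S\<close>,
  cannot avoid each other's outer paths: otherwise the one crossed last could be bypassed.\<close>

lemma pivotal_paths_meet:
  assumes S: "conn (inside S \<eta>) a (hd vs)" "conn (inside S \<eta>) a (hd ws)"
    and vs: "Suc i < length vs" "pedges (take (Suc (Suc i)) vs) \<subseteq> \<eta>" "\<And>e. e \<in> pedges vs \<Longrightarrow> \<not> e \<subseteq> S"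
    and ws: "Suc j < length ws" "pedges (take (Suc (Suc j)) ws) \<subseteq> \<eta>" "\<And>e. e \<in> pedges ws \<Longrightarrow> \<not> e \<subseteq> S"
    and piv: "pivotal (\<lambda>\<xi>. conn \<xi> a x) {vs ! i, vs ! Suc i} \<eta>" "pivotal (\<lambda>\<xi>. conn \<xi> a x) {ws ! j, ws ! Suc j} \<eta>"
  shows "pedges vs \<inter> pedges ws \<noteq> {}"
proof
  assume disj: "pedges vs \<inter> pedges ws = {}"
  define e where "e = {vs ! i, vs ! Suc i}"
  define e' where "e' = {ws ! j, ws ! Suc j}"
  have e_in: "e \<in> pedges (take (Suc (Suc i)) vs)" "e' \<in> pedges (take (Suc (Suc j)) ws)"
    using pedges_take_Suc[OF vs(1)] pedges_take_Suc[OF ws(1)] by (auto simp: e_def e'_def)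
  then have e_in': "e \<in> pedges vs" "e' \<in> pedges ws" using pedges_take_subset by blast+
  have eta: "e \<in> \<eta>" "e' \<in> \<eta>" using e_in vs(2) ws(2) by auto
  \<comment> \<open>The end points of either edge are reached from \<open>a\<close> without the
    other edge: a stretch inside \<open>S\<close>, where no outer edge lies, and the own outer path,
    assumed disjoint from the other one.\<close>
  have reach: "conn (\<eta> - {f}) a u" if S': "conn (inside S \<eta>) a (hd us)" and us: "Suc k < length us"
      "pedges (take (Suc (Suc k)) us) \<subseteq> \<eta>" and f: "\<not> f \<subseteq> S" "f \<notin> pedges us" and u: "u \<in> {us ! k, us ! Suc k}" for us k f u
  proof -
    have "inside S \<eta> \<subseteq> \<eta> - {f}" using f(1) by (auto simp: inside_def)
    then have 1: "conn (\<eta> - {f}) a (hd us)" by (rule conn_mono[OF S'])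
    have 2: "pedges (take (Suc (Suc k)) us) \<subseteq> \<eta> - {f}" using us(2) f(2) pedges_take_subset[of "Suc (Suc k)" us] by blast
    have "conn (pedges (take (Suc (Suc k)) us)) (hd us) u" using u us(1) conn_take[of k "Suc (Suc k)" us] conn_take[of "Suc k" "Suc (Suc k)" us] by auto
    then have "conn (\<eta> - {f}) (hd us) u" by (rule conn_mono[OF _ 2])
    with 1 show ?thesis by (rule conn_trans)
  qed
  have r1: "conn (\<eta> - {e'}) a u" if "u \<in> e" for u
    by (rule reach[OF S(1) vs(1,2)]) (use ws(3)[OF e_in'(2)] disj e_in' that in \<open>auto simp: e_def\<close>)
  have r2: "conn (\<eta> - {e}) a u" if "u \<in> e'" for u
    by (rule reach[OF S(2) ws(1,2)]) (use vs(3)[OF e_in'(1)] disj e_in' that in \<open>auto simp: e'_def\<close>)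
  have np: "\<not> conn (\<eta> - {e}) a x" "\<not> conn (\<eta> - {e'}) a x" using piv by (auto simp: pivotal_def e_def e'_def)
  have "insert e \<eta> = \<eta>" using eta by auto
  then have "conn \<eta> a x" using piv(1) by (simp add: pivotal_def e_def)
  then have "conn \<eta> x a" by (rule conn_sym)
  let ?\<zeta> = "\<eta> - {e, e'}"
  \<comment> \<open>Walk from \<open>x\<close> towards \<open>a\<close> until an end point of
    \<open>e\<close> or \<open>e'\<close> is met. Up to there neither edge is used, and that end
    point can be joined to \<open>a\<close> without the other edge, contradicting its
    pivotality.\<close>
  have "conn ?\<zeta> x a \<or> (\<exists>u\<in>e \<union> e'. conn ?\<zeta> x u)"
    using \<open>conn \<eta> x a\<close>
  proof (induction rule: conn_induct)
    case (step w w')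
    show ?case
    proof (cases "\<exists>u\<in>e \<union> e'. conn ?\<zeta> x u")
      case False
      then have w: "conn ?\<zeta> x w" using step by auto
      then have "w \<notin> e \<union> e'" using False by auto
      then have "{w, w'} \<in> ?\<zeta>" using step(2) by auto
      then show ?thesis using conn_trans[OF w conn_edge] by auto
    qed auto
  qed simp
  then show False
  proof (elim disjE bexE)
    assume "conn ?\<zeta> x a"
    then have "conn (\<eta> - {e}) x a" by (rule conn_mono) auto
    from conn_sym[OF this] np(1) show False by simp
  next
    fix u assume u: "u \<in> e \<union> e'" "conn ?\<zeta> x u"
    have c: "conn (\<eta> - {e}) u x" "conn (\<eta> - {e'}) u x"
      by (rule conn_sym, rule conn_mono[OF u(2)], blast)+
    show False
    proof (cases "u \<in> e")
      case True
      from conn_trans[OF r1[OF True] c(2)] np(2) show False by simp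
    next
      case False
      then have "u \<in> e'" using u(1) by auto
      from conn_trans[OF r2[OF this] c(1)] np(1) show False by simp
    qed
  qed
qed

text \<open>An event inside \<open>B\<close> is independent of the part of the path before its first visit to \<open>B\<close>.\<close>

lemma first_entrance_decoupling:
  assumes F: "finite F" and p: "0 \<le> p" "p \<le> 1" and N: "finite N" and a: "a \<notin> B" and y: "y \<in> B"
    and A: "\<And>\<xi>. A \<xi> = A (inside B \<xi>)"
    and adj: "\<And>u v. {u, v} \<in> F \<Longrightarrow> u \<in> S \<Longrightarrow> u \<notin> B \<Longrightarrow> v \<in> B \<Longrightarrow> u \<in> N"
  shows "bprob p F (\<lambda>\<xi>. conn (inside S \<xi>) a y \<and> A \<xi>) \<le> (\<Sum>u\<in>N. tau_in p F S a u) * bprob p F A"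
proof -
  have "bprob p F (\<lambda>\<xi>. conn (inside S \<xi>) a y \<and> A \<xi>) \<le> (\<Sum>u\<in>N. bprob p F (\<lambda>\<xi>. conn (inside (S - B) \<xi>) a u \<and> A \<xi>))"
  proof (rule bprob_union_le[OF p N])
    fix \<xi> assume w: "\<xi> \<subseteq> F" "conn (inside S \<xi>) a y \<and> A \<xi>"
    have "\<exists>u\<in>- B. \<exists>v. v \<notin> - B \<and> {u, v} \<in> inside S \<xi> \<and> disj_occ (\<lambda>\<xi>. conn (inside (- B) \<xi>) a u)
       (disj_occ (\<lambda>\<xi>. {u, v} \<in> \<xi>) (\<lambda>\<xi>. conn \<xi> v y)) (inside S \<xi>)"
      by (rule conn_first_exit) (use w a y in auto)
    then obtain u v where uv: "u \<notin> B" "v \<in> B" "{u, v} \<in> inside S \<xi>"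
      "disj_occ (\<lambda>\<xi>. conn (inside (- B) \<xi>) a u) (disj_occ (\<lambda>\<xi>. {u, v} \<in> \<xi>) (\<lambda>\<xi>. conn \<xi> v y)) (inside S \<xi>)"
      by auto
    then obtain \<xi>' where w': "\<xi>' \<subseteq> inside S \<xi>" "conn (inside (- B) \<xi>') a u" unfolding disj_occ_def by auto
    have "inside (- B) \<xi>' \<subseteq> inside (S - B) \<xi>" using w'(1) by (auto simp: inside_def)
    from conn_mono[OF w'(2) this] have "conn (inside (S - B) \<xi>) a u" .
    moreover have "u \<in> N" by (rule adj[of u v]) (use uv w(1) in \<open>auto simp: inside_def\<close>)
    ultimately show "\<exists>u\<in>N. conn (inside (S - B) \<xi>) a u \<and> A \<xi>" using w(2) by auto
  qed
  also have "\<dots> = (\<Sum>u\<in>N. tau_in p F (S - B) a u * bprob p F A)"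
  proof (rule sum.cong[OF refl])
    fix u
    show "bprob p F (\<lambda>\<xi>. conn (inside (S - B) \<xi>) a u \<and> A \<xi>) = tau_in p F (S - B) a u * bprob p F A"
    \<comment> \<open>The empty set would count as an edge inside both regions. Removing it changes
      no connection and makes the two edge families disjoint.\<close>
    proof (rule bprob_indep[OF F, of "inside (S - B) F - {{}}" "inside B F"])
      fix \<xi> assume w: "\<xi> \<subseteq> F"
      have "conn (inside (S - B) \<xi>) a u = conn (inside (S - B) \<xi> - {{}}) a u"
        by (simp add: conn_def)
      moreover have "conn (inside (S - B) (\<xi> \<inter> (inside (S - B) F - {{}}))) a u = conn (inside (S - B) (\<xi> \<inter> (inside (S - B) F - {{}})) - {{}}) a u"
        by (simp add: conn_def)
      moreover have "inside (S - B) (\<xi> \<inter> (inside (S - B) F - {{}})) - {{}} = inside (S - B) \<xi> - {{}}"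
        using w by (auto simp: inside_def)
      ultimately show "conn (inside (S - B) \<xi>) a u = conn (inside (S - B) (\<xi> \<inter> (inside (S - B) F - {{}}))) a u" by simp
      have "inside B (\<xi> \<inter> inside B F) = inside B \<xi>" using w by (auto simp: inside_def)
      then show "A \<xi> = A (\<xi> \<inter> inside B F)" using A[of \<xi>] A[of "\<xi> \<inter> inside B F"] by simp
    qed (auto simp: inside_def)
  qed
  also have "\<dots> \<le> (\<Sum>u\<in>N. tau_in p F S a u * bprob p F A)"
  proof (intro sum_mono mult_right_mono bprob_mono p bprob_nonneg)
    fix u \<xi> assume "conn (inside (S - B) \<xi>) a u"
    then show "conn (inside S \<xi>) a u" by (rule conn_mono) (auto simp: inside_def)
  qed
  finally show ?thesis by (simp add: sum_distrib_right)
qed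

text \<open>The opening is a map on configurations that creates a pivotal edge at some stage
  \<open>i < l\<close>; finite energy pays \<open>p ^ l\<close> to make the opened configuration a
  typical one. \<open>A'\<close> is whatever survives the opening.\<close>

lemma opening_bound:
  assumes F: "finite F" and p: "0 \<le> p" "p \<le> 1"
    and vs: "vs \<noteq> []" "length vs \<le> Suc l" "pedges vs \<subseteq> F" "card (pedges vs) \<le> l"
    and A: "\<And>\<xi> i. A \<xi> \<Longrightarrow> A' (\<xi> \<union> pedges (take i vs))"
  shows "p ^ l * bprob p F (\<lambda>\<xi>. A \<xi> \<and> conn \<xi> a (hd vs) \<and> conn \<xi> (last vs) x \<and> \<not> conn \<xi> a x) \<le>
     (\<Sum>i<l. bprob p F (\<lambda>\<eta>. Suc i < length vs \<and> A' \<eta> \<and> pedges (take (Suc (Suc i)) vs) \<subseteq> \<eta> \<and> pivotal (\<lambda>\<xi>. conn \<xi> a x) {vs ! i, vs ! Suc i} \<eta>))"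
proof -
  let ?H = "\<lambda>i \<eta>. Suc i < length vs \<and> A' \<eta> \<and> pedges (take (Suc (Suc i)) vs) \<subseteq> \<eta> \<and> pivotal (\<lambda>\<xi>. conn \<xi> a x) {vs ! i, vs ! Suc i} \<eta>"
  have "bprob p F (\<lambda>\<xi>. A \<xi> \<and> conn \<xi> a (hd vs) \<and> conn \<xi> (last vs) x \<and> \<not> conn \<xi> a x)
    \<le> (\<Sum>i<l. bprob p F (\<lambda>\<xi>. ?H i (\<xi> \<union> pedges (take (Suc (Suc i)) vs))))"
  proof (rule bprob_union_le[OF p])
    fix \<xi> assume w: "A \<xi> \<and> conn \<xi> a (hd vs) \<and> conn \<xi> (last vs) x \<and> \<not> conn \<xi> a x"
    then obtain i where i: "Suc i < length vs" "pivotal (\<lambda>\<xi>. conn \<xi> a x) {vs ! i, vs ! Suc i} (\<xi> \<union> pedges (take (Suc (Suc i)) vs))"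
      using open_path_pivotal[OF vs(1), of \<xi> a x] by blast
    moreover have "A' (\<xi> \<union> pedges (take (Suc (Suc i)) vs))" using A w by blast
    ultimately have "?H i (\<xi> \<union> pedges (take (Suc (Suc i)) vs))" by simp
    moreover have "i \<in> {..<l}" using i(1) vs(2) by simp
    ultimately show "\<exists>i\<in>{..<l}. ?H i (\<xi> \<union> pedges (take (Suc (Suc i)) vs))" by (rule bexI)
  qed simp
  then have "p ^ l * bprob p F (\<lambda>\<xi>. A \<xi> \<and> conn \<xi> a (hd vs) \<and> conn \<xi> (last vs) x \<and> \<not> conn \<xi> a x)
    \<le> (\<Sum>i<l. p ^ l * bprob p F (\<lambda>\<xi>. ?H i (\<xi> \<union> pedges (take (Suc (Suc i)) vs))))"
    unfolding sum_distrib_left[symmetric] using p by (intro mult_left_mono) auto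
  also have "\<dots> \<le> (\<Sum>i<l. bprob p F (?H i))"
  proof (rule sum_mono)
    fix i
    have sub: "pedges (take (Suc (Suc i)) vs) \<subseteq> pedges vs" by (rule pedges_take_subset)
    have "card (pedges (take (Suc (Suc i)) vs)) \<le> card (pedges vs)" by (rule card_mono[OF _ sub]) simp
    with vs(4) have "card (pedges (take (Suc (Suc i)) vs)) \<le> l" by simp
    then show "p ^ l * bprob p F (\<lambda>\<xi>. ?H i (\<xi> \<union> pedges (take (Suc (Suc i)) vs))) \<le> bprob p F (?H i)"
      using sub vs(3) by (intro bprob_finite_energy[OF F p]) auto
  qed
  finally show ?thesis .
qed

lemma card_pedges: "card (pedges vs) \<le> length vs - 1"
proof (induction vs rule: pedges.induct)
  case (1 x y zs)
  have "card (pedges (x # y # zs)) \<le> Suc (card (pedges (y # zs)))" by (simp add: card_insert_le_m1 card_insert_if)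
  then show ?case using 1 by simp
qed auto

lemma nth_edge_in_pedges: "Suc i < length vs \<Longrightarrow> {vs ! i, vs ! Suc i} \<in> pedges vs"
  using pedges_take_Suc[of i vs] pedges_take_subset[of "Suc (Suc i)" vs] by auto

text \<open>A pivotal edge is charged by at most \<open>m\<close> of the paths and, crudely,
  \<open>l\<close> times by each. With Russo's formula this is a lower bound for a
  derivative.\<close>

lemma sum_pivotal_ge:
  assumes F: "finite F" and p: "0 \<le> p" "p \<le> 1" and I: "finite I"
    and P: "\<And>i. i \<in> I \<Longrightarrow> P i \<noteq> [] \<and> length (P i) \<le> Suc l \<and> pedges (P i) \<subseteq> F"
    and m: "\<And>e. card {i \<in> I. e \<in> pedges (P i)} \<le> m"
  shows "p ^ l * (\<Sum>i\<in>I. bprob p F (\<lambda>\<xi>. conn \<xi> a (hd (P i)) \<and> conn \<xi> (last (P i)) x \<and> \<not> conn \<xi> a x))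
    \<le> real (l * m) * (\<Sum>e\<in>F. bprob p F (pivotal (\<lambda>\<xi>. conn \<xi> a x) e))"
proof -
  let ?q = "\<lambda>e. bprob p F (pivotal (\<lambda>\<xi>. conn \<xi> a x) e)"
  have q0: "0 \<le> ?q e" for e by (rule bprob_nonneg[OF p])
  have one: "p ^ l * bprob p F (\<lambda>\<xi>. conn \<xi> a (hd (P i)) \<and> conn \<xi> (last (P i)) x \<and> \<not> conn \<xi> a x) \<le> real l * (\<Sum>e\<in>F. if e \<in> pedges (P i) then ?q e else 0)"
    if "i \<in> I" for i
  proof -
    let ?vs = "P i"
    have c: "card (pedges ?vs) \<le> l" using card_pedges[of ?vs] P[OF that] by linarith
    have "p ^ l * bprob p F (\<lambda>\<xi>. True \<and> conn \<xi> a (hd ?vs) \<and> conn \<xi> (last ?vs) x \<and> \<not> conn \<xi> a x) \<le>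
     (\<Sum>k<l. bprob p F (\<lambda>\<eta>. Suc k < length ?vs \<and> True \<and> pedges (take (Suc (Suc k)) ?vs) \<subseteq> \<eta> \<and> pivotal (\<lambda>\<xi>. conn \<xi> a x) {?vs ! k, ?vs ! Suc k} \<eta>))"
      using P[OF that] c by (intro opening_bound[OF F p]) auto
    also have "\<dots> \<le> (\<Sum>k<l. \<Sum>e\<in>F. if e \<in> pedges (P i) then ?q e else 0)"
    proof (rule sum_mono)
      fix k
      show "bprob p F (\<lambda>\<eta>. Suc k < length ?vs \<and> True \<and> pedges (take (Suc (Suc k)) ?vs) \<subseteq> \<eta> \<and> pivotal (\<lambda>\<xi>. conn \<xi> a x) {?vs ! k, ?vs ! Suc k} \<eta>)
         \<le> (\<Sum>e\<in>F. if e \<in> pedges (P i) then ?q e else 0)"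
      proof (cases "Suc k < length ?vs")
        case False
        then show ?thesis using q0 by (simp add: bprob_def sum_nonneg bexp_def)
      next
        case True
        let ?e = "{?vs ! k, ?vs ! Suc k}"
        have e: "?e \<in> pedges ?vs" by (rule nth_edge_in_pedges[OF True])
        then have eF: "?e \<in> F" using P[OF that] by auto
        have "bprob p F (\<lambda>\<eta>. Suc k < length ?vs \<and> True \<and> pedges (take (Suc (Suc k)) ?vs) \<subseteq> \<eta> \<and> pivotal (\<lambda>\<xi>. conn \<xi> a x) ?e \<eta>) \<le> ?q ?e"
          by (rule bprob_mono[OF p]) simp
        also have "\<dots> = (if ?e \<in> pedges (P i) then ?q ?e else 0)" using e by simp
        also have "\<dots> \<le> (\<Sum>e\<in>F. if e \<in> pedges (P i) then ?q e else 0)"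
          using eF F q0 by (intro member_le_sum[of ?e F "\<lambda>e. if e \<in> pedges (P i) then ?q e else 0"]) auto
        finally show ?thesis .
      qed
    qed
    finally show ?thesis by simp
  qed
  have "p ^ l * (\<Sum>i\<in>I. bprob p F (\<lambda>\<xi>. conn \<xi> a (hd (P i)) \<and> conn \<xi> (last (P i)) x \<and> \<not> conn \<xi> a x))
    \<le> (\<Sum>i\<in>I. real l * (\<Sum>e\<in>F. if e \<in> pedges (P i) then ?q e else 0))"
    unfolding sum_distrib_left[of "p ^ l"] by (rule sum_mono) (rule one)
  also have "\<dots> = real l * (\<Sum>e\<in>F. \<Sum>i\<in>I. if e \<in> pedges (P i) then ?q e else 0)"
    unfolding sum_distrib_left[symmetric] by (subst sum.swap) simp
  also have "\<dots> = real l * (\<Sum>e\<in>F. real (card {i \<in> I. e \<in> pedges (P i)}) * ?q e)"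
    using I by (simp add: sum.If_cases Int_def)
  also have "\<dots> \<le> real l * (\<Sum>e\<in>F. real m * ?q e)"
    using m q0 by (intro mult_left_mono sum_mono mult_right_mono) auto
  finally show ?thesis by (simp add: sum_distrib_left mult.assoc)
qed

text \<open>Here the right side is a probability, not a sum over pivotal edges. By
  \<open>pivotal_paths_meet\<close>, in one configuration all paths carrying a pivotal edge
  intersect any fixed one of them, so at most \<open>m\<close> indices count at all, and only when
  \<open>a\<close> is connected to \<open>x\<close>.\<close>

lemma exit_pivotal_bound:
  assumes F: "finite F" and p: "0 \<le> p" "p \<le> 1" and I: "finite I"
    and P: "\<And>i. i \<in> I \<Longrightarrow> P i \<noteq> [] \<and> length (P i) \<le> Suc l \<and> pedges (P i) \<subseteq> F"
    and out: "\<And>i e. i \<in> I \<Longrightarrow> e \<in> pedges (P i) \<Longrightarrow> \<not> e \<subseteq> S"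
    and m: "\<And>i. i \<in> I \<Longrightarrow> card {j \<in> I. pedges (P i) \<inter> pedges (P j) \<noteq> {}} \<le> m"
    and A: "\<And>i \<xi>. i \<in> I \<Longrightarrow> A i \<xi> \<Longrightarrow> conn (inside S \<xi>) a (hd (P i)) \<and> conn \<xi> (last (P i)) x \<and> \<not> conn \<xi> a x"
  shows "p ^ l * (\<Sum>i\<in>I. bprob p F (A i)) \<le> real (l * m) * tau p F a x"
proof -
  let ?B = "\<lambda>i \<xi>. conn (inside S \<xi>) a (hd (P i))"
  let ?H = "\<lambda>i k \<eta>. Suc k < length (P i) \<and> ?B i \<eta> \<and> pedges (take (Suc (Suc k)) (P i)) \<subseteq> \<eta> \<and> pivotal (\<lambda>\<xi>. conn \<xi> a x) {P i ! k, P i ! Suc k} \<eta>"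
  have one: "p ^ l * bprob p F (A i) \<le> (\<Sum>k<l. bprob p F (?H i k))" if "i \<in> I" for i
  proof -
    have c: "card (pedges (P i)) \<le> l" using card_pedges[of "P i"] P[OF that] by linarith
    have "bprob p F (A i) \<le> bprob p F (\<lambda>\<xi>. ?B i \<xi> \<and> conn \<xi> a (hd (P i)) \<and> conn \<xi> (last (P i)) x \<and> \<not> conn \<xi> a x)"
    proof (rule bprob_mono[OF p])
      fix \<xi> assume "A i \<xi>"
      from A[OF that this] show "?B i \<xi> \<and> conn \<xi> a (hd (P i)) \<and> conn \<xi> (last (P i)) x \<and> \<not> conn \<xi> a x"
        using conn_mono[OF _ inside_subset, of S \<xi> a "hd (P i)"] by simp
    qed
    then have "p ^ l * bprob p F (A i) \<le> p ^ l * bprob p F (\<lambda>\<xi>. ?B i \<xi> \<and> conn \<xi> a (hd (P i)) \<and> conn \<xi> (last (P i)) x \<and> \<not> conn \<xi> a x)"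
      using p by (intro mult_left_mono) auto
    also have "\<dots> \<le> (\<Sum>k<l. bprob p F (?H i k))"
    proof (rule opening_bound[OF F p])
      fix \<xi> k assume "?B i \<xi>"
      then show "?B i (\<xi> \<union> pedges (take k (P i)))" by (rule conn_mono) (auto simp: inside_def)
    qed (use P[OF that] c in auto)
    finally show ?thesis .
  qed
  have "p ^ l * (\<Sum>i\<in>I. bprob p F (A i)) \<le> (\<Sum>i\<in>I. \<Sum>k<l. bprob p F (?H i k))"
    unfolding sum_distrib_left by (rule sum_mono) (rule one)
  also have "\<dots> = bexp p F (\<lambda>\<eta>. \<Sum>i\<in>I. \<Sum>k<l. of_bool (?H i k \<eta>))"
    unfolding bexp_sum bprob_def ..
  also have "\<dots> \<le> bexp p F (\<lambda>\<eta>. real (l * m) * of_bool (conn \<eta> a x))"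
  proof (rule bexp_mono[OF p])
    fix \<eta>
    let ?I = "{i \<in> I. \<exists>k. ?H i k \<eta>}"
    have "(\<Sum>i\<in>I. \<Sum>k<l. of_bool (?H i k \<eta>)) \<le> (\<Sum>i\<in>I. \<Sum>k<l. of_bool (i \<in> ?I) :: real)"
      by (intro sum_mono) auto
    also have "\<dots> = real l * real (card ?I)" using I by (simp add: Int_def flip: sum_distrib_left)
    finally have le: "(\<Sum>i\<in>I. \<Sum>k<l. of_bool (?H i k \<eta>)) \<le> real l * real (card ?I)" .
    show "(\<Sum>i\<in>I. \<Sum>k<l. of_bool (?H i k \<eta>)) \<le> real (l * m) * of_bool (conn \<eta> a x)"
    proof (cases "?I = {}")
      case True
      have "real l * real (card ?I) = 0" unfolding True by simp
      moreover have "0 \<le> real (l * m) * of_bool (conn \<eta> a x)" by simp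
      ultimately show ?thesis using le by linarith
    next
      case False
      then obtain i k where i: "i \<in> I" and H: "?H i k \<eta>" by blast
      have "?I \<subseteq> {j \<in> I. pedges (P i) \<inter> pedges (P j) \<noteq> {}}"
      proof
        fix j assume "j \<in> ?I"
        then obtain k' where j: "j \<in> I" and H': "?H j k' \<eta>" by blast
        have "pedges (P i) \<inter> pedges (P j) \<noteq> {}"
          by (rule pivotal_paths_meet[of S \<eta> a "P i" "P j" k k' x]) (use H H' out[OF i] out[OF j] in auto)
        then show "j \<in> {j \<in> I. pedges (P i) \<inter> pedges (P j) \<noteq> {}}" using j by simp
      qed
      then have "card ?I \<le> card {j \<in> I. pedges (P i) \<inter> pedges (P j) \<noteq> {}}" using I by (intro card_mono) auto
      with m[OF i] have "card ?I \<le> m" by simp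
      then have "real l * real (card ?I) \<le> real (l * m)" by (simp add: mult_left_mono)
      moreover have "real (l * m) * of_bool (conn \<eta> a x) = real (l * m)"
      proof -
        have "{P i ! k, P i ! Suc k} \<in> \<eta>" using H pedges_take_Suc[of k "P i"] by auto
        then have "insert {P i ! k, P i ! Suc k} \<eta> = \<eta>" by auto
        then show ?thesis using H by (simp add: pivotal_def)
      qed
      ultimately show ?thesis using le by linarith
    qed
  qed
  finally show ?thesis unfolding bexp_cmult bprob_def .
qed

section \<open>Splitting large clusters\<close>

text \<open>Rooted trees, built by hanging one tree below the root of another. This binary
  decomposition is what the splitting argument recurses on, and disjoint vertex sets give disjoint
  edge sets.\<close>

inductive rtree :: "'v \<Rightarrow> 'v set set \<Rightarrow> 'v set \<Rightarrow> bool" where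
  single: "rtree r {} {r}"
| join: "rtree r E V \<Longrightarrow> rtree c E' V' \<Longrightarrow> V \<inter> V' = {} \<Longrightarrow> rtree r (insert {r, c} (E \<union> E')) (V \<union> V')"

lemma rtree_props:
  assumes "rtree r E V"
  shows "r \<in> V \<and> finite V \<and> (\<forall>e\<in>E. e \<noteq> {} \<and> e \<subseteq> V) \<and> (\<forall>v\<in>V. conn E r v)"
  using assms
proof induction
  case (join r E V c E' V')
  let ?E = "insert {r, c} (E \<union> E')"
  have "conn ?E r v" if "v \<in> V" for v
    using join.IH(1) that by (blast intro: conn_mono[of E])
  moreover have "conn ?E r v" if "v \<in> V'" for v
  proof (rule conn_trans)
    show "conn ?E r c" by (rule conn_edge) simp
    show "conn ?E c v" using join.IH(2) that by (blast intro: conn_mono[of E'])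
  qed
  ultimately show ?case using join.IH by auto
qed simp

lemma rtree_leaf:
  assumes "rtree r E V" "u \<in> V" "w \<notin> V"
  shows "rtree r (insert {u, w} E) (insert w V)"
  using assms
proof induction
  case (single r)
  then show ?case using rtree.join[OF rtree.single[of r] rtree.single[of w]] by (simp add: insert_commute)
next
  case (join r E V c E' V')
  show ?case
  proof (cases "u \<in> V")
    case True
    then have "rtree r (insert {u, w} E) (insert w V)" using join by auto
    then have "rtree r (insert {r, c} (insert {u, w} E \<union> E')) (insert w V \<union> V')"
      by (rule rtree.join[OF _ join.hyps(2)]) (use join in auto)
    then show ?thesis by (simp add: insert_commute)
  next
    case False
    then have "rtree c (insert {u, w} E') (insert w V')" using join by auto
    then have "rtree r (insert {r, c} (E \<union> insert {u, w} E')) (V \<union> insert w V')"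
      by (rule rtree.join[OF join.hyps(1)]) (use join in auto)
    then show ?thesis by (simp add: insert_commute)
  qed
qed

text \<open>A tree that does not yet span the cluster has an open edge leaving it, which adds one
  leaf.\<close>

lemma rtree_spanning:
  assumes fin: "finite (clu \<xi> {x})"
  shows "\<exists>E. E \<subseteq> \<xi> \<and> rtree x E (clu \<xi> {x})"
proof -
  let ?C = "clu \<xi> {x}"
  have xC: "x \<in> ?C" by (simp add: clu_def)
  then have pos: "1 \<le> card ?C" using fin by (metis One_nat_def Suc_leI card_gt_0_iff empty_iff)
  have "k \<le> card ?C \<Longrightarrow> \<exists>E V. E \<subseteq> \<xi> \<and> V \<subseteq> ?C \<and> rtree x E V \<and> card V = k" if "1 \<le> k" for k
    using that
  proof (induction k rule: nat_induct_at_least)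
    case base
    show ?case using xC by (intro exI[of _ "{}"] exI[of _ "{x}"]) (auto intro: rtree.single)
  next
    case (Suc k)
    then obtain E V where EV: "E \<subseteq> \<xi>" "V \<subseteq> ?C" "rtree x E V" "card V = k" by auto
    then have "V \<noteq> ?C" using Suc.prems by auto
    then obtain z where z: "z \<in> ?C" "z \<notin> V" using EV(2) by auto
    have xV: "x \<in> V" "finite V" using rtree_props[OF EV(3)] by auto
    have "conn \<xi> x z" using z(1) by (simp add: clu_def)
    from conn_first_exit[OF this xV(1) z(2)] obtain u v where uv: "u \<in> V" "v \<notin> V" "{u, v} \<in> \<xi>" by blast
    have "conn \<xi> x u" using uv(1) EV(2) by (auto simp: clu_def)
    from conn_trans[OF this conn_edge[OF uv(3)]] have vC: "v \<in> ?C" by (simp add: clu_def)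
    have "rtree x (insert {u, v} E) (insert v V)" by (rule rtree_leaf[OF EV(3) uv(1,2)])
    moreover have "card (insert v V) = Suc k" using uv(2) xV(2) EV(4) by simp
    moreover have "insert {u, v} E \<subseteq> \<xi>" "insert v V \<subseteq> ?C" using uv(3) EV(1,2) vC by auto
    ultimately show ?case by blast
  qed
  from this[OF pos order_refl] obtain E V where "E \<subseteq> \<xi>" "V \<subseteq> ?C" "rtree x E V" "card V = card ?C" by blast
  moreover from this have "V = ?C" using card_subset_eq[OF fin] by blast
  ultimately show ?thesis by blast
qed

text \<open>Descend into a half that still has \<open>q\<close> points of \<open>M\<close>. When
  neither half has that many, the whole has fewer than \<open>2 * q\<close> and is cut off. What is
  left stays connected to the root, which the recursion needs.\<close>

lemma rtree_split:
  assumes "rtree r E V" "0 < q" "q \<le> card (V \<inter> M)"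
  shows "\<exists>E1 V1 c E2 V2. E1 \<subseteq> E \<and> E2 \<subseteq> E \<and> E1 \<inter> E2 = {} \<and> q \<le> card (V1 \<inter> M) \<and> card (V1 \<inter> M) < 2 * q \<and>
     (\<forall>v\<in>V1. conn E1 c v) \<and> (\<forall>v\<in>V2. conn E2 r v) \<and> V \<subseteq> V1 \<union> V2"
  using assms(1,3)
proof induction
  case (single r)
  have "card ({r} \<inter> M) \<le> card {r}" by (rule card_mono) auto
  then have "card ({r} \<inter> M) < 2 * q" using assms(2) by simp
  then show ?case using single
    by (intro exI[of _ "{}"] exI[of _ "{r}"] exI[of _ r]) auto
next
  case (join r E V c E' V')
  have pr: "r \<in> V" "finite V" "\<forall>e\<in>E. e \<noteq> {} \<and> e \<subseteq> V" "\<forall>v\<in>V. conn E r v"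
    "c \<in> V'" "finite V'" "\<forall>e\<in>E'. e \<noteq> {} \<and> e \<subseteq> V'" "\<forall>v\<in>V'. conn E' c v"
    using rtree_props[OF join.hyps(1)] rtree_props[OF join.hyps(2)] by auto
  have notin: "c \<notin> V" "r \<notin> V'" using pr(1,5) join.hyps(3) by auto
  have "e \<noteq> {} \<and> e \<subseteq> V \<inter> V'" if "e \<in> E" "e \<in> E'" for e using pr(3,7) that by auto
  then have "E \<inter> E' = {}" using join.hyps(3) by auto
  moreover have "{r, c} \<notin> E" "{r, c} \<notin> E'" using pr(3,7) notin by auto
  ultimately have disj: "E \<inter> E' = {}" "{r, c} \<notin> E" "{r, c} \<notin> E'" by auto
  have card: "card ((V \<union> V') \<inter> M) = card (V \<inter> M) + card (V' \<inter> M)"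
    unfolding Int_Un_distrib2 by (rule card_Un_disjoint) (use pr join.hyps(3) in auto)
  let ?E = "insert {r, c} (E \<union> E')"
  show ?case
  proof (cases "q \<le> card (V' \<inter> M)")
    case True
    from join.IH(2)[OF True] obtain E1 V1 d E2 V2 where
      s: "E1 \<subseteq> E'" "E2 \<subseteq> E'" "E1 \<inter> E2 = {}" "q \<le> card (V1 \<inter> M)" "card (V1 \<inter> M) < 2 * q"
      "\<forall>v\<in>V1. conn E1 d v" "\<forall>v\<in>V2. conn E2 c v" "V' \<subseteq> V1 \<union> V2" by blast
    let ?E2 = "insert {r, c} (E \<union> E2)"
    have rc: "conn ?E2 r c" by (rule conn_edge) simp
    have c2: "conn ?E2 r v" if "v \<in> V \<union> V2" for v
    proof (cases "v \<in> V")
      case True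
      then show ?thesis using pr(4) by (blast intro: conn_mono[of E])
    next
      case False
      then have "conn E2 c v" using that s(7) by auto
      then have "conn ?E2 c v" by (rule conn_mono) auto
      with rc show ?thesis by (rule conn_trans)
    qed
    have "E1 \<subseteq> ?E" "?E2 \<subseteq> ?E" "E1 \<inter> ?E2 = {}" "V \<union> V' \<subseteq> V1 \<union> (V \<union> V2)"
      using s disj by auto
    then show ?thesis using s(4,5,6) c2
      by (intro exI[of _ E1] exI[of _ V1] exI[of _ d] exI[of _ ?E2] exI[of _ "V \<union> V2"]) auto
  next
    case F1: False
    show ?thesis
    proof (cases "q \<le> card (V \<inter> M)")
      case True
      from join.IH(1)[OF True] obtain E1 V1 d E2 V2 where
        s: "E1 \<subseteq> E" "E2 \<subseteq> E" "E1 \<inter> E2 = {}" "q \<le> card (V1 \<inter> M)" "card (V1 \<inter> M) < 2 * q"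
        "\<forall>v\<in>V1. conn E1 d v" "\<forall>v\<in>V2. conn E2 r v" "V \<subseteq> V1 \<union> V2" by blast
      let ?E2 = "insert {r, c} (E2 \<union> E')"
      have rc: "conn ?E2 r c" by (rule conn_edge) simp
      have c2: "conn ?E2 r v" if "v \<in> V2 \<union> V'" for v
      proof (cases "v \<in> V2")
        case True
        then show ?thesis using s(7) by (blast intro: conn_mono[of E2])
      next
        case False
        then have "conn E' c v" using that pr(8) by auto
        then have "conn ?E2 c v" by (rule conn_mono) auto
        with rc show ?thesis by (rule conn_trans)
      qed
      have "E1 \<subseteq> ?E" "?E2 \<subseteq> ?E" "E1 \<inter> ?E2 = {}" "V \<union> V' \<subseteq> V1 \<union> (V2 \<union> V')"
        using s disj by auto
      then show ?thesis using s(4,5,6) c2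
        by (intro exI[of _ E1] exI[of _ V1] exI[of _ d] exI[of _ ?E2] exI[of _ "V2 \<union> V'"]) auto
    next
      case False
      have c1: "\<forall>v\<in>V \<union> V'. conn ?E r v"
        using rtree_props[OF rtree.join[OF join.hyps]] by blast
      have "card ((V \<union> V') \<inter> M) < 2 * q" using card F1 False by linarith
      then show ?thesis using c1 join.prems
        by (intro exI[of _ ?E] exI[of _ "V \<union> V'"] exI[of _ r] exI[of _ "{}"]) auto
    qed
  qed
qed

text \<open>The edges of \<open>W\<close> are declared open: below they wire the boundary of a box.\<close>

definition big_cluster :: "'v set set \<Rightarrow> 'v set \<Rightarrow> nat \<Rightarrow> 'v set set \<Rightarrow> bool" where
  "big_cluster W M k \<xi> \<longleftrightarrow> (\<exists>v. k \<le> card (clu (\<xi> \<union> W) {v} \<inter> M))"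

lemma incr_big_cluster:
  assumes "finite M"
  shows "incr (big_cluster W M k)"
proof (rule incrI)
  fix \<xi> \<eta> :: "'a set set" assume "\<xi> \<subseteq> \<eta>" "big_cluster W M k \<xi>"
  then obtain v where "k \<le> card (clu (\<xi> \<union> W) {v} \<inter> M)" by (auto simp: big_cluster_def)
  also have "\<dots> \<le> card (clu (\<eta> \<union> W) {v} \<inter> M)"
  proof (rule card_mono)
    have "clu (\<xi> \<union> W) {v} \<subseteq> clu (\<eta> \<union> W) {v}" by (rule clu_mono) (use \<open>\<xi> \<subseteq> \<eta>\<close> in auto)
    then show "clu (\<xi> \<union> W) {v} \<inter> M \<subseteq> clu (\<eta> \<union> W) {v} \<inter> M" by auto
  qed (use assms in simp)
  finally show "big_cluster W M k \<eta>" by (auto simp: big_cluster_def)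
qed

text \<open>From a spanning tree with \<open>3 * k\<close> points, a piece with at least
  \<open>k\<close> and fewer than \<open>2 * k\<close> points is cut off; more than \<open>k\<close>
  remain. The two pieces use disjoint edges.\<close>

lemma big_cluster_split:
  assumes "finite M" "finite (\<Union>(\<xi> \<union> W))" "0 < k" "big_cluster W M (3 * k) \<xi>"
  shows "disj_occ (big_cluster W M k) (big_cluster W M k) \<xi>"
proof -
  obtain r where r: "3 * k \<le> card (clu (\<xi> \<union> W) {r} \<inter> M)" using assms(4) by (auto simp: big_cluster_def)
  have "finite (clu (\<xi> \<union> W) {r})" by (rule finite_clu) (use assms(2) in auto)
  from rtree_spanning[OF this] obtain E where E: "E \<subseteq> \<xi> \<union> W" "rtree r E (clu (\<xi> \<union> W) {r})" by blast
  have "k \<le> card (clu (\<xi> \<union> W) {r} \<inter> M)" using r by simp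
  from rtree_split[OF E(2) assms(3) this] obtain E1 V1 c E2 V2 where
    s: "E1 \<subseteq> E" "E2 \<subseteq> E" "E1 \<inter> E2 = {}" "k \<le> card (V1 \<inter> M)" "card (V1 \<inter> M) < 2 * k"
      "\<forall>v\<in>V1. conn E1 c v" "\<forall>v\<in>V2. conn E2 r v" "clu (\<xi> \<union> W) {r} \<subseteq> V1 \<union> V2" by blast
  have "card (clu (\<xi> \<union> W) {r} \<inter> M) \<le> card ((V1 \<inter> M) \<union> (V2 \<inter> M))"
    using s(8) assms(1) by (intro card_mono) auto
  also have "\<dots> \<le> card (V1 \<inter> M) + card (V2 \<inter> M)" by (rule card_Un_le)
  finally have k2: "k \<le> card (V2 \<inter> M)" using r s(5) by linarith
  \<comment> \<open>Wired edges are available to both witnesses, so only the edges of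
    \<open>\<xi>\<close> have to be disjoint.\<close>
  have big: "big_cluster W M k (E' \<inter> \<xi>)" if "E' \<subseteq> E" "\<forall>v\<in>V. conn E' b v" "k \<le> card (V \<inter> M)" for E' V b
  proof -
    have "E' \<subseteq> E' \<inter> \<xi> \<union> W" using that(1) E(1) by auto
    then have "V \<subseteq> clu (E' \<inter> \<xi> \<union> W) {b}" using that(2) by (auto simp: clu_def intro: conn_mono)
    then have "card (V \<inter> M) \<le> card (clu (E' \<inter> \<xi> \<union> W) {b} \<inter> M)" using assms(1) by (intro card_mono) auto
    then show ?thesis using that(3) unfolding big_cluster_def by (meson order_trans)
  qed
  show ?thesis
    by (rule disj_occI[where u = "E1 \<inter> \<xi>" and v = "E2 \<inter> \<xi>"])
      (fact big[OF s(1,6,4)], fact big[OF s(2,7) k2], use s(3) in auto)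
qed

text \<open>By the splitting and BK, tripling the size squares the probability. A weak bound at one
  size thus becomes arbitrarily good at a constant multiple of it.\<close>

lemma big_cluster_power:
  assumes F: "finite F" "finite (\<Union>(F \<union> W))" and p: "0 \<le> p" "p \<le> 1" and "finite M" "0 < k"
  shows "bprob p F (big_cluster W M (3 ^ j * k)) \<le> bprob p F (big_cluster W M k) ^ (2 ^ j)"
proof (induction j)
  case (Suc j)
  have "bprob p F (big_cluster W M (3 ^ Suc j * k)) \<le> bprob p F (disj_occ (big_cluster W M (3 ^ j * k)) (big_cluster W M (3 ^ j * k)))"
  proof (rule bprob_mono[OF p])
    fix \<xi> assume w: "\<xi> \<subseteq> F" "big_cluster W M (3 ^ Suc j * k) \<xi>"
    have "finite (\<Union>(\<xi> \<union> W))" by (rule finite_subset[OF _ F(2)]) (use w(1) in auto)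
    then show "disj_occ (big_cluster W M (3 ^ j * k)) (big_cluster W M (3 ^ j * k)) \<xi>"
      using w(2) assms(5,6) by (intro big_cluster_split) (auto simp: mult.assoc)
  qed
  also have "\<dots> \<le> bprob p F (big_cluster W M (3 ^ j * k)) * bprob p F (big_cluster W M (3 ^ j * k))"
    by (intro bk F p incr_big_cluster assms(5))
  also have "\<dots> \<le> bprob p F (big_cluster W M k) ^ (2 ^ j) * bprob p F (big_cluster W M k) ^ (2 ^ j)"
    by (intro mult_mono Suc.IH zero_le_power bprob_nonneg[OF p])
  finally show ?case by (simp add: mult_2 power_add)
qed simp

text \<open>Two first moments: a cluster with \<open>k\<close> points of \<open>M\<close> yields
  \<open>k\<close> points whose own cluster is large, and a single point has a large cluster only if
  it reaches the wiring or its unwired cluster is large.\<close>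

lemma big_cluster_base:
  assumes F: "finite F" "finite (\<Union>(F \<union> W))" and p: "0 \<le> p" "p \<le> 1" and M: "finite M" and k: "0 < k"
  shows "bprob p F (big_cluster W M k) \<le>
    (\<Sum>v\<in>M. (\<Sum>u\<in>M. tau p F v u) / real k + bprob p F (\<lambda>\<xi>. \<exists>y\<in>\<Union>W. conn \<xi> v y)) / real k"
proof -
  let ?L = "\<lambda>v \<xi>. k \<le> card (clu (\<xi> \<union> W) {v} \<inter> M)"
  have sym: "clu \<eta> {u} = clu \<eta> {v}" if "u \<in> clu \<eta> {v}" for u v and \<eta> :: "'a set set"
  proof -
    have "conn \<eta> v u" using that by (simp add: clu_def)
    from conn_trans[OF this] conn_trans[OF conn_sym[OF this]] show ?thesis by (auto simp: clu_def)
  qed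
  have "bprob p F (big_cluster W M k) \<le> bexp p F (\<lambda>\<xi>. \<Sum>v\<in>M. of_bool (?L v \<xi>)) / real k"
  proof (rule markov_bprob[OF p])
    fix \<xi> assume "big_cluster W M k \<xi>"
    then obtain v where v: "?L v \<xi>" by (auto simp: big_cluster_def)
    then have "real k \<le> (\<Sum>u\<in>clu (\<xi> \<union> W) {v} \<inter> M. 1)" by simp
    also have "\<dots> = (\<Sum>u\<in>clu (\<xi> \<union> W) {v} \<inter> M. of_bool (?L u \<xi>))"
      by (rule sum.cong) (use v sym[of _ "\<xi> \<union> W" v] in auto)
    also have "\<dots> \<le> (\<Sum>u\<in>M. of_bool (?L u \<xi>))" using M by (intro sum_mono2) auto
    finally show "real k \<le> (\<Sum>v\<in>M. of_bool (?L v \<xi>))" .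
  qed (use k in \<open>auto intro: sum_nonneg\<close>)
  also have "bexp p F (\<lambda>\<xi>. \<Sum>v\<in>M. of_bool (?L v \<xi>)) = (\<Sum>v\<in>M. bprob p F (?L v))" by (simp only: bexp_sum bprob_def)
  also have "\<dots> \<le> (\<Sum>v\<in>M. (\<Sum>u\<in>M. tau p F v u) / real k + bprob p F (\<lambda>\<xi>. \<exists>y\<in>\<Union>W. conn \<xi> v y))"
  proof (rule sum_mono)
    fix v
    have "bprob p F (?L v) \<le> bprob p F (\<lambda>\<xi>. k \<le> card (clu \<xi> {v} \<inter> M)) + bprob p F (\<lambda>\<xi>. \<exists>y\<in>\<Union>W. conn \<xi> v y)"
    proof (rule bprob_disj_le[OF p])
      fix \<xi> assume L: "?L v \<xi>"
      \<comment> \<open>Before a path first visits a vertex of the wiring, all its edges belong to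
        \<open>\<xi>\<close>.\<close>
      have "conn \<xi> v y \<or> (\<exists>y\<in>\<Union>W. conn \<xi> v y)" if "conn (\<xi> \<union> W) v y" for y
        using that
      proof (induction rule: conn_induct)
        case (step y z)
        show ?case
        proof (cases "\<exists>y\<in>\<Union>W. conn \<xi> v y")
          case False
          then have "conn \<xi> v y" "y \<notin> \<Union>W" using step(3) by auto
          then have "{y, z} \<in> \<xi>" using step(2) by auto
          then show ?thesis using conn_trans[OF \<open>conn \<xi> v y\<close> conn_edge] by auto
        qed auto
      qed simp
      then have "clu (\<xi> \<union> W) {v} \<subseteq> clu \<xi> {v} \<or> (\<exists>y\<in>\<Union>W. conn \<xi> v y)" by (auto simp: clu_def)
      then show "k \<le> card (clu \<xi> {v} \<inter> M) \<or> (\<exists>y\<in>\<Union>W. conn \<xi> v y)"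
      proof
        assume "clu (\<xi> \<union> W) {v} \<subseteq> clu \<xi> {v}"
        then have "card (clu (\<xi> \<union> W) {v} \<inter> M) \<le> card (clu \<xi> {v} \<inter> M)" using M by (intro card_mono) auto
        then show ?thesis using L by simp
      qed simp
    qed
    moreover have "bprob p F (\<lambda>\<xi>. k \<le> card (clu \<xi> {v} \<inter> M)) \<le> bexp p F (\<lambda>\<xi>. \<Sum>u\<in>M. of_bool (conn \<xi> v u)) / real k"
    proof (rule markov_bprob[OF p])
      fix \<xi> assume "k \<le> card (clu \<xi> {v} \<inter> M)"
      moreover have "(\<Sum>u\<in>M. of_bool (conn \<xi> v u) :: real) = real (card (clu \<xi> {v} \<inter> M))"
        using M by (simp add: clu_def Int_def conj_commute)
      ultimately show "real k \<le> (\<Sum>u\<in>M. of_bool (conn \<xi> v u))" by simp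
    qed (use k in \<open>auto intro: sum_nonneg\<close>)
    ultimately show "bprob p F (?L v) \<le> (\<Sum>u\<in>M. tau p F v u) / real k + bprob p F (\<lambda>\<xi>. \<exists>y\<in>\<Union>W. conn \<xi> v y)"
      unfolding bexp_sum bprob_def by linarith
  qed
  finally show ?thesis by (simp add: divide_right_mono)
qed

text \<open>Seen from inside \<open>B\<close>, the cluster of \<open>a\<close> may fall apart. As
  \<open>a\<close> lies outside, each piece reaches the rim \<open>D\<close>, and the wiring of
  \<open>D\<close> joins the pieces again.\<close>

lemma cluster_in_wired_box:
  assumes a: "a \<notin> B" and M: "M \<subseteq> B" "finite M" and k: "0 < k" "k \<le> card (clu \<xi> {a} \<inter> M)" and w: "\<xi> \<subseteq> F"
    and D: "\<And>u v. {u, v} \<in> F \<Longrightarrow> u \<in> B \<Longrightarrow> v \<notin> B \<Longrightarrow> u \<in> D"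
  shows "big_cluster {{u, v} | u v. u \<in> D \<and> v \<in> D} M k (inside B \<xi>)"
proof -
  let ?W = "{{u, v} | u v. u \<in> D \<and> v \<in> D}"
  have ex: "\<exists>u\<in>D. conn (inside B \<xi>) y u" if "y \<in> clu \<xi> {a} \<inter> M" for y
  proof -
    have ya: "conn \<xi> y a" and yB: "y \<in> B" using that M(1) by (auto simp: clu_def intro: conn_sym)
    from conn_first_exit[OF ya yB a] obtain u v where uv: "u \<in> B" "v \<notin> B" "{u, v} \<in> \<xi>"
      "disj_occ (\<lambda>\<xi>. conn (inside B \<xi>) y u) (disj_occ (\<lambda>\<xi>. {u, v} \<in> \<xi>) (\<lambda>\<xi>. conn \<xi> v a)) \<xi>"
      by blast
    obtain \<xi>' where "\<xi>' \<subseteq> \<xi>" "conn (inside B \<xi>') y u" using uv(4) unfolding disj_occ_def by blast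
    then have "conn (inside B \<xi>) y u" by (meson conn_mono inside_mono)
    moreover have "u \<in> D" by (rule D[of u v]) (use uv w in auto)
    ultimately show ?thesis by blast
  qed
  have "clu \<xi> {a} \<inter> M \<noteq> {}" using k by (metis card.empty not_le)
  then obtain b where b: "b \<in> D" using ex by blast
  have "clu \<xi> {a} \<inter> M \<subseteq> clu (inside B \<xi> \<union> ?W) {b} \<inter> M"
  proof
    fix y assume y: "y \<in> clu \<xi> {a} \<inter> M"
    obtain u where u: "u \<in> D" "conn (inside B \<xi>) y u" using ex[OF y] by blast
    have "{b, u} \<in> inside B \<xi> \<union> ?W" using b u(1) by blast
    moreover have "conn (inside B \<xi> \<union> ?W) u y" by (rule conn_sym, rule conn_mono[OF u(2)]) auto
    ultimately have "conn (inside B \<xi> \<union> ?W) b y" by (meson conn_edge conn_trans)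
    then show "y \<in> clu (inside B \<xi> \<union> ?W) {b} \<inter> M" using y by (simp add: clu_def)
  qed
  then have "card (clu \<xi> {a} \<inter> M) \<le> card (clu (inside B \<xi> \<union> ?W) {b} \<inter> M)" using M(2) by (intro card_mono) auto
  then show ?thesis using k(2) unfolding big_cluster_def by (meson order_trans)
qed

section \<open>Lattice sums\<close>

definition jb :: "int ^ 'd::finite \<Rightarrow> real" where
  "jb x = max 1 (real_of_int (norm_linf x))"

lemma norm_linf_le_iff: "norm_linf x \<le> k \<longleftrightarrow> (\<forall>i. \<bar>x $ i\<bar> \<le> k)"
  unfolding norm_linf_def by (subst Max_le_iff) auto

lemma norm_linf_component: "\<bar>x $ i\<bar> \<le> norm_linf x"
  using norm_linf_le_iff[of x "norm_linf x"] by simp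

lemma norm_linf_nonneg [simp]: "0 \<le> norm_linf x"
  using norm_linf_component[of x undefined] by linarith

lemma norm_linf_zero [simp]: "norm_linf 0 = 0"
  by (rule antisym) (simp_all add: norm_linf_le_iff)

lemma norm_linf_triangle: "norm_linf (x + y) \<le> norm_linf x + norm_linf y"
  unfolding norm_linf_le_iff
proof
  fix i
  show "\<bar>(x + y) $ i\<bar> \<le> norm_linf x + norm_linf y"
    using norm_linf_component[of x i] norm_linf_component[of y i] by simp
qed

lemma norm_linf_minus [simp]: "norm_linf (- x) = norm_linf x"
  by (simp add: norm_linf_def)

lemma norm_linf_commute: "norm_linf (x - y) = norm_linf (y - x)"
  using norm_linf_minus[of "x - y"] by simp

lemma norm_linf_triangle_sub: "norm_linf x \<le> norm_linf y + norm_linf (x - y)"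
  using norm_linf_triangle[of y "x - y"] by simp

lemma norm_linf_triangle3: "norm_linf (x - z) \<le> norm_linf (x - y) + norm_linf (y - z)"
  using norm_linf_triangle[of "x - y" "y - z"] by simp

lemma jb_ge_1 [simp]: "1 \<le> jb x" by (simp add: jb_def)
lemma jb_pos [simp]: "0 < jb x" by (simp add: jb_def)
lemma jb_nonneg [simp]: "0 \<le> jb x" by (simp add: jb_def)
lemma jb_minus [simp]: "jb (- x) = jb x" by (simp add: jb_def)
lemma jb_commute: "jb (x - y) = jb (y - x)" by (simp add: jb_def norm_linf_commute)
lemma jb_zero [simp]: "jb 0 = 1" by (simp add: jb_def)

lemma jb_mult: "jb (x + y) \<le> 2 * jb x * jb y"
proof -
  have "real_of_int (norm_linf (x + y)) \<le> real_of_int (norm_linf x) + real_of_int (norm_linf y)"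
    using norm_linf_triangle[of x y] by linarith
  also have "\<dots> \<le> jb x + jb y" by (simp add: jb_def)
  finally have "jb (x + y) \<le> jb x + jb y" unfolding jb_def[of "x + y"]
    using jb_ge_1[of x] jb_ge_1[of y] by linarith
  also have "\<dots> \<le> jb x * jb y + jb x * jb y"
    by (intro add_mono) (simp_all add: mult_left_mono[of 1 "jb y" "jb x", simplified] mult_right_mono[of 1 "jb x" "jb y", simplified])
  finally show ?thesis by simp
qed

lemma box_eq: "box n = {x. \<forall>i. x $ i \<in> {- int n..int n}}"
  by (auto simp: box_def norm_linf_le_iff abs_le_iff) (metis minus_le_iff)+

lemma card_vec_set:
  fixes S :: "int set"
  assumes "finite S"
  shows "finite {x :: int ^ 'd::finite. \<forall>i. x $ i \<in> S} \<and> card {x :: int ^ 'd. \<forall>i. x $ i \<in> S} = card S ^ CARD('d)"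
proof -
  have "bij_betw (\<lambda>x :: int ^ 'd. \<lambda>i. x $ i) {x. \<forall>i. x $ i \<in> S} (PiE UNIV (\<lambda>_. S))"
    by (rule bij_betw_byWitness[where f' = "\<lambda>f. \<chi> i. f i"]) (auto simp: PiE_def)
  then have "finite {x :: int ^ 'd. \<forall>i. x $ i \<in> S} = finite (PiE (UNIV :: 'd set) (\<lambda>_. S))"
    "card {x :: int ^ 'd. \<forall>i. x $ i \<in> S} = card (PiE (UNIV :: 'd set) (\<lambda>_. S))"
    by (rule bij_betw_finite, rule bij_betw_same_card)
  then show ?thesis using assms by (simp add: card_PiE finite_PiE)
qed

lemma finite_box [simp]: "finite (box n :: (int ^ 'd::finite) set)"
  unfolding box_eq using card_vec_set[of "{- int n..int n}"] by blast

lemma card_box: "card (box n :: (int ^ 'd::finite) set) = (2 * n + 1) ^ CARD('d)"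
proof -
  have "card {- int n..int n} = 2 * n + 1" by simp
  then show ?thesis unfolding box_eq using card_vec_set[of "{- int n..int n}", where 'd = 'd] by simp
qed

lemma power_diff_le:
  fixes a b :: real
  assumes "0 \<le> b" "b \<le> a"
  shows "a ^ Suc n - b ^ Suc n \<le> real (Suc n) * (a - b) * a ^ n"
proof (induction n)
  case (Suc n)
  have "a ^ Suc (Suc n) - b ^ Suc (Suc n) = a * (a ^ Suc n - b ^ Suc n) + (a - b) * b ^ Suc n"
    by (simp add: algebra_simps)
  also have "\<dots> \<le> a * (real (Suc n) * (a - b) * a ^ n) + (a - b) * a ^ Suc n"
    using assms Suc by (intro add_mono mult_left_mono power_mono) auto
  also have "\<dots> = real (Suc (Suc n)) * (a - b) * a ^ Suc n" by (simp add: algebra_simps)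
  finally show ?case .
qed simp

definition sphere_set :: "nat \<Rightarrow> (int ^ 'd::finite) set" where
  "sphere_set k = {x. norm_linf x = int k}"

text \<open>The dimensional constant of \<open>card_sphere_set\<close>: a difference of two cubes,
  with \<open>2 k + 1\<close> bounded by \<open>3 k\<close>.\<close>

definition sphc :: "'d::finite itself \<Rightarrow> real" where
  "sphc _ = 2 * real CARD('d) * 3 ^ (CARD('d) - 1)"

lemma sphc_nonneg [simp]: "0 \<le> sphc TYPE('d::finite)" by (simp add: sphc_def)

lemma finite_sphere_set [simp]: "finite (sphere_set k)"
  by (rule finite_subset[OF _ finite_box[of k]]) (auto simp: sphere_set_def box_def)

lemma card_sphere_set:
  assumes "1 \<le> k"
  shows "real (card (sphere_set k :: (int ^ 'd::finite) set)) \<le> sphc TYPE('d) * real k ^ (CARD('d) - 1)"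
proof -
  obtain m where m: "CARD('d) = Suc m" by (metis Suc_pred' zero_less_card_finite)
  have eq: "sphere_set k = (box k - box (k - 1) :: (int ^ 'd) set)"
    using assms by (auto simp: sphere_set_def box_def of_nat_diff)
  have sub: "box (k - 1) \<subseteq> (box k :: (int ^ 'd) set)" by (auto simp: box_def)
  have "real (card (sphere_set k :: (int ^ 'd) set)) = real (card (box k :: (int ^ 'd) set)) - real (card (box (k - 1) :: (int ^ 'd) set))"
    unfolding eq using card_Diff_subset[OF finite_box sub] card_mono[OF finite_box sub] by simp
  also have "\<dots> = (2 * real k + 1) ^ Suc m - (2 * real k - 1) ^ Suc m"
  proof -
    have "real (2 * (k - 1) + 1) = 2 * real k - 1" "real (2 * k + 1) = 2 * real k + 1"
      using assms by (simp_all add: of_nat_diff)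
    then show ?thesis unfolding card_box m of_nat_power by (simp add: add.commute)
  qed
  also have "\<dots> \<le> real (Suc m) * ((2 * real k + 1) - (2 * real k - 1)) * (2 * real k + 1) ^ m"
    by (rule power_diff_le) (use assms in auto)
  also have "\<dots> \<le> real (Suc m) * 2 * (3 * real k) ^ m"
    using assms by (intro mult_mono power_mono) auto
  finally show ?thesis by (simp add: sphc_def m power_mult_distrib mult_ac)
qed

lemma sum_by_spheres:
  fixes X :: "(int ^ 'd::finite) set"
  assumes X: "finite X" "\<And>x. x \<in> X \<Longrightarrow> int r \<le> norm_linf x \<and> norm_linf x \<le> int n" and h: "\<And>k. 0 \<le> h k"
  shows "(\<Sum>x\<in>X. h (nat (norm_linf x))) \<le> (\<Sum>k\<in>{r..n}. real (card (sphere_set k :: (int ^ 'd) set)) * h k)"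
proof -
  let ?f = "\<lambda>x :: int ^ 'd. nat (norm_linf x)"
  have "(\<Sum>x\<in>X. h (?f x)) = (\<Sum>k\<in>{r..n}. \<Sum>x\<in>{x\<in>X. ?f x = k}. h (?f x))"
    by (rule sum.group[symmetric]) (use X in \<open>force simp: nat_le_iff le_nat_iff\<close>)+
  also have "\<dots> = (\<Sum>k\<in>{r..n}. real (card {x\<in>X. ?f x = k}) * h k)"
    by (rule sum.cong) auto
  also have "\<dots> \<le> (\<Sum>k\<in>{r..n}. real (card (sphere_set k :: (int ^ 'd) set)) * h k)"
  proof (intro sum_mono mult_right_mono h of_nat_mono card_mono finite_sphere_set)
    fix k show "{x\<in>X. ?f x = k} \<subseteq> sphere_set k" by (auto simp: sphere_set_def)
  qed
  finally show ?thesis .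
qed

lemma sum_ball:
  assumes a: "a < CARD('d::finite)"
  shows "(\<Sum>x\<in>(box n :: (int ^ 'd) set). 1 / jb x ^ a) \<le> (1 + sphc TYPE('d)) * max 1 (real n) ^ (CARD('d) - a)"
proof -
  let ?h = "\<lambda>k. 1 / max 1 (real k) ^ a"
  have "(\<Sum>x\<in>(box n :: (int ^ 'd) set). 1 / jb x ^ a) = (\<Sum>x\<in>(box n :: (int ^ 'd) set). ?h (nat (norm_linf x)))"
    by (simp add: jb_def)
  also have "\<dots> \<le> (\<Sum>k\<in>{0..n}. real (card (sphere_set k :: (int ^ 'd) set)) * ?h k)"
    by (rule sum_by_spheres, rule finite_box) (auto simp: box_def)
  also have "\<dots> = real (card (sphere_set 0 :: (int ^ 'd) set)) + (\<Sum>k\<in>{1..n}. real (card (sphere_set k :: (int ^ 'd) set)) * ?h k)"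
    by (simp add: sum.atLeast_Suc_atMost)
  also have "real (card (sphere_set 0 :: (int ^ 'd) set)) \<le> real (card (box 0 :: (int ^ 'd) set))"
    by (intro of_nat_mono card_mono, rule finite_box) (auto simp: sphere_set_def box_def)
  also have "\<dots> = 1" by (simp add: card_box)
  also have "(\<Sum>k\<in>{1..n}. real (card (sphere_set k :: (int ^ 'd) set)) * ?h k) \<le> (\<Sum>k\<in>{1..n}. sphc TYPE('d) * real n ^ (CARD('d) - 1 - a))"
  proof (rule sum_mono)
    fix k assume k: "k \<in> {1..n}"
    have "real (card (sphere_set k :: (int ^ 'd) set)) * ?h k \<le> sphc TYPE('d) * real k ^ (CARD('d) - 1) * ?h k"
      using k by (intro mult_right_mono card_sphere_set) auto
    also have "\<dots> = sphc TYPE('d) * (real k ^ (CARD('d) - 1) / real k ^ a)" using k by (simp add: max_def)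
    also have "real k ^ (CARD('d) - 1) / real k ^ a = real k ^ (CARD('d) - 1 - a)"
      using k a by (subst power_diff) auto
    also have "sphc TYPE('d) * \<dots> \<le> sphc TYPE('d) * real n ^ (CARD('d) - 1 - a)"
      using k by (intro mult_left_mono power_mono) auto
    finally show "real (card (sphere_set k :: (int ^ 'd) set)) * ?h k \<le> sphc TYPE('d) * real n ^ (CARD('d) - 1 - a)" .
  qed
  also have "\<dots> = sphc TYPE('d) * real n ^ (CARD('d) - a)"
  proof -
    have "CARD('d) - a = Suc (CARD('d) - 1 - a)" using a by simp
    then show ?thesis by (simp add: mult_ac)
  qed
  also have "\<dots> \<le> sphc TYPE('d) * max 1 (real n) ^ (CARD('d) - a)"
    by (intro mult_left_mono power_mono) auto
  also have "1 + \<dots> \<le> (1 + sphc TYPE('d)) * max 1 (real n) ^ (CARD('d) - a)"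
    by (simp add: algebra_simps)
  finally show ?thesis by simp
qed

lemma sum_inverse_squares: "1 \<le> r \<Longrightarrow> (\<Sum>k\<in>{r..n}. 1 / (real k)\<^sup>2) \<le> 2 / real r"
proof (cases "r \<le> n")
  case True
  assume r: "1 \<le> r"
  \<comment> \<open>The extra \<open>- 1 / real n\<close> makes the induction telescope.\<close>
  have "(\<Sum>k\<in>{r..n}. 1 / (real k)\<^sup>2) \<le> 2 / real r - 1 / real n"
    using True
  proof (induction n rule: dec_induct)
    case base
    have "1 / (real r)\<^sup>2 \<le> 1 / real r" using r by (simp add: power2_eq_square field_simps)
    then show ?case by simp
  next
    case (step n)
    have n: "real n > 0" using step r by simp
    have "1 / (real (Suc n))\<^sup>2 \<le> 1 / (real n * real (Suc n))"
      unfolding power2_eq_square using n by (intro divide_left_mono mult_right_mono mult_pos_pos) auto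
    also have "\<dots> = 1 / real n - 1 / real (Suc n)" using n by (simp add: field_simps)
    finally have "1 / (real (Suc n))\<^sup>2 \<le> 1 / real n - 1 / real (Suc n)" .
    then show ?case using step by simp
  qed
  also have "\<dots> \<le> 2 / real r" by simp
  finally show ?thesis .
qed simp

lemma sum_tail:
  fixes X :: "(int ^ 'd::finite) set"
  assumes q: "CARD('d) < q" and X: "finite X" "\<And>x. x \<in> X \<Longrightarrow> int r \<le> norm_linf x" and r: "1 \<le> r"
  shows "(\<Sum>x\<in>X. 1 / jb x ^ q) \<le> 2 * sphc TYPE('d) / real r ^ (q - CARD('d))"
proof -
  define n where "n = nat (Max (insert 0 (norm_linf ` X)))"
  have n: "norm_linf x \<le> int n" if "x \<in> X" for x
  proof -
    have "norm_linf x \<le> Max (insert 0 (norm_linf ` X))" using that X(1) by (intro Max_ge) auto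
    then show ?thesis by (simp add: n_def)
  qed
  obtain s where s: "q = CARD('d) + Suc s" using q less_iff_Suc_add by auto
  let ?h = "\<lambda>k. 1 / max 1 (real k) ^ q"
  have "(\<Sum>x\<in>X. 1 / jb x ^ q) = (\<Sum>x\<in>X. ?h (nat (norm_linf x)))" by (simp add: jb_def)
  also have "\<dots> \<le> (\<Sum>k\<in>{r..n}. real (card (sphere_set k :: (int ^ 'd) set)) * ?h k)"
    by (rule sum_by_spheres) (use X n in auto)
  \<comment> \<open>All but two powers of \<open>k\<close> are frozen at \<open>k = r\<close>, which
    leaves a sum of inverse squares.\<close>
  also have "\<dots> \<le> (\<Sum>k\<in>{r..n}. sphc TYPE('d) / real r ^ s * (1 / (real k)\<^sup>2))"
  proof (rule sum_mono)
    fix k assume k: "k \<in> {r..n}"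
    have kp: "real k > 0" using k r by auto
    obtain m where m: "CARD('d) = Suc m" by (metis Suc_pred' zero_less_card_finite)
    have "real (card (sphere_set k :: (int ^ 'd) set)) * ?h k \<le> sphc TYPE('d) * real k ^ (CARD('d) - 1) * ?h k"
      using k r by (intro mult_right_mono card_sphere_set) auto
    also have "\<dots> = sphc TYPE('d) / real k ^ s * (1 / (real k)\<^sup>2)"
      using k r kp by (simp add: max_def m s power_add power2_eq_square field_simps)
    also have "\<dots> \<le> sphc TYPE('d) / real r ^ s * (1 / (real k)\<^sup>2)"
      using k r kp by (intro mult_right_mono divide_left_mono power_mono) auto
    finally show "real (card (sphere_set k :: (int ^ 'd) set)) * ?h k \<le> sphc TYPE('d) / real r ^ s * (1 / (real k)\<^sup>2)" .
  qed
  also have "\<dots> = sphc TYPE('d) / real r ^ s * (\<Sum>k\<in>{r..n}. 1 / (real k)\<^sup>2)" by (simp add: sum_distrib_left)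
  also have "\<dots> \<le> sphc TYPE('d) / real r ^ s * (2 / real r)"
    by (intro mult_left_mono sum_inverse_squares r) auto
  also have "\<dots> = 2 * sphc TYPE('d) / real r ^ (q - CARD('d))" by (simp add: s mult_ac)
  finally show ?thesis .
qed

section \<open>Convolutions of power laws\<close>

lemma sum_reflect:
  fixes X :: "'a::ab_group_add set"
  shows "(\<Sum>u\<in>X. f (x - u)) = (\<Sum>u\<in>(\<lambda>u. x - u) ` X. f u)"
  by (subst sum.reindex) (auto simp: inj_on_def)

text \<open>For \<open>u\<close> at most half as long as \<open>x\<close>, the factor at
  \<open>x - u\<close> is comparable to its value at \<open>x\<close>, and the other factor is
  summed over a ball.\<close>

lemma convolution_near:
  fixes X :: "(int ^ 'd::finite) set" and x :: "int ^ 'd"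
  assumes a: "a < CARD('d)" and X: "finite X" "\<And>u. u \<in> X \<Longrightarrow> 2 * norm_linf u \<le> norm_linf x" and ab: "CARD('d) < a + b"
  shows "(\<Sum>u\<in>X. 1 / (jb u ^ a * jb (x - u) ^ b)) \<le> 2 ^ b * (1 + sphc TYPE('d)) / jb x ^ (a + b - CARD('d))"
proof -
  define n where "n = nat (norm_linf x)"
  have sub: "X \<subseteq> box n"
  proof
    fix u assume "u \<in> X"
    then have "norm_linf u \<le> norm_linf x" using X(2)[of u] norm_linf_nonneg[of u] by linarith
    then show "u \<in> box n" by (simp add: box_def n_def)
  qed
  have jx: "jb x = max 1 (real n)" by (simp add: jb_def n_def)
  have ge: "jb x / 2 \<le> jb (x - u)" if "u \<in> X" for u
  proof -
    have "norm_linf x \<le> norm_linf u + norm_linf (x - u)" by (rule norm_linf_triangle_sub)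
    with X(2)[OF that] have "norm_linf x \<le> 2 * norm_linf (x - u)" by linarith
    then show ?thesis by (auto simp: jb_def)
  qed
  have "(\<Sum>u\<in>X. 1 / (jb u ^ a * jb (x - u) ^ b)) \<le> (\<Sum>u\<in>X. 2 ^ b / jb x ^ b * (1 / jb u ^ a))"
  proof (rule sum_mono)
    fix u assume "u \<in> X"
    have "1 / (jb u ^ a * jb (x - u) ^ b) \<le> 1 / (jb u ^ a * (jb x / 2) ^ b)"
      using ge[OF \<open>u \<in> X\<close>] by (intro divide_left_mono mult_left_mono power_mono mult_pos_pos) auto
    then show "1 / (jb u ^ a * jb (x - u) ^ b) \<le> 2 ^ b / jb x ^ b * (1 / jb u ^ a)"
      by (simp add: power_divide mult_ac)
  qed
  also have "\<dots> = 2 ^ b / jb x ^ b * (\<Sum>u\<in>X. 1 / jb u ^ a)" by (simp add: sum_distrib_left)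
  also have "\<dots> \<le> 2 ^ b / jb x ^ b * ((1 + sphc TYPE('d)) * jb x ^ (CARD('d) - a))"
  proof (rule mult_left_mono)
    have "(\<Sum>u\<in>X. 1 / jb u ^ a) \<le> (\<Sum>u\<in>(box n :: (int ^ 'd) set). 1 / jb u ^ a)" using sub by (intro sum_mono2) auto
    also have "\<dots> \<le> (1 + sphc TYPE('d)) * jb x ^ (CARD('d) - a)" unfolding jx by (rule sum_ball[OF a])
    finally show "(\<Sum>u\<in>X. 1 / jb u ^ a) \<le> (1 + sphc TYPE('d)) * jb x ^ (CARD('d) - a)" .
  qed simp
  also have "2 ^ b / jb x ^ b * ((1 + sphc TYPE('d)) * jb x ^ (CARD('d) - a)) = 2 ^ b * (1 + sphc TYPE('d)) * (jb x ^ (CARD('d) - a) / jb x ^ b)"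
    by simp
  also have "jb x ^ (CARD('d) - a) / jb x ^ b = 1 / jb x ^ (a + b - CARD('d))"
  proof -
    have "b = (CARD('d) - a) + (a + b - CARD('d))" using a ab by simp
    then have "jb x ^ b = jb x ^ (CARD('d) - a) * jb x ^ (a + b - CARD('d))" by (metis power_add)
    moreover have "jb x \<noteq> 0" using jb_pos[of x] by linarith
    ultimately show ?thesis by (simp add: divide_simps)
  qed
  finally show ?thesis by simp
qed

lemma convolution_far:
  fixes X :: "(int ^ 'd::finite) set" and x :: "int ^ 'd"
  assumes X: "finite X" "\<And>u. u \<in> X \<Longrightarrow> norm_linf x < 2 * norm_linf u" and q: "CARD('d) < q"
  shows "(\<Sum>u\<in>X. 1 / jb u ^ q) \<le> 2 * sphc TYPE('d) * 2 ^ (q - CARD('d)) / jb x ^ (q - CARD('d))"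
proof -
  define r where "r = nat (norm_linf x) div 2 + 1"
  have r: "int r \<le> norm_linf u" if "u \<in> X" for u
  proof -
    have "int r = norm_linf x div 2 + 1" by (simp add: r_def zdiv_int)
    with X(2)[OF that] show ?thesis by linarith
  qed
  have le: "jb x / 2 \<le> real r"
  proof -
    have "norm_linf x \<le> 2 * int r" by (simp add: r_def zdiv_int)
    then have "real_of_int (norm_linf x) \<le> 2 * real r" by linarith
    moreover have "1 \<le> real r" by (simp add: r_def)
    ultimately show ?thesis by (simp add: jb_def)
  qed
  have "(\<Sum>u\<in>X. 1 / jb u ^ q) \<le> 2 * sphc TYPE('d) / real r ^ (q - CARD('d))"
    by (rule sum_tail[OF q X(1) r]) (auto simp: r_def)
  also have "\<dots> \<le> 2 * sphc TYPE('d) / (jb x / 2) ^ (q - CARD('d))"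
    using le by (intro divide_left_mono power_mono mult_pos_pos zero_less_power) (auto simp: r_def)
  finally show ?thesis by (simp add: power_divide)
qed

text \<open>Three regions: near \<open>0\<close>, near \<open>x\<close> (reflected to the first),
  and far from both. In the last one the product is at most the sum of two pure powers of exponent
  \<open>a + b\<close>, whose tails converge.\<close>

lemma convolution:
  assumes a: "a < CARD('d::finite)" and b: "b < CARD('d)" and ab: "CARD('d) < a + b"
  shows "\<exists>C>0. \<forall>X (x :: int ^ 'd). finite X \<longrightarrow> (\<Sum>u\<in>X. 1 / (jb u ^ a * jb (x - u) ^ b)) \<le> C / jb x ^ (a + b - CARD('d))"
proof -
  define K where "K = 2 ^ b * (1 + sphc TYPE('d)) + 2 ^ a * (1 + sphc TYPE('d)) + 2 * (2 * sphc TYPE('d) * 2 ^ (a + b - CARD('d)))"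
  have "K \<ge> 2 ^ b * (1 + sphc TYPE('d))" by (simp add: K_def)
  moreover have "2 ^ b * (1 + sphc TYPE('d)) > 0" by (intro mult_pos_pos add_pos_nonneg) auto
  ultimately have K0: "K > 0" by linarith
  have "(\<Sum>u\<in>X. 1 / (jb u ^ a * jb (x - u) ^ b)) \<le> K / jb x ^ (a + b - CARD('d))" if X: "finite X" for X and x :: "int ^ 'd"
  proof -
    let ?f = "\<lambda>u. 1 / (jb u ^ a * jb (x - u) ^ b)"
    let ?Y = "(\<lambda>u. x - u) ` X"
    let ?J = "jb x ^ (a + b - CARD('d))"
    let ?X1 = "{u \<in> X. 2 * norm_linf u \<le> norm_linf x}"
    let ?X2 = "{u \<in> X. 2 * norm_linf (x - u) \<le> norm_linf x}"
    let ?X3 = "{u \<in> X. norm_linf x < 2 * norm_linf u}"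
    let ?X4 = "{u \<in> X. norm_linf x < 2 * norm_linf (x - u)}"
    have f0: "0 \<le> ?f u" for u by simp
    have pt: "?f u \<le> 1 / jb u ^ (a + b) + 1 / jb (x - u) ^ (a + b)" for u
    proof (cases "jb u \<le> jb (x - u)")
      case True
      have "?f u \<le> 1 / (jb u ^ a * jb u ^ b)"
        using True by (intro divide_left_mono mult_left_mono power_mono mult_pos_pos) auto
      then show ?thesis by (simp add: power_add add_increasing2)
    next
      case False
      have "?f u \<le> 1 / (jb (x - u) ^ a * jb (x - u) ^ b)"
        using False by (intro divide_left_mono mult_right_mono power_mono mult_pos_pos) auto
      then show ?thesis by (simp add: power_add add_increasing)
    qed
    have s1: "(\<Sum>u\<in>?X1. ?f u) \<le> 2 ^ b * (1 + sphc TYPE('d)) / ?J"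
      by (rule convolution_near[OF a _ _ ab]) (use X in auto)
    have "(\<Sum>u\<in>?X2. ?f u) = (\<Sum>u\<in>(\<lambda>u. x - u) ` ?X2. 1 / (jb u ^ b * jb (x - u) ^ a))"
      using sum_reflect[of "\<lambda>u. 1 / (jb u ^ b * jb (x - u) ^ a)" x ?X2] by (simp add: mult.commute)
    also have "\<dots> \<le> 2 ^ a * (1 + sphc TYPE('d)) / jb x ^ (b + a - CARD('d))"
      by (rule convolution_near[OF b]) (use X ab in auto)
    finally have s2: "(\<Sum>u\<in>?X2. ?f u) \<le> 2 ^ a * (1 + sphc TYPE('d)) / ?J" by (simp add: add.commute)
    have s3: "(\<Sum>u\<in>?X3. 1 / jb u ^ (a + b)) \<le> 2 * sphc TYPE('d) * 2 ^ (a + b - CARD('d)) / ?J"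
      by (rule convolution_far[OF _ _ ab]) (use X in auto)
    have "(\<Sum>u\<in>?X4. 1 / jb (x - u) ^ (a + b)) = (\<Sum>u\<in>(\<lambda>u. x - u) ` ?X4. 1 / jb u ^ (a + b))"
      by (rule sum_reflect)
    also have "\<dots> \<le> 2 * sphc TYPE('d) * 2 ^ (a + b - CARD('d)) / ?J"
      by (rule convolution_far[OF _ _ ab]) (use X in auto)
    finally have s4: "(\<Sum>u\<in>?X4. 1 / jb (x - u) ^ (a + b)) \<le> 2 * sphc TYPE('d) * 2 ^ (a + b - CARD('d)) / ?J" .
    have "(\<Sum>u\<in>X. ?f u) \<le> (\<Sum>u\<in>X. (if u \<in> ?X1 then ?f u else 0) + (if u \<in> ?X2 then ?f u else 0)
        + ((if u \<in> ?X3 then 1 / jb u ^ (a + b) else 0) + (if u \<in> ?X4 then 1 / jb (x - u) ^ (a + b) else 0)))"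
    proof (rule sum_mono)
      fix u assume u: "u \<in> X"
      have nn: "0 \<le> 1 / jb u ^ (a + b)" "0 \<le> 1 / jb (x - u) ^ (a + b)" by simp_all
      show "?f u \<le> (if u \<in> ?X1 then ?f u else 0) + (if u \<in> ?X2 then ?f u else 0)
        + ((if u \<in> ?X3 then 1 / jb u ^ (a + b) else 0) + (if u \<in> ?X4 then 1 / jb (x - u) ^ (a + b) else 0))"
      proof (cases "u \<in> ?X1 \<or> u \<in> ?X2")
        case True
        have if0: "0 \<le> (if P then t else 0)" if "0 \<le> t" for P and t :: real using that by simp
        have "?f u \<le> (if u \<in> ?X1 then ?f u else 0) + (if u \<in> ?X2 then ?f u else 0)"
        proof (cases "u \<in> ?X1")
          case True
          then show ?thesis using if0[OF f0[of u], of "u \<in> ?X2"] by simp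
        next
          case F: False
          then have "u \<in> ?X2" using True by auto
          then show ?thesis using if0[OF f0[of u], of "u \<in> ?X1"] by simp
        qed
        then show ?thesis using if0[OF nn(1), of "u \<in> ?X3"] if0[OF nn(2), of "u \<in> ?X4"] by linarith
      next
        case False
        then have "u \<in> ?X3" "u \<in> ?X4" using u by auto
        then show ?thesis using pt[of u] False by simp
      qed
    qed
    also have "\<dots> = (\<Sum>u\<in>?X1. ?f u) + (\<Sum>u\<in>?X2. ?f u) + ((\<Sum>u\<in>?X3. 1 / jb u ^ (a + b)) + (\<Sum>u\<in>?X4. 1 / jb (x - u) ^ (a + b)))"
      unfolding sum.distrib using X by (simp add: sum.If_cases Int_def)
    also have "\<dots> \<le> K / ?J"
      using s1 s2 s3 s4 by (simp add: K_def add_divide_distrib)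
    finally show ?thesis .
  qed
  with K0 show ?thesis by blast
qed

text \<open>The singularity \<open>v\<close> may be anywhere relative to the box. Points within
  \<open>n\<close> of \<open>v\<close> are summed as a ball around \<open>v\<close>; any other point
  contributes at most \<open>n ^ (2 - d)\<close>.\<close>

lemma sum_shifted_box:
  fixes X :: "(int ^ 'd::finite) set"
  assumes d: "2 < CARD('d)" and n: "1 \<le> n" and X: "\<And>x. x \<in> X \<Longrightarrow> norm_linf (x - z) \<le> int n"
  shows "finite X \<and> (\<Sum>x\<in>X. 1 / jb (x - v) ^ (CARD('d) - 2)) \<le> (1 + sphc TYPE('d) + 3 ^ CARD('d)) * (real n)\<^sup>2"
proof -
  have sub: "X \<subseteq> (\<lambda>y. y + z) ` box n"
  proof
    fix x assume "x \<in> X"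
    then have "x - z \<in> box n" using X by (simp add: box_def)
    then show "x \<in> (\<lambda>y. y + z) ` box n" by (metis diff_add_cancel image_eqI)
  qed
  then have fin: "finite X" by (rule finite_subset) simp
  have "card X \<le> card ((\<lambda>y. y + z) ` (box n :: (int ^ 'd) set))" by (rule card_mono[OF _ sub]) simp
  also have "\<dots> \<le> card (box n :: (int ^ 'd) set)" by (rule card_image_le) simp
  also have "\<dots> = (2 * n + 1) ^ CARD('d)" by (rule card_box)
  also have "\<dots> \<le> (3 * n) ^ CARD('d)" using n by (intro power_mono) auto
  finally have "real (card X) \<le> real ((3 * n) ^ CARD('d))" by (rule of_nat_mono)
  then have card: "real (card X) \<le> (3 * real n) ^ CARD('d)" by simp
  let ?q = "CARD('d) - 2"
  let ?X1 = "{x \<in> X. norm_linf (x - v) \<le> int n}"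
  let ?X2 = "{x \<in> X. \<not> norm_linf (x - v) \<le> int n}"
  have "(\<Sum>x\<in>?X1. 1 / jb (x - v) ^ ?q) = (\<Sum>x\<in>(\<lambda>x. x - v) ` ?X1. 1 / jb x ^ ?q)"
    by (subst sum.reindex) (auto simp: inj_on_def)
  also have "\<dots> \<le> (\<Sum>x\<in>(box n :: (int ^ 'd) set). 1 / jb x ^ ?q)"
  proof (rule sum_mono2)
    show "(\<lambda>x. x - v) ` ?X1 \<subseteq> box n" by (auto simp: box_def)
  qed simp_all
  also have "\<dots> \<le> (1 + sphc TYPE('d)) * max 1 (real n) ^ (CARD('d) - ?q)" by (rule sum_ball) (use d in auto)
  also have "\<dots> = (1 + sphc TYPE('d)) * (real n)\<^sup>2" using n d by (simp add: max_def)
  finally have s1: "(\<Sum>x\<in>?X1. 1 / jb (x - v) ^ ?q) \<le> (1 + sphc TYPE('d)) * (real n)\<^sup>2" .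
  have "(\<Sum>x\<in>?X2. 1 / jb (x - v) ^ ?q) \<le> (\<Sum>x\<in>?X2. 1 / real n ^ ?q)"
    by (intro sum_mono divide_left_mono power_mono mult_pos_pos) (use n in \<open>auto simp: jb_def\<close>)
  also have "\<dots> \<le> (\<Sum>x\<in>X. 1 / real n ^ ?q)" by (rule sum_mono2[OF fin]) auto
  also have "\<dots> = real (card X) / real n ^ ?q" by simp
  also have "\<dots> \<le> (3 * real n) ^ CARD('d) / real n ^ ?q" using card by (intro divide_right_mono) auto
  also have "\<dots> = 3 ^ CARD('d) * (real n)\<^sup>2"
  proof -
    have "real n ^ CARD('d) = real n ^ ?q * (real n)\<^sup>2" using d by (metis le_add_diff_inverse2 less_imp_le power_add)
    then show ?thesis using n by (simp add: power_mult_distrib)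
  qed
  finally have s2: "(\<Sum>x\<in>?X2. 1 / jb (x - v) ^ ?q) \<le> 3 ^ CARD('d) * (real n)\<^sup>2" .
  have "(\<Sum>x\<in>X. 1 / jb (x - v) ^ ?q) = (\<Sum>x\<in>?X1 \<union> ?X2. 1 / jb (x - v) ^ ?q)" by (rule sum.cong) auto
  also have "\<dots> = (\<Sum>x\<in>?X1. 1 / jb (x - v) ^ ?q) + (\<Sum>x\<in>?X2. 1 / jb (x - v) ^ ?q)"
    by (rule sum.union_disjoint) (use fin in auto)
  finally show ?thesis using s1 s2 fin by (simp add: algebra_simps)
qed

lemma sum_shifted_box_le:
  fixes X :: "(int ^ 'd::finite) set"
  assumes d: "2 < CARD('d)"
  shows "\<exists>C>0. \<forall>X z v n. 1 \<le> n \<longrightarrow> (\<forall>x\<in>X. norm_linf (x - z) \<le> int n) \<longrightarrow>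
    finite X \<and> (\<Sum>x\<in>X. 1 / jb (x - v :: int ^ 'd) ^ (CARD('d) - 2)) \<le> C * (real n)\<^sup>2"
proof (intro exI conjI allI impI)
  show "0 < 1 + sphc TYPE('d) + 3 ^ CARD('d)" by (intro add_pos_pos add_pos_nonneg) auto
  fix X :: "(int ^ 'd) set" and z v :: "int ^ 'd" and n :: nat
  assume "1 \<le> n" "\<forall>x\<in>X. norm_linf (x - z) \<le> int n"
  then have "finite X \<and> (\<Sum>x\<in>X. 1 / jb (x - v) ^ (CARD('d) - 2)) \<le> (1 + sphc TYPE('d) + 3 ^ CARD('d)) * (real n)\<^sup>2"
    by (intro sum_shifted_box[OF d]) auto
  then show "finite X" "(\<Sum>x\<in>X. 1 / jb (x - v) ^ (CARD('d) - 2)) \<le> (1 + sphc TYPE('d) + 3 ^ CARD('d)) * (real n)\<^sup>2" by auto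
qed

section \<open>Infinite volume\<close>

text \<open>What both families of edges have in common. Nearest-neighbour edges are included so that
  explicit lattice paths can be opened.\<close>

locale lattice_percolation =
  fixes \<E> :: "'d::finite edge set" and L :: nat
  assumes edge_pair: "e \<in> \<E> \<Longrightarrow> \<exists>x y. e = {x, y} \<and> x \<noteq> y"
    and edge_range: "{x, y} \<in> \<E> \<Longrightarrow> norm_linf (x - y) \<le> int L"
    and edge_shift: "e \<in> \<E> \<Longrightarrow> (\<lambda>x. x + z) ` e \<in> \<E>"
    and edge_nn: "norm_l1 (x - y) = 1 \<Longrightarrow> {x, y} \<in> \<E>"
    and L_pos: "1 \<le> L"
begin

definition fin_sub :: "'d edge set \<Rightarrow> bool" where
  "fin_sub F \<longleftrightarrow> finite F \<and> F \<subseteq> \<E>"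

definition EI :: "(int ^ 'd) set \<Rightarrow> 'd edge set" where
  "EI X = {e \<in> \<E>. e \<subseteq> X}"

text \<open>For increasing events with finite witnesses this is the infinite-volume probability
  (\<open>measure_incr_event\<close>). The supremum lets every inequality be proved on finite edge
  sets.\<close>

definition PS :: "real \<Rightarrow> ('d edge set \<Rightarrow> bool) \<Rightarrow> real" where
  "PS p A = (SUP F\<in>Collect fin_sub. bprob p F A)"

lemma fin_sub_empty: "fin_sub {}" by (simp add: fin_sub_def)

lemma fin_sub_Un: "fin_sub F \<Longrightarrow> fin_sub G \<Longrightarrow> fin_sub (F \<union> G)" by (auto simp: fin_sub_def)

lemma fin_sub_EI: "finite X \<Longrightarrow> fin_sub (EI X)"
  unfolding fin_sub_def EI_def by (auto intro: finite_subset[of _ "Pow X"])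

lemma fin_subD: "fin_sub F \<Longrightarrow> finite F" "fin_sub F \<Longrightarrow> F \<subseteq> \<E>" "fin_sub F \<Longrightarrow> finite (\<Union>F)"
proof -
  assume F: "fin_sub F"
  have "finite e" if "e \<in> F" for e
  proof -
    have "e \<in> \<E>" using that F by (auto simp: fin_sub_def)
    from edge_pair[OF this] obtain x y where "e = {x, y}" by blast
    then show ?thesis by simp
  qed
  then show "finite F" "F \<subseteq> \<E>" "finite (\<Union>F)" using F by (auto simp: fin_sub_def)
qed

lemma fin_sub_subset_EI_box:
  assumes "fin_sub F"
  shows "\<exists>n. F \<subseteq> EI (box n)"
proof -
  define n where "n = nat (Max (insert 0 (norm_linf ` \<Union>F)))"
  have "\<Union>F \<subseteq> box n"
  proof
    fix x assume "x \<in> \<Union>F"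
    then have "norm_linf x \<le> Max (insert 0 (norm_linf ` \<Union>F))" using fin_subD(3)[OF assms] by (intro Max_ge) auto
    then show "x \<in> box n" by (simp add: box_def n_def)
  qed
  then have "F \<subseteq> EI (box n)" using fin_subD(2)[OF assms] by (auto simp: EI_def)
  then show ?thesis by blast
qed

context
  fixes p :: real assumes p: "0 \<le> p" "p \<le> 1"
begin

lemma PS_upper: "fin_sub F \<Longrightarrow> bprob p F A \<le> PS p A"
  unfolding PS_def using bprob_le_1[OF p] fin_subD(1) by (intro cSUP_upper bdd_aboveI[of _ 1]) auto

lemma PS_least: "(\<And>F. fin_sub F \<Longrightarrow> bprob p F A \<le> c) \<Longrightarrow> PS p A \<le> c"
  unfolding PS_def using fin_sub_empty by (intro cSUP_least) auto

lemma PS_nonneg: "0 \<le> PS p A"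
  using PS_upper[OF fin_sub_empty, of A] bprob_nonneg[OF p, of "{}" A] by linarith

lemma PS_le_1: "PS p A \<le> 1"
  by (rule PS_least) (rule bprob_le_1[OF p fin_subD(1)])

text \<open>Stated for all larger \<open>G\<close>, so that finitely many approximations can be met
  by one edge set.\<close>

lemma PS_approx:
  assumes "incr A" "\<epsilon> > 0"
  shows "\<exists>F. fin_sub F \<and> (\<forall>G. fin_sub G \<longrightarrow> F \<subseteq> G \<longrightarrow> PS p A - \<epsilon> < bprob p G A)"
proof -
  have "\<exists>F. fin_sub F \<and> PS p A - \<epsilon> < bprob p F A"
  proof (rule ccontr)
    assume "\<not> ?thesis"
    then have "PS p A \<le> PS p A - \<epsilon>" by (intro PS_least) (auto simp: not_less)
    with assms(2) show False by simp
  qed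
  then obtain F where F: "fin_sub F" "PS p A - \<epsilon> < bprob p F A" by blast
  have "PS p A - \<epsilon> < bprob p G A" if "fin_sub G" "F \<subseteq> G" for G
    using F(2) bprob_subset[OF fin_subD(1)[OF that(1)] that(2) assms(1) p] by linarith
  with F(1) show ?thesis by blast
qed

lemma PS_mono_event: "(\<And>\<xi>. A \<xi> \<Longrightarrow> B \<xi>) \<Longrightarrow> PS p A \<le> PS p B"
proof (rule PS_least)
  fix F assume "\<And>\<xi>. A \<xi> \<Longrightarrow> B \<xi>" "fin_sub F"
  then show "bprob p F A \<le> PS p B"
    using PS_upper[of F B] bprob_mono[OF p, of F A B] by fastforce
qed

lemma PS_approx_finite:
  assumes "finite I" "\<And>i. i \<in> I \<Longrightarrow> incr (A i)" "\<epsilon> > 0"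
  shows "\<exists>F. fin_sub F \<and> (\<forall>G. fin_sub G \<longrightarrow> F \<subseteq> G \<longrightarrow> (\<forall>i\<in>I. PS p (A i) - \<epsilon> < bprob p G (A i)))"
  using assms(1,2)
proof (induction I rule: finite_induct)
  case empty
  then show ?case using fin_sub_empty by auto
next
  case (insert j I)
  then obtain F where F: "fin_sub F" "\<forall>G. fin_sub G \<longrightarrow> F \<subseteq> G \<longrightarrow> (\<forall>i\<in>I. PS p (A i) - \<epsilon> < bprob p G (A i))" by auto
  obtain F' where F': "fin_sub F'" "\<forall>G. fin_sub G \<longrightarrow> F' \<subseteq> G \<longrightarrow> PS p (A j) - \<epsilon> < bprob p G (A j)"
    using PS_approx[of "A j", OF _ assms(3)] insert.prems by auto
  show ?case using F F' fin_sub_Un[OF F(1) F'(1)] by (intro exI[of _ "F \<union> F'"]) auto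
qed

end

lemma PS_mono_param:
  assumes "incr A" "0 \<le> p" "p \<le> q" "q \<le> 1"
  shows "PS p A \<le> PS q A"
proof (rule PS_least)
  fix F assume F: "fin_sub F"
  show "bprob p F A \<le> PS q A"
    using bprob_mono_param[OF fin_subD(1)[OF F] assms] PS_upper[of q F A] F assms by simp
qed (use assms in auto)

subsection \<open>Translations\<close>

definition shift :: "int ^ 'd \<Rightarrow> 'd edge set \<Rightarrow> 'd edge set" where
  "shift z \<xi> = (\<lambda>e. (\<lambda>x. x + z) ` e) ` \<xi>"

lemma inj_shift_edge: "inj (\<lambda>e :: 'd edge. (\<lambda>x. x + z) ` e)"
  by (rule injI) (auto simp: inj_image_eq_iff)

lemma shift_shift: "shift z (shift w \<xi>) = shift (w + z) \<xi>"
  by (auto simp: shift_def image_image add.assoc)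

lemma shift_zero [simp]: "shift 0 \<xi> = \<xi>" by (simp add: shift_def)

lemma fin_sub_shift: "fin_sub F \<Longrightarrow> fin_sub (shift z F)"
  unfolding fin_sub_def shift_def using edge_shift by auto

lemma conn_shift: "conn \<xi> x y \<Longrightarrow> conn (shift z \<xi>) (x + z) (y + z)"
proof (induction rule: conn_induct)
  case (step y w)
  have "{y + z, w + z} \<in> shift z \<xi>" unfolding shift_def
    by (rule image_eqI[OF _ step(2)]) auto
  from conn_trans[OF step(3) conn_edge[OF this]] show ?case .
qed simp

lemma conn_shift_iff: "conn (shift z \<xi>) (x + z) (y + z) \<longleftrightarrow> conn \<xi> x y"
  using conn_shift[of \<xi> x y z] conn_shift[of "shift z \<xi>" "x + z" "y + z" "- z"] by (auto simp: shift_shift)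

lemma bprob_shift: "fin_sub F \<Longrightarrow> bprob p (shift z F) A = bprob p F (\<lambda>\<xi>. A (shift z \<xi>))"
  unfolding bprob_def shift_def by (rule bexp_image[OF fin_subD(1) inj_shift_edge])

lemma PS_shift_le:
  assumes p: "0 \<le> p" "p \<le> 1"
  shows "PS p (\<lambda>\<xi>. A (shift z \<xi>)) \<le> PS p A"
proof (rule PS_least[OF p])
  fix F assume F: "fin_sub F"
  show "bprob p F (\<lambda>\<xi>. A (shift z \<xi>)) \<le> PS p A"
    using PS_upper[OF p fin_sub_shift[OF F], of z A] bprob_shift[OF F, of p z A] by simp
qed

lemma PS_shift:
  assumes p: "0 \<le> p" "p \<le> 1"
  shows "PS p (\<lambda>\<xi>. A (shift z \<xi>)) = PS p A"
proof (rule antisym[OF PS_shift_le[OF p]])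
  show "PS p A \<le> PS p (\<lambda>\<xi>. A (shift z \<xi>))"
    using PS_shift_le[OF p, of "\<lambda>\<xi>. A (shift z \<xi>)" "- z"] by (simp add: shift_shift)
qed

definition T :: "real \<Rightarrow> int ^ 'd \<Rightarrow> int ^ 'd \<Rightarrow> real" where
  "T p x y = PS p (\<lambda>\<xi>. conn \<xi> x y)"

text \<open>A substitute for reaching the boundary of a box: it is translation covariant and
  decreasing in \<open>n\<close> by definition, and independent of the range of the edges.\<close>

definition far :: "nat \<Rightarrow> int ^ 'd \<Rightarrow> 'd edge set \<Rightarrow> bool" where
  "far n x \<xi> \<longleftrightarrow> (\<exists>y. int n \<le> norm_linf (y - x) \<and> conn \<xi> x y)"

definition arm :: "real \<Rightarrow> nat \<Rightarrow> real" where
  "arm p n = PS p (far n 0)"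

lemma incr_far: "incr (far n x)"
  unfolding far_def by (rule incrI) (blast intro: conn_mono)

lemma far_shift: "far n (x + z) (shift z \<xi>) \<longleftrightarrow> far n x \<xi>"
proof
  assume "far n x \<xi>"
  then obtain y where "int n \<le> norm_linf (y - x)" "conn \<xi> x y" by (auto simp: far_def)
  then have "int n \<le> norm_linf ((y + z) - (x + z))" "conn (shift z \<xi>) (x + z) (y + z)" by (auto intro: conn_shift)
  then show "far n (x + z) (shift z \<xi>)" unfolding far_def by blast
next
  assume "far n (x + z) (shift z \<xi>)"
  then obtain y where y: "int n \<le> norm_linf (y - (x + z))" "conn (shift z \<xi>) (x + z) y" by (auto simp: far_def)
  then have "conn \<xi> x (y - z)" using conn_shift_iff[of z \<xi> x "y - z"] by simp
  moreover have "int n \<le> norm_linf ((y - z) - x)" using y(1) by (simp add: algebra_simps)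
  ultimately show "far n x \<xi>" unfolding far_def by blast
qed

context
  fixes p :: real assumes p: "0 \<le> p" "p \<le> 1"
begin

lemma tau_le_T: "fin_sub F \<Longrightarrow> tau p F x y \<le> T p x y"
  unfolding T_def by (rule PS_upper[OF p])

lemma T_shift: "T p (x + z) (y + z) = T p x y"
  using PS_shift[OF p, of "\<lambda>\<xi>. conn \<xi> (x + z) (y + z)" z] by (simp add: T_def conn_shift_iff)

lemma T_diff: "T p x y = T p 0 (y - x)"
  using T_shift[of 0 x "y - x"] by simp

lemma T_sym: "T p x y = T p y x"
proof -
  have "(\<lambda>\<xi> :: 'd edge set. conn \<xi> x y) = (\<lambda>\<xi>. conn \<xi> y x)" by (intro ext iffI) (rule conn_sym, assumption)+
  then show ?thesis by (simp add: T_def)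
qed

lemma T_nonneg [simp]: "0 \<le> T p x y" unfolding T_def by (rule PS_nonneg[OF p])
lemma T_le_1: "T p x y \<le> 1" unfolding T_def by (rule PS_le_1[OF p])

lemma T_refl [simp]: "T p x x = 1"
proof (rule antisym[OF T_le_1])
  show "1 \<le> T p x x" using tau_le_T[OF fin_sub_empty, of x x] by (simp add: bprob_def)
qed

lemma far_le_arm: "fin_sub F \<Longrightarrow> bprob p F (far n x) \<le> arm p n"
proof -
  assume F: "fin_sub F"
  have "PS p (far n x) = arm p n"
    using PS_shift[OF p, of "far n x" x] far_shift[of n 0 x] by (simp add: arm_def)
  with PS_upper[OF p F, of "far n x"] show ?thesis by simp
qed

lemma arm_nonneg: "0 \<le> arm p n" unfolding arm_def by (rule PS_nonneg[OF p])
lemma arm_le_1: "arm p n \<le> 1" unfolding arm_def by (rule PS_le_1[OF p])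

lemma arm_antimono: "m \<le> n \<Longrightarrow> arm p n \<le> arm p m"
  unfolding arm_def by (rule PS_mono_event[OF p]) (force simp: far_def)

end

lemma T_mono: "0 \<le> p \<Longrightarrow> p \<le> q \<Longrightarrow> q \<le> 1 \<Longrightarrow> T p x y \<le> T q x y"
  unfolding T_def by (rule PS_mono_param[OF incr_conn])

lemma arm_mono: "0 \<le> p \<Longrightarrow> p \<le> q \<Longrightarrow> q \<le> 1 \<Longrightarrow> arm p n \<le> arm q n"
  unfolding arm_def by (rule PS_mono_param[OF incr_far])

definition deg :: nat where "deg = card (box L :: (int ^ 'd) set)"

lemma card_neighbours:
  assumes "F \<subseteq> \<E>"
  shows "finite {v \<in> V. {u, v} \<in> F}" "card {v \<in> V. {u, v} \<in> F} \<le> deg"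
proof -
  have sub: "{v \<in> V. {u, v} \<in> F} \<subseteq> (\<lambda>x. x + u) ` box L"
  proof
    fix v assume "v \<in> {v \<in> V. {u, v} \<in> F}"
    then have "norm_linf (v - u) \<le> int L" using edge_range[of u v] assms by (auto simp: norm_linf_commute)
    then show "v \<in> (\<lambda>x. x + u) ` box L" by (intro image_eqI[of _ _ "v - u"]) (auto simp: box_def)
  qed
  show "finite {v \<in> V. {u, v} \<in> F}" by (rule finite_subset[OF sub]) simp
  have "card {v \<in> V. {u, v} \<in> F} \<le> card ((\<lambda>x. x + u) ` (box L :: (int ^ 'd) set))" by (rule card_mono[OF _ sub]) simp
  also have "\<dots> \<le> deg" unfolding deg_def by (rule card_image_le) simp
  finally show "card {v \<in> V. {u, v} \<in> F} \<le> deg" .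
qed

subsection \<open>The product measure\<close>

context
  fixes p :: real assumes p: "0 \<le> p" "p \<le> 1"
begin

lemma prob_space_percolation: "prob_space (percolation \<E> p)"
  unfolding percolation_def by (rule prob_space_PiM) (rule measure_pmf.prob_space_axioms)

lemma measure_cylinder:
  assumes F: "fin_sub F" and \<eta>: "\<eta> \<subseteq> F"
  shows "{\<xi> \<in> space (percolation \<E> p). {e \<in> F. \<xi> e} = \<eta>} \<in> sets (percolation \<E> p)"
    "measure (percolation \<E> p) {\<xi> \<in> space (percolation \<E> p). {e \<in> F. \<xi> e} = \<eta>} = p ^ card \<eta> * (1 - p) ^ card (F - \<eta>)"
proof -
  interpret product_prob_space "\<lambda>_ :: 'd edge. measure_pmf (bernoulli_pmf p)" \<E>
    by unfold_locales
  let ?X = "\<lambda>e. if e \<in> \<eta> then {True} else {False}"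
  have fin: "finite F" "F \<subseteq> \<E>" using fin_subD[OF F] by auto
  have sp: "space (percolation \<E> p) = PiE \<E> (\<lambda>_. UNIV)" by (simp add: percolation_def space_PiM)
  have eq: "{\<xi> \<in> space (percolation \<E> p). {e \<in> F. \<xi> e} = \<eta>} = prod_emb \<E> (\<lambda>_. measure_pmf (bernoulli_pmf p)) F (Pi\<^sub>E F ?X)"
    (is "?A = ?B")
  proof (intro set_eqI iffI)
    fix \<xi> assume w: "\<xi> \<in> ?A"
    then have "restrict \<xi> F \<in> Pi\<^sub>E F ?X" by (auto simp: PiE_iff)
    with w show "\<xi> \<in> ?B" by (simp add: prod_emb_def sp)
  next
    fix \<xi> assume w: "\<xi> \<in> ?B"
    then have "\<forall>e\<in>F. \<xi> e \<in> ?X e" by (auto simp: prod_emb_def PiE_iff)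
    then have "\<forall>e\<in>F. \<xi> e = (e \<in> \<eta>)" by (auto split: if_splits)
    with w \<eta> show "\<xi> \<in> ?A" by (auto simp: prod_emb_def sp)
  qed
  show "{\<xi> \<in> space (percolation \<E> p). {e \<in> F. \<xi> e} = \<eta>} \<in> sets (percolation \<E> p)"
    unfolding eq unfolding percolation_def using fin by (intro sets_PiM_I) auto
  have "measure (percolation \<E> p) {\<xi> \<in> space (percolation \<E> p). {e \<in> F. \<xi> e} = \<eta>} = (\<Prod>e\<in>F. measure (measure_pmf (bernoulli_pmf p)) (?X e))"
    unfolding eq unfolding percolation_def using fin by (intro measure_PiM_emb) auto
  also have "\<dots> = (\<Prod>e\<in>F. if e \<in> \<eta> then p else 1 - p)"
    by (rule prod.cong) (use p in \<open>auto simp: measure_pmf_single\<close>)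
  also have "\<dots> = p ^ card \<eta> * (1 - p) ^ card (F - \<eta>)"
  proof -
    have "F \<inter> {e. e \<in> \<eta>} = \<eta>" "F \<inter> - {e. e \<in> \<eta>} = F - \<eta>" using \<eta> by auto
    then show ?thesis using fin by (simp add: prod.If_cases)
  qed
  finally show "measure (percolation \<E> p) {\<xi> \<in> space (percolation \<E> p). {e \<in> F. \<xi> e} = \<eta>} = p ^ card \<eta> * (1 - p) ^ card (F - \<eta>)" .
qed

lemma measure_finite_event:
  assumes F: "fin_sub F"
  shows "{\<xi> \<in> space (percolation \<E> p). B {e \<in> F. \<xi> e}} \<in> sets (percolation \<E> p)"
    "measure (percolation \<E> p) {\<xi> \<in> space (percolation \<E> p). B {e \<in> F. \<xi> e}} = bprob p F B"
proof -
  interpret prob_space "percolation \<E> p" by (rule prob_space_percolation)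
  let ?C = "\<lambda>\<eta>. {\<xi> \<in> space (percolation \<E> p). {e \<in> F. \<xi> e} = \<eta>}"
  let ?I = "{\<eta> \<in> Pow F. B \<eta>}"
  have fin: "finite ?I" using fin_subD(1)[OF F] by simp
  have eq: "{\<xi> \<in> space (percolation \<E> p). B {e \<in> F. \<xi> e}} = (\<Union>\<eta>\<in>?I. ?C \<eta>)" by auto
  show "{\<xi> \<in> space (percolation \<E> p). B {e \<in> F. \<xi> e}} \<in> sets (percolation \<E> p)"
    unfolding eq using fin measure_cylinder(1)[OF F] by (intro sets.finite_UN) auto
  have "measure (percolation \<E> p) {\<xi> \<in> space (percolation \<E> p). B {e \<in> F. \<xi> e}} = (\<Sum>\<eta>\<in>?I. measure (percolation \<E> p) (?C \<eta>))"
    unfolding eq by (rule finite_measure_finite_Union[OF fin]) (use measure_cylinder(1)[OF F] in \<open>auto simp: disjoint_family_on_def\<close>)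
  also have "\<dots> = (\<Sum>\<eta>\<in>?I. p ^ card \<eta> * (1 - p) ^ card (F - \<eta>))"
    by (rule sum.cong) (use measure_cylinder(2)[OF F] in auto)
  also have "\<dots> = bprob p F B"
    unfolding bprob_def bexp_def using fin_subD(1)[OF F]
    by (intro sum.mono_neutral_cong_left) auto
  finally show "measure (percolation \<E> p) {\<xi> \<in> space (percolation \<E> p). B {e \<in> F. \<xi> e}} = bprob p F B" .
qed

text \<open>With finite witnesses the event is the increasing union of its versions in finite boxes,
  so continuity from below identifies its measure with the supremum.\<close>

lemma measure_incr_event:
  assumes inc: "incr A" and fin: "\<And>\<xi>. A \<xi> \<Longrightarrow> \<exists>\<eta>\<subseteq>\<xi>. finite \<eta> \<and> A \<eta>"
  shows "{\<xi> \<in> space (percolation \<E> p). A {e \<in> \<E>. \<xi> e}} \<in> sets (percolation \<E> p)"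
    "measure (percolation \<E> p) {\<xi> \<in> space (percolation \<E> p). A {e \<in> \<E>. \<xi> e}} = PS p A"
proof -
  interpret prob_space "percolation \<E> p" by (rule prob_space_percolation)
  let ?F = "\<lambda>n. EI (box n)"
  let ?C = "\<lambda>n. {\<xi> \<in> space (percolation \<E> p). A {e \<in> ?F n. \<xi> e}}"
  have F: "fin_sub (?F n)" for n by (rule fin_sub_EI) simp
  have Fsub: "?F m \<subseteq> ?F n" if "m \<le> n" for m n using that by (force simp: EI_def box_def)
  have C_sets: "?C n \<in> sets (percolation \<E> p)" for n by (rule measure_finite_event(1)[OF F])
  have eq: "{\<xi> \<in> space (percolation \<E> p). A {e \<in> \<E>. \<xi> e}} = (\<Union>n. ?C n)" (is "?A = _")
  proof (intro set_eqI iffI)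
    fix \<xi> assume w: "\<xi> \<in> ?A"
    then obtain \<eta> where \<eta>: "\<eta> \<subseteq> {e \<in> \<E>. \<xi> e}" "finite \<eta>" "A \<eta>" using fin by blast
    then have "fin_sub \<eta>" by (auto simp: fin_sub_def)
    then obtain n where "\<eta> \<subseteq> ?F n" using fin_sub_subset_EI_box by blast
    then have "\<eta> \<subseteq> {e \<in> ?F n. \<xi> e}" using \<eta>(1) by auto
    then have "A {e \<in> ?F n. \<xi> e}" by (rule incrD[OF inc]) (rule \<eta>(3))
    with w show "\<xi> \<in> (\<Union>n. ?C n)" by auto
  next
    fix \<xi> assume "\<xi> \<in> (\<Union>n. ?C n)"
    then obtain n where w: "\<xi> \<in> space (percolation \<E> p)" "A {e \<in> ?F n. \<xi> e}" by auto
    have "{e \<in> ?F n. \<xi> e} \<subseteq> {e \<in> \<E>. \<xi> e}" by (auto simp: EI_def)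
    from incrD[OF inc this w(2)] w(1) show "\<xi> \<in> ?A" by simp
  qed
  show A_sets: "?A \<in> sets (percolation \<E> p)" unfolding eq using C_sets by blast
  have "incseq ?C"
  proof (rule incseq_SucI, rule subsetI)
    fix n \<xi> assume w: "\<xi> \<in> ?C n"
    have "{e \<in> ?F n. \<xi> e} \<subseteq> {e \<in> ?F (Suc n). \<xi> e}" using Fsub[of n "Suc n"] by auto
    from incrD[OF inc this] w show "\<xi> \<in> ?C (Suc n)" by simp
  qed
  then have lim: "(\<lambda>n. measure (percolation \<E> p) (?C n)) \<longlonglongrightarrow> measure (percolation \<E> p) (\<Union>n. ?C n)"
    using C_sets by (intro finite_Lim_measure_incseq) auto
  show "measure (percolation \<E> p) ?A = PS p A"
  proof (rule antisym)
    show "measure (percolation \<E> p) ?A \<le> PS p A"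
      unfolding eq by (rule LIMSEQ_le_const2[OF lim]) (use measure_finite_event(2)[OF F] PS_upper[OF p F] in auto)
    show "PS p A \<le> measure (percolation \<E> p) ?A"
    proof (rule PS_least[OF p])
      fix F assume F: "fin_sub F"
      have "bprob p F A = measure (percolation \<E> p) {\<xi> \<in> space (percolation \<E> p). A {e \<in> F. \<xi> e}}"
        by (rule measure_finite_event(2)[OF F, symmetric])
      also have "\<dots> \<le> measure (percolation \<E> p) ?A"
      proof (rule finite_measure_mono[OF _ A_sets], rule subsetI)
        fix \<xi> assume w: "\<xi> \<in> {\<xi> \<in> space (percolation \<E> p). A {e \<in> F. \<xi> e}}"
        have "{e \<in> F. \<xi> e} \<subseteq> {e \<in> \<E>. \<xi> e}" using fin_subD(2)[OF F] by auto
        from incrD[OF inc this] w show "\<xi> \<in> ?A" by simp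
      qed
      finally show "bprob p F A \<le> measure (percolation \<E> p) ?A" .
    qed
  qed
qed

lemma connected_in_conn: "connected_in \<E> \<xi> x y \<longleftrightarrow> conn {e \<in> \<E>. \<xi> e} x y"
proof -
  have "open_adjacent \<E> \<xi> = (\<lambda>u v. {u, v} \<in> {e \<in> \<E>. \<xi> e})"
    by (auto simp: open_adjacent_def adjacent_def fun_eq_iff)
  then show ?thesis by (simp add: connected_in_def conn_def)
qed

lemma conn_finite: "conn \<xi> x y \<Longrightarrow> \<exists>\<eta>\<subseteq>\<xi>. finite \<eta> \<and> conn \<eta> x y"
proof -
  assume c: "conn \<xi> x y"
  obtain xs where xs: "xs \<noteq> []" "hd xs = x" "last xs = y" "pedges xs \<subseteq> \<xi>" using conn_path[OF c] by blast
  then have "conn (pedges xs) x y" using path_conn'[of xs "pedges xs"] by simp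
  then show ?thesis using xs(4) by (intro exI[of _ "pedges xs"]) simp
qed

lemma two_point_eq_T: "two_point \<E> p x y = T p x y"
  unfolding two_point_def T_def connected_in_conn by (rule measure_incr_event(2)[OF incr_conn conn_finite])

lemma far_finite: "far n x \<xi> \<Longrightarrow> \<exists>\<eta>\<subseteq>\<xi>. finite \<eta> \<and> far n x \<eta>"
proof -
  assume "far n x \<xi>"
  then obtain y where y: "int n \<le> norm_linf (y - x)" "conn \<xi> x y" by (auto simp: far_def)
  from conn_finite[OF y(2)] obtain \<eta> where "\<eta> \<subseteq> \<xi>" "finite \<eta>" "conn \<eta> x y" by blast
  then show ?thesis using y(1) by (intro exI[of _ \<eta>]) (auto simp: far_def)
qed

text \<open>Leaving the box means passing through its vertex boundary; conversely a boundary vertex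
  has a neighbour outside and hence norm at least \<open>n - L\<close>. For \<open>n < L\<close> the
  truncated difference is 0 and the bound is trivial.\<close>

lemma one_arm_bounds: "arm p (Suc n) \<le> one_arm \<E> n p" "one_arm \<E> n p \<le> arm p (n - L)"
proof -
  interpret prob_space "percolation \<E> p" by (rule prob_space_percolation)
  have far_eq: "measure (percolation \<E> p) {\<xi> \<in> space (percolation \<E> p). far k 0 {e \<in> \<E>. \<xi> e}} = arm p k"
    and far_sets: "{\<xi> \<in> space (percolation \<E> p). far k 0 {e \<in> \<E>. \<xi> e}} \<in> sets (percolation \<E> p)" for k
    unfolding arm_def using measure_incr_event[OF incr_far far_finite] by auto
  show "arm p (Suc n) \<le> one_arm \<E> n p"
    unfolding far_eq[symmetric] one_arm_def
  proof (rule finite_measure_mono[OF _ one_arm_measurable], rule subsetI)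
    fix \<xi> assume w: "\<xi> \<in> {\<xi> \<in> space (percolation \<E> p). far (Suc n) 0 {e \<in> \<E>. \<xi> e}}"
    then obtain y where y: "int (Suc n) \<le> norm_linf y" "conn {e \<in> \<E>. \<xi> e} 0 y" by (auto simp: far_def)
    have "y \<notin> box n" "0 \<in> (box n :: (int ^ 'd) set)" using y(1) by (auto simp: box_def)
    from conn_first_exit[OF y(2) this(2,1)] obtain u v where uv: "u \<in> box n" "v \<notin> box n" "{u, v} \<in> {e \<in> \<E>. \<xi> e}"
      "disj_occ (\<lambda>\<xi>. conn (inside (box n) \<xi>) 0 u) (disj_occ (\<lambda>\<xi>. {u, v} \<in> \<xi>) (\<lambda>\<xi>. conn \<xi> v y)) {e \<in> \<E>. \<xi> e}" by blast
    obtain \<xi>' where w': "\<xi>' \<subseteq> {e \<in> \<E>. \<xi> e}" "conn (inside (box n) \<xi>') 0 u" using uv(4) unfolding disj_occ_def by blast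
    have "inside (box n) \<xi>' \<subseteq> {e \<in> \<E>. \<xi> e}" using w'(1) by (auto simp: inside_def)
    from conn_mono[OF w'(2) this] have "connected_in \<E> \<xi> 0 u" by (simp add: connected_in_conn)
    moreover have "u \<in> vertex_boundary \<E> (box n)" using uv by (auto simp: vertex_boundary_def adjacent_def)
    ultimately show "\<xi> \<in> {\<xi> \<in> space (percolation \<E> p). \<exists>y\<in>vertex_boundary \<E> (box n). connected_in \<E> \<xi> 0 y}"
      using w by auto
  qed
  show "one_arm \<E> n p \<le> arm p (n - L)"
    unfolding far_eq[symmetric] one_arm_def
  proof (rule finite_measure_mono[OF _ far_sets], rule subsetI)
    fix \<xi> assume w: "\<xi> \<in> {\<xi> \<in> space (percolation \<E> p). \<exists>y\<in>vertex_boundary \<E> (box n). connected_in \<E> \<xi> 0 y}"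
    then obtain y z where y: "connected_in \<E> \<xi> 0 y" "z \<notin> box n" "{y, z} \<in> \<E>"
      by (auto simp: vertex_boundary_def adjacent_def)
    have "norm_linf z \<le> norm_linf y + norm_linf (z - y)" by (rule norm_linf_triangle_sub)
    also have "norm_linf (z - y) \<le> int L" using edge_range[OF y(3)] by (simp add: norm_linf_commute)
    finally have "int (n - L) \<le> norm_linf y" using y(2) norm_linf_nonneg[of y] by (cases "L \<le> n") (auto simp: box_def of_nat_diff)
    then show "\<xi> \<in> {\<xi> \<in> space (percolation \<E> p). far (n - L) 0 {e \<in> \<E>. \<xi> e}}"
      using w y(1) by (auto simp: far_def connected_in_conn)
  qed
qed

text \<open>A cluster with arms of every length is infinite; continuity from above does the
  rest.\<close>

lemma percolation_prob_ge:
  assumes c: "\<And>n. c \<le> arm p n"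
  shows "c \<le> percolation_prob \<E> p"
proof -
  interpret prob_space "percolation \<E> p" by (rule prob_space_percolation)
  let ?C = "\<lambda>n. {\<xi> \<in> space (percolation \<E> p). far n 0 {e \<in> \<E>. \<xi> e}}"
  have C: "?C n \<in> sets (percolation \<E> p)" "measure (percolation \<E> p) (?C n) = arm p n" for n
    unfolding arm_def using measure_incr_event[OF incr_far far_finite] by auto
  have "decseq ?C" by (rule decseq_SucI) (force simp: far_def)
  then have lim: "(\<lambda>n. measure (percolation \<E> p) (?C n)) \<longlonglongrightarrow> measure (percolation \<E> p) (\<Inter>n. ?C n)"
    using C(1) by (intro finite_Lim_measure_decseq) auto
  have "c \<le> measure (percolation \<E> p) (\<Inter>n. ?C n)"
    by (rule LIMSEQ_le_const[OF lim]) (use C(2) c in auto)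
  also have "\<dots> \<le> percolation_prob \<E> p"
    unfolding percolation_prob_def
  proof (rule finite_measure_mono[OF _ infinite_cluster_measurable], rule subsetI)
    fix \<xi> assume w: "\<xi> \<in> (\<Inter>n. ?C n)"
    have "infinite (cluster \<E> \<xi> 0)"
    proof
      assume fin: "finite (cluster \<E> \<xi> 0)"
      define n where "n = nat (Max (insert 0 (norm_linf ` cluster \<E> \<xi> 0))) + 1"
      have "far n 0 {e \<in> \<E>. \<xi> e}" using w by auto
      then obtain y where y: "int n \<le> norm_linf y" "y \<in> cluster \<E> \<xi> 0"
        by (auto simp: far_def cluster_def connected_in_conn)
      have "norm_linf y \<le> Max (insert 0 (norm_linf ` cluster \<E> \<xi> 0))" using y(2) fin by (intro Max_ge) auto
      then show False using y(1) by (simp add: n_def split: if_splits)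
    qed
    then show "\<xi> \<in> {\<xi> \<in> space (percolation \<E> p). infinite (cluster \<E> \<xi> 0)}" using w by auto
  qed
  finally show ?thesis .
qed

end

end

section \<open>Straight lattice paths\<close>

definition axis_pt :: "'d \<Rightarrow> int \<Rightarrow> int ^ 'd::finite" where
  "axis_pt i k = (\<chi> j. if j = i then k else 0)"

lemma norm_linf_axis [simp]: "norm_linf (axis_pt i k) = \<bar>k\<bar>"
proof (rule antisym)
  show "norm_linf (axis_pt i k) \<le> \<bar>k\<bar>" by (simp add: norm_linf_le_iff axis_pt_def)
  show "\<bar>k\<bar> \<le> norm_linf (axis_pt i k)" using norm_linf_component[of "axis_pt i k" i] by (simp add: axis_pt_def)
qed

lemma norm_l1_axis: "norm_l1 (axis_pt i k) = \<bar>k\<bar>"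
proof -
  have "norm_l1 (axis_pt i k) = (\<Sum>j\<in>UNIV. if j = i then \<bar>k\<bar> else 0)"
    unfolding norm_l1_def by (rule sum.cong) (auto simp: axis_pt_def)
  then show ?thesis by simp
qed

lemma axis_diff: "axis_pt i k - axis_pt i l = axis_pt i (k - l)"
  by (simp add: axis_pt_def vec_eq_iff)

lemma axis_zero [simp]: "axis_pt i 0 = 0" by (simp add: axis_pt_def vec_eq_iff)

definition line_path :: "'d \<Rightarrow> nat \<Rightarrow> int ^ 'd::finite \<Rightarrow> (int ^ 'd) list" where
  "line_path i R u = map (\<lambda>k. u + axis_pt i (int k)) [0..<Suc R]"

lemma pedges_map_upt: "pedges (map f [k..<n]) = {{f j, f (Suc j)} | j. k \<le> j \<and> Suc j < n}"
proof (induction "n - k" arbitrary: k)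
  case (Suc m)
  show ?case
  proof (cases "Suc k < n")
    case True
    have "m = n - Suc k" using Suc by simp
    from Suc(1)[OF this] have IH: "pedges (map f [Suc k..<n]) = {{f j, f (Suc j)} | j. Suc k \<le> j \<and> Suc j < n}" .
    have "map f [k..<n] = f k # f (Suc k) # map f [Suc (Suc k)..<n]"
      using True by (simp add: upt_conv_Cons)
    moreover have "map f [Suc k..<n] = f (Suc k) # map f [Suc (Suc k)..<n]"
      using True by (simp add: upt_conv_Cons)
    ultimately have "pedges (map f [k..<n]) = insert {f k, f (Suc k)} {{f j, f (Suc j)} | j. Suc k \<le> j \<and> Suc j < n}"
      using IH by simp
    also have "\<dots> = {{f j, f (Suc j)} | j. k \<le> j \<and> Suc j < n}"
    proof -
      have "{{f j, f (Suc j)} | j. k \<le> j \<and> Suc j < n} = (\<lambda>j. {f j, f (Suc j)}) ` {j. k \<le> j \<and> Suc j < n}" by auto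
      also have "{j. k \<le> j \<and> Suc j < n} = insert k {j. Suc k \<le> j \<and> Suc j < n}" using True by auto
      finally show ?thesis by auto
    qed
    finally show ?thesis .
  next
    case False
    then have "n = Suc k" using Suc(2) by simp
    then show ?thesis by auto
  qed
qed auto

lemma line_path_simps [simp]: "line_path i R u \<noteq> []" "length (line_path i R u) = Suc R"
  "hd (line_path i R u) = u" "last (line_path i R u) = u + axis_pt i (int R)"
  by (simp_all add: line_path_def hd_map del: upt_Suc) (simp add: last_map)

lemma pedges_line_path: "pedges (line_path i R u) = {{u + axis_pt i (int k), u + axis_pt i (int (Suc k))} | k. k < R}"
  unfolding line_path_def pedges_map_upt by auto

context lattice_percolation
begin

lemma line_edge: "{u + axis_pt i k, u + axis_pt i (k + 1)} \<in> \<E>"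
  by (rule edge_nn) (simp add: axis_diff norm_l1_axis)

lemma line_path_edges: "pedges (line_path i R u) \<subseteq> \<E>"
proof
  fix e assume "e \<in> pedges (line_path i R u)"
  then obtain k where "e = {u + axis_pt i (int k), u + axis_pt i (int (Suc k))}" by (auto simp: pedges_line_path)
  then show "e \<in> \<E>" using line_edge[of u i "int k"] by (simp add: add.commute)
qed

text \<open>The edge determines the starting point up to the position on the path and the choice of
  one of its end points.\<close>

lemma card_line_paths:
  assumes "finite I"
  shows "card {u \<in> I. e \<in> pedges (line_path i R u)} \<le> 2 * Suc R"
proof (cases "\<exists>x y. e = {x, y}")
  case True
  then obtain x y where e: "e = {x, y}" by blast
  let ?S = "(\<lambda>k. x - axis_pt i (int k)) ` {..R} \<union> (\<lambda>k. y - axis_pt i (int k)) ` {..R}"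
  have "{u \<in> I. e \<in> pedges (line_path i R u)} \<subseteq> ?S"
  proof
    fix u assume "u \<in> {u \<in> I. e \<in> pedges (line_path i R u)}"
    then obtain k where k: "k < R" "e = {u + axis_pt i (int k), u + axis_pt i (int (Suc k))}" by (auto simp: pedges_line_path)
    then have "x = u + axis_pt i (int k) \<or> y = u + axis_pt i (int k)" using e by (auto simp: doubleton_eq_iff)
    then have "u = x - axis_pt i (int k) \<or> u = y - axis_pt i (int k)" by auto
    then show "u \<in> ?S" using k(1) by auto
  qed
  then have "card {u \<in> I. e \<in> pedges (line_path i R u)} \<le> card ?S" by (rule card_mono[rotated]) simp
  also have "\<dots> \<le> card ((\<lambda>k. x - axis_pt i (int k)) ` {..R}) + card ((\<lambda>k. y - axis_pt i (int k)) ` {..R})" by (rule card_Un_le)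
  also have "\<dots> \<le> card {..R} + card {..R}" by (intro add_mono card_image_le) auto
  finally show ?thesis by simp
next
  case False
  then have "{u \<in> I. e \<in> pedges (line_path i R u)} = {}" by (auto simp: pedges_line_path)
  then show ?thesis by (simp only: card.empty)
qed

section \<open>Sharpness\<close>

definition tauS :: "real \<Rightarrow> (int ^ 'd) set \<Rightarrow> int ^ 'd \<Rightarrow> int ^ 'd \<Rightarrow> real" where
  "tauS p S x y = bprob p (EI S) (\<lambda>\<xi>. conn \<xi> x y)"

definition out :: "(int ^ 'd) set \<Rightarrow> int ^ 'd \<Rightarrow> (int ^ 'd) set" where
  "out S u = {v. v \<notin> S \<and> {u, v} \<in> \<E>}"

text \<open>The functional of Duminil-Copin and Tassion, without its factor
  \<open>p\<close>.\<close>

definition phi :: "real \<Rightarrow> (int ^ 'd) set \<Rightarrow> real" where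
  "phi p S = (\<Sum>u\<in>S. real (card (out S u)) * tauS p S 0 u)"

lemma finite_out: "finite (out S u)" "card (out S u) \<le> deg"
  using card_neighbours[OF order_refl, of "- S" u] by (auto simp: out_def)

lemma inside_eq: "\<xi> \<subseteq> \<E> \<Longrightarrow> inside S \<xi> = \<xi> \<inter> EI S"
  by (auto simp: inside_def EI_def)

lemma bprob_inside_eq:
  assumes F: "fin_sub F" and S: "EI S \<subseteq> F"
  shows "tau_in p F S x y = tauS p S x y"
  unfolding tauS_def
  by (rule bprob_local[OF fin_subD(1)[OF F] S]) (use fin_subD(2)[OF F] in \<open>simp add: inside_eq subset_trans\<close>)

lemma bprob_inside_le:
  assumes F: "fin_sub F" and S: "finite S" and p: "0 \<le> p" "p \<le> 1"
  shows "tau_in p F S x y \<le> tauS p S x y"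
proof -
  have U: "fin_sub (F \<union> EI S)" by (rule fin_sub_Un[OF F fin_sub_EI[OF S]])
  have "tau_in p F S x y \<le> tau_in p (F \<union> EI S) S x y"
    by (rule bprob_subset[OF fin_subD(1)[OF U] _ incr_conn_inside p]) simp
  also have "\<dots> = tauS p S x y" by (rule bprob_inside_eq[OF U]) simp
  finally show ?thesis .
qed

lemma tauS_nonneg: "0 \<le> p \<Longrightarrow> p \<le> 1 \<Longrightarrow> 0 \<le> tauS p S x y"
  unfolding tauS_def by (rule bprob_nonneg)

lemma tauS_mono: "finite S \<Longrightarrow> 0 \<le> p \<Longrightarrow> p \<le> q \<Longrightarrow> q \<le> 1 \<Longrightarrow> tauS p S x y \<le> tauS q S x y"
  unfolding tauS_def by (rule bprob_mono_param[OF fin_subD(1)[OF fin_sub_EI] incr_conn])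

lemma tauS_le_T: "finite S \<Longrightarrow> 0 \<le> p \<Longrightarrow> p \<le> 1 \<Longrightarrow> tauS p S x y \<le> T p x y"
  unfolding tauS_def by (rule tau_le_T[OF _ _ fin_sub_EI])

lemma EI_shift: "EI ((\<lambda>x. x + z) ` S) = shift z (EI S)"
proof (intro set_eqI iffI)
  fix e assume e: "e \<in> EI ((\<lambda>x. x + z) ` S)"
  let ?e = "(\<lambda>x. x + (- z)) ` e"
  have "?e \<in> \<E>" using e edge_shift[of e "- z"] by (simp add: EI_def)
  moreover have "?e \<subseteq> S" using e by (auto simp: EI_def)
  moreover have "e = (\<lambda>x. x + z) ` ?e" by (simp add: image_image)
  ultimately show "e \<in> shift z (EI S)" unfolding shift_def EI_def by blast
next
  fix e assume "e \<in> shift z (EI S)"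
  then show "e \<in> EI ((\<lambda>x. x + z) ` S)" using edge_shift by (auto simp: shift_def EI_def)
qed

lemma tauS_shift:
  assumes "finite S"
  shows "tauS p ((\<lambda>x. x + z) ` S) (x + z) (y + z) = tauS p S x y"
  unfolding tauS_def EI_shift by (simp add: bprob_shift[OF fin_sub_EI[OF assms]] conn_shift_iff)

lemma out_shift: "out ((\<lambda>x. x + z) ` S) (u + z) = (\<lambda>x. x + z) ` out S u"
proof -
  have e: "{u + z, v + z} \<in> \<E> \<longleftrightarrow> {u, v} \<in> \<E>" for v
    using edge_shift[of "{u, v}" z] edge_shift[of "{u + z, v + z}" "- z"] by auto
  show ?thesis
  proof (intro set_eqI iffI)
    fix v assume "v \<in> out ((\<lambda>x. x + z) ` S) (u + z)"
    then have "v - z \<in> out S u" using e[of "v - z"] by (auto simp: out_def image_iff)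
    then show "v \<in> (\<lambda>x. x + z) ` out S u" by (intro image_eqI[of _ _ "v - z"]) auto
  next
    fix v assume "v \<in> (\<lambda>x. x + z) ` out S u"
    then show "v \<in> out ((\<lambda>x. x + z) ` S) (u + z)" using e by (auto simp: out_def)
  qed
qed

lemma off_eq_inside: "off W \<xi> = inside (- W) \<xi>" by (auto simp: off_def inside_def)

text \<open>The Duminil-Copin--Tassion argument: exploring the cluster of the complement of the box leaves a
  random set \<open>S\<close> around the origin, and every edge leaving \<open>S\<close> from the cluster of \<open>0\<close> in \<open>S\<close> is pivotal.\<close>

lemma far_derivative_ge:
  assumes n: "1 \<le> n" and s: "0 \<le> s" "s \<le> 1" and phi: "\<And>S. finite S \<Longrightarrow> 0 \<in> S \<Longrightarrow> 1 \<le> phi s S"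
    and F: "fin_sub F" "\<And>e. e \<in> \<E> \<Longrightarrow> e \<inter> box (n - 1) \<noteq> {} \<Longrightarrow> e \<in> F"
  shows "1 - bprob s F (far n 0) \<le> (\<Sum>e\<in>F. bprob s F (pivotal (far n 0) e))"
proof -
  let ?B = "box (n - 1) :: (int ^ 'd) set"
  let ?Y = "- ?B"
  let ?C = "\<lambda>\<xi> :: 'd edge set. clu \<xi> ?Y"
  let ?f = "\<lambda>\<xi> :: 'd edge set. of_bool (0 \<notin> ?C \<xi>) :: real"
  let ?g = "\<lambda>T (\<eta> :: 'd edge set). \<Sum>u\<in>- T. real (card (out (- T) u)) * of_bool (conn \<eta> 0 u)"
  have notbox: "y \<notin> ?B \<longleftrightarrow> int n \<le> norm_linf y" for y :: "int ^ 'd" using n by (auto simp: box_def of_nat_diff)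
  have far_iff: "far n 0 \<xi> \<longleftrightarrow> 0 \<in> ?C \<xi>" for \<xi> :: "'d edge set"
  proof
    assume "far n 0 \<xi>"
    then obtain y where y: "int n \<le> norm_linf y" "conn \<xi> 0 y" by (auto simp: far_def)
    then have "y \<in> ?Y" using notbox[of y] by simp
    then show "0 \<in> ?C \<xi>" using conn_sym[OF y(2)] unfolding clu_def by blast
  next
    assume "0 \<in> ?C \<xi>"
    then obtain y where y: "y \<in> ?Y" "conn \<xi> y 0" unfolding clu_def by blast
    then show "far n 0 \<xi>" using notbox[of y] conn_sym[OF y(2)] unfolding far_def by auto
  qed
  have YC: "?Y \<subseteq> ?C \<xi>" for \<xi> :: "'d edge set"
  proof
    fix y assume "y \<in> ?Y"
    then have "\<exists>b\<in>?Y. conn \<xi> b y" by (rule bexI[rotated]) (rule conn_refl)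
    then show "y \<in> ?C \<xi>" unfolding clu_def by (rule CollectI)
  qed
  then have CB: "- ?C \<xi> \<subseteq> ?B" for \<xi> :: "'d edge set" by auto
  have finC: "finite (- ?C \<xi>)" for \<xi> :: "'d edge set" by (rule finite_subset[OF CB]) simp
  have fin: "finite F" by (rule fin_subD(1)[OF F(1)])
  have f_eq: "?f \<xi> = ?f (touch (?C \<xi>) \<xi>)" for \<xi> :: "'d edge set"
    using clu_eq_iff_touch[of \<xi> ?Y "?C \<xi>"] by simp
  have inner: "bexp s F (\<lambda>\<eta>. ?g (?C \<xi>) (off (?C \<xi>) \<eta>)) = phi s (- ?C \<xi>)" for \<xi> :: "'d edge set"
  proof -
    let ?S = "- ?C \<xi>"
    have sub: "EI ?S \<subseteq> F"
    proof
      fix e assume e: "e \<in> EI ?S"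
      then have "e \<subseteq> ?B" "e \<in> \<E>" using CB[of \<xi>] by (auto simp: EI_def)
      moreover from this obtain x y where "e = {x, y}" using edge_pair by blast
      ultimately show "e \<in> F" using F(2) by auto
    qed
    have "bexp s F (\<lambda>\<eta>. ?g (?C \<xi>) (off (?C \<xi>) \<eta>)) = (\<Sum>u\<in>?S. real (card (out ?S u)) * bprob s F (\<lambda>\<eta>. conn (inside ?S \<eta>) 0 u))"
      unfolding off_eq_inside bexp_sum bexp_cmult bprob_def ..
    then show ?thesis unfolding phi_def bprob_inside_eq[OF F(1) sub] .
  qed
  have "1 - bprob s F (far n 0) = bexp s F ?f"
  proof -
    have "bexp s F ?f + bprob s F (far n 0) = bexp s F (\<lambda>\<xi>. 1)"
      unfolding bprob_def bexp_add[symmetric] far_iff by (rule bexp_cong) simp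
    then show ?thesis using fin by simp
  qed
  \<comment> \<open>Given the exposed cluster, the edges inside its complement are fresh, and the
    mean number of pairs counted there is \<open>phi\<close>, which is at least 1.\<close>
  also have "\<dots> \<le> bexp s F (\<lambda>\<xi>. ?f \<xi> * bexp s F (\<lambda>\<eta>. ?g (?C \<xi>) (off (?C \<xi>) \<eta>)))"
    unfolding inner
  proof (rule bexp_mono[OF s])
    fix \<xi> :: "'d edge set"
    show "?f \<xi> \<le> ?f \<xi> * phi s (- ?C \<xi>)" using phi[OF finC, of \<xi>] by (cases "0 \<in> ?C \<xi>") auto
  qed
  also have "\<dots> = bexp s F (\<lambda>\<xi>. ?f \<xi> * ?g (?C \<xi>) (off (?C \<xi>) \<xi>))"
    by (rule cluster_decoupling[OF fin, where f = ?f and B = ?Y and g = ?g and p = s, symmetric]) (rule f_eq)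
  also have "\<dots> \<le> bexp s F (\<lambda>\<xi>. \<Sum>e\<in>F. of_bool (pivotal (far n 0) e \<xi>))"
  proof (rule bexp_mono[OF s])
    fix \<xi> assume w: "\<xi> \<subseteq> F"
    show "?f \<xi> * ?g (?C \<xi>) (off (?C \<xi>) \<xi>) \<le> (\<Sum>e\<in>F. of_bool (pivotal (far n 0) e \<xi>))"
    proof (cases "0 \<in> ?C \<xi>")
      case True
      then show ?thesis by (simp add: sum_nonneg del: sum_of_bool_eq)
    next
      case False
      let ?S = "- ?C \<xi>"
      let ?S' = "{u \<in> ?S. conn (off (?C \<xi>) \<xi>) 0 u}"
      let ?I = "Sigma ?S' (out ?S)"
      have inj: "inj_on (\<lambda>(u, v). {u, v}) ?I"
        by (rule inj_onI) (auto simp: out_def doubleton_eq_iff)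
      have "(\<lambda>(u, v). {u, v}) ` ?I \<subseteq> {e \<in> F. pivotal (far n 0) e \<xi>}"
      proof (rule image_subsetI)
        fix i assume "i \<in> ?I"
        then obtain u v where i: "i = (u, v)" "u \<in> ?S" "conn (off (?C \<xi>) \<xi>) 0 u" "v \<notin> ?S" "{u, v} \<in> \<E>" by (auto simp: out_def)
        have "u \<in> ?B" using i(2) CB by auto
        then have eF: "{u, v} \<in> F" using F(2)[OF i(5)] by auto
        obtain b where b: "b \<in> ?Y" "conn \<xi> b v" using i(4) by (auto simp: clu_def)
        let ?w = "insert {u, v} \<xi>"
        have 1: "conn ?w 0 u" by (rule conn_mono[OF i(3)]) (auto simp: off_def)
        have 2: "conn ?w u v" by (rule conn_edge) simp
        have 3: "conn ?w v b" by (rule conn_sym, rule conn_mono[OF b(2)]) auto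
        have "conn ?w 0 b" by (rule conn_trans[OF conn_trans[OF 1 2] 3])
        then have "far n 0 ?w" using b(1) notbox[of b] by (auto simp: far_def)
        moreover have "\<not> far n 0 (\<xi> - {{u, v}})"
          using incrD[OF incr_far, of "\<xi> - {{u, v}}" \<xi> n 0] False far_iff by blast
        ultimately show "(case i of (u, v) \<Rightarrow> {u, v}) \<in> {e \<in> F. pivotal (far n 0) e \<xi>}"
          using eF i(1) by (simp add: pivotal_def)
      qed
      then have "card ?I \<le> card {e \<in> F. pivotal (far n 0) e \<xi>}"
        by (rule card_inj_on_le[OF inj]) (use fin in simp)
      moreover have "card ?I = (\<Sum>u\<in>?S'. card (out ?S u))"
        by (rule card_SigmaI) (use finite_subset[OF _ finC[of \<xi>], of ?S'] finite_out(1) in auto)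
      moreover have "?g (?C \<xi>) (off (?C \<xi>) \<xi>) = real (\<Sum>u\<in>?S'. card (out ?S u))"
        unfolding of_nat_sum sum.inter_filter[OF finC[of \<xi>]] by (rule sum.cong) auto
      ultimately have "?g (?C \<xi>) (off (?C \<xi>) \<xi>) \<le> real (card {e \<in> F. pivotal (far n 0) e \<xi>})"
        by (simp only: of_nat_le_iff)
      also have "\<dots> = (\<Sum>e\<in>F. of_bool (pivotal (far n 0) e \<xi>))" using fin by (simp add: Int_def)
      finally have g_le: "?g (?C \<xi>) (off (?C \<xi>) \<xi>) \<le> (\<Sum>e\<in>F. of_bool (pivotal (far n 0) e \<xi>))" .
      have f1: "?f \<xi> = 1" using False by simp
      show ?thesis unfolding f1 mult_1 by (rule g_le)
    qed
  qed
  also have "\<dots> = (\<Sum>e\<in>F. bprob s F (pivotal (far n 0) e))" unfolding bprob_def bexp_sum ..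
  finally show ?thesis .
qed

lemma phi_mono: "finite S \<Longrightarrow> 0 \<le> p \<Longrightarrow> p \<le> q \<Longrightarrow> q \<le> 1 \<Longrightarrow> phi p S \<le> phi q S"
  unfolding phi_def by (intro sum_mono mult_left_mono tauS_mono) auto

text \<open>The derivative is at least 1 minus the probability, so by the mean value theorem
  \<open>p - p0\<close> is at most twice the probability, uniformly in \<open>n\<close>.\<close>

lemma arm_ge_of_phi:
  assumes p: "0 \<le> p0" "p0 < p" "p \<le> 1" and phi: "\<And>S. finite S \<Longrightarrow> 0 \<in> S \<Longrightarrow> 1 \<le> phi p0 S"
  shows "(p - p0) / 2 \<le> arm p n"
proof -
  \<comment> \<open>The differential inequality needs a positive radius; for \<open>n = 0\<close>
    the radius 1 is used instead.\<close>
  define m where "m = max 1 n"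
  define F where "F = {e \<in> \<E>. e \<inter> box (m - 1) \<noteq> {}}"
  have "F \<subseteq> EI (box (m - 1 + L))"
  proof
    fix e assume e: "e \<in> F"
    then obtain x where x: "e \<in> \<E>" "x \<in> e" "norm_linf x \<le> int (m - 1)" by (auto simp: F_def box_def)
    have "y \<in> box (m - 1 + L)" if y: "y \<in> e" for y
    proof -
      have "norm_linf (y - x) \<le> int L"
      proof (cases "y = x")
        case False
        obtain a b where ab: "e = {a, b}" using edge_pair[OF x(1)] by blast
        have "e = {y, x}" using ab False y x(2) by auto
        then show ?thesis using edge_range[of y x] x(1) by simp
      qed simp
      then show ?thesis using norm_linf_triangle_sub[of y x] x(3) by (simp add: box_def)
    qed
    then show "e \<in> EI (box (m - 1 + L))" using x(1) by (auto simp: EI_def)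
  qed
  then have F: "fin_sub F" using fin_sub_EI[OF finite_box, of "m - 1 + L"] by (auto simp: fin_sub_def intro: finite_subset)
  let ?A = "far m 0 :: 'd edge set \<Rightarrow> bool"
  have "\<exists>s>p0. s < p \<and> bprob p F ?A - bprob p0 F ?A = (p - p0) * (\<Sum>e\<in>F. bprob s F (pivotal ?A e))"
    by (rule MVT2[OF p(2)]) (rule russo_pivotal[OF fin_subD(1)[OF F] incr_far])
  then obtain s where s: "p0 < s" "s < p" "bprob p F ?A - bprob p0 F ?A = (p - p0) * (\<Sum>e\<in>F. bprob s F (pivotal ?A e))" by blast
  have "1 - bprob s F ?A \<le> (\<Sum>e\<in>F. bprob s F (pivotal ?A e))"
  proof (rule far_derivative_ge[OF _ _ _ _ F])
    fix S :: "(int ^ 'd) set" assume S: "finite S" "0 \<in> S"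
    show "1 \<le> phi s S" using phi[OF S] phi_mono[OF S(1), of p0 s] s p by simp
  qed (use s p in \<open>auto simp: m_def F_def\<close>)
  moreover have "bprob s F ?A \<le> bprob p F ?A" by (rule bprob_mono_param[OF fin_subD(1)[OF F] incr_far]) (use s p in auto)
  ultimately have "(p - p0) * (1 - bprob p F ?A) \<le> bprob p F ?A - bprob p0 F ?A"
    unfolding s(3) using p by (intro mult_left_mono) auto
  moreover have "0 \<le> bprob p0 F ?A" "bprob p F ?A \<le> 1" "0 \<le> bprob p F ?A"
    using p by (auto intro!: bprob_nonneg bprob_le_1[OF _ _ fin_subD(1)[OF F]])
  moreover have "bprob p F ?A \<le> arm p m" by (rule far_le_arm[OF _ _ F]) (use p in auto)
  moreover have "arm p m \<le> arm p n" by (rule arm_antimono) (use p in \<open>auto simp: m_def\<close>)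
  moreover have "(p - p0) * bprob p F ?A \<le> 1 * bprob p F ?A" using p calculation by (intro mult_right_mono) auto
  ultimately show ?thesis by (simp add: algebra_simps)
qed

lemma arm_one: "arm 1 n = 1"
proof (rule antisym)
  show "arm 1 n \<le> 1" by (rule arm_le_1) auto
  let ?vs = "line_path undefined n (0 :: int ^ 'd)"
  have F: "fin_sub (pedges ?vs)" using line_path_edges by (simp add: fin_sub_def)
  have "far n 0 (pedges ?vs)"
    using path_conn'[of ?vs "pedges ?vs"] unfolding far_def by (intro exI[of _ "axis_pt undefined (int n)"]) simp
  then have "1 \<le> bprob 1 (pedges ?vs) (far n 0)"
    unfolding bprob_def bexp_def by (subst sum.remove[of _ "pedges ?vs"]) (auto intro!: sum_nonneg)
  also have "\<dots> \<le> arm 1 n" by (rule far_le_arm[OF _ _ F]) auto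
  finally show "1 \<le> arm 1 n" .
qed

lemma p_crit_bounds: "0 \<le> p_crit \<E>" "p_crit \<E> \<le> 1"
proof -
  have "1 \<le> percolation_prob \<E> 1" by (rule percolation_prob_ge) (auto simp: arm_one)
  then have 1: "1 \<in> {p \<in> {0..1}. percolation_prob \<E> p > 0}" by simp
  then show "0 \<le> p_crit \<E>" unfolding p_crit_def by (intro cInf_greatest) auto
  show "p_crit \<E> \<le> 1" unfolding p_crit_def by (rule cInf_lower[OF 1 bdd_belowI[of _ 0]]) auto
qed

text \<open>If no finite set had \<open>phi\<close> below 1 at \<open>p\<close>, arms of all lengths
  would have probability bounded below at a parameter strictly between \<open>p\<close> and the
  critical one.\<close>

lemma sharpness:
  assumes "0 \<le> p" "p < p_crit \<E>"
  shows "\<exists>S. finite S \<and> 0 \<in> S \<and> phi p S < 1"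
proof (rule ccontr)
  assume "\<not> ?thesis"
  then have phi: "1 \<le> phi p S" if "finite S" "0 \<in> S" for S using that by force
  define q where "q = (p + p_crit \<E>) / 2"
  have q: "p < q" "q < p_crit \<E>" "q \<le> 1" using assms p_crit_bounds by (auto simp: q_def)
  have "(q - p) / 2 \<le> percolation_prob \<E> q"
    by (rule percolation_prob_ge) (use assms q arm_ge_of_phi[OF assms(1) q(1,3) phi] in auto)
  then have "q \<in> {p \<in> {0..1}. percolation_prob \<E> p > 0}" using q assms by simp
  then have "p_crit \<E> \<le> q" unfolding p_crit_def by (rule cInf_lower[OF _ bdd_belowI[of _ 0]]) auto
  with q(2) show False by simp
qed

text \<open>Simon-Lieb with translates of \<open>S\<close> gives the self-consistent bound
  \<open>M \<le> card S + phi p S * M\<close> for the largest finite-volume susceptibility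
  \<open>M\<close>, which is finite and can be solved for.\<close>

lemma susceptibility_finite:
  assumes p: "0 \<le> p" "p \<le> 1" and S: "finite S" "0 \<in> S" and phi: "phi p S < 1" and X: "finite X"
  shows "(\<Sum>x\<in>X. T p 0 x) \<le> real (card S) / (1 - phi p S)"
proof -
  have bound: "(\<Sum>x\<in>X. tau p F 0 x) \<le> real (card S) / (1 - phi p S)" if F: "fin_sub F" for F
  proof -
    define V where "V = insert 0 (\<Union>F \<union> X)"
    have V: "finite V" "\<Union>F \<subseteq> V" "0 \<in> V" "X \<subseteq> V" using fin_subD(3)[OF F] X by (auto simp: V_def)
    let ?c = "\<lambda>a. \<Sum>x\<in>V. tau p F a x"
    \<comment> \<open>A finite edge set is not translation invariant, so the maximum over all
      starting points has to be bounded.\<close>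
    define M where "M = Max (?c ` V)"
    have M: "?c a \<le> M" if "a \<in> V" for a unfolding M_def using that V by (intro Max_ge) auto
    have M0: "0 \<le> M" using M[OF V(3)] sum_nonneg[of V "\<lambda>x. tau p F 0 x"] bprob_nonneg[OF p] by force
    have "?c a \<le> real (card S) + phi p S * M" if a: "a \<in> V" for a
    proof -
      let ?S = "(\<lambda>x. x + a) ` S"
      have cS: "card ?S = card S" by (rule card_image) (simp add: inj_on_def)
      have aS: "a \<in> ?S" using S(2) by (intro image_eqI[of _ _ 0]) auto
      have "?c a \<le> (\<Sum>x\<in>V. of_bool (x \<in> ?S) + (\<Sum>u\<in>?S. \<Sum>v\<in>{v \<in> V. v \<notin> ?S \<and> {u, v} \<in> F}. tauS p ?S a u * tau p F v x))"
      proof (rule sum_mono)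
        fix x assume "x \<in> V"
        show "tau p F a x \<le> of_bool (x \<in> ?S) + (\<Sum>u\<in>?S. \<Sum>v\<in>{v \<in> V. v \<notin> ?S \<and> {u, v} \<in> F}. tauS p ?S a u * tau p F v x)"
        proof (cases "x \<in> ?S")
          case True
          have "0 \<le> (\<Sum>u\<in>?S. \<Sum>v\<in>{v \<in> V. v \<notin> ?S \<and> {u, v} \<in> F}. tauS p ?S a u * tau p F v x)"
            by (intro sum_nonneg mult_nonneg_nonneg tauS_nonneg[OF p] bprob_nonneg[OF p])
          with True show ?thesis using bprob_le_1[OF p fin_subD(1)[OF F], of "\<lambda>\<xi>. conn \<xi> a x"] by simp
        next
          case False
          have "tau p F a x \<le> (\<Sum>u\<in>?S. \<Sum>v\<in>{v \<in> V. v \<notin> ?S \<and> {u, v} \<in> F}. tau_in p F ?S a u * (p * tau p F v x))"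
            using simon_lieb[OF fin_subD(1)[OF F] p, of ?S a "{x}" V] S(1) aS False V(1,2) by simp
          also have "\<dots> \<le> (\<Sum>u\<in>?S. \<Sum>v\<in>{v \<in> V. v \<notin> ?S \<and> {u, v} \<in> F}. tauS p ?S a u * (1 * tau p F v x))"
            using p S(1) by (intro sum_mono mult_mono mult_right_mono bprob_inside_le[OF F] mult_nonneg_nonneg bprob_nonneg tauS_nonneg) auto
          finally show ?thesis using False by simp
        qed
      qed
      also have "\<dots> = (\<Sum>x\<in>V. of_bool (x \<in> ?S)) + (\<Sum>u\<in>?S. \<Sum>v\<in>{v \<in> V. v \<notin> ?S \<and> {u, v} \<in> F}. tauS p ?S a u * ?c v)"
      proof -
        have "(\<Sum>x\<in>V. \<Sum>u\<in>?S. \<Sum>v\<in>{v \<in> V. v \<notin> ?S \<and> {u, v} \<in> F}. tauS p ?S a u * tau p F v x)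
          = (\<Sum>u\<in>?S. \<Sum>x\<in>V. \<Sum>v\<in>{v \<in> V. v \<notin> ?S \<and> {u, v} \<in> F}. tauS p ?S a u * tau p F v x)" by (rule sum.swap)
        also have "\<dots> = (\<Sum>u\<in>?S. \<Sum>v\<in>{v \<in> V. v \<notin> ?S \<and> {u, v} \<in> F}. tauS p ?S a u * ?c v)"
          unfolding sum_distrib_left by (rule sum.cong[OF refl]) (rule sum.swap)
        finally show ?thesis by (simp only: sum.distrib)
      qed
      also have "(\<Sum>x\<in>V. of_bool (x \<in> ?S) :: real) \<le> real (card S)"
      proof -
        have "(\<Sum>x\<in>V. of_bool (x \<in> ?S) :: real) = real (card (V \<inter> ?S))" using V(1) by simp
        also have "\<dots> \<le> real (card ?S)" using S(1) by (intro of_nat_mono card_mono) auto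
        finally show ?thesis by (simp only: cS)
      qed
      also have "(\<Sum>u\<in>?S. \<Sum>v\<in>{v \<in> V. v \<notin> ?S \<and> {u, v} \<in> F}. tauS p ?S a u * ?c v) \<le> (\<Sum>u\<in>?S. real (card (out ?S u)) * tauS p ?S a u * M)"
      proof (rule sum_mono)
        fix u
        let ?N = "{v \<in> V. v \<notin> ?S \<and> {u, v} \<in> F}"
        have "?N \<subseteq> out ?S u" using fin_subD(2)[OF F] by (auto simp: out_def)
        then have card: "card ?N \<le> card (out ?S u)" by (rule card_mono[OF finite_out(1)])
        have "(\<Sum>v\<in>?N. tauS p ?S a u * ?c v) \<le> (\<Sum>v\<in>?N. tauS p ?S a u * M)"
          using M by (intro sum_mono mult_left_mono tauS_nonneg[OF p]) auto
        also have "\<dots> = real (card ?N) * (tauS p ?S a u * M)" by simp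
        also have "\<dots> \<le> real (card (out ?S u)) * (tauS p ?S a u * M)"
          using card M0 tauS_nonneg[OF p] by (intro mult_right_mono mult_nonneg_nonneg) auto
        finally show "(\<Sum>v\<in>?N. tauS p ?S a u * ?c v) \<le> real (card (out ?S u)) * tauS p ?S a u * M" by simp
      qed
      also have "(\<Sum>u\<in>?S. real (card (out ?S u)) * tauS p ?S a u * M) = phi p S * M"
      proof -
        have "(\<Sum>u\<in>?S. real (card (out ?S u)) * tauS p ?S a u) = (\<Sum>u\<in>S. real (card (out ?S (u + a))) * tauS p ?S (0 + a) (u + a))"
          by (subst sum.reindex) (auto simp: inj_on_def)
        also have "\<dots> = phi p S" unfolding phi_def out_shift tauS_shift[OF S(1)]
          by (intro sum.cong refl arg_cong2[where f = "(*)"] arg_cong[where f = real] card_image) (simp add: inj_on_def)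
        finally show ?thesis by (simp only: sum_distrib_right[symmetric])
      qed
      finally show ?thesis by simp
    qed
    moreover have "M \<in> ?c ` V" unfolding M_def using V by (intro Max_in) auto
    ultimately have "M \<le> real (card S) + phi p S * M" by auto
    then have "M \<le> real (card S) / (1 - phi p S)" using phi by (simp add: field_simps)
    moreover have "(\<Sum>x\<in>X. tau p F 0 x) \<le> ?c 0" using V by (intro sum_mono2) (auto intro: bprob_nonneg[OF p])
    ultimately show ?thesis using M[OF V(3)] by linarith
  qed
  show ?thesis
  proof (rule field_le_epsilon)
    fix \<epsilon> :: real assume \<epsilon>: "\<epsilon> > 0"
    define \<delta> where "\<delta> = \<epsilon> / (1 + real (card X))"
    have \<delta>: "\<delta> > 0" using \<epsilon> by (simp add: \<delta>_def)
    obtain F where F: "fin_sub F" "\<forall>G. fin_sub G \<longrightarrow> F \<subseteq> G \<longrightarrow> (\<forall>x\<in>X. PS p (\<lambda>\<xi>. conn \<xi> 0 x) - \<delta> < tau p G 0 x)"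
      using PS_approx_finite[OF p X, of "\<lambda>x \<xi>. conn \<xi> 0 x", OF incr_conn \<delta>] by blast
    have "(\<Sum>x\<in>X. T p 0 x) \<le> (\<Sum>x\<in>X. tau p F 0 x + \<delta>)"
    proof (rule sum_mono)
      fix x assume "x \<in> X"
      then have "T p 0 x - \<delta> < tau p F 0 x" using F by (simp add: T_def)
      then show "T p 0 x \<le> tau p F 0 x + \<delta>" by simp
    qed
    also have "\<dots> = (\<Sum>x\<in>X. tau p F 0 x) + real (card X) * \<delta>" by (simp add: sum.distrib)
    also have "real (card X) * \<delta> \<le> \<epsilon>" using \<epsilon> by (simp add: \<delta>_def field_simps)
    finally show "(\<Sum>x\<in>X. T p 0 x) \<le> real (card S) / (1 - phi p S) + \<epsilon>" using bound[OF F(1)] by linarith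
  qed
qed

text \<open>A real supremum, meaningful only where it is bounded; sharpness provides this below the
  critical point (\<open>chi_bdd\<close>).\<close>

definition chi :: "real \<Rightarrow> real" where
  "chi p = (SUP X\<in>Collect finite. \<Sum>x\<in>X. T p 0 x)"

lemma chi_bdd:
  assumes "0 \<le> p" "p < p_crit \<E>"
  shows "bdd_above ((\<lambda>X. \<Sum>x\<in>X. T p 0 x) ` Collect finite)"
proof -
  obtain S where S: "finite S" "0 \<in> S" "phi p S < 1" using sharpness[OF assms] by blast
  show ?thesis
    by (rule bdd_aboveI2[where M = "real (card S) / (1 - phi p S)"]) (use susceptibility_finite[OF assms(1) _ S] assms p_crit_bounds in auto)
qed

lemma chi_upper:
  assumes "0 \<le> p" "p < p_crit \<E>" "finite X"
  shows "(\<Sum>x\<in>X. T p 0 x) \<le> chi p"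
  unfolding chi_def by (rule cSUP_upper[OF _ chi_bdd[OF assms(1,2)]]) (use assms(3) in simp)

lemma chi_upper':
  assumes p: "0 \<le> p" "p < p_crit \<E>" and X: "finite X"
  shows "(\<Sum>x\<in>X. T p v x) \<le> chi p"
proof -
  have "(\<Sum>x\<in>X. T p v x) = (\<Sum>x\<in>X. T p 0 (x - v))" by (rule sum.cong) (use T_diff[of p v] p p_crit_bounds in auto)
  also have "\<dots> = (\<Sum>x\<in>(\<lambda>x. x - v) ` X. T p 0 x)" by (subst sum.reindex) (auto simp: inj_on_def)
  also have "\<dots> \<le> chi p" by (rule chi_upper[OF p]) (use X in simp)
  finally show ?thesis .
qed

lemma chi_ge_1: "0 \<le> p \<Longrightarrow> p < p_crit \<E> \<Longrightarrow> 1 \<le> chi p"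
  using chi_upper[of p "{0}"] p_crit_bounds by simp

lemma chi_approx:
  assumes "0 \<le> p" "p < p_crit \<E>" "c < chi p"
  shows "\<exists>X. finite X \<and> c < (\<Sum>x\<in>X. T p 0 x)"
  using less_cSUP_iff[OF _ chi_bdd[OF assms(1,2)], of c] assms(3) unfolding chi_def by auto

lemma chi_mono:
  assumes "0 \<le> p" "p \<le> q" "q < p_crit \<E>"
  shows "chi p \<le> chi q"
  unfolding chi_def[of p]
proof (rule cSUP_least)
  fix X :: "(int ^ 'd) set" assume "X \<in> Collect finite"
  then have "finite X" by simp
  have "(\<Sum>x\<in>X. T p 0 x) \<le> (\<Sum>x\<in>X. T q 0 x)" using assms p_crit_bounds by (intro sum_mono T_mono) auto
  also have "\<dots> \<le> chi q" by (rule chi_upper[OF _ assms(3) \<open>finite X\<close>]) (use assms in simp)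
  finally show "(\<Sum>x\<in>X. T p 0 x) \<le> chi q" .
qed auto

end

section \<open>The susceptibility\<close>

locale critical_percolation = lattice_percolation \<E> L for \<E> :: "'d::finite edge set" and L +
  fixes a b :: real
  assumes dim: "6 < CARD('d)" and ab: "0 < a" "a \<le> b"
    and T_lower: "a / jb (x - y) ^ (CARD('d) - 2) \<le> T (p_crit \<E>) x y"
    and T_upper: "T (p_crit \<E>) x y \<le> b / jb (x - y) ^ (CARD('d) - 2)"
begin

abbreviation pc :: real where "pc \<equiv> p_crit \<E>"

lemma b_pos: "0 < b" using ab by simp

text \<open>The two-point bounds themselves exclude the end points: at \<open>p = 0\<close> the
  lower bound fails for a neighbour of \<open>0\<close>, and at \<open>p = 1\<close> (next lemma)
  the upper bound fails far away.\<close>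

lemma pc_pos: "0 < pc"
proof (rule ccontr)
  assume "\<not> 0 < pc"
  then have pc0: "pc = 0" using p_crit_bounds by simp
  let ?x = "axis_pt undefined 1 :: int ^ 'd"
  have "norm_linf ?x = 1" by simp
  then have ne: "0 \<noteq> ?x" by (metis norm_linf_zero zero_neq_one)
  have "T 0 0 ?x \<le> 0"
    unfolding T_def
  proof (rule PS_least)
    fix F assume F: "fin_sub F"
    have "(0 :: real) ^ card \<xi> * (1 - 0) ^ card (F - \<xi>) * of_bool (conn \<xi> 0 ?x) = 0" if "\<xi> \<subseteq> F" for \<xi>
    proof (cases "\<xi> = {}")
      case True
      have "\<not> conn {} 0 ?x" using conn_in_Union[of "{}" 0 ?x] ne by auto
      then show ?thesis using True by simp
    next
      case False
      then have "card \<xi> \<noteq> 0" using finite_subset[OF that fin_subD(1)[OF F]] by simp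
      then show ?thesis by simp
    qed
    then have "bprob 0 F (\<lambda>\<xi>. conn \<xi> 0 ?x) = 0" unfolding bprob_def bexp_def by (intro sum.neutral) auto
    then show "bprob 0 F (\<lambda>\<xi>. conn \<xi> 0 ?x) \<le> 0" by simp
  qed auto
  moreover have "0 < a / jb (0 - ?x) ^ (CARD('d) - 2)" using ab by simp
  ultimately show False using T_lower[of 0 ?x] pc0 by simp
qed

lemma pc_less_1: "pc < 1"
proof (rule ccontr)
  assume "\<not> pc < 1"
  then have pc1: "pc = 1" using p_crit_bounds by simp
  obtain n :: nat where n: "b < real n" using reals_Archimedean2 by blast
  then have n1: "1 \<le> n" using b_pos by (cases n) auto
  let ?x = "axis_pt undefined (int n) :: int ^ 'd"
  let ?vs = "line_path undefined n (0 :: int ^ 'd)"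
  have F: "fin_sub (pedges ?vs)" using line_path_edges by (simp add: fin_sub_def)
  have "conn (pedges ?vs) 0 ?x" using path_conn'[of ?vs "pedges ?vs"] by simp
  then have "1 \<le> tau 1 (pedges ?vs) 0 ?x"
    unfolding bprob_def bexp_def by (subst sum.remove[of _ "pedges ?vs"]) (auto intro!: sum_nonneg)
  also have "\<dots> \<le> T 1 0 ?x" by (rule tau_le_T[OF _ _ F]) auto
  also have "\<dots> \<le> b / jb (0 - ?x) ^ (CARD('d) - 2)" using T_upper[of 0 ?x] pc1 by simp
  also have "jb (0 - ?x) = real n" using n1 by (simp add: jb_def)
  also have "b / real n ^ (CARD('d) - 2) \<le> b / real n ^ 1"
    using n1 dim b_pos by (intro divide_left_mono power_increasing) auto
  also have "\<dots> < 1" using n n1 by simp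
  finally show False by simp
qed

lemma T_le:
  assumes "0 \<le> s" "s \<le> pc"
  shows "T s x y \<le> b / jb (x - y) ^ (CARD('d) - 2)"
  using T_mono[OF assms, of x y] T_upper[of x y] pc_less_1 by linarith

text \<open>The open bubble; the exponent is \<open>2 (d - 2) - d\<close>.\<close>

lemma convolution_T: "\<exists>C>0. \<forall>s X x y. 0 \<le> s \<longrightarrow> s \<le> pc \<longrightarrow> finite X \<longrightarrow>
    (\<Sum>v\<in>X. T s x v * T s v y) \<le> C / jb (x - y) ^ (CARD('d) - 4)"
proof -
  let ?q = "CARD('d) - 2"
  obtain C where C: "C > 0" "\<And>X (x :: int ^ 'd). finite X \<Longrightarrow> (\<Sum>u\<in>X. 1 / (jb u ^ ?q * jb (x - u) ^ ?q)) \<le> C / jb x ^ (?q + ?q - CARD('d))"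
  proof -
    have h: "?q < CARD('d)" "CARD('d) < ?q + ?q" using dim by linarith+
    from convolution[OF h(1) h(1) h(2)] that show ?thesis by blast
  qed
  have e: "?q + ?q - CARD('d) = CARD('d) - 4" using dim by simp
  have "(\<Sum>v\<in>X. T s x v * T s v y) \<le> (b\<^sup>2 * C) / jb (x - y) ^ (CARD('d) - 4)" if s: "0 \<le> s" "s \<le> pc" and X: "finite X" for s X x y
  proof -
    have s1: "s \<le> 1" using s pc_less_1 by simp
    have "(\<Sum>v\<in>X. T s x v * T s v y) \<le> (\<Sum>v\<in>X. (b / jb (x - v) ^ ?q) * (b / jb (v - y) ^ ?q))"
      using s b_pos by (intro sum_mono mult_mono T_le) (auto intro: T_nonneg[OF s(1) s1])
    also have "\<dots> = b\<^sup>2 * (\<Sum>v\<in>X. 1 / (jb (x - v) ^ ?q * jb (v - y) ^ ?q))"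
      unfolding sum_distrib_left by (rule sum.cong) (simp_all add: power2_eq_square)
    also have "(\<Sum>v\<in>X. 1 / (jb (x - v) ^ ?q * jb (v - y) ^ ?q)) = (\<Sum>u\<in>(\<lambda>v. x - v) ` X. 1 / (jb u ^ ?q * jb ((x - y) - u) ^ ?q))"
      by (subst sum.reindex) (auto simp: inj_on_def)
    also have "b\<^sup>2 * \<dots> \<le> b\<^sup>2 * (C / jb (x - y) ^ (CARD('d) - 4))"
      using C(2)[of "(\<lambda>v. x - v) ` X" "x - y"] X unfolding e by (intro mult_left_mono) auto
    finally show ?thesis by simp
  qed
  then show ?thesis using C(1) b_pos by (intro exI[of _ "b\<^sup>2 * C"]) auto
qed

text \<open>The open triangle is small when its ends are far apart; this is where \<open>d > 6\<close> enters.\<close>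

lemma open_triangle: "\<exists>K>0. \<forall>s U V x i R. 0 \<le> s \<longrightarrow> s \<le> pc \<longrightarrow> finite U \<longrightarrow> finite V \<longrightarrow> 1 \<le> R \<longrightarrow>
    (\<Sum>u\<in>U. \<Sum>v\<in>V. T s x u * (T s x v * T s v (u + axis_pt i (int R)))) \<le> K / real R"
proof -
  let ?q = "CARD('d) - 2" and ?r = "CARD('d) - 4"
  obtain C where C: "C > 0" "\<And>s X x y. 0 \<le> s \<Longrightarrow> s \<le> pc \<Longrightarrow> finite X \<Longrightarrow> (\<Sum>v\<in>X. T s x v * T s v y) \<le> C / jb (x - y) ^ ?r"
    using convolution_T by auto
  obtain D where D: "D > 0" "\<And>X (x :: int ^ 'd). finite X \<Longrightarrow> (\<Sum>u\<in>X. 1 / (jb u ^ ?q * jb (x - u) ^ ?r)) \<le> D / jb x ^ (?q + ?r - CARD('d))"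
  proof -
    have h: "?q < CARD('d)" "?r < CARD('d)" "CARD('d) < ?q + ?r" using dim by linarith+
    from convolution[OF h] that show ?thesis by blast
  qed
  have "(\<Sum>u\<in>U. \<Sum>v\<in>V. T s x u * (T s x v * T s v (u + axis_pt i (int R)))) \<le> (b * C * D) / real R"
    if s: "0 \<le> s" "s \<le> pc" and U: "finite U" "finite V" and R: "1 \<le> R" for s U V x i R
  proof -
    have s1: "s \<le> 1" using s pc_less_1 by simp
    let ?e = "axis_pt i (int R)"
    have "(\<Sum>u\<in>U. \<Sum>v\<in>V. T s x u * (T s x v * T s v (u + ?e))) = (\<Sum>u\<in>U. T s x u * (\<Sum>v\<in>V. T s x v * T s v (u + ?e)))"
      by (simp add: sum_distrib_left)
    also have "\<dots> \<le> (\<Sum>u\<in>U. (b / jb (x - u) ^ ?q) * (C / jb (x - (u + ?e)) ^ ?r))"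
      using s b_pos U C by (intro sum_mono mult_mono T_le C(2) sum_nonneg mult_nonneg_nonneg) (auto intro: T_nonneg[OF s(1) s1])
    also have "\<dots> = b * C * (\<Sum>u\<in>U. 1 / (jb (x - u) ^ ?q * jb (x - u - ?e) ^ ?r))"
      unfolding sum_distrib_left by (rule sum.cong) (simp_all add: algebra_simps)
    also have "(\<Sum>u\<in>U. 1 / (jb (x - u) ^ ?q * jb (x - u - ?e) ^ ?r)) = (\<Sum>w\<in>(\<lambda>u. x - u) ` U. 1 / (jb w ^ ?q * jb (?e - w) ^ ?r))"
      by (subst sum.reindex) (auto simp: inj_on_def jb_commute[of "x - _" ?e])
    also have "b * C * \<dots> \<le> b * C * (D / jb ?e ^ (?q + ?r - CARD('d)))"
      using D(2)[of "(\<lambda>u. x - u) ` U" ?e] U b_pos C(1) by (intro mult_left_mono) auto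
    also have "jb ?e = real R" using R by (simp add: jb_def)
    \<comment> \<open>The exponent of \<open>R\<close> is
      \<open>(d - 2) + (d - 4) - d = d - 6\<close>, hence at least 1.\<close>
    also have "D / real R ^ (?q + ?r - CARD('d)) \<le> D / real R ^ 1"
      using R D(1) dim by (intro divide_left_mono power_increasing) auto
    finally show ?thesis using b_pos C(1) by (simp add: mult_left_mono)
  qed
  then show ?thesis using C(1) D(1) b_pos by (intro exI[of _ "b * C * D"]) auto
qed

text \<open>If \<open>0\<close> is connected to \<open>u\<close>, and \<open>u + R e\<close> to \<open>x\<close>, by disjoint clusters, some edge between them can be made pivotal
  at bounded cost.\<close>

lemma pivotal_sum_lower:
  assumes K: "\<And>s U V x R. 0 \<le> s \<Longrightarrow> s \<le> pc \<Longrightarrow> finite U \<Longrightarrow> finite V \<Longrightarrow> 1 \<le> R \<Longrightarrow>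
      (\<Sum>u\<in>U. \<Sum>v\<in>V. T s x u * (T s x v * T s v (u + axis_pt i (int R)))) \<le> K / real R"
    and s: "0 \<le> s" "s < pc" and R: "1 \<le> R" and U: "finite U"
    and F: "fin_sub F" "\<And>u. u \<in> U \<Longrightarrow> pedges (line_path i R u) \<subseteq> F"
  defines "X \<equiv> (\<lambda>(u, w). u + axis_pt i (int R) + w) ` (U \<times> U)"
  shows "s ^ R * ((\<Sum>u\<in>U. \<Sum>w\<in>U. tau s F 0 u * tau s F (u + axis_pt i (int R)) (u + axis_pt i (int R) + w)) - K / real R * (chi s)\<^sup>2)
     \<le> real (R * (2 * Suc R)) * (\<Sum>x\<in>X. \<Sum>e\<in>F. bprob s F (pivotal (\<lambda>\<xi>. conn \<xi> 0 x) e))"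
proof -
  let ?e = "axis_pt i (int R) :: int ^ 'd"
  have s1: "s \<le> 1" "s \<le> pc" using s pc_less_1 by auto
  note p = s(1) s1(1)
  have fin: "finite F" "finite (\<Union>F)" using fin_subD[OF F(1)] by auto
  define V where "V = insert 0 (\<Union>F)"
  have V: "finite V" "0 \<in> V" "\<Union>F \<subseteq> V" using fin by (auto simp: V_def)
  let ?A = "\<lambda>u x \<xi>. conn \<xi> 0 u \<and> conn \<xi> (u + ?e) x \<and> \<not> conn \<xi> 0 x"
  \<comment> \<open>The clusters are made disjoint by \<open>disjoint_clusters_ge\<close>; the
    probability that \<open>u\<close> and \<open>v\<close> both lie in the cluster of
    \<open>0\<close> is then bounded by the tree-graph inequality, with branch point
    \<open>w\<close>.\<close>
  have low: "tau s F 0 u * tau s F (u + ?e) x - (\<Sum>v\<in>V. \<Sum>w\<in>V. T s 0 w * (T s w u * (T s w v * (T s v (u + ?e) * T s v x)))) \<le> bprob s F (?A u x)" for u x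
  proof -
    have Aeq: "conn \<xi> 0 u = conn (touch (clu \<xi> {0}) \<xi>) 0 u" for \<xi> :: "'d edge set"
      using clu_eq_iff_touch[of \<xi> "{0}" "clu \<xi> {0}"] by (auto simp: clu_def)
    have "tau s F 0 u * tau s F (u + ?e) x - (\<Sum>v\<in>V. bprob s F (\<lambda>\<xi>. conn \<xi> 0 u \<and> conn \<xi> 0 v) * (tau s F (u + ?e) v * tau s F v x))
      = bexp s F (\<lambda>\<xi>. of_bool (conn \<xi> 0 u) * (tau s F (u + ?e) x - (\<Sum>v\<in>clu \<xi> {0}. tau s F (u + ?e) v * tau s F v x)))"
    proof -
      have "bexp s F (\<lambda>\<xi>. of_bool (conn \<xi> 0 u) * (tau s F (u + ?e) x - (\<Sum>v\<in>clu \<xi> {0}. tau s F (u + ?e) v * tau s F v x)))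
         = bexp s F (\<lambda>\<xi>. tau s F (u + ?e) x * of_bool (conn \<xi> 0 u) - (\<Sum>v\<in>V. (tau s F (u + ?e) v * tau s F v x) * of_bool (conn \<xi> 0 u \<and> conn \<xi> 0 v)))"
      proof (rule bexp_cong)
        fix \<xi> assume w: "\<xi> \<subseteq> F"
        have sub: "clu \<xi> {0} \<subseteq> V"
          using conn_in_Union w by (fastforce simp: clu_def V_def)
        have "(\<Sum>v\<in>V. (tau s F (u + ?e) v * tau s F v x) * of_bool (conn \<xi> 0 u \<and> conn \<xi> 0 v))
          = of_bool (conn \<xi> 0 u) * (\<Sum>v\<in>V. if v \<in> clu \<xi> {0} then tau s F (u + ?e) v * tau s F v x else 0)"
          unfolding sum_distrib_left by (rule sum.cong) (auto simp: clu_def)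
        also have "(\<Sum>v\<in>V. if v \<in> clu \<xi> {0} then tau s F (u + ?e) v * tau s F v x else 0) = (\<Sum>v\<in>clu \<xi> {0}. tau s F (u + ?e) v * tau s F v x)"
          unfolding sum.inter_restrict[OF V(1), symmetric] using sub by (simp add: Int_absorb1)
        finally show "of_bool (conn \<xi> 0 u) * (tau s F (u + ?e) x - (\<Sum>v\<in>clu \<xi> {0}. tau s F (u + ?e) v * tau s F v x))
           = tau s F (u + ?e) x * of_bool (conn \<xi> 0 u) - (\<Sum>v\<in>V. (tau s F (u + ?e) v * tau s F v x) * of_bool (conn \<xi> 0 u \<and> conn \<xi> 0 v))"
          by (simp add: algebra_simps)
      qed
      then show ?thesis unfolding bexp_diff bexp_cmult bexp_sum by (simp add: bprob_def mult_ac)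
    qed
    also have "\<dots> \<le> bprob s F (?A u x)"
      by (rule disjoint_clusters_ge[OF fin p, of "\<lambda>\<xi>. conn \<xi> 0 u" 0 "u + ?e" x, OF Aeq])
    finally have 1: "tau s F 0 u * tau s F (u + ?e) x - (\<Sum>v\<in>V. bprob s F (\<lambda>\<xi>. conn \<xi> 0 u \<and> conn \<xi> 0 v) * (tau s F (u + ?e) v * tau s F v x)) \<le> bprob s F (?A u x)" .
    have "(\<Sum>v\<in>V. bprob s F (\<lambda>\<xi>. conn \<xi> 0 u \<and> conn \<xi> 0 v) * (tau s F (u + ?e) v * tau s F v x))
      \<le> (\<Sum>v\<in>V. (\<Sum>w\<in>V. T s 0 w * (T s w u * T s w v)) * (T s v (u + ?e) * T s v x))"
    proof (intro sum_mono mult_mono)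
      fix v
      have "bprob s F (\<lambda>\<xi>. conn \<xi> 0 u \<and> conn \<xi> 0 v) \<le> (\<Sum>w\<in>V. tau s F 0 w * (tau s F w u * tau s F w v))"
        by (rule tree_graph[OF fin(1) p V])
      also have "\<dots> \<le> (\<Sum>w\<in>V. T s 0 w * (T s w u * T s w v))"
        by (intro sum_mono mult_mono tau_le_T[OF p F(1)] mult_nonneg_nonneg bprob_nonneg[OF p] T_nonneg[OF p])
      finally show "bprob s F (\<lambda>\<xi>. conn \<xi> 0 u \<and> conn \<xi> 0 v) \<le> (\<Sum>w\<in>V. T s 0 w * (T s w u * T s w v))" .
      show "tau s F (u + ?e) v \<le> T s v (u + ?e)" unfolding T_sym[OF p, of v] by (rule tau_le_T[OF p F(1)])
    qed (auto intro!: tau_le_T[OF p F(1)] sum_nonneg mult_nonneg_nonneg bprob_nonneg[OF p] T_nonneg[OF p])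
    also have "\<dots> = (\<Sum>v\<in>V. \<Sum>w\<in>V. T s 0 w * (T s w u * (T s w v * (T s v (u + ?e) * T s v x))))"
      by (simp add: sum_distrib_right mult.assoc)
    finally show ?thesis using 1 by linarith
  qed
  \<comment> \<open>The free end \<open>z\<close> sums to one factor \<open>chi s\<close>, the loop
    through \<open>w\<close>, \<open>u\<close> and \<open>v\<close> is the open triangle, and the
    leg from \<open>0\<close> to \<open>w\<close> sums to the second factor.\<close>
  have err: "(\<Sum>u\<in>U. \<Sum>z\<in>U. \<Sum>v\<in>V. \<Sum>w\<in>V. T s 0 w * (T s w u * (T s w v * (T s v (u + ?e) * T s v (u + ?e + z))))) \<le> K / real R * (chi s)\<^sup>2"
  proof -
    have chi0: "0 \<le> chi s" using chi_ge_1[OF s] by simp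
    have "(\<Sum>u\<in>U. \<Sum>z\<in>U. \<Sum>v\<in>V. \<Sum>w\<in>V. T s 0 w * (T s w u * (T s w v * (T s v (u + ?e) * T s v (u + ?e + z)))))
      = (\<Sum>u\<in>U. \<Sum>v\<in>V. \<Sum>w\<in>V. T s 0 w * (T s w u * (T s w v * T s v (u + ?e))) * (\<Sum>z\<in>U. T s v (u + ?e + z)))"
      (is "?L = _")
    proof (rule sum.cong[OF refl])
      fix u
      have "(\<Sum>z\<in>U. \<Sum>v\<in>V. \<Sum>w\<in>V. T s 0 w * (T s w u * (T s w v * (T s v (u + ?e) * T s v (u + ?e + z)))))
        = (\<Sum>v\<in>V. \<Sum>z\<in>U. \<Sum>w\<in>V. T s 0 w * (T s w u * (T s w v * (T s v (u + ?e) * T s v (u + ?e + z)))))" by (rule sum.swap)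
      also have "\<dots> = (\<Sum>v\<in>V. \<Sum>w\<in>V. \<Sum>z\<in>U. T s 0 w * (T s w u * (T s w v * (T s v (u + ?e) * T s v (u + ?e + z)))))"
        by (rule sum.cong[OF refl]) (rule sum.swap)
      also have "\<dots> = (\<Sum>v\<in>V. \<Sum>w\<in>V. T s 0 w * (T s w u * (T s w v * T s v (u + ?e))) * (\<Sum>z\<in>U. T s v (u + ?e + z)))"
        by (simp add: sum_distrib_left mult.assoc)
      finally show "(\<Sum>z\<in>U. \<Sum>v\<in>V. \<Sum>w\<in>V. T s 0 w * (T s w u * (T s w v * (T s v (u + ?e) * T s v (u + ?e + z)))))
        = (\<Sum>v\<in>V. \<Sum>w\<in>V. T s 0 w * (T s w u * (T s w v * T s v (u + ?e))) * (\<Sum>z\<in>U. T s v (u + ?e + z)))" .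
    qed
    also have "\<dots> \<le> (\<Sum>u\<in>U. \<Sum>v\<in>V. \<Sum>w\<in>V. T s 0 w * (T s w u * (T s w v * T s v (u + ?e))) * chi s)"
    proof (intro sum_mono mult_left_mono)
      fix u v
      have "(\<Sum>z\<in>U. T s v (u + ?e + z)) = (\<Sum>x\<in>(\<lambda>z. u + ?e + z) ` U. T s v x)" by (subst sum.reindex) (auto simp: inj_on_def)
      also have "\<dots> \<le> chi s" by (rule chi_upper'[OF s]) (use U in simp)
      finally show "(\<Sum>z\<in>U. T s v (u + ?e + z)) \<le> chi s" .
    qed (auto intro!: mult_nonneg_nonneg T_nonneg[OF p])
    also have "\<dots> = chi s * (\<Sum>u\<in>U. \<Sum>v\<in>V. \<Sum>w\<in>V. T s 0 w * (T s w u * (T s w v * T s v (u + ?e))))"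
      unfolding sum_distrib_left by (intro sum.cong refl mult.commute)
    also have "chi s * (\<Sum>u\<in>U. \<Sum>v\<in>V. \<Sum>w\<in>V. T s 0 w * (T s w u * (T s w v * T s v (u + ?e)))) \<le> chi s * (chi s * (K / real R))"
    proof (rule mult_left_mono[OF _ chi0])
    have "(\<Sum>u\<in>U. \<Sum>v\<in>V. \<Sum>w\<in>V. T s 0 w * (T s w u * (T s w v * T s v (u + ?e)))) = (\<Sum>w\<in>V. \<Sum>u\<in>U. \<Sum>v\<in>V. T s 0 w * (T s w u * (T s w v * T s v (u + ?e))))"
    proof -
      have "(\<Sum>u\<in>U. \<Sum>v\<in>V. \<Sum>w\<in>V. T s 0 w * (T s w u * (T s w v * T s v (u + ?e)))) = (\<Sum>u\<in>U. \<Sum>w\<in>V. \<Sum>v\<in>V. T s 0 w * (T s w u * (T s w v * T s v (u + ?e))))"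
        by (rule sum.cong[OF refl]) (rule sum.swap)
      also have "\<dots> = (\<Sum>w\<in>V. \<Sum>u\<in>U. \<Sum>v\<in>V. T s 0 w * (T s w u * (T s w v * T s v (u + ?e))))" by (rule sum.swap)
      finally show ?thesis .
    qed
    also have "\<dots> = (\<Sum>w\<in>V. T s 0 w * (\<Sum>u\<in>U. \<Sum>v\<in>V. T s w u * (T s w v * T s v (u + ?e))))" by (simp add: sum_distrib_left)
    also have "\<dots> \<le> (\<Sum>w\<in>V. T s 0 w * (K / real R))"
      by (intro sum_mono mult_left_mono K s1 s(1) U V(1) R T_nonneg[OF p])
    also have "\<dots> = (\<Sum>w\<in>V. T s 0 w) * (K / real R)" by (simp only: sum_distrib_right)
    also have "\<dots> \<le> chi s * (K / real R)"
    proof (rule mult_right_mono[OF chi_upper[OF s V(1)]])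
      show "0 \<le> K / real R" using K[OF s(1) s1(2) _ _ R, of "{}" "{}" 0] by simp
    qed
      finally show "(\<Sum>u\<in>U. \<Sum>v\<in>V. \<Sum>w\<in>V. T s 0 w * (T s w u * (T s w v * T s v (u + ?e)))) \<le> chi s * (K / real R)" .
    qed
    finally show ?thesis by (simp add: power2_eq_square mult_ac)
  qed
  have "(\<Sum>u\<in>U. \<Sum>w\<in>U. tau s F 0 u * tau s F (u + ?e) (u + ?e + w)) - K / real R * (chi s)\<^sup>2
     \<le> (\<Sum>u\<in>U. \<Sum>w\<in>U. bprob s F (?A u (u + ?e + w)))"
  proof -
    have "(\<Sum>u\<in>U. \<Sum>z\<in>U. tau s F 0 u * tau s F (u + ?e) (u + ?e + z)) - (\<Sum>u\<in>U. \<Sum>z\<in>U. \<Sum>v\<in>V. \<Sum>w\<in>V. T s 0 w * (T s w u * (T s w v * (T s v (u + ?e) * T s v (u + ?e + z)))))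
      \<le> (\<Sum>u\<in>U. \<Sum>z\<in>U. bprob s F (?A u (u + ?e + z)))"
      unfolding sum_subtractf[symmetric] by (intro sum_mono low)
    then show ?thesis using err by linarith
  qed
  \<comment> \<open>Regrouped by the end point \<open>x\<close>, because
    \<open>sum_pivotal_ge\<close> works with a fixed target.\<close>
  also have "(\<Sum>u\<in>U. \<Sum>w\<in>U. bprob s F (?A u (u + ?e + w))) = (\<Sum>x\<in>X. \<Sum>u\<in>{u \<in> U. x - (u + ?e) \<in> U}. bprob s F (?A u x))"
  proof -
    have "(\<Sum>u\<in>U. \<Sum>w\<in>U. bprob s F (?A u (u + ?e + w))) = (\<Sum>(u, w)\<in>U \<times> U. bprob s F (?A u (u + ?e + w)))" by (rule sum.cartesian_product)
    also have "\<dots> = (\<Sum>(x, u)\<in>Sigma X (\<lambda>x. {u \<in> U. x - (u + ?e) \<in> U}). bprob s F (?A u x))"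
      by (rule sum.reindex_bij_witness[of _ "\<lambda>(x, u). (u, x - (u + ?e))" "\<lambda>(u, w). (u + ?e + w, u)"]) (auto simp: X_def)
    also have "\<dots> = (\<Sum>x\<in>X. \<Sum>u\<in>{u \<in> U. x - (u + ?e) \<in> U}. bprob s F (?A u x))"
      using U by (subst sum.Sigma) (auto simp: X_def)
    finally show ?thesis .
  qed
  finally have "s ^ R * ((\<Sum>u\<in>U. \<Sum>w\<in>U. tau s F 0 u * tau s F (u + ?e) (u + ?e + w)) - K / real R * (chi s)\<^sup>2)
     \<le> s ^ R * (\<Sum>x\<in>X. \<Sum>u\<in>{u \<in> U. x - (u + ?e) \<in> U}. bprob s F (?A u x))"
    using s(1) by (intro mult_left_mono) auto
  also have "\<dots> = (\<Sum>x\<in>X. s ^ R * (\<Sum>u\<in>{u \<in> U. x - (u + ?e) \<in> U}. bprob s F (?A u x)))" by (simp add: sum_distrib_left)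
  also have "\<dots> \<le> (\<Sum>x\<in>X. real (R * (2 * Suc R)) * (\<Sum>e\<in>F. bprob s F (pivotal (\<lambda>\<xi>. conn \<xi> 0 x) e)))"
  proof (rule sum_mono)
    fix x
    let ?I = "{u \<in> U. x - (u + ?e) \<in> U}"
    have "s ^ R * (\<Sum>u\<in>?I. bprob s F (\<lambda>\<xi>. conn \<xi> 0 (hd (line_path i R u)) \<and> conn \<xi> (last (line_path i R u)) x \<and> \<not> conn \<xi> 0 x))
       \<le> real (R * (2 * Suc R)) * (\<Sum>e\<in>F. bprob s F (pivotal (\<lambda>\<xi>. conn \<xi> 0 x) e))"
    proof (rule sum_pivotal_ge[OF fin(1) p])
      show "finite ?I" using U by simp
      show "card {u \<in> ?I. e \<in> pedges (line_path i R u)} \<le> 2 * Suc R" for e by (rule card_line_paths) (use U in simp)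
    qed (use F(2) in auto)
    then show "s ^ R * (\<Sum>u\<in>?I. bprob s F (?A u x)) \<le> real (R * (2 * Suc R)) * (\<Sum>e\<in>F. bprob s F (pivotal (\<lambda>\<xi>. conn \<xi> 0 x) e))"
      by simp
  qed
  finally show ?thesis by (simp add: sum_distrib_left)
qed

text \<open>A finite-increment form of \<open>chi' \<ge> c * chi^2\<close>, since the mean value
  theorem is applied to a finite-volume sum. The error sits at an unknown intermediate parameter and
  is bounded at \<open>q\<close>, so the inequality has content only while \<open>chi\<close> has
  not grown by a large factor.\<close>

lemma chi_increment: "\<exists>c>0. \<forall>p q. pc / 2 \<le> p \<longrightarrow> p < q \<longrightarrow> q < pc \<longrightarrow>
    c * (q - p) * ((chi p)\<^sup>2 / 2 - (chi q)\<^sup>2 / 64) \<le> chi q"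
proof -
  define i :: 'd where "i = undefined"
  obtain K where K: "K > 0" "\<And>s U V x R. 0 \<le> s \<Longrightarrow> s \<le> pc \<Longrightarrow> finite U \<Longrightarrow> finite V \<Longrightarrow> 1 \<le> R \<Longrightarrow>
      (\<Sum>u\<in>U. \<Sum>v\<in>V. T s x u * (T s x v * T s v (u + axis_pt i (int R)))) \<le> K / real R"
    using open_triangle by blast
  \<comment> \<open>The distance at which the open triangle is below \<open>1 / 64\<close>.\<close>
  obtain R :: nat where R0: "64 * K \<le> real R" using real_arch_simple by blast
  then have R: "1 \<le> R" using K(1) by (cases R) auto
  have KR: "K / real R \<le> 1 / 64" using R0 R by (simp add: field_simps)
  define c where "c = (pc / 2) ^ R / real (R * (2 * Suc R))"
  have "0 < R * (2 * Suc R)" using R by simp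
  then have Npos: "0 < real (R * (2 * Suc R))" by (simp only: of_nat_0_less_iff)
  then have c0: "c > 0" unfolding c_def by (rule divide_pos_pos[rotated]) (use pc_pos in simp)
  have "c * (q - p) * ((chi p)\<^sup>2 / 2 - (chi q)\<^sup>2 / 64) \<le> chi q" if pq: "pc / 2 \<le> p" "p < q" "q < pc" for p q
  proof -
    let ?e = "axis_pt i (int R) :: int ^ 'd"
    have p0: "0 \<le> p" "p \<le> 1" "p < pc" "0 \<le> q" "q \<le> 1" using pq pc_pos pc_less_1 by auto
    have chi1: "1 \<le> chi p" "1 \<le> chi q" using chi_ge_1 p0 pq by auto
    \<comment> \<open>The square of \<open>3 / 4\<close> is \<open>9 / 16\<close>, which leaves
      \<open>1 / 16\<close> above the required \<open>1 / 2\<close> for the finite-volume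
      errors.\<close>
    obtain U where U: "finite U" "3 / 4 * chi p < (\<Sum>x\<in>U. T p 0 x)" using chi_approx[of p "3 / 4 * chi p"] chi1 p0 by auto
    define X where "X = (\<lambda>(u, w). u + ?e + w) ` (U \<times> U)"
    have X: "finite X" using U by (simp add: X_def)
    define \<epsilon> where "\<epsilon> = 1 / (64 * (1 + (real (card U))\<^sup>2))"
    have \<epsilon>: "\<epsilon> > 0" by (simp add: \<epsilon>_def add_pos_nonneg)
    obtain F0 where F0: "fin_sub F0" "\<And>G u w. fin_sub G \<Longrightarrow> F0 \<subseteq> G \<Longrightarrow> u \<in> U \<Longrightarrow> w \<in> U \<Longrightarrow>
        T p 0 u - \<epsilon> < tau p G 0 u \<and> T p (u + ?e) (u + ?e + w) - \<epsilon> < tau p G (u + ?e) (u + ?e + w)"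
    proof -
      obtain F1 where F1: "fin_sub F1" "\<forall>G. fin_sub G \<longrightarrow> F1 \<subseteq> G \<longrightarrow> (\<forall>u\<in>U. PS p (\<lambda>\<xi>. conn \<xi> 0 u) - \<epsilon> < tau p G 0 u)"
        using PS_approx_finite[OF p0(1,2) U(1), of "\<lambda>u \<xi>. conn \<xi> 0 u", OF incr_conn \<epsilon>] by blast
      obtain F2 where F2: "fin_sub F2" "\<forall>G. fin_sub G \<longrightarrow> F2 \<subseteq> G \<longrightarrow> (\<forall>i\<in>U \<times> U. PS p (\<lambda>\<xi>. conn \<xi> (fst i + ?e) (fst i + ?e + snd i)) - \<epsilon> < tau p G (fst i + ?e) (fst i + ?e + snd i))"
        using PS_approx_finite[OF p0(1,2) finite_cartesian_product[OF U(1) U(1)], of "\<lambda>i \<xi>. conn \<xi> (fst i + ?e) (fst i + ?e + snd i)", OF incr_conn \<epsilon>] by blast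
      show ?thesis
      proof (rule that[of "F1 \<union> F2"])
        show "fin_sub (F1 \<union> F2)" by (rule fin_sub_Un[OF F1(1) F2(1)])
        fix G u w assume G: "fin_sub G" "F1 \<union> F2 \<subseteq> G" "u \<in> U" "w \<in> U"
        have "T p 0 u - \<epsilon> < tau p G 0 u" using F1(2)[rule_format, OF G(1) _ G(3)] G(2) by (simp add: T_def)
        moreover have "T p (u + ?e) (u + ?e + w) - \<epsilon> < tau p G (u + ?e) (u + ?e + w)"
          using F2(2)[rule_format, OF G(1), of "(u, w)"] G by (simp add: T_def)
        ultimately show "T p 0 u - \<epsilon> < tau p G 0 u \<and> T p (u + ?e) (u + ?e + w) - \<epsilon> < tau p G (u + ?e) (u + ?e + w)" ..
      qed
    qed
    define F where "F = F0 \<union> (\<Union>u\<in>U. pedges (line_path i R u))"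
    have F: "fin_sub F" using F0(1) U(1) line_path_edges by (auto simp: F_def fin_sub_def)
    have line: "pedges (line_path i R u) \<subseteq> F" if "u \<in> U" for u using that by (auto simp: F_def)
    have fin: "finite F" by (rule fin_subD(1)[OF F])
    let ?main = "\<lambda>s. \<Sum>u\<in>U. \<Sum>w\<in>U. tau s F 0 u * tau s F (u + ?e) (u + ?e + w)"
    have main_p: "(chi p)\<^sup>2 / 2 \<le> ?main p"
    proof -
      have "(\<Sum>u\<in>U. \<Sum>w\<in>U. T p 0 u * T p 0 w - 2 * \<epsilon>) \<le> ?main p"
      proof (intro sum_mono)
        fix u w assume uw: "u \<in> U" "w \<in> U"
        have Tw: "T p (u + ?e) (u + ?e + w) = T p 0 w" using T_diff[OF p0(1,2), of "u + ?e" "u + ?e + w"] by simp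
        have lt: "T p 0 u - \<epsilon> < tau p F 0 u" "T p 0 w - \<epsilon> < tau p F (u + ?e) (u + ?e + w)"
          using F0(2)[OF F _ uw] Tw by (auto simp: F_def)
        have le1: "T p 0 u \<le> 1" "tau p F (u + ?e) (u + ?e + w) \<le> 1" "0 \<le> T p 0 u" "0 \<le> tau p F (u + ?e) (u + ?e + w)"
          using T_le_1[OF p0(1,2)] bprob_le_1[OF p0(1,2) fin] T_nonneg[OF p0(1,2)] bprob_nonneg[OF p0(1,2)] by auto
        have "T p 0 u * T p 0 w - \<epsilon> \<le> T p 0 u * (T p 0 w - \<epsilon>)"
          using mult_right_mono[OF le1(1), of \<epsilon>] \<epsilon> by (simp add: algebra_simps)
        also have "\<dots> \<le> T p 0 u * tau p F (u + ?e) (u + ?e + w)" using lt(2) le1(3) by (intro mult_left_mono) auto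
        also have "\<dots> - \<epsilon> \<le> (T p 0 u - \<epsilon>) * tau p F (u + ?e) (u + ?e + w)"
          using mult_left_mono[OF le1(2), of \<epsilon>] \<epsilon> by (simp add: algebra_simps)
        also have "\<dots> \<le> tau p F 0 u * tau p F (u + ?e) (u + ?e + w)" using lt(1) le1(4) by (intro mult_right_mono) auto
        finally show "T p 0 u * T p 0 w - 2 * \<epsilon> \<le> tau p F 0 u * tau p F (u + ?e) (u + ?e + w)" by simp
      qed
      moreover have "(\<Sum>u\<in>U. \<Sum>w\<in>U. T p 0 u * T p 0 w - 2 * \<epsilon>) = (\<Sum>u\<in>U. T p 0 u)\<^sup>2 - 2 * \<epsilon> * (real (card U))\<^sup>2"
        by (simp add: sum_subtractf sum_product power2_eq_square mult_ac)
      moreover have "(3 / 4 * chi p)\<^sup>2 \<le> (\<Sum>u\<in>U. T p 0 u)\<^sup>2" using U(2) chi1 by (intro power_mono) auto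
      moreover have "2 * \<epsilon> * (real (card U))\<^sup>2 \<le> 1 / 32" unfolding \<epsilon>_def by (simp add: field_simps add_pos_nonneg)
      moreover have "1 \<le> (chi p)\<^sup>2" using chi1 by (simp add: one_le_power)
      ultimately show ?thesis by (simp add: power_mult_distrib power_divide)
    qed
    let ?f = "\<lambda>s. \<Sum>x\<in>X. tau s F 0 x"
    let ?f' = "\<lambda>s. \<Sum>x\<in>X. \<Sum>e\<in>F. bprob s F (pivotal (\<lambda>\<xi>. conn \<xi> 0 x) e)"
    have "\<exists>s>p. s < q \<and> ?f q - ?f p = (q - p) * ?f' s"
      by (rule MVT2[OF pq(2)]) (intro DERIV_sum russo_pivotal[OF fin incr_conn])
    then obtain s where s: "p < s" "s < q" "?f q - ?f p = (q - p) * ?f' s" by blast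
    have s0: "0 \<le> s" "s < pc" "s \<le> 1" using s pq p0 by auto
    have "s ^ R * (?main s - K / real R * (chi s)\<^sup>2) \<le> real (R * (2 * Suc R)) * ?f' s"
      unfolding X_def by (rule pivotal_sum_lower[OF K(2) s0(1,2) R U(1) F line])
    moreover have "?main p \<le> ?main s"
      using s p0 s0 by (intro sum_mono mult_mono bprob_mono_param[OF fin incr_conn] bprob_nonneg) auto
    moreover have "K / real R * (chi s)\<^sup>2 \<le> 1 / 64 * (chi q)\<^sup>2"
      using KR chi_mono[of s q] chi_ge_1[of s] s0 s pq K(1) R by (intro mult_mono power_mono) auto
    ultimately have key: "s ^ R * ((chi p)\<^sup>2 / 2 - (chi q)\<^sup>2 / 64) \<le> real (R * (2 * Suc R)) * ?f' s"
    proof -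
      assume h: "s ^ R * (?main s - K / real R * (chi s)\<^sup>2) \<le> real (R * (2 * Suc R)) * ?f' s" "?main p \<le> ?main s" "K / real R * (chi s)\<^sup>2 \<le> 1 / 64 * (chi q)\<^sup>2"
      have "s ^ R * ((chi p)\<^sup>2 / 2 - (chi q)\<^sup>2 / 64) \<le> s ^ R * (?main s - K / real R * (chi s)\<^sup>2)"
        using h(2,3) main_p s0(1) by (intro mult_left_mono) auto
      then show ?thesis using h(1) by linarith
    qed
    have fq: "(q - p) * ?f' s \<le> chi q"
    proof -
      have "0 \<le> ?f p" using p0 by (intro sum_nonneg bprob_nonneg) auto
      moreover have "?f q \<le> (\<Sum>x\<in>X. T q 0 x)" using p0 by (intro sum_mono tau_le_T[OF _ _ F]) auto
      moreover have "\<dots> \<le> chi q" by (rule chi_upper) (use p0 pq X in auto)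
      ultimately show ?thesis using s(3) by linarith
    qed
    show ?thesis
    proof (cases "0 \<le> (chi p)\<^sup>2 / 2 - (chi q)\<^sup>2 / 64")
      case False
      then have "c * (q - p) * ((chi p)\<^sup>2 / 2 - (chi q)\<^sup>2 / 64) \<le> 0" using c0 pq by (intro mult_nonneg_nonpos) auto
      then show ?thesis using chi1 by simp
    next
      case True
      have "(pc / 2) ^ R * ((chi p)\<^sup>2 / 2 - (chi q)\<^sup>2 / 64) \<le> s ^ R * ((chi p)\<^sup>2 / 2 - (chi q)\<^sup>2 / 64)"
        using True s pq pc_pos by (intro mult_right_mono power_mono) auto
      also note key
      finally have "c * ((chi p)\<^sup>2 / 2 - (chi q)\<^sup>2 / 64) \<le> ?f' s"
        unfolding c_def times_divide_eq_left by (subst pos_divide_le_eq[OF Npos]) (simp only: mult.commute)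
      then have "(q - p) * (c * ((chi p)\<^sup>2 / 2 - (chi q)\<^sup>2 / 64)) \<le> (q - p) * ?f' s" using pq by (intro mult_left_mono) auto
      with fq show ?thesis by (simp add: mult_ac)
    qed
  qed
  with c0 show ?thesis by blast
qed

text \<open>If \<open>chi p\<close> were larger, \<open>chi\<close> would quadruple along steps that
  shrink by a factor 4. Their sum converges to a point below \<open>pc\<close>, where
  \<open>chi\<close> would be infinite.\<close>

lemma chi_upper_bound: "\<exists>C>0. \<forall>p. pc / 2 \<le> p \<longrightarrow> p < pc \<longrightarrow> chi p \<le> C / (pc - p)"
proof -
  obtain c where c: "c > 0" "\<And>p q. pc / 2 \<le> p \<Longrightarrow> p < q \<Longrightarrow> q < pc \<Longrightarrow> c * (q - p) * ((chi p)\<^sup>2 / 2 - (chi q)\<^sup>2 / 64) \<le> chi q"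
    using chi_increment by blast
  have "chi p \<le> (32 / c) / (pc - p)" if p: "pc / 2 \<le> p" "p < pc" for p
  proof (rule ccontr)
    assume "\<not> ?thesis"
    then have big: "32 / (c * chi p) < pc - p"
      using p c(1) chi_ge_1[of p] pc_pos by (simp add: field_simps)
    have chi1: "1 \<le> chi p" using chi_ge_1[of p] p pc_pos by simp
    \<comment> \<open>With this step the gain \<open>c * \<delta> * chi^2 / 4\<close> equals
      \<open>4 * chi p\<close>. The steps add up to at most \<open>4 / 3 * \<delta>\<close>, which
      is less than \<open>32 / (c * chi p)\<close>.\<close>
    define \<delta> where "\<delta> = 16 / (c * chi p)"
    have \<delta>: "\<delta> > 0" using c(1) chi1 by (simp add: \<delta>_def)
    define r where "r j = p + \<delta> * (\<Sum>k<j. (1 / 4) ^ k)" for j :: nat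
    have geo: "(\<Sum>k<j. (1 / 4 :: real) ^ k) \<le> 4 / 3" for j
      by (simp add: sum_gp_strict)
    have r_le: "r j \<le> p + \<delta> * (4 / 3)" for j unfolding r_def using geo[of j] \<delta> by simp
    have q0: "p + \<delta> * (4 / 3) < pc" using big \<delta> c(1) chi1 by (simp add: \<delta>_def field_simps)
    have r_ge: "p \<le> r j" for j unfolding r_def using \<delta> by (simp add: sum_nonneg)
    have grow: "4 ^ j * chi p \<le> chi (r j)" for j
    proof (induction j)
      case 0
      then show ?case by (simp add: r_def)
    next
      case (Suc j)
      have step: "r (Suc j) = r j + \<delta> * (1 / 4) ^ j" by (simp add: r_def algebra_simps)
      have lt: "r j < r (Suc j)" using step \<delta> by simp
      have rpc: "r (Suc j) < pc" using r_le[of "Suc j"] q0 by simp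
      have pc2: "pc / 2 \<le> r j" using r_ge[of j] p by simp
      have inc: "c * (r (Suc j) - r j) * ((chi (r j))\<^sup>2 / 2 - (chi (r (Suc j)))\<^sup>2 / 64) \<le> chi (r (Suc j))"
        by (rule c(2)[OF pc2 lt rpc])
      have cj: "1 \<le> chi (r j)" using chi_ge_1[of "r j"] pc2 pc_pos lt rpc by simp
      \<comment> \<open>If \<open>chi\<close> grew by less than 4, its square by less than 16, the
        error is at most a quarter of the square and the increment inequality forces growth by 4
        after all.\<close>
      have "4 * chi (r j) \<le> chi (r (Suc j))"
      proof (rule ccontr)
        assume n: "\<not> 4 * chi (r j) \<le> chi (r (Suc j))"
        then have "(chi (r (Suc j)))\<^sup>2 \<le> (4 * chi (r j))\<^sup>2"
          using chi_mono[of "r j" "r (Suc j)"] cj pc2 pc_pos lt rpc by (intro power_mono) auto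
        then have ge: "(chi (r j))\<^sup>2 / 4 \<le> (chi (r j))\<^sup>2 / 2 - (chi (r (Suc j)))\<^sup>2 / 64" by (simp add: power_mult_distrib)
        have "4 * chi (r j) \<le> 4 * chi (r j) * (chi (r j) / (4 ^ j * chi p))"
          using Suc cj chi1 by (simp add: field_simps)
        also have "\<dots> = c * (\<delta> * (1 / 4) ^ j) * ((chi (r j))\<^sup>2 / 4)"
          using c(1) chi1 by (simp add: \<delta>_def power2_eq_square field_simps)
        also have "\<dots> \<le> c * (\<delta> * (1 / 4) ^ j) * ((chi (r j))\<^sup>2 / 2 - (chi (r (Suc j)))\<^sup>2 / 64)"
          using ge c(1) \<delta> by (intro mult_left_mono) auto
        also have "\<dots> \<le> chi (r (Suc j))" using inc step by simp
        finally show False using n by simp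
      qed
      with Suc show ?case by simp
    qed
    have bounded: "chi (r j) \<le> chi (p + \<delta> * (4 / 3))" for j
      using r_le[of j] r_ge[of j] q0 p pc_pos by (intro chi_mono) auto
    obtain j where j: "chi (p + \<delta> * (4 / 3)) < 4 ^ j" using real_arch_pow[of 4] by auto
    have "(4 :: real) ^ j \<le> 4 ^ j * chi p" using chi1 by simp
    with grow[of j] bounded[of j] j show False by linarith
  qed
  then show ?thesis using c(1) by (intro exI[of _ "32 / c"]) auto
qed

end

section \<open>Intrinsic balls and an a priori bound on the arm probability\<close>

lemma bprob_pivotal_open:
  assumes "finite F" "e \<in> F"
  shows "bprob s F (\<lambda>\<xi>. pivotal A e \<xi> \<and> e \<in> \<xi>) = s * bprob s F (pivotal A e)"
proof -
  have "bprob s F (\<lambda>\<xi>. pivotal A e \<xi> \<and> e \<in> \<xi>) = bexp s F (\<lambda>\<xi>. s * of_bool (pivotal A e (insert e \<xi>) \<and> e \<in> insert e \<xi>)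
     + (1 - s) * of_bool (pivotal A e (\<xi> - {e}) \<and> e \<in> \<xi> - {e}))"
    unfolding bprob_def by (rule bexp_resample[OF assms])
  also have "\<dots> = bexp s F (\<lambda>\<xi>. s * of_bool (pivotal A e \<xi>))"
    by (rule bexp_cong) (simp add: pivotal_def)
  finally show ?thesis by (simp add: bexp_cmult bprob_def)
qed

text \<open>An open pivotal edge lies in every witness, so at most \<open>n\<close> are pivotal when
  the event occurs. By Russo \<open>s * P' \<le> n * P\<close>, that is, \<open>P / s ^ n\<close>
  does not increase.\<close>

lemma bprob_ratio_le:
  assumes F: "finite F" and A: "incr A" "\<And>\<xi>. A \<xi> \<Longrightarrow> \<exists>\<eta>\<subseteq>\<xi>. finite \<eta> \<and> card \<eta> \<le> n \<and> A \<eta>" and pq: "0 < p" "p \<le> q" "q \<le> 1"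
  shows "bprob q F A \<le> (q / p) ^ n * bprob p F A"
proof -
  let ?f = "\<lambda>s. bprob s F A" and ?f' = "\<lambda>s. \<Sum>e\<in>F. bprob s F (pivotal A e)"
  have "bprob q F A / q ^ n \<le> bprob p F A / p ^ n"
  proof (rule DERIV_nonpos_imp_nonincreasing[OF pq(2)])
    fix s assume "p \<le> s" "s \<le> q"
    then have s: "0 < s" "s \<le> 1" using pq by auto
    have "s * ?f' s = bexp s F (\<lambda>\<xi>. \<Sum>e\<in>F. of_bool (pivotal A e \<xi> \<and> e \<in> \<xi>))"
      unfolding sum_distrib_left bexp_sum bprob_def[symmetric] by (rule sum.cong) (simp_all add: bprob_pivotal_open[OF F])
    also have "\<dots> \<le> bexp s F (\<lambda>\<xi>. real n * of_bool (A \<xi>))"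
    proof (rule bexp_mono)
      fix \<xi> assume "\<xi> \<subseteq> F"
      show "(\<Sum>e\<in>F. of_bool (pivotal A e \<xi> \<and> e \<in> \<xi>)) \<le> real n * of_bool (A \<xi>)"
      proof (cases "A \<xi>")
        case False
        have "\<not> (pivotal A e \<xi> \<and> e \<in> \<xi>)" for e using False by (auto simp: pivotal_def insert_absorb)
        then have "(\<Sum>e\<in>F. of_bool (pivotal A e \<xi> \<and> e \<in> \<xi>) :: real) = 0" by (intro sum.neutral) auto
        then show ?thesis by simp
      next
        case True
        then obtain \<eta> where eta: "\<eta> \<subseteq> \<xi>" "finite \<eta>" "card \<eta> \<le> n" "A \<eta>" using A(2) by blast
        have "{e \<in> F. pivotal A e \<xi> \<and> e \<in> \<xi>} \<subseteq> \<eta>"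
        proof
          fix e assume e: "e \<in> {e \<in> F. pivotal A e \<xi> \<and> e \<in> \<xi>}"
          show "e \<in> \<eta>"
          proof (rule ccontr)
            assume "e \<notin> \<eta>"
            then have "\<eta> \<subseteq> \<xi> - {e}" using eta(1) by auto
            from incrD[OF A(1) this eta(4)] e show False by (simp add: pivotal_def)
          qed
        qed
        from card_mono[OF eta(2) this] eta(3) have "card {e \<in> F. pivotal A e \<xi> \<and> e \<in> \<xi>} \<le> n" by linarith
        then show ?thesis using True F by (simp add: Int_def)
      qed
    qed (use s in auto)
    finally have le: "s * ?f' s \<le> real n * ?f s" by (simp add: bexp_cmult bprob_def)
    have der: "((\<lambda>s. ?f s / s ^ n) has_real_derivative ((?f' s * s ^ n - ?f s * (real n * s ^ (n - 1))) / (s ^ n * s ^ n))) (at s)"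
      using s by (intro DERIV_divide russo_pivotal[OF F A(1)]) (auto intro!: derivative_eq_intros)
    have "(?f' s * s ^ n - ?f s * (real n * s ^ (n - 1))) * s \<le> 0"
    proof -
      have "(?f' s * s ^ n - ?f s * (real n * s ^ (n - 1))) * s = s ^ n * (s * ?f' s - real n * ?f s)"
        by (cases n) (simp_all add: algebra_simps)
      also have "\<dots> \<le> 0" using le s by (intro mult_nonneg_nonpos) auto
      finally show ?thesis .
    qed
    then have "?f' s * s ^ n - ?f s * (real n * s ^ (n - 1)) \<le> 0" using s by (simp add: mult_le_0_iff)
    then have "(?f' s * s ^ n - ?f s * (real n * s ^ (n - 1))) / (s ^ n * s ^ n) \<le> 0"
      using s by (intro divide_nonpos_pos) auto
    with der show "\<exists>y. ((\<lambda>s. ?f s / s ^ n) has_real_derivative y) (at s) \<and> y \<le> 0" by blast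
  qed
  then show ?thesis using pq by (simp add: field_simps power_divide)
qed

text \<open>The ball of radius \<open>k\<close> in the graph metric of the open edges.\<close>

fun gball :: "'v set set \<Rightarrow> 'v \<Rightarrow> nat \<Rightarrow> 'v set" where
  "gball \<xi> x 0 = {x}"
| "gball \<xi> x (Suc k) = gball \<xi> x k \<union> {z. \<exists>y\<in>gball \<xi> x k. {y, z} \<in> \<xi>}"

lemma gball_mono: "\<xi> \<subseteq> \<eta> \<Longrightarrow> gball \<xi> x k \<subseteq> gball \<eta> x k"
  by (induction k) auto

lemma gball_incseq: "j \<le> k \<Longrightarrow> gball \<xi> x j \<subseteq> gball \<xi> x k"
  by (induction k) (auto simp: le_Suc_eq)

lemma gball_subset_clu: "gball \<xi> x k \<subseteq> clu \<xi> {x}"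
proof (induction k)
  case (Suc k)
  have "z \<in> clu \<xi> {x}" if "y \<in> gball \<xi> x k" "{y, z} \<in> \<xi>" for y z
    using Suc that conn_trans[OF _ conn_edge[OF that(2)], of x] by (auto simp: clu_def)
  then show ?case using Suc by auto
qed (simp add: clu_def)

lemma gball_stable:
  assumes "gball \<xi> x (Suc k) = gball \<xi> x k"
  shows "clu \<xi> {x} = gball \<xi> x k"
proof
  have "y \<in> gball \<xi> x k" if "conn \<xi> x y" for y
    using that
  proof (induction rule: conn_induct)
    case refl
    show ?case using gball_incseq[of 0 k \<xi> x] by auto
  next
    case (step y z)
    then have "z \<in> gball \<xi> x (Suc k)" by auto
    then show ?case by (simp only: assms)
  qed
  then show "clu \<xi> {x} \<subseteq> gball \<xi> x k" by (auto simp: clu_def)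
qed (rule gball_subset_clu)

lemma gball_witness:
  "z \<in> gball \<xi> x k \<Longrightarrow> \<exists>\<eta>\<subseteq>\<xi>. finite \<eta> \<and> card \<eta> \<le> k \<and> z \<in> gball \<eta> x k"
proof (induction k arbitrary: z)
  case 0
  then show ?case by (intro exI[of _ "{}"]) auto
next
  case (Suc k)
  show ?case
  proof (cases "z \<in> gball \<xi> x k")
    case True
    from Suc.IH[OF this] obtain \<eta> where "\<eta> \<subseteq> \<xi>" "finite \<eta>" "card \<eta> \<le> k" "z \<in> gball \<eta> x k" by blast
    then show ?thesis by (intro exI[of _ \<eta>]) auto
  next
    case False
    then obtain y where y: "y \<in> gball \<xi> x k" "{y, z} \<in> \<xi>" using Suc.prems by auto
    from Suc.IH[OF y(1)] obtain \<eta> where eta: "\<eta> \<subseteq> \<xi>" "finite \<eta>" "card \<eta> \<le> k" "y \<in> gball \<eta> x k" by blast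
    have "y \<in> gball (insert {y, z} \<eta>) x k" using gball_mono[of \<eta> "insert {y, z} \<eta>"] eta(4) by blast
    then have "z \<in> gball (insert {y, z} \<eta>) x (Suc k)" by auto
    moreover have "card (insert {y, z} \<eta>) \<le> Suc k" using eta(2,3) by (simp add: card_insert_if)
    ultimately show ?thesis using eta y(2) by (intro exI[of _ "insert {y, z} \<eta>"]) auto
  qed
qed

text \<open>The ball of radius \<open>n + 1\<close> is built from edges touching the ball of radius
  \<open>n\<close> only. So revealing the latter decides whether an intrinsic arm reaches distance
  \<open>n + 1\<close>.\<close>

lemma gball_insert_untouched:
  assumes "e \<inter> gball \<xi> x n = {}" "k \<le> Suc n"
  shows "gball (insert e \<xi>) x k = gball \<xi> x k"
  using assms(2)
proof (induction k)
  case (Suc k)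
  then have IH: "gball (insert e \<xi>) x k = gball \<xi> x k" by simp
  have "gball \<xi> x k \<subseteq> gball \<xi> x n" using Suc.prems by (intro gball_incseq) simp
  then have "e \<noteq> {y, z}" if "y \<in> gball \<xi> x k" for y z using assms(1) that by auto
  then show ?case by (auto simp: IH)
qed simp

lemma gball_delete_untouched:
  assumes "e \<inter> gball \<xi> x n = {}" "k \<le> Suc n"
  shows "gball (\<xi> - {e}) x k = gball \<xi> x k"
  using assms(2)
proof (induction k)
  case (Suc k)
  then have IH: "gball (\<xi> - {e}) x k = gball \<xi> x k" by simp
  have "gball \<xi> x k \<subseteq> gball \<xi> x n" using Suc.prems by (intro gball_incseq) simp
  then have "e \<noteq> {y, z}" if "y \<in> gball \<xi> x k" for y z using assms(1) that by auto
  then show ?case by (auto simp: IH)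
qed simp

text \<open>A nonempty last sphere forces all earlier spheres to be nonempty, and each contributes a
  point.\<close>

lemma card_gball:
  assumes "finite (gball \<xi> x (Suc n))" "gball \<xi> x (Suc n) \<noteq> gball \<xi> x n"
  shows "Suc n < card (gball \<xi> x (Suc n))"
proof -
  have ne: "gball \<xi> x (Suc k) \<noteq> gball \<xi> x k" if "k \<le> n" for k
  proof
    assume "gball \<xi> x (Suc k) = gball \<xi> x k"
    from gball_stable[OF this] have "clu \<xi> {x} = gball \<xi> x k" .
    then have "gball \<xi> x (Suc n) \<subseteq> gball \<xi> x n"
      using gball_subset_clu[of \<xi> x "Suc n"] gball_incseq[OF that, of \<xi> x] by (metis subset_trans)
    with gball_incseq[of n "Suc n" \<xi> x] assms(2) show False by auto
  qed
  have "k \<le> Suc n \<Longrightarrow> k < card (gball \<xi> x k)" for k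
  proof (induction k)
    case (Suc k)
    have "gball \<xi> x k \<subset> gball \<xi> x (Suc k)" using ne[of k] Suc.prems gball_incseq[of k "Suc k" \<xi> x] by auto
    moreover have "finite (gball \<xi> x (Suc k))" by (rule finite_subset[OF gball_incseq assms(1)]) (rule Suc.prems)
    ultimately have "card (gball \<xi> x k) < card (gball \<xi> x (Suc k))" by (rule psubset_card_mono[rotated])
    then show ?case using Suc by simp
  qed simp
  from this[OF order_refl] show ?thesis .
qed

context critical_percolation
begin

lemma card_touching_le:
  assumes F: "fin_sub F" and X: "finite X"
  shows "card {e \<in> F. e \<inter> X \<noteq> {}} \<le> deg * card X"
proof -
  have "{e \<in> F. e \<inter> X \<noteq> {}} \<subseteq> (\<Union>x\<in>X. (\<lambda>v. {x, v}) ` {v \<in> \<Union>F. {x, v} \<in> F})"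
  proof
    fix e assume e: "e \<in> {e \<in> F. e \<inter> X \<noteq> {}}"
    then obtain x where x: "x \<in> X" "x \<in> e" by auto
    have "e \<in> \<E>" using e fin_subD(2)[OF F] by auto
    then obtain u v where "e = {u, v}" using edge_pair by blast
    then obtain w where "e = {x, w}" using x by auto
    moreover from this have "w \<in> {v \<in> \<Union>F. {x, v} \<in> F}" using e by auto
    ultimately show "e \<in> (\<Union>x\<in>X. (\<lambda>v. {x, v}) ` {v \<in> \<Union>F. {x, v} \<in> F})" using x(1) by blast
  qed
  moreover have fin: "finite ((\<lambda>v. {x, v}) ` {v \<in> \<Union>F. {x, v} \<in> F})" for x
    using card_neighbours(1)[OF fin_subD(2)[OF F]] by blast
  ultimately have "card {e \<in> F. e \<inter> X \<noteq> {}} \<le> card (\<Union>x\<in>X. (\<lambda>v. {x, v}) ` {v \<in> \<Union>F. {x, v} \<in> F})"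
    using X by (intro card_mono) auto
  also have "\<dots> \<le> (\<Sum>x\<in>X. card ((\<lambda>v. {x, v}) ` {v \<in> \<Union>F. {x, v} \<in> F}))" by (rule card_UN_le[OF X])
  also have "\<dots> \<le> (\<Sum>x\<in>X. deg)"
  proof (rule sum_mono)
    fix x
    have "card ((\<lambda>v. {x, v}) ` {v \<in> \<Union>F. {x, v} \<in> F}) \<le> card {v \<in> \<Union>F. {x, v} \<in> F}"
      by (rule card_image_le) (rule card_neighbours(1)[OF fin_subD(2)[OF F]])
    also have "\<dots> \<le> deg" by (rule card_neighbours(2)[OF fin_subD(2)[OF F]])
    finally show "card ((\<lambda>v. {x, v}) ` {v \<in> \<Union>F. {x, v} \<in> F}) \<le> deg" .
  qed
  finally show ?thesis by (simp add: mult.commute)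
qed

text \<open>Bounds the cost in the Fisher-information inequality of an exploration that reveals the
  edges at the vertices of \<open>X\<close>.\<close>

lemma expected_touching_le:
  assumes F: "fin_sub F" and s: "0 \<le> s" "s \<le> 1" and V: "finite V"
    and X: "\<And>\<xi>. \<xi> \<subseteq> F \<Longrightarrow> X \<xi> \<subseteq> V"
  shows "bexp s F (\<lambda>\<xi>. \<Sum>e\<in>F. of_bool (e \<inter> X \<xi> \<noteq> {})) \<le> real deg * (\<Sum>x\<in>V. bprob s F (\<lambda>\<xi>. x \<in> X \<xi>))"
proof -
  have "bexp s F (\<lambda>\<xi>. \<Sum>e\<in>F. of_bool (e \<inter> X \<xi> \<noteq> {})) \<le> bexp s F (\<lambda>\<xi>. real deg * (\<Sum>x\<in>V. of_bool (x \<in> X \<xi>)))"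
  proof (rule bexp_mono[OF s])
    fix \<xi> assume w: "\<xi> \<subseteq> F"
    have fX: "finite (X \<xi>)" by (rule finite_subset[OF X[OF w] V])
    have "(\<Sum>e\<in>F. of_bool (e \<inter> X \<xi> \<noteq> {}) :: real) = real (card {e \<in> F. e \<inter> X \<xi> \<noteq> {}})"
      using fin_subD(1)[OF F] by (simp add: Int_def)
    also have "\<dots> \<le> real (deg * card (X \<xi>))" by (rule of_nat_mono[OF card_touching_le[OF F fX]])
    also have "\<dots> = real deg * (\<Sum>x\<in>V. of_bool (x \<in> X \<xi>))"
    proof -
      have "V \<inter> X \<xi> = X \<xi>" using X[OF w] by auto
      then show ?thesis using V by simp
    qed
    finally show "(\<Sum>e\<in>F. of_bool (e \<inter> X \<xi> \<noteq> {})) \<le> real deg * (\<Sum>x\<in>V. of_bool (x \<in> X \<xi>))" .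
  qed
  then show ?thesis unfolding bexp_cmult bexp_sum bprob_def .
qed

lemma gball_bound:
  assumes "\<xi> \<subseteq> \<E>"
  shows "y \<in> gball \<xi> 0 k \<Longrightarrow> norm_linf y \<le> int (k * L)"
proof (induction k arbitrary: y)
  case (Suc k)
  show ?case
  proof (cases "y \<in> gball \<xi> 0 k")
    case True
    then show ?thesis using Suc.IH[OF True] by simp
  next
    case False
    then obtain x where x: "x \<in> gball \<xi> 0 k" "{x, y} \<in> \<xi>" using Suc.prems by auto
    have "norm_linf (x - y) \<le> int L" using edge_range x(2) assms by blast
    then show ?thesis using Suc.IH[OF x(1)] norm_linf_triangle_sub[of y x] by (simp add: norm_linf_commute[of y x])
  qed
qed simp

text \<open>Below \<open>pc\<close>, Markov's inequality and the bound on \<open>chi\<close> give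
  the first term. Passing to \<open>pc\<close> reveals an intrinsic ball, whose expected size is of
  order \<open>n\<close> only, hence the second term.\<close>

lemma intrinsic_arm: "\<exists>C>0. \<forall>n F p. 1 \<le> n \<longrightarrow> fin_sub F \<longrightarrow> pc / 2 \<le> p \<longrightarrow> p < pc \<longrightarrow>
    sqrt (bprob pc F (\<lambda>\<xi>. gball \<xi> 0 (Suc n) \<noteq> gball \<xi> 0 n)) \<le> sqrt (C / ((pc - p) * real n)) + (pc - p) * sqrt (C * real n)"
proof -
  obtain C where C: "C > 0" "\<And>p. pc / 2 \<le> p \<Longrightarrow> p < pc \<Longrightarrow> chi p \<le> C / (pc - p)" using chi_upper_bound by blast
  define C1 where "C1 = 3 * real deg * (2 * C / pc) / (pc / 2 * (1 - pc))"
  have C10: "0 \<le> C1" unfolding C1_def using C(1) pc_pos pc_less_1 by simp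
  define D where "D = C + C1"
  have D: "D > 0" using C(1) C10 by (simp add: D_def)
  have "sqrt (bprob pc F (\<lambda>\<xi>. gball \<xi> 0 (Suc n) \<noteq> gball \<xi> 0 n)) \<le> sqrt (D / ((pc - p) * real n)) + (pc - p) * sqrt (D * real n)"
    if n: "1 \<le> n" and F: "fin_sub F" and p: "pc / 2 \<le> p" "p < pc" for n F p
  proof -
    let ?A = "\<lambda>\<xi> :: 'd edge set. gball \<xi> 0 (Suc n) \<noteq> gball \<xi> 0 n"
    let ?R = "\<lambda>e \<xi> :: 'd edge set. e \<inter> gball \<xi> 0 n \<noteq> {}"
    have fin: "finite F" "finite (\<Union>F)" using fin_subD[OF F] by auto
    have p01: "0 < p" "p \<le> 1" "0 \<le> p" using p pc_pos pc_less_1 by auto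
    define V where "V = insert 0 (\<Union>F)"
    have V: "finite V" using fin by (simp add: V_def)
    have cluV: "clu \<xi> {0} \<subseteq> V" if "\<xi> \<subseteq> F" for \<xi> :: "'d edge set"
    proof
      fix y assume "y \<in> clu \<xi> {0}"
      then have "y = 0 \<or> y \<in> \<Union>\<xi>" using conn_in_Union[of \<xi> 0 y] by (simp add: clu_def)
      then show "y \<in> V" using that by (auto simp: V_def)
    qed
    have gV: "gball \<xi> 0 k \<subseteq> V" if "\<xi> \<subseteq> F" for k and \<xi> :: "'d edge set"
      using gball_subset_clu[of \<xi> 0 k] cluV[OF that] by (rule subset_trans)
    have low: "bprob p F ?A \<le> C / ((pc - p) * real n)"
    proof -
      have "bprob p F ?A \<le> bexp p F (\<lambda>\<xi>. \<Sum>x\<in>V. of_bool (conn \<xi> 0 x)) / real n"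
      proof (rule markov_bprob)
        fix \<xi> assume w: "\<xi> \<subseteq> F" "?A \<xi>"
        have "Suc n < card (gball \<xi> 0 (Suc n))"
          by (rule card_gball[OF finite_subset[OF gV[OF w(1)] V] w(2)])
        also have "\<dots> \<le> card (clu \<xi> {0})"
          by (rule card_mono[OF finite_subset[OF cluV[OF w(1)] V] gball_subset_clu])
        finally have "real n \<le> real (card (clu \<xi> {0}))" by simp
        also have "clu \<xi> {0} = V \<inter> {x. conn \<xi> 0 x}" using cluV[OF w(1)] by (auto simp: clu_def)
        also have "real (card (V \<inter> {x. conn \<xi> 0 x})) = (\<Sum>x\<in>V. of_bool (conn \<xi> 0 x))" using V by simp
        finally show "real n \<le> (\<Sum>x\<in>V. of_bool (conn \<xi> 0 x))" .
      qed (use p01 n in \<open>auto intro: sum_nonneg\<close>)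
      also have "bexp p F (\<lambda>\<xi>. \<Sum>x\<in>V. of_bool (conn \<xi> 0 x)) = (\<Sum>x\<in>V. tau p F 0 x)" by (simp only: bexp_sum bprob_def)
      also have "(\<Sum>x\<in>V. tau p F 0 x) / real n \<le> (C / (pc - p)) / real n"
      proof (rule divide_right_mono)
        have "(\<Sum>x\<in>V. tau p F 0 x) \<le> (\<Sum>x\<in>V. T p 0 x)" by (intro sum_mono tau_le_T[OF p01(3,2) F])
        also have "\<dots> \<le> chi p" by (rule chi_upper[OF p01(3) p(2) V])
        also have "\<dots> \<le> C / (pc - p)" by (rule C(2)[OF p])
        finally show "(\<Sum>x\<in>V. tau p F 0 x) \<le> C / (pc - p)" .
      qed simp
      finally show ?thesis by simp
    qed
    have ball: "(\<Sum>x\<in>V. bprob pc F (\<lambda>\<xi>. x \<in> gball \<xi> 0 n)) \<le> 3 * (2 * C / pc) * real n"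
    proof -
      \<comment> \<open>Ball membership needs at most \<open>n\<close> edges, so lowering
        \<open>pc\<close> by the factor \<open>n / (n + 1)\<close> costs at most
        \<open>(1 + 1/n)^n \<le> 3\<close>, while \<open>chi r\<close> is of order
        \<open>n\<close>.\<close>
      define r where "r = pc * (real n / (real n + 1))"
      have pr: "pc - r = pc / (real n + 1)" using n by (simp add: r_def field_simps)
      have "1 / 2 \<le> real n / (real n + 1)" using n by (simp add: field_simps)
      from mult_left_mono[OF this, of pc] have r: "pc / 2 \<le> r" using pc_pos by (simp add: r_def)
      have "0 < pc / (real n + 1)" using pc_pos by simp
      then have r2: "r < pc" using pr by simp
      have rp: "0 < r" using r pc_pos by simp
      have ratio: "(pc / r) ^ n \<le> 3"
      proof -
        have "pc / r = 1 + 1 / real n" using n pc_pos by (simp add: r_def field_simps)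
        also have "\<dots> \<le> exp (1 / real n)" by (rule exp_ge_add_one_self)
        finally have "(pc / r) ^ n \<le> exp (1 / real n) ^ n" using rp pc_pos by (intro power_mono) auto
        also have "\<dots> = exp 1" using n by (simp add: exp_of_nat_mult[symmetric])
        also have "\<dots> \<le> 3" by (rule exp_le)
        finally show ?thesis .
      qed
      have "(\<Sum>x\<in>V. bprob pc F (\<lambda>\<xi>. x \<in> gball \<xi> 0 n)) \<le> (\<Sum>x\<in>V. 3 * T r 0 x)"
      proof (rule sum_mono)
        fix x
        have "bprob pc F (\<lambda>\<xi>. x \<in> gball \<xi> 0 n) \<le> (pc / r) ^ n * bprob r F (\<lambda>\<xi>. x \<in> gball \<xi> 0 n)"
        proof (rule bprob_ratio_le[OF fin(1)])
          show "incr (\<lambda>\<xi>. x \<in> gball \<xi> 0 n)" by (rule incrI) (meson gball_mono subsetD)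
        qed (use gball_witness rp r2 pc_less_1 in auto)
        also have "\<dots> \<le> 3 * T r 0 x"
        proof (rule mult_mono[OF ratio])
          have "bprob r F (\<lambda>\<xi>. x \<in> gball \<xi> 0 n) \<le> tau r F 0 x"
          proof (rule bprob_mono)
            fix \<xi> :: "'d edge set" assume "x \<in> gball \<xi> 0 n"
            then show "conn \<xi> 0 x" using gball_subset_clu[of \<xi> 0 n] by (auto simp: clu_def)
          qed (use rp r2 pc_less_1 in auto)
          also have "\<dots> \<le> T r 0 x" by (rule tau_le_T[OF _ _ F]) (use rp r2 pc_less_1 in auto)
          finally show "bprob r F (\<lambda>\<xi>. x \<in> gball \<xi> 0 n) \<le> T r 0 x" .
        qed (use rp r2 pc_less_1 in \<open>auto intro: bprob_nonneg\<close>)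
        finally show "bprob pc F (\<lambda>\<xi>. x \<in> gball \<xi> 0 n) \<le> 3 * T r 0 x" .
      qed
      also have "\<dots> = 3 * (\<Sum>x\<in>V. T r 0 x)" by (simp add: sum_distrib_left)
      also have "(\<Sum>x\<in>V. T r 0 x) \<le> chi r" by (rule chi_upper[OF _ r2 V]) (use rp in simp)
      also have "chi r \<le> C / (pc - r)" by (rule C(2)[OF r r2])
      also have "C / (pc - r) = C / pc * (real n + 1)" using pr by simp
      also have "\<dots> \<le> C / pc * (2 * real n)" using n C(1) pc_pos by (intro mult_left_mono) auto
      finally show ?thesis by simp
    qed
    have "sqrt (bprob pc F ?A) \<le> sqrt (bprob p F ?A) + (pc - p) * sqrt (real deg * (3 * (2 * C / pc) * real n) / (p * (1 - pc)))"
    proof (rule sqrt_bprob_le[where R = ?R])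
      fix s assume s: "p \<le> s" "s \<le> pc"
      have "bexp s F (\<lambda>\<xi>. \<Sum>e\<in>F. of_bool (?R e \<xi>)) \<le> real deg * (\<Sum>x\<in>V. bprob s F (\<lambda>\<xi>. x \<in> gball \<xi> 0 n))"
        by (rule expected_touching_le[OF F _ _ V]) (use s p01 pc_less_1 gV in auto)
      also have "\<dots> \<le> real deg * (\<Sum>x\<in>V. bprob pc F (\<lambda>\<xi>. x \<in> gball \<xi> 0 n))"
      proof (intro mult_left_mono sum_mono bprob_mono_param[OF fin(1)])
        fix x show "incr (\<lambda>\<xi>. x \<in> gball \<xi> 0 n)" by (rule incrI) (meson gball_mono subsetD)
      qed (use s p01 pc_less_1 in auto)
      also have "\<dots> \<le> real deg * (3 * (2 * C / pc) * real n)" using ball by (intro mult_left_mono) auto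
      finally show "bexp s F (\<lambda>\<xi>. \<Sum>e\<in>F. of_bool (?R e \<xi>)) \<le> real deg * (3 * (2 * C / pc) * real n)" .
    next
      fix e f and \<xi> :: "'d edge set" assume "\<not> e \<inter> gball \<xi> 0 n \<noteq> {}"
      then have e: "e \<inter> gball \<xi> 0 n = {}" by simp
      show "(f \<inter> gball (insert e \<xi>) 0 n \<noteq> {}) = (f \<inter> gball \<xi> 0 n \<noteq> {})" using gball_insert_untouched[OF e, of n] by simp
      show "(f \<inter> gball (\<xi> - {e}) 0 n \<noteq> {}) = (f \<inter> gball \<xi> 0 n \<noteq> {})" using gball_delete_untouched[OF e, of n] by simp
      show "(gball (insert e \<xi>) 0 (Suc n) \<noteq> gball (insert e \<xi>) 0 n) = (gball \<xi> 0 (Suc n) \<noteq> gball \<xi> 0 n)"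
        using gball_insert_untouched[OF e, of n] gball_insert_untouched[OF e, of "Suc n"] by simp
    qed (use fin p01 p pc_less_1 in auto)
    moreover have "sqrt (bprob p F ?A) \<le> sqrt (D / ((pc - p) * real n))"
    proof -
      have "C / ((pc - p) * real n) \<le> D / ((pc - p) * real n)" using C10 p n by (intro divide_right_mono) (auto simp: D_def)
      with low show ?thesis by (intro real_sqrt_le_mono) linarith
    qed
    moreover have "(pc - p) * sqrt (real deg * (3 * (2 * C / pc) * real n) / (p * (1 - pc))) \<le> (pc - p) * sqrt (D * real n)"
    proof (intro mult_left_mono real_sqrt_le_mono)
      have "real deg * (3 * (2 * C / pc) * real n) / (p * (1 - pc)) \<le> real deg * (3 * (2 * C / pc) * real n) / (pc / 2 * (1 - pc))"
        using p pc_pos pc_less_1 C(1) by (intro divide_left_mono mult_right_mono mult_nonneg_nonneg mult_pos_pos) auto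
      also have "\<dots> = C1 * real n" by (simp add: C1_def mult_ac)
      also have "\<dots> \<le> D * real n" using C(1) by (intro mult_right_mono) (auto simp: D_def)
      finally show "real deg * (3 * (2 * C / pc) * real n) / (p * (1 - pc)) \<le> D * real n" .
    qed (use p in simp)
    ultimately show ?thesis by linarith
  qed
  with D show ?thesis by blast
qed

text \<open>With intrinsic radius \<open>n = t ^ 6\<close> and \<open>pc - p\<close> of order
  \<open>1 / t ^ 4\<close>, both terms of \<open>intrinsic_arm\<close> are of order
  \<open>1 / t\<close>; the sixth power avoids fractional exponents. An open path of
  \<open>n\<close> edges moves by at most \<open>L * n\<close>.\<close>

lemma arm_a_priori: "\<exists>C>0. \<forall>t\<ge>1. arm pc (L * t ^ 6 + 1) \<le> C / (real t)\<^sup>2"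
proof -
  obtain C where C: "C > 0" "\<And>n F p. 1 \<le> n \<Longrightarrow> fin_sub F \<Longrightarrow> pc / 2 \<le> p \<Longrightarrow> p < pc \<Longrightarrow>
    sqrt (bprob pc F (\<lambda>\<xi>. gball \<xi> 0 (Suc n) \<noteq> gball \<xi> 0 n)) \<le> sqrt (C / ((pc - p) * real n)) + (pc - p) * sqrt (C * real n)"
    using intrinsic_arm by blast
  define D where "D = sqrt (2 * C / pc) + pc / 2 * sqrt C"
  have D: "D > 0" unfolding D_def using C(1) pc_pos by (intro add_pos_pos) auto
  have "arm pc (L * t ^ 6 + 1) \<le> D\<^sup>2 / (real t)\<^sup>2" if t: "1 \<le> t" for t
    unfolding arm_def
  proof (rule PS_least)
    fix F assume F: "fin_sub F"
    define n where "n = t ^ 6"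
    have n: "1 \<le> n" using t by (simp add: n_def)
    define p where "p = pc - (pc / 2) / real t ^ 4"
    have tp: "0 < real t" "1 \<le> real t" using t by auto
    then have "1 \<le> real t ^ 4" by (simp add: one_le_power)
    then have le: "(pc / 2) / real t ^ 4 \<le> pc / 2" using pc_pos by (simp add: divide_le_eq mult_le_cancel_left1)
    have gt: "0 < (pc / 2) / real t ^ 4" using pc_pos tp by simp
    have p: "pc / 2 \<le> p" "p < pc" using le gt by (auto simp: p_def)
    let ?A = "\<lambda>\<xi> :: 'd edge set. gball \<xi> 0 (Suc n) \<noteq> gball \<xi> 0 n"
    have pcp: "pc - p = (pc / 2) / real t ^ 4" by (simp add: p_def)
    have "sqrt (C / ((pc - p) * real n)) = sqrt (2 * C / pc) / real t"
    proof -
      have "C / ((pc - p) * real n) = (2 * C / pc) / (real t)\<^sup>2"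
        unfolding pcp n_def using tp pc_pos by (simp add: field_simps power2_eq_square eval_nat_numeral)
      then have "sqrt (C / ((pc - p) * real n)) = sqrt (2 * C / pc) / sqrt ((real t)\<^sup>2)" by (simp only: real_sqrt_divide)
      then show ?thesis using tp by simp
    qed
    moreover have "(pc - p) * sqrt (C * real n) = (pc / 2 * sqrt C) / real t"
    proof -
      have "sqrt (C * real n) = sqrt C * real t ^ 3"
      proof -
        have "real n = (real t ^ 3)\<^sup>2" by (simp add: n_def power_mult[symmetric])
        then have "sqrt (C * real n) = sqrt C * sqrt ((real t ^ 3)\<^sup>2)" by (simp only: real_sqrt_mult)
        moreover have "sqrt ((real t ^ 3)\<^sup>2) = real t ^ 3" by (subst real_sqrt_abs) (use tp in simp)
        ultimately show ?thesis by (simp only:)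
      qed
      then show ?thesis unfolding pcp using tp by (simp add: field_simps eval_nat_numeral)
    qed
    ultimately have "sqrt (bprob pc F ?A) \<le> D / real t"
      using C(2)[OF n F p] by (simp add: D_def add_divide_distrib)
    then have "(sqrt (bprob pc F ?A))\<^sup>2 \<le> (D / real t)\<^sup>2"
      by (rule power_mono, intro real_sqrt_ge_zero bprob_nonneg) (use pc_pos pc_less_1 in auto)
    moreover have "0 \<le> bprob pc F ?A" by (rule bprob_nonneg) (use pc_pos pc_less_1 in auto)
    ultimately have le: "bprob pc F ?A \<le> D\<^sup>2 / (real t)\<^sup>2" by (simp only: power_divide real_sqrt_pow2)
    have "bprob pc F (far (L * t ^ 6 + 1) 0) \<le> bprob pc F ?A"
    proof (rule bprob_mono)
      fix \<xi> assume w: "\<xi> \<subseteq> F" "far (L * t ^ 6 + 1) 0 \<xi>"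
      then obtain y where y: "int (L * t ^ 6 + 1) \<le> norm_linf y" "y \<in> clu \<xi> {0}" by (auto simp: far_def clu_def)
      show "?A \<xi>"
      proof
        assume "gball \<xi> 0 (Suc n) = gball \<xi> 0 n"
        from gball_stable[OF this] y(2) have "y \<in> gball \<xi> 0 n" by simp
        then have "norm_linf y \<le> int (n * L)" by (rule gball_bound[rotated]) (use w(1) fin_subD(2)[OF F] in auto)
        then show False using y(1) by (simp add: n_def mult.commute)
      qed
    qed (use pc_pos pc_less_1 in auto)
    with le show "bprob pc F (far (L * t ^ 6 + 1) 0) \<le> D\<^sup>2 / (real t)\<^sup>2" by linarith
  qed (use pc_pos pc_less_1 in auto)
  then show ?thesis using D by (intro exI[of _ "D\<^sup>2"]) auto
qed

text \<open>By Russo's formula and the BK inequality, the derivative in \<open>p\<close> of the two-point function is at most a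
  convolution of two such functions, of order \<open>\<bar>x - y\<bar>^(4 - d)\<close>.\<close>

lemma T_lower_near: "\<exists>c>0. \<forall>p x y. 0 \<le> p \<longrightarrow> p \<le> pc \<longrightarrow> (pc - p) * (jb (x - y))\<^sup>2 \<le> c \<longrightarrow>
    a / 2 / jb (x - y) ^ (CARD('d) - 2) \<le> T p x y"
proof -
  let ?q = "CARD('d) - 2"
  obtain C where C: "C > 0" "\<And>s X x y. 0 \<le> s \<Longrightarrow> s \<le> pc \<Longrightarrow> finite X \<Longrightarrow> (\<Sum>v\<in>X. T s x v * T s v y) \<le> C / jb (x - y) ^ (CARD('d) - 4)"
    using convolution_T by auto
  define D where "D = real deg * (b * (2 * real L) ^ ?q / a)"
  have D0: "0 \<le> D" unfolding D_def using ab b_pos by simp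
  define X where "X = D * C + 1"
  define c where "c = a / 2 / X"
  have DC: "0 < X" unfolding X_def using D0 C(1) by (simp add: add_nonneg_pos)
  have c0: "c > 0" unfolding c_def using ab DC by simp
  note pcn = pc_pos[THEN less_imp_le] pc_less_1[THEN less_imp_le]
  have "a / 2 / jb (x - y) ^ ?q \<le> T p x y" if p: "0 \<le> p" "p \<le> pc" and near: "(pc - p) * (jb (x - y))\<^sup>2 \<le> c" for p x y
  proof (rule field_le_epsilon)
    fix \<epsilon> :: real assume \<epsilon>: "\<epsilon> > 0"
    have p1: "p \<le> 1" using p pc_less_1 by simp
    obtain F where F: "fin_sub F" "T pc x y - \<epsilon> < tau pc F x y"
      using PS_approx[OF pcn incr_conn \<epsilon>, of x y] by (auto simp: T_def)
    have fin: "finite F" by (rule fin_subD(1)[OF F(1)])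
    define V where "V = \<Union>F"
    have V: "finite V" "\<Union>F \<subseteq> V" using fin_subD(3)[OF F(1)] by (auto simp: V_def)
    have piv: "(\<Sum>e\<in>F. bprob s F (pivotal (\<lambda>\<xi>. conn \<xi> x y) e)) \<le> D * C / jb (x - y) ^ (CARD('d) - 4)"
      if s: "0 \<le> s" "s \<le> pc" for s
    proof -
      have s1: "s \<le> 1" using s pc_less_1 by simp
      have "(\<Sum>e\<in>F. bprob s F (pivotal (\<lambda>\<xi>. conn \<xi> x y) e)) \<le> (\<Sum>u\<in>V. \<Sum>v\<in>{v \<in> V. {u, v} \<in> F}. tau s F x u * tau s F v y)"
        by (rule pivotal_sum_le[OF fin s(1) s1 V])
      \<comment> \<open>\<open>v\<close> is within the range of \<open>u\<close>, so
        \<open>T pc v y\<close> and \<open>T pc u y\<close> are comparable by the two-sided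
        estimate, and a convolution over \<open>u\<close> remains.\<close>
      also have "\<dots> \<le> (\<Sum>u\<in>V. \<Sum>v\<in>{v \<in> V. {u, v} \<in> F}. T pc x u * (b * (2 * real L) ^ ?q / a * T pc u y))"
      proof (intro sum_mono mult_mono)
        fix u v assume "v \<in> {v \<in> V. {u, v} \<in> F}"
        then have uv: "{u, v} \<in> \<E>" using fin_subD(2)[OF F(1)] by auto
        show "tau s F x u \<le> T pc x u"
          using tau_le_T[OF s(1) s1 F(1), of x u] T_mono[OF s, of x u] pc_less_1 by linarith
        have "jb (u - v) \<le> real L" using edge_range[OF uv] L_pos by (auto simp: jb_def)
        then have "2 * jb (u - v) * jb (v - y) \<le> 2 * real L * jb (v - y)" by (intro mult_right_mono) auto
        moreover have "jb (u - y) \<le> 2 * jb (u - v) * jb (v - y)" using jb_mult[of "u - v" "v - y"] by simp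
        ultimately have "jb (u - y) \<le> 2 * real L * jb (v - y)" by linarith
        then have "jb (u - y) ^ ?q \<le> (2 * real L) ^ ?q * jb (v - y) ^ ?q" using power_mono[of "jb (u - y)" "2 * real L * jb (v - y)" ?q] by (simp add: power_mult_distrib)
        then have "1 / jb (v - y) ^ ?q \<le> (2 * real L) ^ ?q / jb (u - y) ^ ?q" by (simp add: field_simps)
        from mult_left_mono[OF this, of b] have k: "b / jb (v - y) ^ ?q \<le> b * (2 * real L) ^ ?q / jb (u - y) ^ ?q" using b_pos by simp
        have "tau s F v y \<le> T s v y" by (rule tau_le_T[OF s(1) s1 F(1)])
        also have "\<dots> \<le> b / jb (v - y) ^ ?q" by (rule T_le[OF s])
        also note k
        also have "b * (2 * real L) ^ ?q / jb (u - y) ^ ?q = b * (2 * real L) ^ ?q / a * (a / jb (u - y) ^ ?q)" using ab by simp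
        also have "\<dots> \<le> b * (2 * real L) ^ ?q / a * T pc u y" using T_lower[of u y] ab b_pos by (intro mult_left_mono) auto
        finally show "tau s F v y \<le> b * (2 * real L) ^ ?q / a * T pc u y" .
      qed (auto intro: T_nonneg[OF pcn] bprob_nonneg[OF s(1) s1])
      also have "\<dots> = (\<Sum>u\<in>V. real (card {v \<in> V. {u, v} \<in> F}) * (T pc x u * (b * (2 * real L) ^ ?q / a * T pc u y)))" by simp
      also have "\<dots> \<le> (\<Sum>u\<in>V. real deg * (T pc x u * (b * (2 * real L) ^ ?q / a * T pc u y)))"
        using card_neighbours(2)[OF fin_subD(2)[OF F(1)]] ab b_pos
        by (intro sum_mono mult_right_mono mult_nonneg_nonneg T_nonneg[OF pcn]) auto
      also have "\<dots> = D * (\<Sum>u\<in>V. T pc x u * T pc u y)"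
        unfolding sum_distrib_left D_def by (rule sum.cong) auto
      also have "\<dots> \<le> D * (C / jb (x - y) ^ (CARD('d) - 4))"
        using C(2)[OF pcn(1) order_refl V(1)] D0 by (rule mult_left_mono)
      finally show ?thesis by simp
    qed
    have mvt: "tau pc F x y - tau p F x y \<le> (pc - p) * (D * C / jb (x - y) ^ (CARD('d) - 4))"
    proof (cases "p = pc")
      case False
      then have "p < pc" using p by simp
      from MVT2[OF this russo_pivotal[OF fin incr_conn], of x y]
      obtain s where s: "p < s" "s < pc" "tau pc F x y - tau p F x y = (pc - p) * (\<Sum>e\<in>F. bprob s F (pivotal (\<lambda>\<xi>. conn \<xi> x y) e))" by blast
      show ?thesis unfolding s(3) using piv[of s] s p by (intro mult_left_mono) auto
    qed simp
    have "(pc - p) * (D * C / jb (x - y) ^ (CARD('d) - 4)) = ((pc - p) * (jb (x - y))\<^sup>2) * (D * C) / jb (x - y) ^ ?q"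
    proof -
      have "?q = 2 + (CARD('d) - 4)" using dim by simp
      then have "jb (x - y) ^ ?q = (jb (x - y))\<^sup>2 * jb (x - y) ^ (CARD('d) - 4)" by (metis power_add)
      moreover have "jb (x - y) \<noteq> 0" using jb_pos[of "x - y"] by linarith
      ultimately show ?thesis by simp
    qed
    also have "\<dots> \<le> c * (D * C) / jb (x - y) ^ ?q"
      using near D0 C(1) by (intro divide_right_mono mult_right_mono) auto
    also have "\<dots> \<le> a / 2 / jb (x - y) ^ ?q"
    proof (rule divide_right_mono)
      have "c * (D * C) \<le> c * X" using c0 by (intro mult_left_mono) (auto simp: X_def)
      also have "\<dots> = a / 2" using DC by (simp add: c_def)
      finally show "c * (D * C) \<le> a / 2" .
    qed simp
    finally have "tau pc F x y - tau p F x y \<le> a / 2 / jb (x - y) ^ ?q" using mvt by linarith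
    moreover have "tau p F x y \<le> T p x y" by (rule tau_le_T[OF p(1) p1 F(1)])
    moreover have "a / 2 / jb (x - y) ^ ?q + a / 2 / jb (x - y) ^ ?q \<le> T pc x y" using T_lower[of x y] by (simp add: add_divide_distrib[symmetric])
    ultimately show "a / 2 / jb (x - y) ^ ?q \<le> T p x y + \<epsilon>" using F(2) by linarith
  qed
  with c0 show ?thesis by blast
qed

end

section \<open>Regularity of clusters\<close>

definition bx :: "int ^ 'd::finite \<Rightarrow> nat \<Rightarrow> (int ^ 'd) set" where
  "bx y n = {v. norm_linf (v - y) \<le> int n}"

lemma bx_eq: "bx y n = (\<lambda>x. x + y) ` box n"
proof (intro set_eqI iffI)
  fix v assume "v \<in> bx y n"
  then show "v \<in> (\<lambda>x. x + y) ` box n" by (intro image_eqI[of _ _ "v - y"]) (auto simp: bx_def box_def)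
qed (auto simp: bx_def box_def)

lemma finite_bx [simp]: "finite (bx y n)" by (simp add: bx_eq)

lemma card_bx: "card (bx (y :: int ^ 'd::finite) n) = (2 * n + 1) ^ CARD('d)"
  unfolding bx_eq by (subst card_image) (auto simp: inj_on_def card_box)

lemma card_bx_le:
  assumes "1 \<le> n"
  shows "real (card (bx (y :: int ^ 'd::finite) n)) \<le> (3 * real n) ^ CARD('d)"
  unfolding card_bx of_nat_power using assms by (intro power_mono) auto

lemma big_cluster_antimono: "big_cluster W M k \<xi> \<Longrightarrow> k' \<le> k \<Longrightarrow> big_cluster W M k' \<xi>"
  unfolding big_cluster_def by (meson order_trans)

context critical_percolation
begin

lemma sum_T_box: "\<exists>C>0. \<forall>s n X z v. 0 \<le> s \<longrightarrow> s \<le> pc \<longrightarrow> 1 \<le> n \<longrightarrow> X \<subseteq> bx z n \<longrightarrow> (\<Sum>x\<in>X. T s v x) \<le> C * (real n)\<^sup>2"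
proof -
  have d2: "2 < CARD('d)" using dim by simp
  obtain C where C: "C > 0" "\<And>X z v n. 1 \<le> n \<Longrightarrow> \<forall>x\<in>X. norm_linf (x - z) \<le> int n \<Longrightarrow>
    finite X \<and> (\<Sum>x\<in>X. 1 / jb (x - v :: int ^ 'd) ^ (CARD('d) - 2)) \<le> C * (real n)\<^sup>2"
    using sum_shifted_box_le[OF d2] by blast
  have "(\<Sum>x\<in>X. T s v x) \<le> b * C * (real n)\<^sup>2" if "0 \<le> s" "s \<le> pc" "1 \<le> n" "X \<subseteq> bx z n" for s n X z v
  proof -
    have "(\<Sum>x\<in>X. T s v x) \<le> (\<Sum>x\<in>X. b * (1 / jb (x - v) ^ (CARD('d) - 2)))"
      using T_le[OF that(1,2), of v] by (intro sum_mono) (simp add: jb_commute[of _ v])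
    also have "\<dots> = b * (\<Sum>x\<in>X. 1 / jb (x - v) ^ (CARD('d) - 2))" by (simp only: sum_distrib_left)
    also have "\<dots> \<le> b * (C * (real n)\<^sup>2)"
      using C(2)[OF that(3), of X z v] that(4) b_pos by (intro mult_left_mono) (auto simp: bx_def)
    finally show ?thesis by simp
  qed
  then show ?thesis using C(1) b_pos by (intro exI[of _ "b * C"]) auto
qed

definition mass :: "nat \<Rightarrow> nat" where
  "mass \<beta> = \<beta> ^ (8 * (CARD('d) - 2) - 2)"

text \<open>The exponents are chosen such that \<open>mass \<beta>\<close> is the power \<open>d - 2 - 1/4\<close> of the radius \<open>\<beta>^8\<close>.\<close>

lemma big_cluster_unlikely: "\<exists>N\<ge>1. \<forall>\<beta>\<ge>N. \<forall>p F W y. 0 \<le> p \<longrightarrow> p \<le> pc \<longrightarrow> fin_sub F \<longrightarrow> finite (\<Union>W) \<longrightarrow>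
    (\<forall>v\<in>bx y (\<beta> ^ 8). \<forall>w\<in>\<Union>W. int (L * (\<beta> ^ 11) ^ 6 + 1) \<le> norm_linf (w - v)) \<longrightarrow>
    bprob p F (big_cluster W (bx y (\<beta> ^ 8)) (mass \<beta>)) \<le> 1 / real \<beta> ^ A"
proof -
  let ?d = "CARD('d)"
  obtain C2 where C2: "C2 > 0" "\<And>s n X z v. 0 \<le> s \<Longrightarrow> s \<le> pc \<Longrightarrow> 1 \<le> n \<Longrightarrow> X \<subseteq> bx z n \<Longrightarrow> (\<Sum>x\<in>X. T s v x) \<le> C2 * (real n)\<^sup>2"
    using sum_T_box by blast
  obtain C3 where C3: "C3 > 0" "\<And>t. 1 \<le> t \<Longrightarrow> arm pc (L * t ^ 6 + 1) \<le> C3 / (real t)\<^sup>2"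
    using arm_a_priori by blast
  define C1 where "C1 = 3 ^ ?d * (C2 + C3)"
  obtain N1 :: nat where N1: "C1 \<le> real N1" using real_arch_simple by blast
  \<comment> \<open>\<open>N1\<close> absorbs the constant \<open>C1\<close> into one factor
    \<open>\<beta>\<close>, and \<open>3 ^ A\<close> leaves room for \<open>A\<close>
    triplings.\<close>
  define N where "N = max 1 (max N1 (3 ^ A))"
  have "bprob p F (big_cluster W (bx y (\<beta> ^ 8)) (mass \<beta>)) \<le> 1 / real \<beta> ^ A"
    if \<beta>: "N \<le> \<beta>" and p: "0 \<le> p" "p \<le> pc" and F: "fin_sub F" and W: "finite (\<Union>W)"
      "\<forall>v\<in>bx y (\<beta> ^ 8). \<forall>w\<in>\<Union>W. int (L * (\<beta> ^ 11) ^ 6 + 1) \<le> norm_linf (w - v)" for \<beta> p F W y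
  proof -
    have p1: "p \<le> 1" using p pc_less_1 by simp
    have \<beta>1: "1 \<le> \<beta>" and \<beta>C: "C1 \<le> real \<beta>" and \<beta>3: "3 ^ A \<le> \<beta>" using \<beta> N1 by (auto simp: N_def)
    let ?M = "bx y (\<beta> ^ 8)"
    \<comment> \<open>One factor \<open>\<beta>\<close> below \<open>mass \<beta>\<close>. At this
      size the first-moment bound gives \<open>1 / \<beta>\<close>, and triplings up to the mass
      raise it to the required power.\<close>
    define k where "k = \<beta> ^ (8 * (?d - 2) - 3)"
    have k0: "0 < k" using \<beta>1 by (simp add: k_def)
    have finU: "finite (\<Union>(F \<union> W))" using fin_subD(3)[OF F] W(1) by simp
    let ?x = "real \<beta>"
    have x1: "1 \<le> ?x" "0 < ?x" using \<beta>1 by auto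
    have pw: "?x ^ i \<le> ?x ^ j" if "i \<le> j" for i j using that x1 by (intro power_increasing) auto
    have "bprob p F (big_cluster W ?M k) \<le> (\<Sum>v\<in>?M. (\<Sum>u\<in>?M. tau p F v u) / real k + bprob p F (\<lambda>\<xi>. \<exists>y\<in>\<Union>W. conn \<xi> v y)) / real k"
      by (rule big_cluster_base[OF fin_subD(1)[OF F] finU p(1) p1 finite_bx k0])
    also have "\<dots> \<le> (\<Sum>v\<in>?M. C2 * ?x ^ 16 / real k + C3 / ?x ^ 22) / real k"
    proof (intro divide_right_mono sum_mono add_mono)
      fix v assume v: "v \<in> ?M"
      have "(\<Sum>u\<in>?M. tau p F v u) \<le> (\<Sum>u\<in>?M. T p v u)" by (intro sum_mono tau_le_T[OF p(1) p1 F])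
      also have "\<dots> \<le> C2 * (real (\<beta> ^ 8))\<^sup>2" by (rule C2(2)[OF p _ order_refl]) (use \<beta>1 in simp)
      finally show "(\<Sum>u\<in>?M. tau p F v u) \<le> C2 * ?x ^ 16" by (simp add: power_mult[symmetric])
      have "bprob p F (\<lambda>\<xi>. \<exists>w\<in>\<Union>W. conn \<xi> v w) \<le> bprob p F (far (L * (\<beta> ^ 11) ^ 6 + 1) v)"
      proof (rule bprob_mono[OF p(1) p1])
        fix \<xi> assume "\<exists>w\<in>\<Union>W. conn \<xi> v w"
        then obtain w where w: "w \<in> \<Union>W" "conn \<xi> v w" by blast
        then show "far (L * (\<beta> ^ 11) ^ 6 + 1) v \<xi>" using W(2) v unfolding far_def by blast
      qed
      also have "\<dots> \<le> arm p (L * (\<beta> ^ 11) ^ 6 + 1)" by (rule far_le_arm[OF p(1) p1 F])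
      also have "\<dots> \<le> arm pc (L * (\<beta> ^ 11) ^ 6 + 1)" by (rule arm_mono[OF p]) (use pc_less_1 in simp)
      also have "\<dots> \<le> C3 / (real (\<beta> ^ 11))\<^sup>2" by (rule C3(2)) (use \<beta>1 in simp)
      finally show "bprob p F (\<lambda>\<xi>. \<exists>w\<in>\<Union>W. conn \<xi> v w) \<le> C3 / ?x ^ 22" by (simp add: power_mult[symmetric])
    qed simp_all
    also have "\<dots> = real (card ?M) * (C2 * ?x ^ 16 / real k + C3 / ?x ^ 22) / real k" by simp
    also have "\<dots> \<le> (3 * real (\<beta> ^ 8)) ^ ?d * (C2 * ?x ^ 16 / real k + C3 / ?x ^ 22) / real k"
      using card_bx_le[of "\<beta> ^ 8" y] \<beta>1 C2(1) C3(1) by (intro divide_right_mono mult_right_mono) auto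
    also have "\<dots> = 3 ^ ?d * (C2 * (?x ^ (8 * ?d + 16) / (real k)\<^sup>2) + C3 * (?x ^ (8 * ?d) / (?x ^ 22 * real k)))"
      using k0 x1 by (simp add: power_mult_distrib power_mult[symmetric] power_add power2_eq_square field_simps)
    \<comment> \<open>The first comparison reads \<open>8 d + 18 \<le> 16 d - 38\<close>, which is
      \<open>d \<ge> 7\<close>. The second holds because the wiring is at arm distance
      \<open>t = \<beta> ^ 11\<close>, which gives \<open>\<beta> ^ 22\<close>.\<close>
    also have "\<dots> \<le> 3 ^ ?d * (C2 * (1 / ?x\<^sup>2) + C3 * (1 / ?x\<^sup>2))"
    proof (intro mult_left_mono add_mono)
      have "?x ^ (8 * ?d + 16) * ?x\<^sup>2 \<le> (real k)\<^sup>2"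
        using pw[of "8 * ?d + 18" "(8 * (?d - 2) - 3) * 2"] dim by (simp add: k_def power_mult[symmetric] power_add mult_ac)
      then show "?x ^ (8 * ?d + 16) / (real k)\<^sup>2 \<le> 1 / ?x\<^sup>2" using x1 k0 by (simp add: field_simps)
      have "?x ^ (8 * ?d) * ?x\<^sup>2 \<le> ?x ^ 22 * real k"
        using pw[of "8 * ?d + 2" "22 + (8 * (?d - 2) - 3)"] dim by (simp add: k_def power_add[symmetric] mult_ac)
      then show "?x ^ (8 * ?d) / (?x ^ 22 * real k) \<le> 1 / ?x\<^sup>2" using x1 k0 by (simp add: field_simps)
    qed (use C2(1) C3(1) in auto)
    also have "\<dots> = C1 / ?x\<^sup>2" by (simp add: C1_def add_divide_distrib algebra_simps)
    also have "\<dots> \<le> ?x / ?x\<^sup>2" using \<beta>C by (intro divide_right_mono) auto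
    also have "\<dots> = 1 / ?x" using x1 by (simp add: power2_eq_square)
    finally have base: "bprob p F (big_cluster W ?M k) \<le> 1 / ?x" .
    have mass_eq: "mass \<beta> = \<beta> * k"
    proof -
      have "8 * (?d - 2) - 2 = Suc (8 * (?d - 2) - 3)" using dim by simp
      then show ?thesis by (simp add: mass_def k_def)
    qed
    have "3 ^ A * k \<le> mass \<beta>" unfolding mass_eq by (rule mult_right_mono[OF \<beta>3]) simp
    then have "bprob p F (big_cluster W ?M (mass \<beta>)) \<le> bprob p F (big_cluster W ?M (3 ^ A * k))"
      by (intro bprob_mono[OF p(1) p1]) (rule big_cluster_antimono)
    also have "\<dots> \<le> bprob p F (big_cluster W ?M k) ^ (2 ^ A)"
      by (rule big_cluster_power[OF fin_subD(1)[OF F] finU p(1) p1 finite_bx k0])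
    also have "\<dots> \<le> (1 / ?x) ^ (2 ^ A)" by (rule power_mono[OF base bprob_nonneg[OF p(1) p1]])
    also have "\<dots> \<le> (1 / ?x) ^ A" using x1 by (intro power_decreasing) (auto intro: less_imp_le)
    finally show ?thesis by (simp add: power_one_over)
  qed
  then show ?thesis by (intro exI[of _ N]) (auto simp: N_def)
qed

section \<open>Connections inside a box and its boundary layer\<close>

definition bdry :: "(int ^ 'd) set \<Rightarrow> (int ^ 'd) set" where
  "bdry S = {y \<in> S. out S y \<noteq> {}}"

lemma T_exit_le:
  assumes p: "0 \<le> p" "p \<le> 1" and S: "finite S" "u \<in> S" "z \<notin> S"
  shows "T p u z \<le> (\<Sum>y\<in>S. \<Sum>v\<in>out S y. tauS p S u y * T p v z)"
  unfolding T_def[of p u z]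
proof (rule PS_least[OF p])
  fix F assume F: "fin_sub F"
  have "tau p F u z \<le> (\<Sum>y\<in>S. \<Sum>v\<in>{v \<in> \<Union>F. v \<notin> S \<and> {y, v} \<in> F}. tau_in p F S u y * (p * tau p F v z))"
    using simon_lieb[OF fin_subD(1)[OF F] p S(1,2), of "{z}" "\<Union>F"] S(3) fin_subD(3)[OF F] by simp
  also have "\<dots> \<le> (\<Sum>y\<in>S. \<Sum>v\<in>out S y. tauS p S u y * T p v z)"
  proof (rule sum_mono)
    fix y
    have "(\<Sum>v\<in>{v \<in> \<Union>F. v \<notin> S \<and> {y, v} \<in> F}. tau_in p F S u y * (p * tau p F v z))
       \<le> (\<Sum>v\<in>{v \<in> \<Union>F. v \<notin> S \<and> {y, v} \<in> F}. tauS p S u y * (1 * T p v z))"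
      using p S(1) by (intro sum_mono mult_mono bprob_inside_le[OF F] tau_le_T[OF p F] mult_nonneg_nonneg bprob_nonneg tauS_nonneg) auto
    also have "\<dots> \<le> (\<Sum>v\<in>out S y. tauS p S u y * (1 * T p v z))"
      using fin_subD(2)[OF F] by (intro sum_mono2 finite_out) (auto simp: out_def intro!: mult_nonneg_nonneg tauS_nonneg p T_nonneg)
    finally show "(\<Sum>v\<in>{v \<in> \<Union>F. v \<notin> S \<and> {y, v} \<in> F}. tau_in p F S u y * (p * tau p F v z))
       \<le> (\<Sum>v\<in>out S y. tauS p S u y * T p v z)" by simp
  qed
  finally show "tau p F u z \<le> (\<Sum>y\<in>S. \<Sum>v\<in>out S y. tauS p S u y * T p v z)" .
qed

lemma tauS_harris:
  assumes "finite S" "0 \<le> p" "p \<le> 1"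
  shows "tauS p S x u * tauS p S u y \<le> tauS p S x y"
proof -
  have fin: "finite (EI S)" by (rule fin_subD(1)[OF fin_sub_EI[OF assms(1)]])
  have "tauS p S x u * tauS p S u y \<le> bprob p (EI S) (\<lambda>\<xi>. conn \<xi> x u \<and> conn \<xi> u y)"
    unfolding tauS_def by (rule harris_prob[OF fin assms(2,3) incr_conn incr_conn])
  also have "\<dots> \<le> tauS p S x y"
    unfolding tauS_def by (rule bprob_mono[OF assms(2,3)]) (blast intro: conn_trans)
  finally show ?thesis .
qed

text \<open>A path from \<open>u\<close> to the nearby point \<open>z\<close> outside \<open>S\<close> costs \<open>Q^(2 - d)\<close>, and those leaving \<open>S\<close> farther than
  \<open>h Q\<^sup>2\<close> from \<open>u\<close> are rarer than that; Harris' inequality glues the others to a path from \<open>0\<close> to \<open>u\<close>.\<close>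

lemma layer_bound: "\<exists>C>0. \<exists>c>0. \<exists>h\<ge>1. \<forall>p S Q u z. 0 \<le> p \<longrightarrow> p \<le> pc \<longrightarrow> finite S \<longrightarrow> 1 \<le> Q \<longrightarrow> (pc - p) * (real Q)\<^sup>2 \<le> c \<longrightarrow>
    u \<in> S \<longrightarrow> z \<notin> S \<longrightarrow> norm_linf (z - u) \<le> int Q \<longrightarrow>
    tauS p S 0 u \<le> C * real Q ^ (CARD('d) - 2) * (\<Sum>y\<in>bdry S \<inter> bx u (h * Q\<^sup>2). tauS p S 0 y)"
proof -
  let ?d = "CARD('d)" and ?q = "CARD('d) - 2"
  obtain c where c: "c > 0" "\<And>p x y. 0 \<le> p \<Longrightarrow> p \<le> pc \<Longrightarrow> (pc - p) * (jb (x - y))\<^sup>2 \<le> c \<Longrightarrow> a / 2 / jb (x - y) ^ ?q \<le> T p x y"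
    using T_lower_near by blast
  define K where "K = real deg * b\<^sup>2 * 2 ^ ?q * (2 * sphc TYPE('d))"
  have K0: "0 \<le> K" by (simp add: K_def)
  obtain h0 :: nat where h0: "4 * K / a \<le> real h0" using real_arch_simple by blast
  \<comment> \<open>The part \<open>h0\<close> makes the distant exits at most half of the lower
    bound for \<open>T p u z\<close>; the other keeps \<open>h * Q\<^sup>2\<close> above
    \<open>2 * (L + Q)\<close>, so that points far from \<open>u\<close> are comparably far from
    \<open>z\<close>.\<close>
  define h where "h = max h0 (2 * (L + 1))"
  have h: "4 * K / a \<le> real h" "2 * (L + 1) \<le> h" "1 \<le> h" using h0 by (auto simp: h_def)
  have deg0: "0 < real deg"
  proof -
    have "0 < deg" unfolding deg_def card_box by simp
    then show ?thesis by simp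
  qed
  define C where "C = 4 * real deg / a"
  have C0: "C > 0" using deg0 ab by (simp add: C_def)
  have "tauS p S 0 u \<le> C * real Q ^ ?q * (\<Sum>y\<in>bdry S \<inter> bx u (h * Q\<^sup>2). tauS p S 0 y)"
    if p: "0 \<le> p" "p \<le> pc" and S: "finite S" and Q: "1 \<le> Q" "(pc - p) * (real Q)\<^sup>2 \<le> c" and u: "u \<in> S" and z: "z \<notin> S" "norm_linf (z - u) \<le> int Q" for p S Q u z
  proof -
    have p1: "p \<le> 1" using p pc_less_1 by simp
    define H where "H = h * Q\<^sup>2"
    have H1: "1 \<le> H" using h(3) Q(1) by (simp add: H_def)
    have H2: "2 * (L + Q) \<le> H"
    proof -
      have "Q \<le> Q\<^sup>2" "1 \<le> Q\<^sup>2" using Q(1) by (simp_all add: power2_nat_le_imp_le power2_eq_square)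
      then have "L * 1 + Q \<le> L * Q\<^sup>2 + Q\<^sup>2" by (intro add_mono mult_left_mono) auto
      then have "2 * (L + Q) \<le> 2 * (L + 1) * Q\<^sup>2" by (simp add: algebra_simps)
      also have "\<dots> \<le> h * Q\<^sup>2" by (rule mult_right_mono[OF h(2)]) simp
      finally show ?thesis by (simp add: H_def)
    qed
    have jbu: "jb (u - z) \<le> real Q" using z(2) Q(1) by (simp add: jb_def norm_linf_commute)
    have "(jb (u - z))\<^sup>2 \<le> (real Q)\<^sup>2" by (rule power_mono[OF jbu]) simp
    then have "(pc - p) * (jb (u - z))\<^sup>2 \<le> (pc - p) * (real Q)\<^sup>2" using p by (intro mult_left_mono) auto
    then have "a / 2 / jb (u - z) ^ ?q \<le> T p u z" using Q(2) by (intro c(2)[OF p]) linarith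
    moreover have "a / 2 / real Q ^ ?q \<le> a / 2 / jb (u - z) ^ ?q"
      using jbu ab Q(1) by (intro divide_left_mono power_mono mult_pos_pos) auto
    ultimately have low: "a / 2 / real Q ^ ?q \<le> T p u z" by linarith
    let ?f = "\<lambda>y. \<Sum>v\<in>out S y. tauS p S u y * T p v z"
    let ?N = "bdry S \<inter> bx u H"
    let ?X = "{y \<in> bdry S. y \<notin> bx u H}"
    have finX: "finite ?X" "finite ?N" "finite (bdry S)" using S by (auto simp: bdry_def)
    have "T p u z \<le> (\<Sum>y\<in>S. ?f y)" by (rule T_exit_le[OF p(1) p1 S u z(1)])
    also have "\<dots> = (\<Sum>y\<in>bdry S. ?f y)"
      by (rule sum.mono_neutral_right[OF S]) (auto simp: bdry_def)
    also have "\<dots> = (\<Sum>y\<in>?N \<union> ?X. ?f y)" by (rule sum.cong) auto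
    also have "\<dots> = (\<Sum>y\<in>?N. ?f y) + (\<Sum>y\<in>?X. ?f y)" by (rule sum.union_disjoint) (use finX in auto)
    also have "(\<Sum>y\<in>?N. ?f y) \<le> (\<Sum>y\<in>?N. real deg * tauS p S u y)"
    proof (rule sum_mono)
      fix y
      have "?f y \<le> (\<Sum>v\<in>out S y. tauS p S u y * 1)"
        by (intro sum_mono mult_left_mono T_le_1[OF p(1) p1] tauS_nonneg[OF p(1) p1])
      also have "\<dots> = real (card (out S y)) * tauS p S u y" by simp
      also have "\<dots> \<le> real deg * tauS p S u y"
        using finite_out(2)[of S y] by (intro mult_right_mono tauS_nonneg[OF p(1) p1]) auto
      finally show "?f y \<le> real deg * tauS p S u y" .
    qed
    also have "(\<Sum>y\<in>?X. ?f y) \<le> (\<Sum>y\<in>?X. real deg * b\<^sup>2 * 2 ^ ?q * (1 / jb (u - y) ^ (2 * ?q)))"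
    proof (rule sum_mono)
      fix y assume y: "y \<in> ?X"
      have one: "tauS p S u y * T p v z \<le> b\<^sup>2 * 2 ^ ?q * (1 / jb (u - y) ^ (2 * ?q))" if v: "v \<in> out S y" for v
      proof -
        have "norm_linf (y - v) \<le> int L" using edge_range[of y v] v by (auto simp: out_def)
        moreover have "norm_linf (u - y) \<le> norm_linf (u - z) + norm_linf (z - v) + norm_linf (v - y)"
          using norm_linf_triangle3[of u y z] norm_linf_triangle3[of z y v] by linarith
        moreover have "int H < norm_linf (u - y)" using y by (simp add: bx_def norm_linf_commute)
        ultimately have "norm_linf (u - y) \<le> 2 * norm_linf (v - z)"
          using z(2) H2 by (simp add: norm_linf_commute[of v z] norm_linf_commute[of u z] norm_linf_commute[of v y])
        then have half: "jb (u - y) / 2 \<le> jb (v - z)" by (auto simp: jb_def)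
        have "tauS p S u y * T p v z \<le> (b / jb (u - y) ^ ?q) * (b / jb (v - z) ^ ?q)"
          using tauS_le_T[OF S p(1) p1, of u y] T_le[OF p, of u y] T_le[OF p, of v z] b_pos
          by (intro mult_mono T_nonneg[OF p(1) p1]) auto
        also have "\<dots> \<le> (b / jb (u - y) ^ ?q) * (b / (jb (u - y) / 2) ^ ?q)"
          using half b_pos by (intro mult_left_mono divide_left_mono power_mono mult_pos_pos) auto
        also have "\<dots> = b\<^sup>2 * 2 ^ ?q * (1 / jb (u - y) ^ (2 * ?q))"
          by (simp add: power_divide power2_eq_square mult_2 power_add)
        finally show ?thesis .
      qed
      have "?f y \<le> (\<Sum>v\<in>out S y. b\<^sup>2 * 2 ^ ?q * (1 / jb (u - y) ^ (2 * ?q)))" by (rule sum_mono[OF one])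
      also have "\<dots> = real (card (out S y)) * (b\<^sup>2 * 2 ^ ?q * (1 / jb (u - y) ^ (2 * ?q)))" by simp
      also have "\<dots> \<le> real deg * (b\<^sup>2 * 2 ^ ?q * (1 / jb (u - y) ^ (2 * ?q)))"
        using finite_out(2)[of S y] by (intro mult_right_mono) auto
      finally show "?f y \<le> real deg * b\<^sup>2 * 2 ^ ?q * (1 / jb (u - y) ^ (2 * ?q))" by (simp add: mult.assoc)
    qed
    also have "\<dots> = real deg * b\<^sup>2 * 2 ^ ?q * (\<Sum>w\<in>(\<lambda>y. u - y) ` ?X. 1 / jb w ^ (2 * ?q))"
      unfolding sum_distrib_left by (subst sum.reindex) (auto simp: inj_on_def)
    also have "\<dots> \<le> real deg * b\<^sup>2 * 2 ^ ?q * (2 * sphc TYPE('d) / real H ^ (2 * ?q - ?d))"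
    proof (intro mult_left_mono sum_tail H1)
      show "?d < 2 * ?q" using dim by linarith
    qed (use finX in \<open>auto simp: bx_def norm_linf_commute\<close>)
    also have "\<dots> = K / real H ^ (?d - 4)"
    proof -
      have "2 * ?q - ?d = ?d - 4" using dim by linarith
      then show ?thesis by (simp add: K_def)
    qed
    \<comment> \<open>Here \<open>2 (d - 4) \<ge> d - 2\<close> is used: the radius
      \<open>Q^2\<close> makes distant exits as rare as \<open>Q ^ (2 - d)\<close>, which a radius
      of order \<open>Q\<close> would not.\<close>
    also have "\<dots> \<le> K / (real h * real Q ^ ?q)"
    proof (rule divide_left_mono[OF _ K0])
      have "real h * real Q ^ ?q \<le> real h ^ (?d - 4) * real Q ^ (2 * (?d - 4))"
        using h(3) Q(1) dim by (intro mult_mono self_le_power power_increasing) auto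
      also have "\<dots> = real H ^ (?d - 4)" by (simp add: H_def power_mult_distrib power_mult)
      finally show "real h * real Q ^ ?q \<le> real H ^ (?d - 4)" .
    qed (use h(3) Q(1) H1 in auto)
    also have "\<dots> \<le> a / 4 / real Q ^ ?q"
      using h(1,3) Q(1) ab by (simp add: field_simps)
    finally have "T p u z \<le> (\<Sum>y\<in>?N. real deg * tauS p S u y) + a / 4 / real Q ^ ?q" by (simp add: add_mono)
    then have key: "a / 4 / real Q ^ ?q \<le> real deg * (\<Sum>y\<in>?N. tauS p S u y)"
      using low by (simp add: sum_distrib_left)
    have "tauS p S 0 u * (a / 4 / real Q ^ ?q) \<le> tauS p S 0 u * (real deg * (\<Sum>y\<in>?N. tauS p S u y))"
      by (rule mult_left_mono[OF key tauS_nonneg[OF p(1) p1]])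
    also have "\<dots> = real deg * (\<Sum>y\<in>?N. tauS p S 0 u * tauS p S u y)" by (simp add: sum_distrib_left mult_ac)
    also have "\<dots> \<le> real deg * (\<Sum>y\<in>?N. tauS p S 0 y)"
      by (intro mult_left_mono sum_mono tauS_harris[OF S p(1) p1]) simp
    finally have "tauS p S 0 u * (a / 4 / real Q ^ ?q) \<le> real deg * (\<Sum>y\<in>?N. tauS p S 0 y)" .
    then have "tauS p S 0 u \<le> real deg * (\<Sum>y\<in>?N. tauS p S 0 y) / (a / 4 / real Q ^ ?q)"
      using ab Q(1) by (subst pos_le_divide_eq) auto
    also have "\<dots> = C * real Q ^ ?q * (\<Sum>y\<in>?N. tauS p S 0 y)" by (simp add: C_def)
    finally show ?thesis unfolding H_def .
  qed
  then show ?thesis using C0 c(1) h(3) by blast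
qed


lemma bx_sym: "u \<in> bx y n \<longleftrightarrow> y \<in> bx u n"
  by (simp add: bx_def norm_linf_commute)

lemma bx_mono: "m \<le> n \<Longrightarrow> bx y m \<subseteq> bx y n"
  by (force simp: bx_def)

lemma norm_bdry_box: "y \<in> bdry (box k) \<Longrightarrow> int k - int L < norm_linf y"
proof -
  assume "y \<in> bdry (box k)"
  then obtain v where v: "v \<notin> box k" "{y, v} \<in> \<E>" by (auto simp: bdry_def out_def)
  then show ?thesis using edge_range[OF v(2)] norm_linf_triangle_sub[of v y] by (simp add: box_def norm_linf_commute)
qed

lemma finite_bdry: "finite S \<Longrightarrow> finite (bdry S)"
  by (simp add: bdry_def)

text \<open>\<open>0\<close> lies outside the box \<open>B\<close> around \<open>y\<close>. Wiring
  the rim of \<open>B\<close> makes a large cluster near \<open>y\<close> an event inside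
  \<open>B\<close>, independent of the path from \<open>0\<close> before it enters. The sum over
  \<open>u\<close> is the price: the possible last vertices before the entrance.\<close>

lemma irregular_local:
  assumes N: "\<And>p F W y. 0 \<le> p \<Longrightarrow> p \<le> pc \<Longrightarrow> fin_sub F \<Longrightarrow> finite (\<Union>W) \<Longrightarrow>
      (\<forall>v\<in>bx y (\<beta> ^ 8). \<forall>w\<in>\<Union>W. int (L * (\<beta> ^ 11) ^ 6 + 1) \<le> norm_linf (w - v)) \<Longrightarrow>
      bprob p F (big_cluster W (bx y (\<beta> ^ 8)) (mass \<beta>)) \<le> \<delta>"
    and \<beta>: "1 \<le> \<beta>" "6 * L * \<beta> ^ 66 \<le> k" and p: "0 \<le> p" "p \<le> pc" and F: "fin_sub F" and y: "y \<in> bdry (box k)"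
  shows "bprob p F (\<lambda>\<xi>. conn (inside (box k) \<xi>) 0 y \<and> mass \<beta> \<le> card (clu \<xi> {0} \<inter> bx y (\<beta> ^ 8)))
    \<le> (\<Sum>u\<in>box k \<inter> bx y (5 * L * \<beta> ^ 66). tauS p (box k) 0 u) * \<delta>"
proof -
  have p1: "p \<le> 1" using p pc_less_1 by simp
  let ?b = "\<beta> ^ 66" and ?S = "box k :: (int ^ 'd) set" and ?M = "bx y (\<beta> ^ 8)"
  \<comment> \<open>The rim has thickness at most \<open>L\<close>, and it must stay
    \<open>L * \<beta> ^ 66 + 1\<close> away from the inner box of radius
    \<open>\<beta> ^ 8\<close>, since \<open>(\<beta> ^ 11) ^ 6 = \<beta> ^ 66\<close>.\<close>
  define D where "D = \<beta> ^ 8 + L * ?b + 1 + L"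
  define B where "B = bx y D"
  define W where "W = {{u, v} | u v. u \<in> {u \<in> B. \<exists>v. v \<notin> B \<and> {u, v} \<in> \<E>} \<and> v \<in> {u \<in> B. \<exists>v. v \<notin> B \<and> {u, v} \<in> \<E>}}"
  let ?A = "\<lambda>\<xi>. big_cluster W ?M (mass \<beta>) (inside B \<xi>)"
  have b1: "1 \<le> ?b" "\<beta> ^ 8 \<le> ?b" "L \<le> L * ?b" "?b \<le> L * ?b" using \<beta>(1) L_pos by (auto intro: power_increasing)
  then have D: "D + L \<le> 5 * L * ?b" using L_pos unfolding D_def by linarith
  have a: "0 \<notin> B" using norm_bdry_box[OF y] D \<beta>(2) b1 by (simp add: B_def bx_def)
  have mass0: "0 < mass \<beta>" using \<beta>(1) by (simp add: mass_def)
  have rim: "int (\<beta> ^ 8 + L * ?b + 1) \<le> norm_linf (u - y)" if "u \<in> B" "v \<notin> B" "{u, v} \<in> \<E>" for u v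
    using that edge_range[OF that(3)] norm_linf_triangle3[of v y u] by (simp add: B_def bx_def D_def norm_linf_commute)
  have "bprob p F (\<lambda>\<xi>. conn (inside ?S \<xi>) 0 y \<and> mass \<beta> \<le> card (clu \<xi> {0} \<inter> ?M)) \<le> bprob p F (\<lambda>\<xi>. conn (inside ?S \<xi>) 0 y \<and> ?A \<xi>)"
  proof (rule bprob_mono[OF p(1) p1])
    fix \<xi> assume w: "\<xi> \<subseteq> F" "conn (inside ?S \<xi>) 0 y \<and> mass \<beta> \<le> card (clu \<xi> {0} \<inter> ?M)"
    have "?A \<xi>" unfolding W_def
    proof (rule cluster_in_wired_box[OF a _ finite_bx mass0 _ w(1)])
      show "?M \<subseteq> B" unfolding B_def by (rule bx_mono) (simp add: D_def)
      show "mass \<beta> \<le> card (clu \<xi> {0} \<inter> ?M)" using w(2) by simp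
    qed (use fin_subD(2)[OF F] in blast)
    then show "conn (inside ?S \<xi>) 0 y \<and> ?A \<xi>" using w(2) by simp
  qed
  also have "\<dots> \<le> (\<Sum>u\<in>?S \<inter> bx y (5 * L * ?b). tau_in p F ?S 0 u) * bprob p F ?A"
  proof (rule first_entrance_decoupling[OF fin_subD(1)[OF F] p(1) p1 _ a])
    show "y \<in> B" by (simp add: B_def bx_def)
    show "\<And>\<xi>. ?A \<xi> = ?A (inside B \<xi>)" by (simp add: inside_def conj_ac)
    fix u v assume uv: "{u, v} \<in> F" "u \<in> ?S" "u \<notin> B" "v \<in> B"
    have "norm_linf (u - v) \<le> int L" using fin_subD(2)[OF F] uv(1) by (intro edge_range) auto
    then have "u \<in> bx y (D + L)" using norm_linf_triangle3[of u y v] uv(4) by (simp add: B_def bx_def)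
    then show "u \<in> ?S \<inter> bx y (5 * L * ?b)" using bx_mono[OF D] uv(2) by blast
  qed simp
  also have "\<dots> \<le> (\<Sum>u\<in>?S \<inter> bx y (5 * L * ?b). tauS p ?S 0 u) * \<delta>"
  proof (intro mult_mono sum_mono sum_nonneg)
    show "tau_in p F ?S 0 u \<le> tauS p ?S 0 u" for u
      by (rule bprob_inside_le[OF F finite_box p(1) p1])
    have "bprob p F ?A \<le> bprob p F (big_cluster W ?M (mass \<beta>))"
      by (rule bprob_mono[OF p(1) p1]) (erule incrD[OF incr_big_cluster[OF finite_bx] inside_subset])
    also have "\<dots> \<le> \<delta>"
    proof (rule N[OF p F])
      have sub: "\<Union>W \<subseteq> {u \<in> B. \<exists>v. v \<notin> B \<and> {u, v} \<in> \<E>}" unfolding W_def by blast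
      then show "finite (\<Union>W)" by (rule finite_subset) (simp add: B_def)
      show "\<forall>v\<in>?M. \<forall>w\<in>\<Union>W. int (L * (\<beta> ^ 11) ^ 6 + 1) \<le> norm_linf (w - v)"
      proof (intro ballI)
        fix v w assume v: "v \<in> ?M" and w: "w \<in> \<Union>W"
        obtain w' where "w \<in> B" "w' \<notin> B" "{w, w'} \<in> \<E>" using sub w by blast
        from rim[OF this] have "int (\<beta> ^ 8 + L * ?b + 1) \<le> norm_linf (w - v) + norm_linf (v - y)"
          using norm_linf_triangle3[of w y v] by linarith
        moreover have "(\<beta> ^ 11) ^ 6 = ?b" by (simp add: power_mult[symmetric])
        ultimately show "int (L * (\<beta> ^ 11) ^ 6 + 1) \<le> norm_linf (w - v)" using v by (simp add: bx_def)
      qed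
    qed
    finally show "bprob p F ?A \<le> \<delta>" .
  qed (simp_all add: bprob_nonneg[OF p(1) p1] tauS_nonneg[OF p(1) p1])
  finally show ?thesis .
qed

text \<open>\<open>layer_bound\<close> is summed over the layer. A boundary vertex \<open>y'\<close>
  is used by at most order \<open>Q ^ (2 d)\<close> points \<open>u\<close>, each near at most order
  \<open>Q ^ d\<close> vertices \<open>y\<close>; with the factor \<open>Q ^ (d - 2)\<close> this is
  the exponent \<open>4 d - 2\<close>.\<close>

lemma layer_sum: "\<exists>C>0. \<exists>c>0. \<forall>p k Q r. 0 \<le> p \<longrightarrow> p \<le> pc \<longrightarrow> 1 \<le> Q \<longrightarrow> (pc - p) * (real Q)\<^sup>2 \<le> c \<longrightarrow> r + L \<le> Q \<longrightarrow>
    (\<Sum>y\<in>bdry (box k). \<Sum>u\<in>box k \<inter> bx y r. tauS p (box k) 0 u)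
      \<le> C * real Q ^ (4 * CARD('d) - 2) * (\<Sum>y\<in>bdry (box k). tauS p (box k) 0 y)"
proof -
  let ?d = "CARD('d)"
  obtain C c h where C: "C > 0" "c > 0" "1 \<le> h" "\<And>p S Q u z. 0 \<le> p \<Longrightarrow> p \<le> pc \<Longrightarrow> finite S \<Longrightarrow> 1 \<le> Q \<Longrightarrow> (pc - p) * (real Q)\<^sup>2 \<le> c \<Longrightarrow>
    u \<in> S \<Longrightarrow> z \<notin> S \<Longrightarrow> norm_linf (z - u) \<le> int Q \<Longrightarrow>
    tauS p S 0 u \<le> C * real Q ^ (?d - 2) * (\<Sum>y\<in>bdry S \<inter> bx u (h * Q\<^sup>2). tauS p S 0 y)"
    using layer_bound by metis
  define C' where "C' = C * (3 ^ ?d * ((3 * real h) ^ ?d))"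
  have "(\<Sum>y\<in>bdry (box k). \<Sum>u\<in>box k \<inter> bx y r. tauS p (box k) 0 u)
      \<le> C' * real Q ^ (4 * ?d - 2) * (\<Sum>y\<in>bdry (box k). tauS p (box k) 0 y)"
    if p: "0 \<le> p" "p \<le> pc" and Q: "1 \<le> Q" "(pc - p) * (real Q)\<^sup>2 \<le> c" "r + L \<le> Q" for p k Q r
  proof -
    have p1: "p \<le> 1" using p pc_less_1 by simp
    let ?S = "box k :: (int ^ 'd) set" and ?H = "h * Q\<^sup>2"
    let ?B = "bdry ?S"
    have finB: "finite ?B" by (simp add: finite_bdry)
    have near: "\<exists>z. z \<notin> ?S \<and> norm_linf (z - u) \<le> int Q" if yu: "y \<in> ?B" "u \<in> bx y r" for y u
    proof -
      obtain z where z: "z \<notin> ?S" "{y, z} \<in> \<E>" using yu(1) by (auto simp: bdry_def out_def)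
      have "norm_linf (z - u) \<le> int L + int r"
        using edge_range[OF z(2)] yu(2) norm_linf_triangle3[of z u y] by (simp add: bx_def norm_linf_commute)
      then show ?thesis using z(1) Q(3) by (intro exI[of _ z]) auto
    qed
    have "(\<Sum>y\<in>?B. \<Sum>u\<in>?S \<inter> bx y r. tauS p ?S 0 u)
       \<le> (\<Sum>y\<in>?B. \<Sum>u\<in>?S \<inter> bx y r. C * real Q ^ (?d - 2) * (\<Sum>y'\<in>?B. of_bool (y' \<in> bx u ?H) * tauS p ?S 0 y'))"
    proof (intro sum_mono)
      fix y u assume y: "y \<in> ?B" and u: "u \<in> ?S \<inter> bx y r"
      obtain z where z: "z \<notin> ?S" "norm_linf (z - u) \<le> int Q" using near[OF y] u by blast
      have "tauS p ?S 0 u \<le> C * real Q ^ (?d - 2) * (\<Sum>y'\<in>?B \<inter> bx u ?H. tauS p ?S 0 y')"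
        by (rule C(4)[OF p finite_box Q(1,2) _ z]) (use u in simp)
      also have "(\<Sum>y'\<in>?B \<inter> bx u ?H. tauS p ?S 0 y') = (\<Sum>y'\<in>?B. of_bool (y' \<in> bx u ?H) * tauS p ?S 0 y')"
        by (rule sum.mono_neutral_cong_left[OF finB]) auto
      finally show "tauS p ?S 0 u \<le> C * real Q ^ (?d - 2) * (\<Sum>y'\<in>?B. of_bool (y' \<in> bx u ?H) * tauS p ?S 0 y')" .
    qed
    also have "\<dots> = C * real Q ^ (?d - 2) * (\<Sum>y'\<in>?B. (\<Sum>y\<in>?B. \<Sum>u\<in>?S \<inter> bx y r. of_bool (y' \<in> bx u ?H)) * tauS p ?S 0 y')"
      unfolding sum_distrib_left[symmetric] sum_distrib_right
      by (subst sum.swap, subst sum.swap[of _ _ "?S \<inter> bx _ r"]) (simp add: sum_distrib_right)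
    also have "\<dots> \<le> C * real Q ^ (?d - 2) * (\<Sum>y'\<in>?B. ((3 * real Q) ^ ?d * (3 * real ?H) ^ ?d) * tauS p ?S 0 y')"
    proof (intro mult_left_mono sum_mono mult_right_mono tauS_nonneg[OF p(1) p1])
      fix y' assume "y' \<in> ?B"
      have "(\<Sum>y\<in>?B. \<Sum>u\<in>?S \<inter> bx y r. of_bool (y' \<in> bx u ?H)) \<le> (\<Sum>u\<in>bx y' ?H. \<Sum>y\<in>bx u r. 1 :: real)"
      proof -
        have "(\<Sum>y\<in>?B. \<Sum>u\<in>?S \<inter> bx y r. of_bool (y' \<in> bx u ?H)) = (\<Sum>(y, u)\<in>Sigma ?B (\<lambda>y. ?S \<inter> bx y r). of_bool (y' \<in> bx u ?H) :: real)"
          by (rule sum.Sigma) (use finB in auto)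
        also have "\<dots> = (\<Sum>(y, u)\<in>{(y, u) \<in> Sigma ?B (\<lambda>y. ?S \<inter> bx y r). y' \<in> bx u ?H}. 1)"
          by (rule sum.mono_neutral_cong_right) (use finB in auto)
        also have "\<dots> = real (card {(y, u) \<in> Sigma ?B (\<lambda>y. ?S \<inter> bx y r). y' \<in> bx u ?H})" by (simp add: case_prod_beta)
        also have "\<dots> \<le> real (card ((\<lambda>(u, y). (y, u)) ` Sigma (bx y' ?H) (\<lambda>u. bx u r)))"
          by (intro of_nat_mono card_mono finite_imageI finite_SigmaI) (auto simp: bx_sym image_iff)
        also have "\<dots> = real (card (Sigma (bx y' ?H) (\<lambda>u. bx u r)))" by (subst card_image) (auto simp: inj_on_def)
        also have "\<dots> = (\<Sum>u\<in>bx y' ?H. \<Sum>y\<in>bx u r. 1)" by (subst card_SigmaI) auto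
        finally show ?thesis .
      qed
      also have "\<dots> \<le> (\<Sum>u\<in>bx y' ?H. (3 * real Q) ^ ?d)"
      proof (rule sum_mono)
        fix u :: "int ^ 'd"
        have "(\<Sum>y\<in>bx u r. 1 :: real) \<le> real (card (bx u Q))"
          using Q(3) by (simp, intro card_mono finite_bx bx_mono) simp
        also have "\<dots> \<le> (3 * real Q) ^ ?d" by (rule card_bx_le[OF Q(1)])
        finally show "(\<Sum>y\<in>bx u r. 1) \<le> (3 * real Q) ^ ?d" .
      qed
      also have "\<dots> \<le> (3 * real Q) ^ ?d * (3 * real ?H) ^ ?d"
        using card_bx_le[of ?H y'] C(3) Q(1) by (simp add: mult.commute)
      finally show "(\<Sum>y\<in>?B. \<Sum>u\<in>?S \<inter> bx y r. of_bool (y' \<in> bx u ?H)) \<le> (3 * real Q) ^ ?d * (3 * real ?H) ^ ?d" .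
    qed (use C(1) in auto)
    also have "\<dots> = C * real Q ^ (?d - 2) * ((3 * real Q) ^ ?d * (3 * real ?H) ^ ?d) * (\<Sum>y\<in>?B. tauS p ?S 0 y)"
      unfolding sum_distrib_left[symmetric] by (simp only: mult.assoc)
    also have "C * real Q ^ (?d - 2) * ((3 * real Q) ^ ?d * (3 * real ?H) ^ ?d) = C' * real Q ^ (4 * ?d - 2)"
    proof -
      have "4 * ?d - 2 = (?d - 2) + (?d + 2 * ?d)" using dim by simp
      then have "real Q ^ (4 * ?d - 2) = real Q ^ (?d - 2) * (real Q ^ ?d * (real Q)\<^sup>2 ^ ?d)"
        by (simp only: power_add power_mult)
      then show ?thesis by (simp only: C'_def power_mult_distrib of_nat_mult of_nat_power mult_ac)
    qed
    finally show ?thesis .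
  qed
  moreover have "C' > 0" using C(1,3) by (simp add: C'_def)
  ultimately show ?thesis using C(2) by blast
qed

text \<open>Two regimes. If the wired box fits at scale \<open>m\<close>, locality and the layer
  bound give a small multiple of the boundary sum. Otherwise \<open>\<beta>\<close> is at least a
  power of \<open>m\<close>, and the unconditional estimate without wiring beats the number of
  boundary vertices, which is the error term.\<close>

lemma irregular_scale: "\<exists>N\<ge>1. \<exists>C>0. \<exists>c>0. \<forall>\<beta>\<ge>N. \<forall>p k m F. 0 \<le> p \<longrightarrow> p \<le> pc \<longrightarrow> 1 \<le> m \<longrightarrow> m \<le> k \<longrightarrow> (pc - p) * (real m)\<^sup>2 \<le> c \<longrightarrow> fin_sub F \<longrightarrow>
    (\<Sum>y\<in>bdry (box k). bprob p F (\<lambda>\<xi>. conn (inside (box k) \<xi>) 0 y \<and> mass \<beta> \<le> card (clu \<xi> {0} \<inter> bx y (\<beta> ^ 8))))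
      \<le> ((\<Sum>y\<in>bdry (box k). tauS p (box k) 0 y) / 4 + C * real k ^ CARD('d) / real m ^ (CARD('d) + 1)) / real \<beta>"
proof -
  let ?d = "CARD('d)" and ?e = "4 * CARD('d) - 2"
  \<comment> \<open>The layer costs \<open>\<beta> ^ (66 (4 d - 2))\<close>. Of the two further
    powers, one absorbs the constant and one remains as the summable factor.\<close>
  define A where "A = 66 * ?e + 2"
  obtain N0 where N0: "1 \<le> N0" "\<And>\<beta> p F W y. N0 \<le> \<beta> \<Longrightarrow> 0 \<le> p \<Longrightarrow> p \<le> pc \<Longrightarrow> fin_sub F \<Longrightarrow> finite (\<Union>W) \<Longrightarrow>
      (\<forall>v\<in>bx y (\<beta> ^ 8). \<forall>w\<in>\<Union>W. int (L * (\<beta> ^ 11) ^ 6 + 1) \<le> norm_linf (w - v)) \<Longrightarrow>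
      bprob p F (big_cluster W (bx y (\<beta> ^ 8)) (mass \<beta>)) \<le> 1 / real \<beta> ^ A"
    using big_cluster_unlikely[of A] by metis
  obtain C2 c where C2: "C2 > 0" "c > 0" "\<And>p k Q r. 0 \<le> p \<Longrightarrow> p \<le> pc \<Longrightarrow> 1 \<le> Q \<Longrightarrow> (pc - p) * (real Q)\<^sup>2 \<le> c \<Longrightarrow> r + L \<le> Q \<Longrightarrow>
    (\<Sum>y\<in>bdry (box k). \<Sum>u\<in>box k \<inter> bx y r. tauS p (box k) 0 u) \<le> C2 * real Q ^ ?e * (\<Sum>y\<in>bdry (box k). tauS p (box k) 0 y)"
    using layer_sum by metis
  obtain N1 :: nat where N1: "4 * (C2 * real (6 * L) ^ ?e) \<le> real N1" using real_arch_simple by blast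
  define C where "C = 3 ^ ?d * real (6 * L) ^ (?d + 1)"
  have C0: "C > 0" using L_pos by (simp add: C_def)
  have "(\<Sum>y\<in>bdry (box k). bprob p F (\<lambda>\<xi>. conn (inside (box k) \<xi>) 0 y \<and> mass \<beta> \<le> card (clu \<xi> {0} \<inter> bx y (\<beta> ^ 8))))
      \<le> ((\<Sum>y\<in>bdry (box k). tauS p (box k) 0 y) / 4 + C * real k ^ ?d / real m ^ (?d + 1)) / real \<beta>"
    if \<beta>: "max N0 N1 \<le> \<beta>" and p: "0 \<le> p" "p \<le> pc" and m: "1 \<le> m" "m \<le> k" "(pc - p) * (real m)\<^sup>2 \<le> c" and F: "fin_sub F" for \<beta> p k m F
  proof -
    have p1: "p \<le> 1" using p pc_less_1 by simp
    let ?B = "bdry (box k :: (int ^ 'd) set)" and ?b = "\<beta> ^ 66" and ?x = "real \<beta>"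
    let ?\<Phi> = "\<Sum>y\<in>?B. tauS p (box k) 0 y"
    have \<Phi>: "0 \<le> ?\<Phi>" by (intro sum_nonneg tauS_nonneg p p1)
    have \<beta>1: "1 \<le> \<beta>" "N0 \<le> \<beta>" "4 * (C2 * real (6 * L) ^ ?e) \<le> ?x" using \<beta> N0(1) N1 by auto
    have x1: "1 \<le> ?x" "0 < ?x" using \<beta>1 by auto
    show ?thesis
    proof (cases "6 * L * ?b \<le> m")
      case True
      define Q where "Q = 6 * L * ?b"
      have Q1: "1 \<le> Q" "Q \<le> m" "5 * L * ?b + L \<le> Q" using True L_pos \<beta>1 by (auto simp: Q_def)
      have "(pc - p) * (real Q)\<^sup>2 \<le> (pc - p) * (real m)\<^sup>2" using p Q1(2) by (intro mult_left_mono power_mono) auto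
      then have Qc: "(pc - p) * (real Q)\<^sup>2 \<le> c" using m(3) by linarith
      have "(\<Sum>y\<in>?B. bprob p F (\<lambda>\<xi>. conn (inside (box k) \<xi>) 0 y \<and> mass \<beta> \<le> card (clu \<xi> {0} \<inter> bx y (\<beta> ^ 8))))
         \<le> (\<Sum>y\<in>?B. (\<Sum>u\<in>box k \<inter> bx y (5 * L * ?b). tauS p (box k) 0 u) * (1 / ?x ^ A))"
        using True m(2) by (intro sum_mono irregular_local N0(2) \<beta>1 p F) auto
      also have "\<dots> \<le> (C2 * real Q ^ ?e * ?\<Phi>) * (1 / ?x ^ A)"
        unfolding sum_distrib_right[symmetric] by (intro mult_right_mono C2(3) p Q1 Qc) (use x1 in auto)
      also have "\<dots> = (C2 * real (6 * L) ^ ?e) * ?\<Phi> / ?x\<^sup>2"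
      proof -
        define X where "X = ?x ^ (66 * ?e)"
        have "real Q ^ ?e = real (6 * L) ^ ?e * X" by (simp add: Q_def X_def power_mult_distrib power_mult)
        moreover have "?x ^ A = X * ?x\<^sup>2" by (simp only: A_def X_def power_add)
        moreover have "0 < X" using x1 by (simp add: X_def)
        ultimately show ?thesis using x1 by (simp only: mult_ac times_divide_eq_right mult_1_right mult_divide_mult_cancel_left_if) simp
      qed
      also have "\<dots> \<le> (?x / 4) * ?\<Phi> / ?x\<^sup>2"
        using \<beta>1(3) by (intro divide_right_mono mult_right_mono \<Phi>) auto
      also have "\<dots> = ?\<Phi> / 4 / ?x" using x1 by (simp add: power2_eq_square)
      also have "\<dots> \<le> (?\<Phi> / 4 + C * real k ^ ?d / real m ^ (?d + 1)) / ?x"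
        using C0 x1 by (intro divide_right_mono) auto
      finally show ?thesis .
    next
      case False
      have big: "real m ^ (?d + 1) * ?x \<le> real (6 * L) ^ (?d + 1) * ?x ^ A"
      proof -
        have "m \<le> 6 * L * ?b" using False by simp
        then have "real m \<le> real (6 * L) * ?x ^ 66" by (simp only: of_nat_power[symmetric] of_nat_mult[symmetric] of_nat_le_iff)
        then have "real m ^ (?d + 1) \<le> real (6 * L) ^ (?d + 1) * ?x ^ (66 * (?d + 1))"
          unfolding power_mult power_mult_distrib[symmetric] by (intro power_mono) auto
        then have "real m ^ (?d + 1) * ?x \<le> real (6 * L) ^ (?d + 1) * ?x ^ (66 * (?d + 1)) * ?x"
          using x1 by (intro mult_right_mono) auto
        also have "\<dots> = real (6 * L) ^ (?d + 1) * ?x ^ (66 * (?d + 1) + 1)" by (simp only: power_add power_one_right mult.assoc)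
        also have "\<dots> \<le> real (6 * L) ^ (?d + 1) * ?x ^ A"
          using dim x1 by (intro mult_left_mono power_increasing) (auto simp: A_def)
        finally show ?thesis .
      qed
      have "(\<Sum>y\<in>?B. bprob p F (\<lambda>\<xi>. conn (inside (box k) \<xi>) 0 y \<and> mass \<beta> \<le> card (clu \<xi> {0} \<inter> bx y (\<beta> ^ 8)))) \<le> (\<Sum>y\<in>?B. 1 / ?x ^ A)"
      proof (rule sum_mono)
        fix y
        have "bprob p F (\<lambda>\<xi>. conn (inside (box k) \<xi>) 0 y \<and> mass \<beta> \<le> card (clu \<xi> {0} \<inter> bx y (\<beta> ^ 8)))
           \<le> bprob p F (big_cluster {} (bx y (\<beta> ^ 8)) (mass \<beta>))"
          by (rule bprob_mono[OF p(1) p1]) (auto simp: big_cluster_def)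
        also have "\<dots> \<le> 1 / ?x ^ A" by (rule N0(2)[OF \<beta>1(2) p F]) auto
        finally show "bprob p F (\<lambda>\<xi>. conn (inside (box k) \<xi>) 0 y \<and> mass \<beta> \<le> card (clu \<xi> {0} \<inter> bx y (\<beta> ^ 8))) \<le> 1 / ?x ^ A" .
      qed
      also have "\<dots> = real (card ?B) * (1 / ?x ^ A)" by simp
      also have "\<dots> \<le> (3 * real k) ^ ?d * (1 / ?x ^ A)"
      proof (rule mult_right_mono)
        have "card ?B \<le> card (bx (0 :: int ^ 'd) k)" by (intro card_mono finite_bx) (auto simp: bdry_def bx_def box_def)
        then show "real (card ?B) \<le> (3 * real k) ^ ?d" using card_bx_le[of k "0 :: int ^ 'd"] m by linarith
      qed simp
      also have "\<dots> \<le> (3 * real k) ^ ?d * (real (6 * L) ^ (?d + 1) / (real m ^ (?d + 1) * ?x))"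
        using big m(1) x1 by (intro mult_left_mono) (simp_all add: field_simps)
      also have "\<dots> = (C * real k ^ ?d / real m ^ (?d + 1)) / ?x" by (simp add: C_def power_mult_distrib)
      also have "\<dots> \<le> (?\<Phi> / 4 + C * real k ^ ?d / real m ^ (?d + 1)) / ?x" using \<Phi> x1 by (intro divide_right_mono) auto
      finally show ?thesis .
    qed
  qed
  moreover have "1 \<le> max N0 N1" using N0(1) by simp
  ultimately show ?thesis using C0 C2(2) by blast
qed

text \<open>Thinness of the cluster of \<open>0\<close> around \<open>y\<close> at all scales from
  \<open>i\<close> on. Only dyadic \<open>\<beta>\<close> occur, so that the failure bounds
  \<open>1 / 2 ^ j\<close> are summable.\<close>

definition regular :: "nat \<Rightarrow> int ^ 'd \<Rightarrow> 'd edge set \<Rightarrow> bool" where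
  "regular i y \<xi> \<longleftrightarrow> (\<forall>j\<ge>i. card (clu \<xi> {0} \<inter> bx y ((2 ^ j) ^ 8)) < mass (2 ^ j))"

lemma sum_dyadic_le: "(\<Sum>j\<in>{i..<n}. 1 / 2 ^ j :: real) \<le> 2"
proof -
  have "(\<Sum>j\<in>{i..<n}. 1 / 2 ^ j :: real) \<le> (\<Sum>j<n. (1 / 2) ^ j)"
    unfolding power_one_over[symmetric] by (rule sum_mono2) auto
  also have "\<dots> \<le> 2" by (simp add: sum_gp_strict)
  finally show ?thesis .
qed

text \<open>Over a finite edge set the mass eventually exceeds the number of vertices, so only
  finitely many scales can fail.\<close>

lemma le_mass: "j \<le> mass (2 ^ j)"
proof -
  have "j \<le> 2 ^ j" using less_exp[of j] by simp
  also have "\<dots> \<le> mass (2 ^ j)" unfolding mass_def by (rule self_le_power) (use dim in auto)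
  finally show ?thesis .
qed

text \<open>Summing over scales doubles the constants; the share 1/4 becomes 1/2, which can still be
  absorbed by the full boundary sum.\<close>

lemma irregular_total: "\<exists>i0. \<exists>C>0. \<exists>c>0. \<forall>i\<ge>i0. \<forall>p k m F. 0 \<le> p \<longrightarrow> p \<le> pc \<longrightarrow> 1 \<le> m \<longrightarrow> m \<le> k \<longrightarrow> (pc - p) * (real m)\<^sup>2 \<le> c \<longrightarrow> fin_sub F \<longrightarrow>
    (\<Sum>y\<in>bdry (box k). bprob p F (\<lambda>\<xi>. conn (inside (box k) \<xi>) 0 y \<and> \<not> regular i y \<xi>))
      \<le> (\<Sum>y\<in>bdry (box k). tauS p (box k) 0 y) / 2 + C * real k ^ CARD('d) / real m ^ (CARD('d) + 1)"
proof -
  let ?d = "CARD('d)"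
  define P where "P N C c \<longleftrightarrow> (\<forall>\<beta>\<ge>N. \<forall>p k m F. 0 \<le> p \<longrightarrow> p \<le> pc \<longrightarrow> 1 \<le> m \<longrightarrow> m \<le> k \<longrightarrow> (pc - p) * (real m)\<^sup>2 \<le> c \<longrightarrow> fin_sub F \<longrightarrow>
    (\<Sum>y\<in>bdry (box k). bprob p F (\<lambda>\<xi>. conn (inside (box k) \<xi>) 0 y \<and> mass \<beta> \<le> card (clu \<xi> {0} \<inter> bx y (\<beta> ^ 8))))
      \<le> ((\<Sum>y\<in>bdry (box k). tauS p (box k) 0 y) / 4 + C * real k ^ ?d / real m ^ (?d + 1)) / real \<beta>)" for N C c
  have "\<exists>N\<ge>1. \<exists>C>0. \<exists>c>0. P N C c" unfolding P_def by (rule irregular_scale)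
  then obtain N C c where N: "1 \<le> N" "C > 0" "c > 0" "P N C c" by blast
  have "(\<Sum>y\<in>bdry (box k). bprob p F (\<lambda>\<xi>. conn (inside (box k) \<xi>) 0 y \<and> \<not> regular i y \<xi>))
      \<le> (\<Sum>y\<in>bdry (box k). tauS p (box k) 0 y) / 2 + (2 * C) * real k ^ ?d / real m ^ (?d + 1)"
    if i: "N \<le> i" and p: "0 \<le> p" "p \<le> pc" and m: "1 \<le> m" "m \<le> k" "(pc - p) * (real m)\<^sup>2 \<le> c" and F: "fin_sub F" for i p k m F
  proof -
    have p1: "p \<le> 1" using p pc_less_1 by simp
    let ?B = "bdry (box k :: (int ^ 'd) set)" and ?E = "\<lambda>y j \<xi>. conn (inside (box k) \<xi>) 0 y \<and> mass (2 ^ j) \<le> card (clu \<xi> {0} \<inter> bx y ((2 ^ j) ^ 8))"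
    define X where "X = (\<Sum>y\<in>?B. tauS p (box k) 0 y) / 4 + C * real k ^ ?d / real m ^ (?d + 1)"
    have X0: "0 \<le> X" unfolding X_def using N(2) by (intro add_nonneg_nonneg divide_nonneg_nonneg sum_nonneg tauS_nonneg p p1) auto
    define n where "n = Suc (card ({0} \<union> \<Union>F))"
    have "(\<Sum>y\<in>?B. bprob p F (\<lambda>\<xi>. conn (inside (box k) \<xi>) 0 y \<and> \<not> regular i y \<xi>)) \<le> (\<Sum>y\<in>?B. \<Sum>j\<in>{i..<n}. bprob p F (?E y j))"
    proof (intro sum_mono bprob_union_le[OF p(1) p1])
      fix y \<xi> assume w: "\<xi> \<subseteq> F" "conn (inside (box k) \<xi>) 0 y \<and> \<not> regular i y \<xi>"
      then obtain j where j: "i \<le> j" "mass (2 ^ j) \<le> card (clu \<xi> {0} \<inter> bx y ((2 ^ j) ^ 8))" by (auto simp: regular_def not_less)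
      have "clu \<xi> {0} \<subseteq> {0} \<union> \<Union>F" unfolding clu_def using w(1) conn_in_Union[of \<xi> 0] by fastforce
      then have "card (clu \<xi> {0} \<inter> bx y ((2 ^ j) ^ 8)) \<le> card ({0} \<union> \<Union>F)"
        by (intro card_mono) (use fin_subD(3)[OF F] in auto)
      then have "j < n" using j(2) le_mass[of j] by (simp add: n_def)
      then show "\<exists>j\<in>{i..<n}. ?E y j \<xi>" using j w(2) by auto
    qed simp
    also have "\<dots> = (\<Sum>j\<in>{i..<n}. \<Sum>y\<in>?B. bprob p F (?E y j))" by (rule sum.swap)
    also have "\<dots> \<le> (\<Sum>j\<in>{i..<n}. X * (1 / 2 ^ j))"
    proof (rule sum_mono)
      fix j assume "j \<in> {i..<n}"
      then have "N \<le> j" using i by simp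
      also have "j \<le> 2 ^ j" by (simp add: less_imp_le)
      finally have "N \<le> 2 ^ j" .
      from N(4)[unfolded P_def, rule_format, OF this p m F] show "(\<Sum>y\<in>?B. bprob p F (?E y j)) \<le> X * (1 / 2 ^ j)" by (simp add: X_def)
    qed
    also have "\<dots> \<le> X * 2" unfolding sum_distrib_left[symmetric] by (rule mult_left_mono[OF sum_dyadic_le X0])
    finally show ?thesis by (simp add: X_def)
  qed
  note main = this
  show ?thesis
  proof (intro exI conjI allI impI)
    show "0 < 2 * C" "0 < c" using N(2,3) by simp_all
  qed (rule main)
qed

lemma sum_of_bool_times: "finite C \<Longrightarrow> (\<Sum>v\<in>C. of_bool (v \<in> X) * h) = real (card (C \<inter> X)) * (h :: real)"
  by (subst sum_distrib_right[symmetric], simp only: of_bool_def sum.inter_filter[symmetric] Int_def) simp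

text \<open>Averaging over \<open>W\<close>: the points of \<open>C\<close> at scale \<open>2^(8 j)\<close> contribute at most
  \<open>mass (2^(j+1)) / 2^(8 j (d - 2))\<close>, of order \<open>4^(- j)\<close>.\<close>

lemma thin_point: "\<exists>K>0. \<forall>i (y :: int ^ 'd) W C. finite C \<longrightarrow> (\<forall>j\<ge>i. card (C \<inter> bx y ((2 ^ j) ^ 8)) < mass (2 ^ j)) \<longrightarrow>
    W \<subseteq> bx y (3 * (2 ^ i) ^ 8) \<longrightarrow> ((2 ^ i) ^ 8) ^ CARD('d) \<le> card W \<longrightarrow>
    (\<exists>z\<in>W. (\<Sum>v\<in>C. 1 / jb (z - v) ^ (CARD('d) - 2)) \<le> K / 2 ^ i)"
proof -
  let ?d = "CARD('d)" and ?q = "CARD('d) - 2"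
  have d2: "2 < ?d" using dim by simp
  obtain C1 where C1: "C1 > 0" "\<And>X z v n. 1 \<le> n \<Longrightarrow> \<forall>x\<in>X. norm_linf (x - z) \<le> int n \<Longrightarrow>
    finite X \<and> (\<Sum>x\<in>X. 1 / jb (x - v :: int ^ 'd) ^ ?q) \<le> C1 * (real n)\<^sup>2"
    using sum_shifted_box_le[OF d2] by blast
  \<comment> \<open>\<open>9 * C1\<close> serves points of \<open>C\<close> near the box that
    contains \<open>W\<close>, where the sum over \<open>W\<close> is of order
    \<open>(3 R)^2\<close>; \<open>2 ^ ?q\<close> serves distant points.\<close>
  define K0 where "K0 = max (9 * C1) (2 ^ ?q)"
  have K0: "9 * C1 \<le> K0" "2 ^ ?q \<le> K0" "0 < K0" using C1(1) by (auto simp: K0_def)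
  define K where "K = K0 * 2 ^ (8 * ?q - 2) * 2"
  have "\<exists>z\<in>W. (\<Sum>v\<in>C. 1 / jb (z - v) ^ ?q) \<le> K / 2 ^ i"
    if C: "finite C" "\<And>j. i \<le> j \<Longrightarrow> card (C \<inter> bx y ((2 ^ j) ^ 8)) < mass (2 ^ j)"
      and W: "W \<subseteq> bx y (3 * (2 ^ i) ^ 8)" "((2 ^ i) ^ 8) ^ ?d \<le> card W" for i and y :: "int ^ 'd" and W C
  proof -
    define R :: "nat \<Rightarrow> nat" where "R j = (2 ^ j) ^ 8" for j
    have R1: "1 \<le> R j" and R0: "0 < R j" and Rm: "i' \<le> j \<Longrightarrow> R i' \<le> R j" and RS: "R (Suc j) = 256 * R j" for i' j
      by (auto simp: R_def power_mult_distrib intro!: power_mono power_increasing)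
    have Rj: "j < R j" for j
    proof -
      have "j < 2 ^ j" by (rule less_exp)
      also have "\<dots> \<le> R j" unfolding R_def by (rule self_le_power) auto
      finally show ?thesis .
    qed
    have Wc: "real (R i) ^ ?d \<le> real (card W)" using W(2) by (simp only: R_def[symmetric] of_nat_power[symmetric] of_nat_le_iff)
    then have Wc0: "0 < real (card W)" using R0[of i] by (meson less_le_trans of_nat_0_less_iff zero_less_power)
    have finW: "finite W" by (rule finite_subset[OF W(1) finite_bx])
    have Wd: "norm_linf (z - y) \<le> 3 * int (R i)" if "z \<in> W" for z
      using that W(1) by (auto simp: bx_def R_def)
    define n where "n = Suc (Suc i) + nat (\<Sum>v\<in>C. norm_linf (v - y))"
    have Cn: "norm_linf (v - y) < int n" if "v \<in> C" for v
      using member_le_sum[of v C "\<lambda>v. norm_linf (v - y)"] that C(1) by (simp add: n_def)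
    let ?h = "\<lambda>v. \<Sum>j\<in>{i..<n}. of_bool (v \<in> bx y (R (Suc j))) * (1 / real (R j) ^ ?q)"
    have h0: "of_bool (v \<in> bx y (R (Suc j))) * (1 / real (R j) ^ ?q) \<le> ?h v" if "i \<le> j" "j < n" for j v
      by (rule member_le_sum[of j "{i..<n}" "\<lambda>j. of_bool (v \<in> bx y (R (Suc j))) * (1 / real (R j) ^ ?q)"]) (use that in auto)
    have g: "(\<Sum>z\<in>W. 1 / jb (z - v) ^ ?q) \<le> real (card W) * (K0 * ?h v)" if v: "v \<in> C" for v
    proof (cases "v \<in> bx y (R (Suc i))")
      case True
      have "(\<Sum>z\<in>W. 1 / jb (z - v) ^ ?q) \<le> C1 * (real (3 * R i))\<^sup>2"
        using C1(2)[of "3 * R i" W y v] Wd R1[of i] by auto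
      also have "\<dots> = 9 * C1 * (real (R i))\<^sup>2" by (simp add: power2_eq_square)
      also have "\<dots> \<le> K0 * (real (R i))\<^sup>2" by (intro mult_right_mono K0) simp
      also have "\<dots> = real (R i) ^ ?d * (K0 * (1 / real (R i) ^ ?q))"
      proof -
        have "?d = 2 + ?q" using d2 by simp
        then have "real (R i) ^ ?d = (real (R i))\<^sup>2 * real (R i) ^ ?q" by (metis power_add)
        then show ?thesis using R0[of i] by simp
      qed
      also have "\<dots> \<le> real (card W) * (K0 * ?h v)"
        using h0[of i v] True K0(3) by (intro mult_mono Wc mult_left_mono) (auto simp: n_def)
      finally show ?thesis .
    next
      case False
      \<comment> \<open>The first scale whose box contains \<open>v\<close>. The preceding box
        misses \<open>v\<close> and is much larger than the one containing \<open>W\<close>, so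
        \<open>v\<close> is at least half its radius away from all of \<open>W\<close>.\<close>
      define j where "j = (LEAST j. v \<in> bx y (R j))"
      have ex: "v \<in> bx y (R n)" using Cn[OF v] Rj[of n] by (simp add: bx_def)
      have j: "v \<in> bx y (R j)" "j \<le> n" unfolding j_def using LeastI[of "\<lambda>j. v \<in> bx y (R j)", OF ex] Least_le[of "\<lambda>j. v \<in> bx y (R j)", OF ex] by simp_all
      have ij: "Suc i < j"
      proof (rule ccontr)
        assume "\<not> Suc i < j"
        then have "R j \<le> R (Suc i)" by (intro Rm) simp
        then show False using j(1) False bx_mono by blast
      qed
      obtain j' where j': "j = Suc j'" using ij by (cases j) auto
      have nin: "v \<notin> bx y (R j')" using not_less_Least[of j' "\<lambda>j. v \<in> bx y (R j)"] by (simp add: j_def[symmetric] j')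
      have big: "256 * R i \<le> R j'" using Rm[of "Suc i" j'] ij by (simp add: RS j')
      have far: "real (R j') / 2 \<le> jb (z - v)" if "z \<in> W" for z
      proof -
        have "int (R j') < norm_linf (v - y)" using nin by (simp add: bx_def)
        also have "\<dots> \<le> norm_linf (v - z) + 3 * int (R i)" using norm_linf_triangle3[of v y z] Wd[OF that] by linarith
        finally have "int (R j') \<le> 2 * norm_linf (z - v)" using big by (simp add: norm_linf_commute)
        then have "real (R j') \<le> 2 * real_of_int (norm_linf (z - v))" by linarith
        then show ?thesis by (simp add: jb_def)
      qed
      have "(\<Sum>z\<in>W. 1 / jb (z - v) ^ ?q) \<le> (\<Sum>z\<in>W. 1 / (real (R j') / 2) ^ ?q)"
        using far R0[of j'] by (intro sum_mono divide_left_mono power_mono mult_pos_pos) auto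
      also have "\<dots> = real (card W) * (2 ^ ?q * (1 / real (R j') ^ ?q))" by (simp add: power_divide)
      also have "\<dots> \<le> real (card W) * (K0 * ?h v)"
        using h0[of j' v] j j' ij K0 by (intro mult_left_mono mult_mono) auto
      finally show ?thesis .
    qed
    have "(\<Sum>z\<in>W. \<Sum>v\<in>C. 1 / jb (z - v) ^ ?q) = (\<Sum>v\<in>C. \<Sum>z\<in>W. 1 / jb (z - v) ^ ?q)" by (rule sum.swap)
    also have "\<dots> \<le> (\<Sum>v\<in>C. real (card W) * (K0 * ?h v))" by (rule sum_mono[OF g])
    also have "\<dots> = real (card W) * (K0 * (\<Sum>j\<in>{i..<n}. \<Sum>v\<in>C. of_bool (v \<in> bx y (R (Suc j))) * (1 / real (R j) ^ ?q)))"
      unfolding sum_distrib_left[symmetric] by (subst sum.swap) (rule refl)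
    also have "\<dots> \<le> real (card W) * (K0 * (\<Sum>j\<in>{i..<n}. 2 ^ (8 * ?q - 2) * (1 / 2 ^ i * (1 / 2 ^ j))))"
    proof (intro mult_left_mono sum_mono)
      fix j assume j: "j \<in> {i..<n}"
      have "(\<Sum>v\<in>C. of_bool (v \<in> bx y (R (Suc j))) * (1 / real (R j) ^ ?q)) = real (card (C \<inter> bx y (R (Suc j)))) * (1 / real (R j) ^ ?q)"
        by (rule sum_of_bool_times[OF C(1)])
      also have "\<dots> \<le> real (mass (2 ^ Suc j)) * (1 / real (R j) ^ ?q)"
        using C(2)[of "Suc j"] j by (intro mult_right_mono) (auto simp: R_def)
      also have "\<dots> = 2 ^ (8 * ?q - 2) * ((2 ^ j) ^ (8 * ?q - 2) / (2 ^ j) ^ (8 * ?q))"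
        by (simp add: mass_def R_def power_mult_distrib power_mult)
      also have "(2 ^ j) ^ (8 * ?q - 2) / (2 ^ j :: real) ^ (8 * ?q) = 1 / 2 ^ j * (1 / 2 ^ j)"
      proof -
        have "8 * ?q = (8 * ?q - 2) + 2" using d2 by simp
        then have "(2 ^ j :: real) ^ (8 * ?q) = (2 ^ j) ^ (8 * ?q - 2) * (2 ^ j)\<^sup>2" by (metis power_add)
        then show ?thesis by (simp add: power2_eq_square)
      qed
      also have "2 ^ (8 * ?q - 2) * (1 / 2 ^ j * (1 / 2 ^ j)) \<le> 2 ^ (8 * ?q - 2) * (1 / 2 ^ i * (1 / 2 ^ j :: real))"
        using j by (intro mult_left_mono mult_right_mono divide_left_mono power_increasing) auto
      finally show "(\<Sum>v\<in>C. of_bool (v \<in> bx y (R (Suc j))) * (1 / real (R j) ^ ?q)) \<le> 2 ^ (8 * ?q - 2) * (1 / 2 ^ i * (1 / 2 ^ j))" .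
    qed (use K0(3) in auto)
    also have "\<dots> = real (card W) * (K0 * (2 ^ (8 * ?q - 2) * (1 / 2 ^ i * (\<Sum>j\<in>{i..<n}. 1 / 2 ^ j))))"
      unfolding sum_distrib_left[symmetric] by (rule refl)
    also have "\<dots> \<le> real (card W) * (K0 * (2 ^ (8 * ?q - 2) * (1 / 2 ^ i * 2)))"
      using K0(3) by (intro mult_left_mono sum_dyadic_le) auto
    also have "\<dots> = real (card W) * (K / 2 ^ i)" by (simp add: K_def)
    finally have tot: "(\<Sum>z\<in>W. \<Sum>v\<in>C. 1 / jb (z - v) ^ ?q) \<le> real (card W) * (K / 2 ^ i)" .
    show ?thesis
    proof (rule ccontr)
      assume "\<not> ?thesis"
      then have "(\<Sum>z\<in>W. K / 2 ^ i) < (\<Sum>z\<in>W. \<Sum>v\<in>C. 1 / jb (z - v) ^ ?q)"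
        using Wc0 by (intro sum_strict_mono finW) auto
      then show False using tot by simp
    qed
  qed
  note main = this
  have "0 < K" using K0(3) by (simp add: K_def)
  then show ?thesis using main by blast
qed

end

section \<open>The reversed Simon inequality\<close>

lemma pedges_snoc: "vs \<noteq> [] \<Longrightarrow> pedges (vs @ [x]) = insert {last vs, x} (pedges vs)"
  by (induction vs rule: pedges.induct) auto

lemma pedges_subset_set: "e \<in> pedges vs \<Longrightarrow> e \<subseteq> set vs \<and> e \<noteq> {}"
  by (induction vs rule: pedges.induct) auto

lemma pedges_Cons: "vs \<noteq> [] \<Longrightarrow> pedges (x # vs) = insert {x, hd vs} (pedges vs)"
  by (cases vs) auto

lemma conn_inside_touch:
  assumes "conn (inside S \<xi>) a y"
  shows "conn (inside S (touch (clu \<xi> {a}) \<xi>)) a y"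
  using assms
proof (induction rule: conn_induct)
  case (step y z)
  have "conn \<xi> a y" by (rule conn_mono[OF step(1) inside_subset])
  then have "{y, z} \<in> inside S (touch (clu \<xi> {a}) \<xi>)" using step(2) by (auto simp: inside_def touch_def clu_def)
  from conn_trans[OF step(3) conn_edge[OF this]] show ?case .
qed simp

context critical_percolation
begin

text \<open>A nonzero coordinate of \<open>w\<close> is shortened by one unit step at a time.
  \<open>S\<close> is closed under such steps, so the path stays in a translated cube.\<close>

lemma staircase:
  assumes "\<And>j. w $ j \<in> S" "\<And>s. s \<in> S \<Longrightarrow> s \<noteq> 0 \<Longrightarrow> s - sgn s \<in> S"
  shows "\<exists>vs. vs \<noteq> [] \<and> hd vs = z \<and> last vs = w + z \<and> length vs = Suc (nat (norm_l1 w)) \<and> pedges vs \<subseteq> \<E> \<and>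
    set vs \<subseteq> (\<lambda>w. w + z) ` {w. \<forall>j. w $ j \<in> S}"
  using assms(1)
proof (induction "nat (norm_l1 w)" arbitrary: w)
  have l1: "0 \<le> norm_l1 w" for w :: "int ^ 'd" by (simp add: norm_l1_def sum_nonneg)
  {
    case 0
    then have "norm_l1 w = 0" using l1[of w] by simp
    then have "w = 0" by (simp add: norm_l1_def vec_eq_iff sum_nonneg_eq_0_iff)
    then show ?case using 0 by (intro exI[of _ "[z]"]) (force simp: norm_l1_def)
  next
    case (Suc n)
    obtain j where j: "w $ j \<noteq> 0"
    proof (rule ccontr)
      assume "\<not> thesis"
      then have "norm_l1 w = 0" using that by (force simp: norm_l1_def)
      then show False using Suc(2) by simp
    qed
    define w' where "w' = w - axis_pt j (sgn (w $ j))"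
    have w'j: "w' $ i = (if i = j then w $ j - sgn (w $ j) else w $ i)" for i
      by (simp add: w'_def axis_pt_def)
    have "norm_l1 w = \<bar>w $ j\<bar> + (\<Sum>i\<in>UNIV - {j}. \<bar>w $ i\<bar>)" "norm_l1 w' = \<bar>w' $ j\<bar> + (\<Sum>i\<in>UNIV - {j}. \<bar>w' $ i\<bar>)"
      unfolding norm_l1_def by (rule sum.remove; simp)+
    moreover have "(\<Sum>i\<in>UNIV - {j}. \<bar>w' $ i\<bar>) = (\<Sum>i\<in>UNIV - {j}. \<bar>w $ i\<bar>)" by (rule sum.cong) (auto simp: w'j)
    ultimately have l: "norm_l1 w = norm_l1 w' + 1" using j by (auto simp: w'j sgn_if)
    then have n: "n = nat (norm_l1 w')" using Suc(2) l1[of w'] by simp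
    have "w' $ i \<in> S" for i using Suc(3)[of i] assms(2)[OF Suc(3)[of j] j] by (auto simp: w'j)
    from Suc(1)[OF n this] obtain vs where vs: "vs \<noteq> []" "hd vs = z" "last vs = w' + z" "length vs = Suc (nat (norm_l1 w'))" "pedges vs \<subseteq> \<E>"
      "set vs \<subseteq> (\<lambda>w. w + z) ` {w. \<forall>j. w $ j \<in> S}" by blast
    have "(w' + z) - (w + z) = axis_pt j (- sgn (w $ j))" by (simp add: w'_def axis_pt_def vec_eq_iff)
    then have "norm_l1 ((w' + z) - (w + z)) = 1" using j by (simp only: norm_l1_axis) (simp add: sgn_if)
    from edge_nn[OF this] show ?case
      using vs l l1[of w'] Suc(3) by (intro exI[of _ "vs @ [w + z]"]) (auto simp: pedges_snoc nat_add_distrib)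
  }
qed

definition outward :: "nat \<Rightarrow> nat \<Rightarrow> int ^ 'd \<Rightarrow> (int ^ 'd) set \<Rightarrow> (int ^ 'd \<Rightarrow> (int ^ 'd) list) \<Rightarrow> bool" where
  "outward k R y W P \<longleftrightarrow> W \<subseteq> bx y (R + L) \<and> R ^ CARD('d) \<le> card W \<and> (\<forall>z\<in>W. P z \<noteq> [] \<and> hd (P z) = y \<and> last (P z) = z \<and>
    length (P z) \<le> Suc (Suc (CARD('d) * R)) \<and> pedges (P z) \<subseteq> \<E> \<and> (\<forall>e\<in>pedges (P z). \<not> e \<subseteq> box k) \<and> set (P z) \<subseteq> bx y (R + L))"

text \<open>An outside neighbour \<open>z0\<close> of \<open>y\<close> has a coordinate beyond
  \<open>k\<close> in absolute value. A cube at \<open>z0\<close> pointing in the direction of its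
  sign stays outside the box, and so do staircases in it.\<close>

lemma outward_paths:
  assumes y: "y \<in> bdry (box k)"
  shows "\<exists>W P. outward k R y W P"
proof -
  obtain z0 where z0: "z0 \<notin> box k" "{y, z0} \<in> \<E>" using y by (auto simp: bdry_def out_def)
  obtain i where i: "int k < \<bar>z0 $ i\<bar>" using z0(1) by (auto simp: box_def norm_linf_le_iff not_le)
  \<comment> \<open>One sign for all coordinates is enough: only coordinate \<open>i\<close> decides
    that the cube avoids the box.\<close>
  define S where "S = (if 0 \<le> z0 $ i then {0..int R} else {- int R..0})"
  define W where "W = (\<lambda>w. w + z0) ` {w. \<forall>j. w $ j \<in> S}"
  have finS: "finite S" and cS: "card S = R + 1" by (auto simp: S_def)
  have Sb: "\<bar>s\<bar> \<le> int R" if "s \<in> S" for s using that by (auto simp: S_def split: if_splits)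
  have Wc: "card W = (R + 1) ^ CARD('d)"
    unfolding W_def using card_vec_set[OF finS] by (subst card_image) (auto simp: inj_on_def cS)
  have Wb: "W \<subseteq> bx y (R + L)"
  proof
    fix z assume "z \<in> W"
    then obtain w where w: "z = w + z0" "\<And>j. w $ j \<in> S" by (auto simp: W_def)
    have "norm_linf w \<le> int R" using Sb[OF w(2)] by (simp add: norm_linf_le_iff)
    then show "z \<in> bx y (R + L)" using norm_linf_triangle3[of z y z0] edge_range[OF z0(2)] by (simp add: bx_def w(1) norm_linf_commute)
  qed
  have Wo: "z \<notin> box k" if zW: "z \<in> W" for z
  proof -
    obtain w where w: "z = w + z0" "\<And>j. w $ j \<in> S" using zW by (auto simp: W_def)
    have "int k < \<bar>z $ i\<bar>" using i w(2)[of i] by (auto simp: w(1) S_def split: if_splits)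
    then show ?thesis using norm_linf_component[of z i] by (simp add: box_def)
  qed
  have "\<exists>vs. vs \<noteq> [] \<and> hd vs = y \<and> last vs = z \<and> length vs \<le> Suc (Suc (CARD('d) * R)) \<and> pedges vs \<subseteq> \<E> \<and>
      (\<forall>e\<in>pedges vs. \<not> e \<subseteq> box k) \<and> set vs \<subseteq> bx y (R + L)" if zW: "z \<in> W" for z
  proof -
    obtain w where w: "z = w + z0" "\<And>j. w $ j \<in> S" using zW by (auto simp: W_def)
    have "s - sgn s \<in> S" if "s \<in> S" "s \<noteq> 0" for s using that by (auto simp: S_def sgn_if split: if_splits)
    from staircase[of w S, OF w(2) this] obtain vs where vs: "vs \<noteq> []" "hd vs = z0" "last vs = w + z0" "length vs = Suc (nat (norm_l1 w))" "pedges vs \<subseteq> \<E>" "set vs \<subseteq> W"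
      unfolding W_def by blast
    have "norm_l1 w \<le> (\<Sum>j\<in>(UNIV :: 'd set). int R)" unfolding norm_l1_def by (rule sum_mono) (rule Sb[OF w(2)])
    then have len: "nat (norm_l1 w) \<le> CARD('d) * R" by (simp add: nat_le_iff)
    have "\<not> e \<subseteq> box k" if "e \<in> pedges (y # vs)" for e
    proof (cases "e = {y, z0}")
      case False
      then have "e \<in> pedges vs" using that vs(1,2) by (simp add: pedges_Cons)
      then show ?thesis using pedges_subset_set[of e vs] vs(6) Wo by blast
    qed (use z0(1) in simp)
    moreover have "pedges (y # vs) \<subseteq> \<E>" using vs(1,2,5) z0(2) by (simp add: pedges_Cons)
    moreover have "set (y # vs) \<subseteq> bx y (R + L)" using vs(6) Wb by (auto simp: bx_def)
    ultimately show ?thesis using vs len w(1) by (intro exI[of _ "y # vs"]) auto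
  qed
  then have "\<exists>P. \<forall>z\<in>W. P z \<noteq> [] \<and> hd (P z) = y \<and> last (P z) = z \<and> length (P z) \<le> Suc (Suc (CARD('d) * R)) \<and> pedges (P z) \<subseteq> \<E> \<and>
      (\<forall>e\<in>pedges (P z). \<not> e \<subseteq> box k) \<and> set (P z) \<subseteq> bx y (R + L)"
    by (intro bchoice ballI)
  then obtain P where "\<forall>z\<in>W. P z \<noteq> [] \<and> hd (P z) = y \<and> last (P z) = z \<and> length (P z) \<le> Suc (Suc (CARD('d) * R)) \<and> pedges (P z) \<subseteq> \<E> \<and>
      (\<forall>e\<in>pedges (P z). \<not> e \<subseteq> box k) \<and> set (P z) \<subseteq> bx y (R + L)" by (rule exE)
  then have "outward k R y W P" unfolding outward_def using Wb Wc power_mono[of R "R + 1" "CARD('d)"] by simp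
  then show ?thesis by blast
qed

text \<open>The surgery has a fixed size, so its cost is a constant, while each successful pair
  \<open>(y, z)\<close> has of order \<open>m^2\<close> end points \<open>x\<close>. For fixed
  \<open>x\<close>, boundedly many pairs can be successful at once. Irregular vertices account for
  at most half of the left side, up to the error term.\<close>

lemma reversed_simon: "\<exists>C>0. \<exists>c>0. \<exists>m0\<ge>1. \<forall>p k m. pc / 2 \<le> p \<longrightarrow> p \<le> pc \<longrightarrow> m0 \<le> m \<longrightarrow> m \<le> k \<longrightarrow> (pc - p) * (real m)\<^sup>2 \<le> c \<longrightarrow>
    (\<Sum>y\<in>bdry (box k). tauS p (box k) 0 y) \<le> C * (\<Sum>x | int k - 2 * int m \<le> norm_linf x \<and> norm_linf x \<le> int k + 2 * int m. T p 0 x) / (real m)\<^sup>2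
      + C * real k ^ CARD('d) / real m ^ (CARD('d) + 1)"
proof -
  let ?d = "CARD('d)" and ?q = "CARD('d) - 2"
  define irr where "irr i0 C c \<longleftrightarrow> (\<forall>i\<ge>i0. \<forall>p k m F. 0 \<le> p \<longrightarrow> p \<le> pc \<longrightarrow> 1 \<le> m \<longrightarrow> m \<le> k \<longrightarrow> (pc - p) * (real m)\<^sup>2 \<le> c \<longrightarrow> fin_sub F \<longrightarrow>
    (\<Sum>y\<in>bdry (box k). bprob p F (\<lambda>\<xi>. conn (inside (box k) \<xi>) 0 y \<and> \<not> regular i y \<xi>))
      \<le> (\<Sum>y\<in>bdry (box k). tauS p (box k) 0 y) / 2 + C * real k ^ CARD('d) / real m ^ (CARD('d) + 1))" for i0 C c
  have "\<exists>i0. \<exists>C>0. \<exists>c>0. irr i0 C c" unfolding irr_def by (rule irregular_total)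
  then obtain i0 C1 c1 where irr: "C1 > 0" "c1 > 0" "irr i0 C1 c1" by blast
  obtain K where K: "K > 0" "\<And>i (y :: int ^ 'd) W C. finite C \<Longrightarrow> (\<forall>j\<ge>i. card (C \<inter> bx y ((2 ^ j) ^ 8)) < mass (2 ^ j)) \<Longrightarrow>
    W \<subseteq> bx y (3 * (2 ^ i) ^ 8) \<Longrightarrow> ((2 ^ i) ^ 8) ^ ?d \<le> card W \<Longrightarrow> \<exists>z\<in>W. (\<Sum>v\<in>C. 1 / jb (z - v) ^ ?q) \<le> K / 2 ^ i"
    using thin_point by blast
  obtain c2 where c2: "c2 > 0" "\<And>p x y. 0 \<le> p \<Longrightarrow> p \<le> pc \<Longrightarrow> (pc - p) * (jb (x - y))\<^sup>2 \<le> c2 \<Longrightarrow> a / 2 / jb (x - y) ^ ?q \<le> T p x y"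
    using T_lower_near by blast
  obtain C2 where C2: "C2 > 0" "\<And>s n X z v. 0 \<le> s \<Longrightarrow> s \<le> pc \<Longrightarrow> 1 \<le> n \<Longrightarrow> X \<subseteq> bx z n \<Longrightarrow> (\<Sum>x\<in>X. T s v x) \<le> C2 * (real n)\<^sup>2"
    using sum_T_box by blast
  obtain i1 :: nat where i1: "8 * b * C2 * K / a \<le> real i1" using real_arch_simple by blast
  \<comment> \<open>Fixed once, independently of \<open>m\<close> and \<open>k\<close>:
    \<open>i0\<close> for regularity, \<open>i1\<close> so that the BK loss
    \<open>b * C2 * K / 2 ^ i\<close> is at most \<open>a / 8\<close>, half of the gain
    \<open>a / 4\<close>, and \<open>L\<close> so that \<open>R\<close> is at least the
    range.\<close>
  define i where "i = max i0 (max i1 L)"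
  define R :: nat where "R = (2 ^ i) ^ 8"
  define l where "l = Suc (?d * R)"
  \<comment> \<open>A path meeting a given one starts within \<open>4 * R\<close> of its starting
    point and ends within \<open>2 * R\<close> of its own; \<open>M\<close> counts such
    pairs.\<close>
  define M where "M = card (Sigma (bx (0 :: int ^ 'd) (4 * R)) (\<lambda>y. bx y (2 * R)))"
  have two: "real i \<le> 2 ^ i" by (metis less_exp less_imp_le of_nat_le_iff of_nat_numeral of_nat_power)
  have i: "i0 \<le> i" "i1 \<le> i" "L \<le> i" by (auto simp: i_def)
  have i2: "8 * b * C2 * K / a \<le> 2 ^ i" using i1 two i(2) by linarith
  have RL: "L \<le> R" "1 \<le> R"
  proof -
    have "i \<le> 2 ^ i" by (simp add: less_imp_le)
    also have "\<dots> \<le> R" unfolding R_def by (rule self_le_power) auto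
    finally show "L \<le> R" using i(3) by simp
  qed (simp add: R_def)
  have \<epsilon>: "b * C2 * (K / 2 ^ i) \<le> a / 8" using i2 ab by (simp add: field_simps)
  define C3 where "C3 = 2 * (real (l * M) / ((pc / 2) ^ l * (a / 8)))"
  define C where "C = max 1 (max C3 (2 * C1))"
  have CC: "C3 \<le> C" "2 * C1 \<le> C" "0 < C" by (auto simp: C_def)
  have main: "(\<Sum>y\<in>bdry (box k). tauS p (box k) 0 y) \<le> C * (\<Sum>x | int k - 2 * int m \<le> norm_linf x \<and> norm_linf x \<le> int k + 2 * int m. T p 0 x) / (real m)\<^sup>2
      + C * real k ^ CARD('d) / real m ^ (CARD('d) + 1)"
    if p: "pc / 2 \<le> p" "p \<le> pc" and m: "3 * R \<le> m" "m \<le> k" and pm: "(pc - p) * (real m)\<^sup>2 \<le> min c1 c2" for p k m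
  proof -
    have p0: "0 < p" "0 \<le> p" "p \<le> 1" using p pc_pos pc_less_1 by auto
    have m1: "1 \<le> m" "0 < real m" using m RL by auto
    let ?S = "box k :: (int ^ 'd) set" and ?X = "{x :: int ^ 'd. int k - 2 * int m \<le> norm_linf x \<and> norm_linf x \<le> int k + 2 * int m}"
    let ?B = "bdry ?S"
    have finB: "finite ?B" by (simp add: finite_bdry)
    have finX: "finite ?X" by (rule finite_subset[OF _ finite_box[of "k + 2 * m"]]) (auto simp: box_def)
    have "\<forall>y\<in>?B. \<exists>W P. outward k R y W P" by (intro ballI outward_paths)
    from bchoice[OF this] obtain W where "\<forall>y\<in>?B. \<exists>P. outward k R y (W y) P" by blast
    from bchoice[OF this] obtain P where "\<forall>y\<in>?B. outward k R y (W y) (P y)" by blast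
    then have WP: "W y \<subseteq> bx y (R + L) \<and> R ^ ?d \<le> card (W y) \<and> (\<forall>z\<in>W y. P y z \<noteq> [] \<and> hd (P y z) = y \<and> last (P y z) = z \<and>
      length (P y z) \<le> Suc (Suc (?d * R)) \<and> pedges (P y z) \<subseteq> \<E> \<and> (\<forall>e\<in>pedges (P y z). \<not> e \<subseteq> box k) \<and> set (P y z) \<subseteq> bx y (R + L))"
      if "y \<in> ?B" for y using that unfolding outward_def by (rule bspec)
    have WR: "W y \<subseteq> bx y (2 * R)" "finite (W y)" if "y \<in> ?B" for y
    proof -
      show "W y \<subseteq> bx y (2 * R)" using WP[OF that] bx_mono[of "R + L" "2 * R" y] RL by auto
      then show "finite (W y)" by (rule finite_subset) simp
    qed
    define J where "J = Sigma ?B W"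
    have finJ: "finite J" unfolding J_def using finB WR(2) by (intro finite_SigmaI) auto
    let ?Z = "Sigma (snd ` J) (\<lambda>z. bx z m)"
    \<comment> \<open>The error is half of the lower bound \<open>a / 2 / real m ^ ?q\<close>; the
      other half survives in finite volume.\<close>
    obtain F0 where F0: "fin_sub F0" "\<And>G. fin_sub G \<Longrightarrow> F0 \<subseteq> G \<Longrightarrow> \<forall>i\<in>?Z. PS p (\<lambda>\<xi>. conn \<xi> (fst i) (snd i)) - a / 4 / real m ^ ?q < bprob p G (\<lambda>\<xi>. conn \<xi> (fst i) (snd i))"
      using PS_approx_finite[OF p0(2,3), of ?Z "\<lambda>i \<xi>. conn \<xi> (fst i) (snd i)" "a / 4 / real m ^ ?q"] finJ incr_conn ab m1 by fastforce
    define F where "F = F0 \<union> (EI ?S \<union> (\<Union>(y, z)\<in>J. pedges (P y z)))"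
    have PE: "pedges (P y z) \<subseteq> \<E>" if "y \<in> ?B" "z \<in> W y" for y z
      using bspec[OF conjunct2[OF conjunct2[OF WP[OF that(1)]]] that(2)] by blast
    have PB: "set (P y z) \<subseteq> bx y (R + L)" if "y \<in> ?B" "z \<in> W y" for y z
      using bspec[OF conjunct2[OF conjunct2[OF WP[OF that(1)]]] that(2)] by blast
    have "fin_sub (\<Union>(y, z)\<in>J. pedges (P y z))"
      unfolding fin_sub_def using finJ PE by (auto simp: J_def)
    then have F: "fin_sub F" unfolding F_def by (intro fin_sub_Un F0(1) fin_sub_EI finite_box)
    have PF: "pedges (P y z) \<subseteq> F" if "y \<in> ?B" "z \<in> W y" for y z using that by (auto simp: F_def J_def)
    have tau_low: "a / 4 / real m ^ ?q \<le> tau p F z x" if yz: "y \<in> ?B" "z \<in> W y" and x: "x \<in> bx z m" for y z x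
    proof -
      have "(z, x) \<in> ?Z" using yz x by (force simp: J_def)
      from bspec[OF F0(2)[OF F, unfolded F_def, OF Un_upper1] this]
      have 1: "T p z x - a / 4 / real m ^ ?q < tau p F z x" by (simp add: T_def F_def)
      have jm: "jb (z - x) \<le> real m" using x m1 by (simp add: jb_def bx_def norm_linf_commute)
      have "(pc - p) * (jb (z - x))\<^sup>2 \<le> (pc - p) * (real m)\<^sup>2" using p by (intro mult_left_mono power_mono jm) auto
      then have "a / 2 / jb (z - x) ^ ?q \<le> T p z x" using pm by (intro c2(2) p0 p) auto
      moreover have "a / 2 / real m ^ ?q \<le> a / 2 / jb (z - x) ^ ?q"
        using ab jm m1 by (intro divide_left_mono power_mono mult_pos_pos) auto
      moreover have "a / 2 / real m ^ ?q = 2 * (a / 4 / real m ^ ?q)" by simp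
      ultimately show ?thesis using 1 by linarith
    qed
    \<comment> \<open>All three conditions are decided by the cluster of \<open>0\<close>, as the
      exposure in \<open>disjoint_clusters_ge\<close> requires.\<close>
    define A where "A y z \<xi> \<longleftrightarrow> conn (inside ?S \<xi>) 0 y \<and> regular i y \<xi> \<and> (\<Sum>v\<in>clu \<xi> {0}. 1 / jb (z - v) ^ ?q) \<le> K / 2 ^ i" for y z \<xi>
    have A_loc: "A y z \<xi> = A y z (touch (clu \<xi> {0}) \<xi>)" for y z \<xi>
    proof -
      have c: "clu (touch (clu \<xi> {0}) \<xi>) {0} = clu \<xi> {0}" using clu_eq_iff_touch[of \<xi> "{0}" "clu \<xi> {0}"] by simp
      have "conn (inside ?S \<xi>) 0 y \<longleftrightarrow> conn (inside ?S (touch (clu \<xi> {0}) \<xi>)) 0 y"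
        using conn_inside_touch[of ?S \<xi> 0 y] conn_mono[OF _ inside_mono[OF touch_subset], of ?S] by metis
      then show ?thesis unfolding A_def regular_def c by simp
    qed
    let ?E = "\<lambda>y z x \<xi>. A y z \<xi> \<and> conn \<xi> z x \<and> \<not> conn \<xi> 0 x"
    have low: "a / 8 * (real m)\<^sup>2 * bprob p F (A y z) \<le> (\<Sum>x\<in>bx z m. bprob p F (?E y z x))" if yz: "y \<in> ?B" "z \<in> W y" for y z
    proof -
      let ?g = "\<lambda>\<xi> x. of_bool (A y z \<xi>) * (tau p F z x - (\<Sum>v\<in>clu \<xi> {0}. tau p F z v * tau p F v x))"
      have "a / 8 * (real m)\<^sup>2 * bprob p F (A y z) = bexp p F (\<lambda>\<xi>. a / 8 * (real m)\<^sup>2 * of_bool (A y z \<xi>))"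
        by (simp only: bprob_def bexp_cmult)
      also have "\<dots> \<le> bexp p F (\<lambda>\<xi>. \<Sum>x\<in>bx z m. ?g \<xi> x)"
      proof (rule bexp_mono[OF p0(2,3)])
        fix \<xi>
        show "a / 8 * (real m)\<^sup>2 * of_bool (A y z \<xi>) \<le> (\<Sum>x\<in>bx z m. ?g \<xi> x)"
        proof (cases "A y z \<xi>")
          case True
          have dm: "?d = ?q + 2" using dim by simp
          have card: "real m ^ ?d \<le> real (card (bx z m))" unfolding card_bx of_nat_power by (intro power_mono) auto
          have "a / 4 * (real m)\<^sup>2 = real m ^ ?d * (a / 4 / real m ^ ?q)"
            by (subst dm, subst power_add) (use m1 in simp)
          also have "\<dots> \<le> real (card (bx z m)) * (a / 4 / real m ^ ?q)" using ab by (intro mult_right_mono card) auto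
          also have "\<dots> = (\<Sum>x\<in>bx z m. a / 4 / real m ^ ?q)" by simp
          also have "\<dots> \<le> (\<Sum>x\<in>bx z m. tau p F z x)" by (rule sum_mono[OF tau_low[OF yz]])
          finally have 1: "a / 4 * (real m)\<^sup>2 \<le> (\<Sum>x\<in>bx z m. tau p F z x)" .
          have "(\<Sum>x\<in>bx z m. \<Sum>v\<in>clu \<xi> {0}. tau p F z v * tau p F v x) = (\<Sum>v\<in>clu \<xi> {0}. tau p F z v * (\<Sum>x\<in>bx z m. tau p F v x))"
            unfolding sum_distrib_left by (rule sum.swap)
          also have "\<dots> \<le> (\<Sum>v\<in>clu \<xi> {0}. (b * (1 / jb (z - v) ^ ?q)) * (C2 * (real m)\<^sup>2))"
          proof (intro sum_mono mult_mono)
            fix v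
            show "tau p F z v \<le> b * (1 / jb (z - v) ^ ?q)"
              using order_trans[OF tau_le_T[OF p0(2,3) F] T_le[OF p0(2) p(2)], of z v] by simp
            have "(\<Sum>x\<in>bx z m. tau p F v x) \<le> (\<Sum>x\<in>bx z m. T p v x)" by (intro sum_mono tau_le_T[OF p0(2,3) F])
            also have "\<dots> \<le> C2 * (real m)\<^sup>2" by (rule C2(2)[OF p0(2) p(2) m1(1) order_refl])
            finally show "(\<Sum>x\<in>bx z m. tau p F v x) \<le> C2 * (real m)\<^sup>2" .
          qed (use b_pos in \<open>auto intro!: sum_nonneg bprob_nonneg p0\<close>)
          also have "\<dots> = b * C2 * (\<Sum>v\<in>clu \<xi> {0}. 1 / jb (z - v) ^ ?q) * (real m)\<^sup>2"
            by (simp only: sum_distrib_left[symmetric] sum_distrib_right[symmetric] mult_ac)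
          also have "\<dots> \<le> b * C2 * (K / 2 ^ i) * (real m)\<^sup>2"
            using True C2(1) b_pos by (intro mult_right_mono mult_left_mono) (auto simp: A_def)
          also have "\<dots> \<le> a / 8 * (real m)\<^sup>2" by (intro mult_right_mono \<epsilon>) simp
          finally have 2: "(\<Sum>x\<in>bx z m. \<Sum>v\<in>clu \<xi> {0}. tau p F z v * tau p F v x) \<le> a / 8 * (real m)\<^sup>2" .
          have "(\<Sum>x\<in>bx z m. ?g \<xi> x) = (\<Sum>x\<in>bx z m. tau p F z x) - (\<Sum>x\<in>bx z m. \<Sum>v\<in>clu \<xi> {0}. tau p F z v * tau p F v x)"
            using True by (simp add: sum_subtractf)
          then show ?thesis using 1 2 True by simp
        qed simp
      qed
      also have "\<dots> = (\<Sum>x\<in>bx z m. bexp p F (\<lambda>\<xi>. ?g \<xi> x))" by (rule bexp_sum)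
      also have "\<dots> \<le> (\<Sum>x\<in>bx z m. bprob p F (?E y z x))"
        by (intro sum_mono disjoint_clusters_ge fin_subD[OF F] p0) (rule A_loc)
      finally show ?thesis .
    qed
    \<comment> \<open>For fixed \<open>x\<close>, the pairs \<open>(y, z)\<close> are the indices of
      \<open>exit_pivotal_bound\<close>, which needs paths none of whose edges lies inside the
      box.\<close>
    have up: "(pc / 2) ^ l * (\<Sum>i\<in>{i \<in> J. x \<in> bx (snd i) m}. bprob p F (?E (fst i) (snd i) x)) \<le> real (l * M) * T p 0 x" for x
    proof -
      let ?I = "{i \<in> J. x \<in> bx (snd i) m}"
      have "(pc / 2) ^ l * (\<Sum>i\<in>?I. bprob p F (?E (fst i) (snd i) x)) \<le> p ^ l * (\<Sum>i\<in>?I. bprob p F (?E (fst i) (snd i) x))"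
        using p pc_pos by (intro mult_right_mono power_mono sum_nonneg bprob_nonneg p0) auto
      also have "\<dots> \<le> real (l * M) * tau p F 0 x"
      proof (rule exit_pivotal_bound[OF fin_subD(1)[OF F] p0(2,3), where P = "\<lambda>i. P (fst i) (snd i)" and S = ?S])
        show "finite ?I" using finJ by simp
        fix j assume j: "j \<in> ?I"
        obtain y z where yz: "j = (y, z)" "y \<in> ?B" "z \<in> W y" using j by (cases j) (auto simp: J_def)
        note wp = bspec[OF conjunct2[OF conjunct2[OF WP[OF yz(2)]]] yz(3)]
        show "P (fst j) (snd j) \<noteq> [] \<and> length (P (fst j) (snd j)) \<le> Suc l \<and> pedges (P (fst j) (snd j)) \<subseteq> F"
          using wp PF[OF yz(2,3)] by (simp add: yz(1) l_def)
        show "\<not> e \<subseteq> ?S" if "e \<in> pedges (P (fst j) (snd j))" for e using that wp by (simp add: yz(1))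
        show "conn (inside ?S \<xi>) 0 (hd (P (fst j) (snd j))) \<and> conn \<xi> (last (P (fst j) (snd j))) x \<and> \<not> conn \<xi> 0 x"
          if "?E (fst j) (snd j) x \<xi>" for \<xi> using that wp by (simp add: yz(1) A_def)
        have "{j' \<in> ?I. pedges (P (fst j) (snd j)) \<inter> pedges (P (fst j') (snd j')) \<noteq> {}} \<subseteq> (\<lambda>(u, v). (u + y, v + y)) ` Sigma (bx 0 (4 * R)) (\<lambda>y. bx y (2 * R))"
        proof
          fix j' assume j': "j' \<in> {j' \<in> ?I. pedges (P (fst j) (snd j)) \<inter> pedges (P (fst j') (snd j')) \<noteq> {}}"
          obtain y' z' where yz': "j' = (y', z')" "y' \<in> ?B" "z' \<in> W y'" using j' by (cases j') (auto simp: J_def)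
          obtain e where e: "e \<in> pedges (P y z)" "e \<in> pedges (P y' z')" using j' by (auto simp: yz(1) yz'(1))
          obtain u where "u \<in> e" using pedges_subset_set[OF e(1)] by blast
          then have "u \<in> set (P y z)" "u \<in> set (P y' z')"
            using pedges_subset_set[OF e(1)] pedges_subset_set[OF e(2)] by blast+
          then have u: "u \<in> bx y (R + L)" "u \<in> bx y' (R + L)"
            using PB[OF yz(2,3)] PB[OF yz'(2,3)] by (meson subsetD)+
          have "norm_linf (y' - y) \<le> 4 * int R"
            using u norm_linf_triangle3[of y' y u] RL by (simp add: bx_def norm_linf_commute)
          moreover have "norm_linf (z' - y') \<le> 2 * int R" using WR(1)[OF yz'(2)] yz'(3) by (auto simp: bx_def)
          ultimately show "j' \<in> (\<lambda>(u, v). (u + y, v + y)) ` Sigma (bx 0 (4 * R)) (\<lambda>y. bx y (2 * R))"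
            unfolding yz'(1) by (intro image_eqI[of _ _ "(y' - y, z' - y)"]) (auto simp: bx_def)
        qed
        from card_mono[OF _ this] show "card {j' \<in> ?I. pedges (P (fst j) (snd j)) \<inter> pedges (P (fst j') (snd j')) \<noteq> {}} \<le> M"
          using card_image_le[of "Sigma (bx 0 (4 * R)) (\<lambda>y. bx y (2 * R))" "\<lambda>(u, v). (u + y, v + y)"] unfolding M_def by (simp add: order_trans)
      qed
      also have "\<dots> \<le> real (l * M) * T p 0 x" by (intro mult_left_mono tau_le_T[OF p0(2,3) F]) simp
      finally show ?thesis .
    qed
    let ?\<Phi> = "\<Sum>y\<in>?B. tauS p ?S 0 y" and ?G = "\<Sum>y\<in>?B. bprob p F (\<lambda>\<xi>. conn (inside ?S \<xi>) 0 y \<and> regular i y \<xi>)"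
    have "?G \<le> (\<Sum>y\<in>?B. \<Sum>z\<in>W y. bprob p F (A y z))"
    proof (intro sum_mono bprob_union_le[OF p0(2,3) WR(2)])
      fix y \<xi> assume y: "y \<in> ?B" and w: "\<xi> \<subseteq> F" "conn (inside ?S \<xi>) 0 y \<and> regular i y \<xi>"
      have "finite (\<Union>\<xi>)" by (rule finite_subset[OF Union_mono[OF w(1)] fin_subD(3)[OF F]])
      then have fc: "finite (clu \<xi> {0})" by (intro finite_clu) auto
      have "\<exists>z\<in>W y. (\<Sum>v\<in>clu \<xi> {0}. 1 / jb (z - v) ^ ?q) \<le> K / 2 ^ i"
      proof (rule K(2)[OF fc])
        show "W y \<subseteq> bx y (3 * (2 ^ i) ^ 8)" using WR(1)[OF y] bx_mono[of "2 * R" "3 * R" y] unfolding R_def by auto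
      qed (use w(2) WP[OF y] in \<open>auto simp: regular_def R_def\<close>)
      then show "\<exists>z\<in>W y. A y z \<xi>" using w(2) by (auto simp: A_def)
    qed
    also have "\<dots> = (\<Sum>i\<in>J. bprob p F (A (fst i) (snd i)))"
      unfolding J_def using finB WR(2) by (subst sum.Sigma) (auto simp: case_prod_beta)
    finally have "(pc / 2) ^ l * (a / 8 * (real m)\<^sup>2) * ?G \<le> (pc / 2) ^ l * (a / 8 * (real m)\<^sup>2) * (\<Sum>i\<in>J. bprob p F (A (fst i) (snd i)))"
      using ab pc_pos by (intro mult_left_mono) auto
    also have "\<dots> = (pc / 2) ^ l * (\<Sum>i\<in>J. a / 8 * (real m)\<^sup>2 * bprob p F (A (fst i) (snd i)))"
      by (simp only: sum_distrib_left mult.assoc)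
    also have "\<dots> \<le> (pc / 2) ^ l * (\<Sum>i\<in>J. \<Sum>x\<in>{x \<in> ?X. x \<in> bx (snd i) m}. bprob p F (?E (fst i) (snd i) x))"
    proof (intro mult_left_mono sum_mono)
      fix j assume j: "j \<in> J"
      obtain y z where yz: "j = (y, z)" "y \<in> ?B" "z \<in> W y" using j by (cases j) (auto simp: J_def)
      have "bx z m \<subseteq> ?X"
      proof
        fix x assume "x \<in> bx z m"
        moreover have "norm_linf (z - y) \<le> 2 * int R" using WR(1)[OF yz(2)] yz(3) by (auto simp: bx_def)
        moreover have "int k - int R \<le> norm_linf y" "norm_linf y \<le> int k" using norm_bdry_box[OF yz(2)] RL yz(2) by (auto simp: bdry_def box_def)
        ultimately show "x \<in> ?X" using norm_linf_triangle3[of x y z] norm_linf_triangle_sub[of x y] norm_linf_triangle_sub[of y x] m(1)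
          by (auto simp: bx_def norm_linf_commute[of y x])
      qed
      then have "{x \<in> ?X. x \<in> bx z m} = bx z m" by blast
      then show "a / 8 * (real m)\<^sup>2 * bprob p F (A (fst j) (snd j)) \<le> (\<Sum>x\<in>{x \<in> ?X. x \<in> bx (snd j) m}. bprob p F (?E (fst j) (snd j) x))"
        using low[OF yz(2,3)] by (simp only: yz(1) fst_conv snd_conv)
    qed (use pc_pos in simp)
    also have "\<dots> = (\<Sum>x\<in>?X. (pc / 2) ^ l * (\<Sum>i\<in>{i \<in> J. x \<in> bx (snd i) m}. bprob p F (?E (fst i) (snd i) x)))"
      unfolding sum_distrib_left[symmetric] by (subst sum.swap_restrict[OF finJ finX]) (rule refl)
    also have "\<dots> \<le> (\<Sum>x\<in>?X. real (l * M) * T p 0 x)" by (rule sum_mono[OF up])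
    also have "\<dots> = real (l * M) * (\<Sum>x\<in>?X. T p 0 x)" by (simp only: sum_distrib_left)
    finally have G0: "(pc / 2) ^ l * (a / 8 * (real m)\<^sup>2) * ?G \<le> real (l * M) * (\<Sum>x\<in>?X. T p 0 x)" .
    have G: "2 * ?G \<le> C3 * (\<Sum>x\<in>?X. T p 0 x) / (real m)\<^sup>2"
    proof -
      have "0 < (pc / 2) ^ l * (a / 8 * (real m)\<^sup>2)" using pc_pos ab m1 by simp
      then have "?G \<le> real (l * M) * (\<Sum>x\<in>?X. T p 0 x) / ((pc / 2) ^ l * (a / 8 * (real m)\<^sup>2))"
        using G0 by (subst pos_le_divide_eq) (simp_all only: mult.commute)
      then show ?thesis by (simp add: C3_def)
    qed
    \<comment> \<open>\<open>F\<close> contains all edges of the box, so the boundary sum is the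
      same in \<open>F\<close>. Half of it bounds the irregular vertices and is moved to the
      left.\<close>
    have "?\<Phi> = (\<Sum>y\<in>?B. tau_in p F ?S 0 y)"
      by (intro sum.cong refl bprob_inside_eq[symmetric] F) (auto simp: F_def)
    also have "\<dots> \<le> (\<Sum>y\<in>?B. bprob p F (\<lambda>\<xi>. conn (inside ?S \<xi>) 0 y \<and> regular i y \<xi>) + bprob p F (\<lambda>\<xi>. conn (inside ?S \<xi>) 0 y \<and> \<not> regular i y \<xi>))"
      by (intro sum_mono bprob_disj_le[OF p0(2,3)]) auto
    also have "\<dots> = ?G + (\<Sum>y\<in>?B. bprob p F (\<lambda>\<xi>. conn (inside ?S \<xi>) 0 y \<and> \<not> regular i y \<xi>))" by (rule sum.distrib)
    also have "\<dots> \<le> ?G + (?\<Phi> / 2 + C1 * real k ^ ?d / real m ^ (?d + 1))"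
      using irr(3)[unfolded irr_def, rule_format, OF i(1) p0(2) p(2) m1(1) m(2) _ F] pm by (intro add_left_mono) simp
    finally have "?\<Phi> \<le> 2 * ?G + 2 * C1 * real k ^ ?d / real m ^ (?d + 1)" by (simp add: field_simps)
    also have "\<dots> \<le> C * (\<Sum>x\<in>?X. T p 0 x) / (real m)\<^sup>2 + C * real k ^ ?d / real m ^ (?d + 1)"
    proof (rule add_mono)
      have "C3 * (\<Sum>x\<in>?X. T p 0 x) / (real m)\<^sup>2 \<le> C * (\<Sum>x\<in>?X. T p 0 x) / (real m)\<^sup>2"
        by (intro divide_right_mono mult_right_mono CC sum_nonneg T_nonneg p0) auto
      then show "2 * ?G \<le> C * (\<Sum>x\<in>?X. T p 0 x) / (real m)\<^sup>2" using G by linarith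
    qed (intro divide_right_mono mult_right_mono CC; simp)
    finally show ?thesis .
  qed
  show ?thesis
    by (rule exI[of _ C], rule conjI[OF CC(3)], rule exI[of _ "min c1 c2"], rule conjI, use irr(2) c2(1) in simp,
      rule exI[of _ "3 * R"], rule conjI, use RL in simp, intro allI impI, rule main)
qed


section \<open>The one-arm exponent\<close>

text \<open>\<open>J\<close> disjoint annuli of width of order \<open>m = n / (5 J)\<close> share
  the total mass \<open>chi p\<close>. With \<open>pc - p = K / n^2\<close>, their boundary sums add
  up to a constant independent of \<open>J\<close> plus an error, so one of them is as small as
  desired for large \<open>J\<close>.\<close>

lemma small_boundary:
  assumes \<alpha>: "0 < \<alpha>"
  shows "\<exists>K>0. \<exists>n0\<ge>1. \<forall>n\<ge>n0. pc / 2 \<le> pc - K / (real n)\<^sup>2 \<and>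
    (\<exists>k\<le>n. (\<Sum>y\<in>bdry (box k). tauS (pc - K / (real n)\<^sup>2) (box k) 0 y) \<le> \<alpha>)"
proof -
  let ?d = "CARD('d)"
  let ?A = "\<lambda>k m. {x :: int ^ 'd. int k - 2 * int m \<le> norm_linf x \<and> norm_linf x \<le> int k + 2 * int m}"
  obtain C c m0 where C: "C > 0" "c > 0" "1 \<le> m0" "\<And>p k m. pc / 2 \<le> p \<Longrightarrow> p \<le> pc \<Longrightarrow> m0 \<le> m \<Longrightarrow> m \<le> k \<Longrightarrow> (pc - p) * (real m)\<^sup>2 \<le> c \<Longrightarrow>
    (\<Sum>y\<in>bdry (box k). tauS p (box k) 0 y) \<le> C * (\<Sum>x\<in>?A k m. T p 0 x) / (real m)\<^sup>2 + C * real k ^ ?d / real m ^ (?d + 1)"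
    using reversed_simon by blast
  obtain D where D: "D > 0" "\<And>p. pc / 2 \<le> p \<Longrightarrow> p < pc \<Longrightarrow> chi p \<le> D / (pc - p)" using chi_upper_bound by blast
  obtain J0 :: nat where J0: "8 * C * D / (c * \<alpha>) \<le> real J0" using real_arch_simple by blast
  define J where "J = Suc J0"
  have J: "1 \<le> J" "8 * C * D \<le> \<alpha> * c * real J"
    using J0 C(2) \<alpha> by (auto simp: J_def field_simps intro: add_increasing)
  \<comment> \<open>Chosen to give \<open>(pc - p) * (real m)\<^sup>2 \<le> c\<close> for
    \<open>m\<close> of order \<open>n / (5 J)\<close>. It grows like \<open>J^2\<close>, which
    cancels the factor \<open>(n / m)^2\<close>.\<close>
  define K where "K = c * (25 * (real J)\<^sup>2)"
  have K: "K > 0" using C(2) J by (simp add: K_def)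
  obtain N1 :: nat where N1: "2 * C * real (10 * J) ^ (?d + 1) / \<alpha> \<le> real N1" using real_arch_simple by blast
  obtain N2 :: nat where N2: "2 * K / pc \<le> real N2" using real_arch_simple by blast
  define n0 where "n0 = max 1 (max (5 * J * m0) (max N1 N2))"
  have main: "pc / 2 \<le> pc - K / (real n)\<^sup>2 \<and> (\<exists>k\<le>n. (\<Sum>y\<in>bdry (box k). tauS (pc - K / (real n)\<^sup>2) (box k) 0 y) \<le> \<alpha>)" if n: "n0 \<le> n" for n
  proof -
    have n2: "1 \<le> n" "5 * J * m0 \<le> n" "N1 \<le> n" "N2 \<le> n" using n by (auto simp: n0_def)
    have "2 * C * real (10 * J) ^ (?d + 1) / \<alpha> \<le> real n" "2 * K / pc \<le> real n" using N1 N2 n2(3,4) by linarith+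
    then have n1: "1 \<le> n" "5 * J * m0 \<le> n" "2 * C * real (10 * J) ^ (?d + 1) \<le> \<alpha> * real n" "2 * K \<le> pc * real n"
      using n2(1,2) by (simp_all only: pos_divide_le_eq[OF \<alpha>] pos_divide_le_eq[OF pc_pos] mult.commute)
    have rn: "1 \<le> real n" "0 < real n" using n1(1) by auto
    have "K / (real n)\<^sup>2 \<le> K / real n" using K rn by (intro divide_left_mono) (auto simp: power2_eq_square)
    also have "\<dots> \<le> pc / 2" using n1(4) rn by (simp add: field_simps)
    finally have Kn: "K / (real n)\<^sup>2 \<le> pc / 2" .
    define p where "p = pc - K / (real n)\<^sup>2"
    have p: "pc / 2 \<le> p" "p < pc" "0 \<le> p" "p \<le> 1" "pc - p = K / (real n)\<^sup>2"
    proof -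
      have "0 < K / (real n)\<^sup>2" using K rn by simp
      then show "pc / 2 \<le> p" "p < pc" "0 \<le> p" "p \<le> 1" "pc - p = K / (real n)\<^sup>2"
        using Kn pc_pos pc_less_1 unfolding p_def by linarith+
    qed
    define m where "m = n div (5 * J)"
    have J5: "0 < 5 * J" using J by simp
    have mn: "5 * J * m \<le> n" by (simp add: m_def)
    have m0: "m0 \<le> m" unfolding m_def using n1(2) J5 by (simp add: less_eq_div_iff_mult_less_eq mult.commute)
    have nm: "n \<le> 10 * J * m"
    proof -
      have "n < 5 * J * m + 5 * J" using dividend_less_times_div[OF J5, of n] unfolding m_def by linarith
      moreover have "5 * J * 1 \<le> 5 * J * m" using m0 C(3) by (intro mult_left_mono) auto
      ultimately show ?thesis by linarith
    qed
    have m1: "0 < real m" using m0 C(3) by simp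
    have nm': "real n \<le> real (10 * J) * real m" using nm by (simp only: of_nat_mult[symmetric] of_nat_le_iff)
    have mn': "5 * real J * real m \<le> real n" using mn by (metis of_nat_le_iff of_nat_mult of_nat_numeral)
    have pm: "(pc - p) * (real m)\<^sup>2 \<le> c"
    proof -
      have "(5 * real J * real m)\<^sup>2 \<le> (real n)\<^sup>2" by (rule power_mono[OF mn']) simp
      then have "c * (5 * real J * real m)\<^sup>2 \<le> c * (real n)\<^sup>2" using C(2) by simp
      then show ?thesis unfolding p(5) K_def using rn by (simp add: field_simps power_mult_distrib)
    qed
    \<comment> \<open>The spacing \<open>5 * m\<close> exceeds the full width \<open>4 * m\<close>
      of an annulus, so the annuli are disjoint.\<close>
    define k where "k i = 5 * m * Suc i" for i
    have k: "m \<le> k i" "i < J \<Longrightarrow> k i \<le> n" for i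
    proof -
      show "m \<le> k i" by (simp add: k_def)
      assume "i < J"
      then have "5 * m * Suc i \<le> 5 * m * J" by (intro mult_left_mono) auto
      also have "\<dots> = 5 * J * m" by simp
      finally show "k i \<le> n" using mn unfolding k_def by linarith
    qed
    let ?\<Phi> = "\<lambda>i. \<Sum>y\<in>bdry (box (k i)). tauS p (box (k i)) 0 y"
    have finA: "finite (?A k m)" for k m
      by (rule finite_subset[OF _ finite_box[of "k + 2 * m"]]) (auto simp: box_def)
    have disj: "?A (k i) m \<inter> ?A (k j) m = {}" if "i < j" for i j
    proof -
      have "5 * m * Suc (Suc i) \<le> 5 * m * Suc j" using that by (intro mult_left_mono) auto
      then have "k i + 5 * m \<le> k j" by (simp add: k_def algebra_simps)
      then have "k i + 2 * m + 2 * m < k j" using m1 by simp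
      then show ?thesis by auto
    qed
    have "(\<Sum>i<J. ?\<Phi> i) \<le> (\<Sum>i<J. C / (real m)\<^sup>2 * (\<Sum>x\<in>?A (k i) m. T p 0 x) + C * real n ^ ?d / real m ^ (?d + 1))"
    proof (rule sum_mono)
      fix i assume "i \<in> {..<J}"
      then have "C * real (k i) ^ ?d / real m ^ (?d + 1) \<le> C * real n ^ ?d / real m ^ (?d + 1)"
        using k(2)[of i] C(1) by (intro divide_right_mono mult_left_mono power_mono) auto
      then show "?\<Phi> i \<le> C / (real m)\<^sup>2 * (\<Sum>x\<in>?A (k i) m. T p 0 x) + C * real n ^ ?d / real m ^ (?d + 1)"
        using C(4)[OF p(1) less_imp_le[OF p(2)] m0 k(1)[of i] pm] by simp
    qed
    also have "\<dots> = C / (real m)\<^sup>2 * (\<Sum>i<J. \<Sum>x\<in>?A (k i) m. T p 0 x) + real J * (C * real n ^ ?d / real m ^ (?d + 1))"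
      by (simp only: sum.distrib sum_distrib_left[symmetric] sum_constant card_lessThan)
    also have "(\<Sum>i<J. \<Sum>x\<in>?A (k i) m. T p 0 x) = (\<Sum>x\<in>(\<Union>i<J. ?A (k i) m). T p 0 x)"
    proof (rule sum.UNION_disjoint[symmetric])
      show "\<forall>i\<in>{..<J}. \<forall>j\<in>{..<J}. i \<noteq> j \<longrightarrow> ?A (k i) m \<inter> ?A (k j) m = {}"
      proof (intro ballI impI)
        fix i j :: nat assume "i \<noteq> j"
        then consider "i < j" | "j < i" by linarith
        then show "?A (k i) m \<inter> ?A (k j) m = {}"
          by cases (erule disj, subst Int_commute, erule disj)
      qed
    qed (use finA in auto)
    also have "C / (real m)\<^sup>2 * (\<Sum>x\<in>(\<Union>i<J. ?A (k i) m). T p 0 x) \<le> C / (real m)\<^sup>2 * (D / (pc - p))"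
    proof (rule mult_left_mono)
      have "(\<Sum>x\<in>(\<Union>i<J. ?A (k i) m). T p 0 x) \<le> chi p" by (rule chi_upper[OF p(3,2)]) (use finA in auto)
      also have "\<dots> \<le> D / (pc - p)" by (rule D(2)[OF p(1,2)])
      finally show "(\<Sum>x\<in>(\<Union>i<J. ?A (k i) m). T p 0 x) \<le> D / (pc - p)" .
    qed (use C(1) in simp)
    also have "C / (real m)\<^sup>2 * (D / (pc - p)) \<le> real J * (\<alpha> / 2)"
    proof -
      have "C / (real m)\<^sup>2 * (D / (pc - p)) = C * D * ((real n)\<^sup>2 / (real m)\<^sup>2) / K"
        using K rn by (simp add: p(5))
      also have "\<dots> \<le> C * D * (real (10 * J))\<^sup>2 / K"
      proof (intro divide_right_mono mult_left_mono)
        have "(real n)\<^sup>2 \<le> (real (10 * J) * real m)\<^sup>2" by (rule power_mono[OF nm']) simp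
        then show "(real n)\<^sup>2 / (real m)\<^sup>2 \<le> (real (10 * J))\<^sup>2" using m1 by (simp add: field_simps power_mult_distrib)
      qed (use C(1) D(1) K in auto)
      also have "\<dots> = 4 * C * D / c" using J(1) C(2) by (simp add: K_def power2_eq_square field_simps)
      also have "\<dots> \<le> real J * (\<alpha> / 2)" using J(2) C(2) by (simp add: field_simps)
      finally show ?thesis .
    qed
    also have "real J * (C * real n ^ ?d / real m ^ (?d + 1)) \<le> real J * (\<alpha> / 2)"
    proof (rule mult_left_mono)
      have "real n ^ (?d + 1) \<le> (real (10 * J) * real m) ^ (?d + 1)" by (rule power_mono[OF nm']) simp
      then have "C * real n ^ ?d * real n \<le> C * (real (10 * J) ^ (?d + 1) * real m ^ (?d + 1))"
        using C(1) by (simp add: power_mult_distrib mult_ac)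
      also have "\<dots> = (2 * C * real (10 * J) ^ (?d + 1)) * (real m ^ (?d + 1) / 2)" by simp
      also have "\<dots> \<le> (\<alpha> * real n) * (real m ^ (?d + 1) / 2)" by (rule mult_right_mono[OF n1(3)]) simp
      finally have "C * real n ^ ?d \<le> \<alpha> * (real m ^ (?d + 1) / 2)" using rn by simp
      then show "C * real n ^ ?d / real m ^ (?d + 1) \<le> \<alpha> / 2" using m1 by (simp add: pos_divide_le_eq)
    qed simp
    finally have sum: "(\<Sum>i<J. ?\<Phi> i) \<le> real J * \<alpha>" by (simp add: mult.commute)
    have "\<exists>i<J. ?\<Phi> i \<le> \<alpha>"
    proof (rule ccontr)
      assume "\<not> ?thesis"
      then have "(\<Sum>i<J. \<alpha>) < (\<Sum>i<J. ?\<Phi> i)" using J(1) by (intro sum_strict_mono) (auto simp: lessThan_empty_iff)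
      then show False using sum by simp
    qed
    then obtain i where "i < J" "?\<Phi> i \<le> \<alpha>" by blast
    then show ?thesis using p(1) k(2)[of i] unfolding p_def by blast
  qed
  show ?thesis by (rule exI[of _ K], rule conjI[OF K], rule exI[of _ n0], rule conjI, simp add: n0_def, intro allI impI, rule main)
qed

text \<open>Stopping a path at its first exit from \<open>box (n - 1)\<close> shows that the event
  uses only edges inside \<open>box (n + L)\<close>. The exploration then reveals a cluster in a
  box, not the whole one.\<close>

lemma far_local:
  assumes n: "1 \<le> n" and F: "fin_sub F"
  shows "bprob p F (far n 0) = bprob p (F \<inter> EI (box (n + L))) (far n 0)"
proof (rule bprob_local[OF fin_subD(1)[OF F]])
  fix \<xi> assume w: "\<xi> \<subseteq> F"
  show "far n 0 \<xi> = far n 0 (\<xi> \<inter> (F \<inter> EI (box (n + L))))"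
  proof
    assume "far n 0 \<xi>"
    then obtain y where y: "int n \<le> norm_linf y" "conn \<xi> 0 y" by (auto simp: far_def)
    let ?S = "box (n - 1) :: (int ^ 'd) set"
    have "\<exists>u\<in>?S. \<exists>v. v \<notin> ?S \<and> {u, v} \<in> \<xi> \<and> disj_occ (\<lambda>\<xi>. conn (inside ?S \<xi>) 0 u) (disj_occ (\<lambda>\<xi>. {u, v} \<in> \<xi>) (\<lambda>\<xi>. conn \<xi> v y)) \<xi>"
      by (rule conn_first_exit[OF y(2)]) (use y(1) n in \<open>auto simp: box_def\<close>)
    then obtain u v where uv: "u \<in> ?S" "v \<notin> ?S" "{u, v} \<in> \<xi>" "disj_occ (\<lambda>\<xi>. conn (inside ?S \<xi>) 0 u) (disj_occ (\<lambda>\<xi>. {u, v} \<in> \<xi>) (\<lambda>\<xi>. conn \<xi> v y)) \<xi>"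
      by blast
    obtain \<xi>' where w': "\<xi>' \<subseteq> \<xi>" "conn (inside ?S \<xi>') 0 u" using uv(4) unfolding disj_occ_def by blast
    have E: "{u, v} \<in> \<E>" using uv(3) w fin_subD(2)[OF F] by blast
    have v: "norm_linf v \<le> int (n + L)" "int n \<le> norm_linf v"
      using edge_range[OF E] norm_linf_triangle_sub[of v u] uv(1,2) n by (auto simp: box_def norm_linf_commute)
    have "?S \<subseteq> box (n + L)" by (auto simp: box_def)
    then have "inside ?S \<xi>' \<subseteq> \<xi> \<inter> (F \<inter> EI (box (n + L)))"
      using w'(1) w fin_subD(2)[OF F] by (auto simp: inside_def EI_def)
    then have "conn (\<xi> \<inter> (F \<inter> EI (box (n + L)))) 0 u" by (rule conn_mono[OF w'(2)])
    moreover have "{u, v} \<in> \<xi> \<inter> (F \<inter> EI (box (n + L)))"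
      using uv(1,3) v(1) E w by (auto simp: EI_def box_def)
    ultimately have "conn (\<xi> \<inter> (F \<inter> EI (box (n + L)))) 0 v" by (rule conn_trans[OF _ conn_edge])
    then show "far n 0 (\<xi> \<inter> (F \<inter> EI (box (n + L))))" using v(2) unfolding far_def by auto
  next
    assume "far n 0 (\<xi> \<inter> (F \<inter> EI (box (n + L))))"
    then show "far n 0 \<xi>" by (rule incrD[OF incr_far Int_lower1])
  qed
qed simp

lemma clu_insert_untouched:
  assumes "e \<inter> clu \<xi> B = {}"
  shows "clu (insert e \<xi>) B = clu \<xi> B" "clu (\<xi> - {e}) B = clu \<xi> B"
proof -
  have "touch (clu \<xi> B) (insert e \<xi>) = touch (clu \<xi> B) \<xi>" "touch (clu \<xi> B) (\<xi> - {e}) = touch (clu \<xi> B) \<xi>"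
    using assms by (auto simp: touch_def)
  then show "clu (insert e \<xi>) B = clu \<xi> B" "clu (\<xi> - {e}) B = clu \<xi> B"
    using clu_eq_iff_touch[of _ B "clu \<xi> B"] by metis+
qed

text \<open>The exploration reveals the cluster of \<open>0\<close> within
  \<open>box (n + L)\<close>. Its expected size is of order \<open>n^2\<close> for all parameters up
  to \<open>pc\<close>, so the square root of the arm probability has derivative of order at most
  \<open>n\<close>.\<close>

lemma arm_fisher: "\<exists>C>0. \<forall>n\<ge>1. \<forall>p. pc / 2 \<le> p \<longrightarrow> p \<le> pc \<longrightarrow> sqrt (arm pc n) \<le> sqrt (arm p n) + (pc - p) * (C * real n)"
proof -
  obtain C2 where C2: "C2 > 0" "\<And>s n X z v. 0 \<le> s \<Longrightarrow> s \<le> pc \<Longrightarrow> 1 \<le> n \<Longrightarrow> X \<subseteq> bx z n \<Longrightarrow> (\<Sum>x\<in>X. T s v x) \<le> C2 * (real n)\<^sup>2"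
    using sum_T_box by blast
  define D where "D = (real deg * (C2 * (1 + real L)\<^sup>2)) / (pc / 2 * (1 - pc))"
  have D0: "0 \<le> D" unfolding D_def using C2(1) pc_pos pc_less_1 by simp
  define C where "C = sqrt D + 1"
  have C: "C > 0" using D0 by (simp add: C_def add_nonneg_pos)
  have "sqrt (arm pc n) \<le> sqrt (arm p n) + (pc - p) * (C * real n)" if n: "1 \<le> n" and p: "pc / 2 \<le> p" "p \<le> pc" for n p
  proof -
    have p01: "0 < p" "0 \<le> p" "p \<le> 1" using p pc_pos pc_less_1 by auto
    let ?r = "sqrt (arm p n) + (pc - p) * (C * real n)"
    have r0: "0 \<le> ?r" using arm_nonneg[OF p01(2,3), of n] p C by simp
    have one: "sqrt (bprob pc G (far n 0)) \<le> ?r" if G: "fin_sub G" for G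
    proof -
      define F where "F = G \<inter> EI (box (n + L))"
      let ?V = "box (n + L) :: (int ^ 'd) set"
      have F: "fin_sub F" "F \<subseteq> EI ?V" using G by (auto simp: F_def fin_sub_def)
      have far: "far n 0 \<xi> \<longleftrightarrow> (\<exists>y\<in>clu \<xi> {0}. int n \<le> norm_linf y)" for \<xi> :: "'d edge set"
        by (auto simp: far_def clu_def)
      have "sqrt (bprob pc F (far n 0)) \<le> sqrt (bprob p F (far n 0)) + (pc - p) * sqrt ((real deg * (C2 * ((1 + real L) * real n)\<^sup>2)) / (p * (1 - pc)))"
      proof (rule sqrt_bprob_le[where R = "\<lambda>e \<xi>. e \<inter> clu \<xi> {0} \<noteq> {}"])
        fix s assume s: "p \<le> s" "s \<le> pc"
        have s01: "0 \<le> s" "s \<le> 1" using s p01 pc_less_1 by auto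
        have "bexp s F (\<lambda>\<xi>. \<Sum>e\<in>F. of_bool (e \<inter> clu \<xi> {0} \<noteq> {})) \<le> real deg * (\<Sum>x\<in>?V. bprob s F (\<lambda>\<xi>. x \<in> clu \<xi> {0}))"
        proof (rule expected_touching_le[OF F(1) s01 finite_box])
          fix \<xi> assume w: "\<xi> \<subseteq> F"
          then have "\<Union>\<xi> \<subseteq> ?V" using F(2) by (auto simp: EI_def)
          then show "clu \<xi> {0} \<subseteq> ?V" using conn_in_Union[of \<xi> 0] by (fastforce simp: clu_def box_def)
        qed
        also have "\<dots> \<le> real deg * (C2 * ((1 + real L) * real n)\<^sup>2)"
        proof (rule mult_left_mono)
          have "(\<Sum>x\<in>?V. bprob s F (\<lambda>\<xi>. x \<in> clu \<xi> {0})) \<le> (\<Sum>x\<in>?V. T s 0 x)"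
            by (rule sum_mono) (use tau_le_T[OF s01 F(1)] in \<open>simp add: clu_def\<close>)
          also have "\<dots> \<le> C2 * (real (n + L))\<^sup>2" by (rule C2(2)[OF s01(1) s(2), of _ _ 0]) (use n in \<open>auto simp: bx_def box_def\<close>)
          also have "\<dots> \<le> C2 * ((1 + real L) * real n)\<^sup>2"
          proof (intro mult_left_mono power_mono)
            have "L * 1 \<le> L * n" using n by (intro mult_left_mono) auto
            then have "n + L \<le> (1 + L) * n" by simp
            then show "real (n + L) \<le> (1 + real L) * real n" by (metis of_nat_1 of_nat_add of_nat_le_iff of_nat_mult)
          qed (use C2(1) in auto)
          finally show "(\<Sum>x\<in>?V. bprob s F (\<lambda>\<xi>. x \<in> clu \<xi> {0})) \<le> C2 * ((1 + real L) * real n)\<^sup>2" .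
        qed simp
        finally show "bexp s F (\<lambda>\<xi>. \<Sum>e\<in>F. of_bool (e \<inter> clu \<xi> {0} \<noteq> {})) \<le> real deg * (C2 * ((1 + real L) * real n)\<^sup>2)" .
      next
        fix e f and \<xi> :: "'d edge set" assume "\<not> e \<inter> clu \<xi> {0} \<noteq> {}"
        then have "e \<inter> clu \<xi> {0} = {}" by simp
        note c = clu_insert_untouched[OF this]
        show "(f \<inter> clu (insert e \<xi>) {0} \<noteq> {}) = (f \<inter> clu \<xi> {0} \<noteq> {})" "(f \<inter> clu (\<xi> - {e}) {0} \<noteq> {}) = (f \<inter> clu \<xi> {0} \<noteq> {})"
          "far n 0 (insert e \<xi>) = far n 0 \<xi>" unfolding far c by (rule refl)+
      qed (use fin_subD(1)[OF F(1)] p p01 pc_less_1 in auto)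
      also have "\<dots> \<le> ?r"
      proof (intro add_mono mult_left_mono real_sqrt_le_mono far_le_arm[OF p01(2,3) F(1)])
        have "(real deg * (C2 * ((1 + real L) * real n)\<^sup>2)) / (p * (1 - pc)) \<le> (real deg * (C2 * ((1 + real L) * real n)\<^sup>2)) / (pc / 2 * (1 - pc))"
          using p p01 pc_pos pc_less_1 C2(1) by (intro divide_left_mono mult_right_mono mult_pos_pos mult_nonneg_nonneg) auto
        also have "\<dots> = D * (real n)\<^sup>2" by (simp add: D_def power_mult_distrib mult_ac)
        finally have "sqrt ((real deg * (C2 * ((1 + real L) * real n)\<^sup>2)) / (p * (1 - pc))) \<le> sqrt (D * (real n)\<^sup>2)" by (rule real_sqrt_le_mono)
        also have "\<dots> = sqrt D * real n" by (simp add: real_sqrt_mult)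
        also have "\<dots> \<le> C * real n" by (intro mult_right_mono) (auto simp: C_def)
        finally show "sqrt ((real deg * (C2 * ((1 + real L) * real n)\<^sup>2)) / (p * (1 - pc))) \<le> C * real n" .
      qed (use p in simp)
      finally show ?thesis unfolding far_local[OF n G] F_def .
    qed
    have "arm pc n \<le> ?r\<^sup>2" unfolding arm_def[of pc]
    proof (rule PS_least[OF less_imp_le[OF pc_pos] less_imp_le[OF pc_less_1]])
      fix G assume "fin_sub G"
      from one[OF this] show "bprob pc G (far n 0) \<le> ?r\<^sup>2" using r0 by (simp add: sqrt_le_D)
    qed
    then show ?thesis using r0 by (simp add: real_le_lsqrt)
  qed
  with C show ?thesis by blast
qed

text \<open>A vertex just outside \<open>box k\<close> has norm at most \<open>k + L\<close>, so an
  arm to distance \<open>n\<close> has to travel a further distance \<open>j\<close> from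
  there.\<close>

lemma arm_simon:
  assumes p: "0 \<le> p" "p \<le> 1" and n: "k + L + j \<le> n" and \<alpha>: "(\<Sum>y\<in>bdry (box k). tauS p (box k) 0 y) \<le> \<alpha>"
  shows "arm p n \<le> real deg * \<alpha> * arm p j"
  unfolding arm_def[of p n]
proof (rule PS_least[OF p])
  fix F assume F: "fin_sub F"
  let ?S = "box k :: (int ^ 'd) set" and ?Y = "{y :: int ^ 'd. int n \<le> norm_linf y}"
  let ?O = "\<lambda>u. {v \<in> \<Union>F. v \<notin> ?S \<and> {u, v} \<in> F}"
  have kn: "k < n" using n L_pos by simp
  have "bprob p F (far n 0) = bprob p F (\<lambda>\<xi>. \<exists>y\<in>?Y. conn \<xi> 0 y)" by (rule arg_cong[of _ _ "bprob p F"]) (auto simp: far_def fun_eq_iff)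
  also have "\<dots> \<le> (\<Sum>u\<in>?S. \<Sum>v\<in>?O u. tau_in p F ?S 0 u * (p * bprob p F (\<lambda>\<xi>. \<exists>y\<in>?Y. conn \<xi> v y)))"
    by (rule simon_lieb[OF fin_subD(1)[OF F] p finite_box]) (use kn fin_subD(3)[OF F] in \<open>auto simp: box_def\<close>)
  also have "\<dots> = (\<Sum>u\<in>bdry ?S. \<Sum>v\<in>?O u. tau_in p F ?S 0 u * (p * bprob p F (\<lambda>\<xi>. \<exists>y\<in>?Y. conn \<xi> v y)))"
  proof (rule sum.mono_neutral_right)
    show "\<forall>u\<in>?S - bdry ?S. (\<Sum>v\<in>?O u. tau_in p F ?S 0 u * (p * bprob p F (\<lambda>\<xi>. \<exists>y\<in>?Y. conn \<xi> v y))) = 0"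
    proof
      fix u assume "u \<in> ?S - bdry ?S"
      then have "?O u = {}" using fin_subD(2)[OF F] by (auto simp: bdry_def out_def)
      then show "(\<Sum>v\<in>?O u. tau_in p F ?S 0 u * (p * bprob p F (\<lambda>\<xi>. \<exists>y\<in>?Y. conn \<xi> v y))) = 0" by (simp only: sum.empty)
    qed
  qed (auto simp: bdry_def)
  also have "\<dots> \<le> (\<Sum>u\<in>bdry ?S. real deg * (tauS p ?S 0 u * arm p j))"
  proof (rule sum_mono)
    fix u assume u: "u \<in> bdry ?S"
    have "(\<Sum>v\<in>?O u. tau_in p F ?S 0 u * (p * bprob p F (\<lambda>\<xi>. \<exists>y\<in>?Y. conn \<xi> v y))) \<le> (\<Sum>v\<in>?O u. tauS p ?S 0 u * (1 * arm p j))"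
    proof (intro sum_mono mult_mono bprob_inside_le[OF F finite_box p])
      fix v assume v: "v \<in> ?O u"
      then have "norm_linf (u - v) \<le> int L" using fin_subD(2)[OF F] by (intro edge_range) auto
      then have nv: "norm_linf v \<le> int k + int L" using norm_linf_triangle_sub[of v u] u by (auto simp: bdry_def box_def norm_linf_commute)
      have "bprob p F (\<lambda>\<xi>. \<exists>y\<in>?Y. conn \<xi> v y) \<le> bprob p F (far j v)"
      proof (rule bprob_mono[OF p])
        fix \<xi> assume "\<exists>y\<in>?Y. conn \<xi> v y"
        then obtain y where y: "int n \<le> norm_linf y" "conn \<xi> v y" by blast
        then show "far j v \<xi>" using norm_linf_triangle_sub[of y v] nv n unfolding far_def by (intro exI[of _ y]) auto
      qed
      also have "\<dots> \<le> arm p j" by (rule far_le_arm[OF p F])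
      finally show "bprob p F (\<lambda>\<xi>. \<exists>y\<in>?Y. conn \<xi> v y) \<le> arm p j" .
    qed (use p in \<open>auto intro!: mult_nonneg_nonneg bprob_nonneg tauS_nonneg\<close>)
    also have "\<dots> = real (card (?O u)) * (tauS p ?S 0 u * arm p j)" by simp
    also have "\<dots> \<le> real deg * (tauS p ?S 0 u * arm p j)"
    proof (intro mult_right_mono mult_nonneg_nonneg tauS_nonneg arm_nonneg p)
      have "card (?O u) \<le> card (out ?S u)" by (rule card_mono[OF finite_out(1)]) (use fin_subD(2)[OF F] in \<open>auto simp: out_def\<close>)
      then show "real (card (?O u)) \<le> real deg" using finite_out(2)[of ?S u] by linarith
    qed
    finally show "(\<Sum>v\<in>?O u. tau_in p F ?S 0 u * (p * bprob p F (\<lambda>\<xi>. \<exists>y\<in>?Y. conn \<xi> v y))) \<le> real deg * (tauS p ?S 0 u * arm p j)" .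
  qed
  also have "\<dots> = real deg * ((\<Sum>u\<in>bdry ?S. tauS p ?S 0 u) * arm p j)" by (simp only: sum_distrib_left sum_distrib_right)
  also have "\<dots> \<le> real deg * (\<alpha> * arm p j)" by (intro mult_left_mono mult_right_mono \<alpha> arm_nonneg p) simp
  finally show "bprob p F (far n 0) \<le> real deg * \<alpha> * arm p j" by (simp only: mult.assoc)
qed

lemma arm_upper: "\<exists>C>0. \<forall>n\<ge>1. arm pc n \<le> C / (real n)\<^sup>2"
proof -
  have pc01: "0 \<le> pc" "pc \<le> 1" using pc_pos pc_less_1 by auto
  have deg: "0 < real deg" by (simp add: deg_def card_box)
  \<comment> \<open>\<open>576\<close> is the square of \<open>24\<close>: after taking roots,
    Simon's inequality contributes the factor \<open>1 / 24\<close>.\<close>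
  define \<alpha> where "\<alpha> = 1 / (576 * real deg)"
  have \<alpha>: "0 < \<alpha>" "real deg * \<alpha> = (1 / 24)\<^sup>2" using deg by (simp_all add: \<alpha>_def power2_eq_square)
  obtain K n0 where K: "K > 0" "1 \<le> n0" "\<And>n. n0 \<le> n \<Longrightarrow> pc / 2 \<le> pc - K / (real n)\<^sup>2 \<and>
    (\<exists>k\<le>n. (\<Sum>y\<in>bdry (box k). tauS (pc - K / (real n)\<^sup>2) (box k) 0 y) \<le> \<alpha>)"
    using small_boundary[OF \<alpha>(1)] by blast
  obtain D where D: "D > 0" "\<And>n p. 1 \<le> n \<Longrightarrow> pc / 2 \<le> p \<Longrightarrow> p \<le> pc \<Longrightarrow> sqrt (arm pc n) \<le> sqrt (arm p n) + (pc - p) * (D * real n)"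
    using arm_fisher by blast
  \<comment> \<open>\<open>2 * L \<le> n\<close> makes room for
    \<open>k + L + n div 2 \<le> 2 * n\<close> when \<open>k \<le> n\<close>.\<close>
  define n1 where "n1 = max n0 (2 * L)"
  have step: "sqrt (arm pc (2 * n)) \<le> sqrt (arm pc (n div 2)) / 24 + 2 * K * D / real n" if n: "n1 \<le> n" for n
  proof -
    define p where "p = pc - K / (real n)\<^sup>2"
    have n': "n0 \<le> n" "2 * L \<le> n" "1 \<le> n" using n K(2) by (auto simp: n1_def)
    from K(3)[OF n'(1)] obtain k where k: "pc / 2 \<le> p" "k \<le> n" "(\<Sum>y\<in>bdry (box k). tauS p (box k) 0 y) \<le> \<alpha>" unfolding p_def by blast
    have "0 \<le> K / (real n)\<^sup>2" using K(1) by simp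
    then have p: "0 \<le> p" "p \<le> pc" "p \<le> 1" using k(1) pc_pos pc_less_1 unfolding p_def by linarith+
    have "arm p (2 * n) \<le> real deg * \<alpha> * arm p (n div 2)"
      by (rule arm_simon[OF p(1,3) _ k(3)]) (use k(2) n'(2) in linarith)
    also have "\<dots> \<le> real deg * \<alpha> * arm pc (n div 2)"
      using arm_mono[OF p(1,2) pc01(2)] deg \<alpha>(1) by (intro mult_left_mono) auto
    finally have "sqrt (arm p (2 * n)) \<le> sqrt ((1 / 24)\<^sup>2 * arm pc (n div 2))" unfolding \<alpha>(2) by (rule real_sqrt_le_mono)
    also have "\<dots> = sqrt (arm pc (n div 2)) / 24" by (simp add: real_sqrt_mult)
    finally have "sqrt (arm p (2 * n)) \<le> sqrt (arm pc (n div 2)) / 24" .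
    moreover have "sqrt (arm pc (2 * n)) \<le> sqrt (arm p (2 * n)) + (pc - p) * (D * real (2 * n))"
      by (rule D(2)[OF _ k(1) p(2)]) (use n'(3) in simp)
    moreover have "(pc - p) * (D * real (2 * n)) = 2 * K * D / real n" using n'(3) by (simp add: p_def power2_eq_square)
    ultimately show ?thesis by linarith
  qed
  \<comment> \<open>The first part keeps the Fisher term below \<open>B / (4 h)\<close>; the second
    covers all \<open>n < 2 * n1 + 2\<close> by the trivial bound 1.\<close>
  define B where "B = max (8 * K * D) (2 * real n1 + 2)"
  have B: "8 * K * D \<le> B" "2 * real n1 + 2 \<le> B" "0 < B" by (auto simp: B_def)
  have bound: "sqrt (arm pc n) \<le> B / real n" if "1 \<le> n" for n
    using that
  proof (induction n rule: less_induct)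
    case (less n)
    show ?case
    proof (cases "n < 2 * n1 + 2")
      case True
      then have "real n \<le> B" using B(2) by linarith
      then have "1 \<le> B / real n" using less(2) by simp
      moreover have "sqrt (arm pc n) \<le> 1" using arm_le_1[OF pc01, of n] by simp
      ultimately show ?thesis by linarith
    next
      case False
      define h where "h = n div 2"
      define g where "g = h div 2"
      have h: "n1 \<le> h" "2 \<le> h" "2 * h \<le> n" "n \<le> 2 * h + 1" "1 \<le> g" "g < n" "h \<le> 3 * g"
        using False K(2) by (auto simp: h_def g_def n1_def)
      have pos: "0 < real h" "0 < real g" "0 < real n" using h by auto
      have "sqrt (arm pc n) \<le> sqrt (arm pc (2 * h))" by (intro real_sqrt_le_mono arm_antimono pc01 h(3))
      also have "\<dots> \<le> sqrt (arm pc g) / 24 + 2 * K * D / real h" unfolding g_def by (rule step[OF h(1)])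
      also have "\<dots> \<le> (B / real g) / 24 + 2 * K * D / real h" using less(1)[OF h(6,5)] by simp
      \<comment> \<open>Since \<open>h \<le> 3 * g\<close>, the factor \<open>1 / 24\<close> becomes
        \<open>1 / 8\<close>; with the \<open>1 / 4\<close> of the Fisher term the total is
        \<open>3 / 8\<close>, and \<open>3 * n \<le> 8 * h\<close> closes the induction.\<close>
      also have "\<dots> \<le> (3 * B / real h) / 24 + (B / 4) / real h"
      proof (intro add_mono divide_right_mono)
        have "B * real h \<le> B * (3 * real g)" using h(7) B(3) by (intro mult_left_mono) auto
        then show "B / real g \<le> 3 * B / real h" using pos by (simp add: field_simps)
      qed (use B(1) in auto)
      also have "\<dots> = (3 / 8) * B / real h" by (simp add: field_simps)
      also have "\<dots> \<le> B / real n"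
      proof -
        have "3 * real n \<le> 8 * real h" using h(2,4) by linarith
        then have "B * (3 * real n) \<le> B * (8 * real h)" using B(3) by (intro mult_left_mono) auto
        then show ?thesis using pos by (simp add: field_simps)
      qed
      finally show ?thesis .
    qed
  qed
  have "arm pc n \<le> B\<^sup>2 / (real n)\<^sup>2" if "1 \<le> n" for n
    using sqrt_le_D[OF bound[OF that]] by (simp add: power_divide)
  then show ?thesis using B(3) by (intro exI[of _ "B\<^sup>2"]) simp
qed


text \<open>Let \<open>N\<close> be the number of points of an annulus at scale \<open>n\<close>
  connected to \<open>0\<close>. Its mean is at least of order \<open>n^2\<close>, its second moment
  at most of order \<open>n^6\<close>, and it vanishes without an arm; Cauchy-Schwarz gives
  \<open>n^4 / n^6\<close>.\<close>

lemma arm_lower: "\<exists>c>0. \<forall>n\<ge>1. c / (real n)\<^sup>2 \<le> arm pc n"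
proof -
  let ?d = "CARD('d)" and ?q = "CARD('d) - 2"
  have pc01: "0 \<le> pc" "pc \<le> 1" using pc_pos pc_less_1 by auto
  obtain C2 where C2: "C2 > 0" "\<And>s n X z v. 0 \<le> s \<Longrightarrow> s \<le> pc \<Longrightarrow> 1 \<le> n \<Longrightarrow> X \<subseteq> bx z n \<Longrightarrow> (\<Sum>x\<in>X. T s v x) \<le> C2 * (real n)\<^sup>2"
    using sum_T_box by blast
  obtain C3 where C3: "C3 > 0" "\<And>s X x y. 0 \<le> s \<Longrightarrow> s \<le> pc \<Longrightarrow> finite X \<Longrightarrow> (\<Sum>v\<in>X. T s x v * T s v y) \<le> C3 / jb (x - y) ^ (?d - 4)"
    using convolution_T by blast
  define C4 where "C4 = 4 * C2 * C3 * 6 ^ ?d"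
  have C4: "C4 > 0" using C2(1) C3(1) by (simp add: C4_def)
  define c1 where "c1 = a / 2 / 2 ^ ?q"
  have c1: "c1 > 0" using ab by (simp add: c1_def)
  have "c1\<^sup>2 / C4 / (real n)\<^sup>2 \<le> arm pc n" if n: "1 \<le> n" for n
  proof -
    have n0: "0 < real n" using n by simp
    define A where "A = {x :: int ^ 'd. int n \<le> norm_linf x \<and> norm_linf x \<le> int (2 * n)}"
    have Abx: "A \<subseteq> bx 0 (2 * n)" by (auto simp: A_def bx_def)
    have finA: "finite A" by (rule finite_subset[OF Abx finite_bx])
    have cA: "real n ^ ?d \<le> real (card A)"
    proof -
      have "{x :: int ^ 'd. \<forall>i. x $ i \<in> {int n..int (2 * n)}} \<subseteq> A"
      proof
        fix x :: "int ^ 'd" assume x: "x \<in> {x. \<forall>i. x $ i \<in> {int n..int (2 * n)}}"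
        have "int n \<le> x $ i" "x $ i \<le> int (2 * n)" for i using x by auto
        then have "int n \<le> \<bar>x $ i\<bar>" "\<bar>x $ i\<bar> \<le> int (2 * n)" for i by (smt (verit) of_nat_0_le_iff)+
        then have "int n \<le> norm_linf x" "norm_linf x \<le> int (2 * n)"
          using norm_linf_component[of x] order.trans unfolding norm_linf_le_iff by blast+
        then show "x \<in> A" by (simp add: A_def)
      qed
      then have "card {x :: int ^ 'd. \<forall>i. x $ i \<in> {int n..int (2 * n)}} \<le> card A" by (rule card_mono[OF finA])
      moreover have "card {x :: int ^ 'd. \<forall>i. x $ i \<in> {int n..int (2 * n)}} = (n + 1) ^ ?d"
        using conjunct2[OF card_vec_set[of "{int n..int (2 * n)}", where 'd = 'd]] by (simp add: nat_add_distrib)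
      moreover have "n ^ ?d \<le> (n + 1) ^ ?d" by (rule power_mono) auto
      ultimately show ?thesis by (metis of_nat_le_iff of_nat_power order.trans)
    qed
    have CA: "real (card A) \<le> 6 ^ ?d * real n ^ ?d"
    proof -
      have "real (card A) \<le> real (card (bx (0 :: int ^ 'd) (2 * n)))" using card_mono[OF finite_bx Abx] by simp
      also have "\<dots> \<le> (3 * real (2 * n)) ^ ?d" by (rule card_bx_le) (use n in simp)
      also have "3 * real (2 * n) = 6 * real n" by simp
      finally show ?thesis by (simp only: power_mult_distrib)
    qed
    define \<epsilon> where "\<epsilon> = a / 2 / (2 * real n) ^ ?q"
    have \<epsilon>: "\<epsilon> > 0" using ab n0 by (simp add: \<epsilon>_def)
    define good where "good G \<longleftrightarrow> (\<forall>x\<in>A. T pc 0 x - \<epsilon> < tau pc G 0 x)" for G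
    have "\<exists>F. fin_sub F \<and> (\<forall>G. fin_sub G \<longrightarrow> F \<subseteq> G \<longrightarrow> good G)"
      unfolding good_def T_def by (rule PS_approx_finite[OF pc01 finA incr_conn \<epsilon>])
    then obtain F where "fin_sub F" "good F" by blast
    then have F: "fin_sub F" "\<And>x. x \<in> A \<Longrightarrow> T pc 0 x - \<epsilon> < tau pc F 0 x" unfolding good_def by simp_all
    have fin: "finite F" "finite (\<Union>F)" using fin_subD[OF F(1)] by auto
    have low: "\<epsilon> \<le> tau pc F 0 x" if x: "x \<in> A" for x
    proof -
      have "jb (0 - x) \<le> 2 * real n" using x n by (simp add: A_def jb_def)
      then have "a / (2 * real n) ^ ?q \<le> a / jb (0 - x) ^ ?q" using ab n0 by (intro divide_left_mono power_mono mult_pos_pos) auto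
      then have "2 * \<epsilon> \<le> T pc 0 x" using T_lower[of 0 x] by (simp add: \<epsilon>_def)
      then show ?thesis using F(2)[OF x] by linarith
    qed
    let ?N = "\<lambda>\<xi>. \<Sum>x\<in>A. of_bool (conn \<xi> 0 x) :: real"
    have EN: "c1 * (real n)\<^sup>2 \<le> bexp pc F ?N"
    proof -
      have dq: "?d = ?q + 2" using dim by simp
      have "c1 * (real n)\<^sup>2 = real n ^ ?d * \<epsilon>"
        by (subst dq, subst power_add) (use n0 in \<open>simp add: c1_def \<epsilon>_def power_mult_distrib\<close>)
      also have "\<dots> \<le> real (card A) * \<epsilon>" using \<epsilon> by (intro mult_right_mono cA) auto
      also have "\<dots> = (\<Sum>x\<in>A. \<epsilon>)" by simp
      also have "\<dots> \<le> (\<Sum>x\<in>A. tau pc F 0 x)" by (rule sum_mono[OF low])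
      also have "\<dots> = bexp pc F ?N" by (simp only: bexp_sum bprob_def)
      finally show ?thesis .
    qed
    \<comment> \<open>In the tree-graph sum the end point \<open>v\<close> contributes
      \<open>n^2\<close>; the bubble from \<open>0\<close> to \<open>u\<close> contributes
      \<open>n^(4 - d)\<close>, and there are of order \<open>n^d\<close> points
      \<open>u\<close>.\<close>
    have EN2: "bexp pc F (\<lambda>\<xi>. (?N \<xi>)\<^sup>2) \<le> C4 * real n ^ 6"
    proof -
      define V where "V = insert 0 (\<Union>F)"
      have V: "finite V" "0 \<in> V" "\<Union>F \<subseteq> V" using fin by (auto simp: V_def)
      have "bexp pc F (\<lambda>\<xi>. (?N \<xi>)\<^sup>2) = bexp pc F (\<lambda>\<xi>. \<Sum>u\<in>A. \<Sum>v\<in>A. of_bool (conn \<xi> 0 u \<and> conn \<xi> 0 v))"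
        by (simp only: power2_eq_square sum_product of_bool_conj)
      also have "\<dots> = (\<Sum>u\<in>A. \<Sum>v\<in>A. bprob pc F (\<lambda>\<xi>. conn \<xi> 0 u \<and> conn \<xi> 0 v))" by (simp only: bexp_sum bprob_def)
      also have "\<dots> \<le> (\<Sum>u\<in>A. \<Sum>v\<in>A. \<Sum>w\<in>V. T pc 0 w * (T pc w u * T pc w v))"
      proof (intro sum_mono)
        fix u v
        have "bprob pc F (\<lambda>\<xi>. conn \<xi> 0 u \<and> conn \<xi> 0 v) \<le> (\<Sum>w\<in>V. tau pc F 0 w * (tau pc F w u * tau pc F w v))"
          by (rule tree_graph[OF fin(1) pc01 V])
        also have "\<dots> \<le> (\<Sum>w\<in>V. T pc 0 w * (T pc w u * T pc w v))"
          by (intro sum_mono mult_mono tau_le_T[OF pc01 F(1)] mult_nonneg_nonneg bprob_nonneg T_nonneg pc01)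
        finally show "bprob pc F (\<lambda>\<xi>. conn \<xi> 0 u \<and> conn \<xi> 0 v) \<le> (\<Sum>w\<in>V. T pc 0 w * (T pc w u * T pc w v))" .
      qed
      also have "\<dots> = (\<Sum>u\<in>A. \<Sum>w\<in>V. T pc 0 w * T pc w u * (\<Sum>v\<in>A. T pc w v))"
        by (simp only: sum_distrib_left mult.assoc) (intro sum.cong refl sum.swap)
      also have "\<dots> \<le> (\<Sum>u\<in>A. \<Sum>w\<in>V. T pc 0 w * T pc w u * (C2 * (real (2 * n))\<^sup>2))"
        by (intro sum_mono mult_left_mono C2(2)[OF pc01(1) order_refl _ Abx] mult_nonneg_nonneg T_nonneg pc01) (use n in simp)
      also have "\<dots> = (C2 * (real (2 * n))\<^sup>2) * (\<Sum>u\<in>A. \<Sum>w\<in>V. T pc 0 w * T pc w u)"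
        by (simp only: sum_distrib_left mult.commute)
      also have "\<dots> \<le> (C2 * (real (2 * n))\<^sup>2) * (\<Sum>u\<in>A. C3 / real n ^ (?d - 4))"
      proof (intro mult_left_mono sum_mono)
        fix u assume u: "u \<in> A"
        have "(\<Sum>w\<in>V. T pc 0 w * T pc w u) \<le> C3 / jb (0 - u) ^ (?d - 4)" by (rule C3(2)[OF pc01(1) order_refl V(1)])
        also have "\<dots> \<le> C3 / real n ^ (?d - 4)"
        proof (intro divide_left_mono power_mono mult_pos_pos)
          have "int n \<le> norm_linf u" using u by (simp add: A_def)
          then have "real n \<le> real_of_int (norm_linf u)" by linarith
          then show "real n \<le> jb (0 - u)" by (simp add: jb_def)
        qed (use C3(1) n0 in auto)
        finally show "(\<Sum>w\<in>V. T pc 0 w * T pc w u) \<le> C3 / real n ^ (?d - 4)" .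
      qed (use C2(1) in auto)
      also have "\<dots> = (C2 * (real (2 * n))\<^sup>2) * (real (card A) * (C3 / real n ^ (?d - 4)))" by simp
      also have "\<dots> \<le> (C2 * (real (2 * n))\<^sup>2) * (6 ^ ?d * real n ^ ?d * (C3 / real n ^ (?d - 4)))"
        using C2(1) C3(1) CA by (intro mult_left_mono mult_right_mono) auto
      also have "\<dots> = C4 * real n ^ 6"
      proof -
        have "?d = (?d - 4) + 4" using dim by simp
        then have "real n ^ ?d = real n ^ (?d - 4) * real n ^ 4" by (metis power_add)
        then have e: "real n ^ ?d * (C3 / real n ^ (?d - 4)) = C3 * real n ^ 4" using n0 by simp
        have "real n ^ 6 = (real n)\<^sup>2 * real n ^ 4" by (simp add: power_add[symmetric])
        then show ?thesis unfolding mult.assoc[of "6 ^ ?d"] e by (simp add: C4_def power_mult_distrib mult_ac)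
      qed
      finally show ?thesis .
    qed
    have "(bexp pc F ?N)\<^sup>2 \<le> bexp pc F (\<lambda>\<xi>. (?N \<xi>)\<^sup>2) * bprob pc F (far n 0)"
    proof -
      have "bexp pc F ?N = bexp pc F (\<lambda>\<xi>. ?N \<xi> * of_bool (far n 0 \<xi>))"
      proof (rule bexp_cong)
        fix \<xi> :: "'d edge set"
        show "?N \<xi> = ?N \<xi> * of_bool (far n 0 \<xi>)"
        proof (cases "far n 0 \<xi>")
          case False
          then have "\<forall>x\<in>A. \<not> conn \<xi> 0 x" by (auto simp: far_def A_def)
          then have "?N \<xi> = 0" by (intro sum.neutral) auto
          then show ?thesis by (simp only: mult_zero_left)
        qed simp
      qed
      moreover have "bexp pc F (\<lambda>\<xi>. (of_bool (far n 0 \<xi>))\<^sup>2) = bprob pc F (far n 0)"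
        unfolding bprob_def by (rule bexp_cong) simp
      ultimately show ?thesis using bexp_cauchy_schwarz[OF pc01, of F ?N "\<lambda>\<xi>. of_bool (far n 0 \<xi>)"] by simp
    qed
    also have "\<dots> \<le> (C4 * real n ^ 6) * arm pc n"
      by (intro mult_mono EN2 far_le_arm pc01 F(1) bprob_nonneg) (use C4 in auto)
    finally have 1: "(bexp pc F ?N)\<^sup>2 \<le> (C4 * real n ^ 6) * arm pc n" .
    have 2: "(c1 * (real n)\<^sup>2)\<^sup>2 \<le> (bexp pc F ?N)\<^sup>2" by (rule power_mono[OF EN]) (use c1 in simp)
    have 3: "(c1 * (real n)\<^sup>2)\<^sup>2 = c1\<^sup>2 * real n ^ 4" by (simp add: power_mult_distrib)
    have 4: "real n ^ 6 = (real n)\<^sup>2 * real n ^ 4" by (simp add: power_add[symmetric])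
    have "c1\<^sup>2 * real n ^ 4 \<le> (C4 * (real n)\<^sup>2 * arm pc n) * real n ^ 4"
      using order_trans[OF 2 1] unfolding 3 4 by (simp only: mult_ac)
    then have "c1\<^sup>2 \<le> C4 * (real n)\<^sup>2 * arm pc n" by (rule mult_right_le_imp_le) (use n0 in simp)
    then show ?thesis using C4 n0 by (simp add: field_simps)
  qed
  then show ?thesis using c1 C4 by (intro exI[of _ "c1\<^sup>2 / C4"]) simp
qed

lemma one_arm_critical: "\<exists>c C. 0 < c \<and> 0 < C \<and> (\<forall>n\<ge>1. c / real n ^ 2 \<le> one_arm \<E> n pc \<and> one_arm \<E> n pc \<le> C / real n ^ 2)"
proof -
  have pc01: "0 \<le> pc" "pc \<le> 1" using pc_pos pc_less_1 by auto
  obtain C where C: "C > 0" "\<And>n. 1 \<le> n \<Longrightarrow> arm pc n \<le> C / (real n)\<^sup>2" using arm_upper by blast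
  obtain c where c: "c > 0" "\<And>n. 1 \<le> n \<Longrightarrow> c / (real n)\<^sup>2 \<le> arm pc n" using arm_lower by blast
  \<comment> \<open>The second part covers \<open>n < 2 * L\<close>, where \<open>n - L\<close> may
    be too small to be of use.\<close>
  define D where "D = max (4 * C) ((real (2 * L))\<^sup>2)"
  have D: "4 * C \<le> D" "(real (2 * L))\<^sup>2 \<le> D" by (auto simp: D_def)
  have "c / 4 / real n ^ 2 \<le> one_arm \<E> n pc \<and> one_arm \<E> n pc \<le> D / real n ^ 2" if n: "1 \<le> n" for n
  proof
    have "c / 4 / real n ^ 2 = c / (2 * real n)\<^sup>2" by (simp add: power_mult_distrib)
    also have "\<dots> \<le> c / (real (Suc n))\<^sup>2" using c(1) n by (intro divide_left_mono power_mono) auto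
    also have "\<dots> \<le> arm pc (Suc n)" by (rule c(2)) simp
    also have "\<dots> \<le> one_arm \<E> n pc" by (rule one_arm_bounds(1)[OF pc01])
    finally show "c / 4 / real n ^ 2 \<le> one_arm \<E> n pc" .
    have "one_arm \<E> n pc \<le> arm pc (n - L)" by (rule one_arm_bounds(2)[OF pc01])
    also have "\<dots> \<le> D / real n ^ 2"
    proof (cases "n < 2 * L")
      case True
      then have "real n ^ 2 \<le> (real (2 * L))\<^sup>2" by (intro power_mono) auto
      then have "1 \<le> D / real n ^ 2" using D(2) n by (simp add: field_simps)
      then show ?thesis using arm_le_1[OF pc01, of "n - L"] by linarith
    next
      case False
      then have h: "real n / 2 \<le> real (n - L)" "1 \<le> n - L" using n L_pos by auto
      have "arm pc (n - L) \<le> C / (real (n - L))\<^sup>2" by (rule C(2)[OF h(2)])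
      also have "\<dots> \<le> C / (real n / 2)\<^sup>2" using h n C(1) by (intro divide_left_mono power_mono) auto
      also have "\<dots> = 4 * C / real n ^ 2" by (simp add: power_divide)
      also have "\<dots> \<le> D / real n ^ 2" by (rule divide_right_mono[OF D(1)]) simp
      finally show ?thesis .
    qed
    finally show "one_arm \<E> n pc \<le> D / real n ^ 2" .
  qed
  moreover have "0 < D" using C(1) D(1) by linarith
  ultimately show ?thesis using c(1) by (intro exI[of _ "c / 4"] exI[of _ D]) auto
qed

end

section \<open>The two edge sets of the theorem\<close>

lemma norm_linf_le_l1: "norm_linf x \<le> norm_l1 x"
  unfolding norm_linf_le_iff norm_l1_def by (intro allI member_le_sum) auto

lemma norm_l1_commute: "norm_l1 (x - y) = norm_l1 (y - x)"
  unfolding norm_l1_def by (intro sum.cong) (auto simp: abs_minus_commute)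

text \<open>\<open>R\<close> stands for \<open>k = 1\<close> in the nearest-neighbour case and for
  \<open>0 < k \<le> L\<close> in the spread-out case; positivity of \<open>k\<close> rules out
  loops.\<close>

lemma lattice_percolation_edges:
  fixes \<E> :: "'d::finite edge set"
  assumes "\<E> = {{x, y} | x y. R (norm_l1 (x - y))}" "\<And>k. R k \<Longrightarrow> 0 < k \<and> k \<le> int L" "R 1" "1 \<le> L"
  shows "lattice_percolation \<E> L"
proof
  have iff: "{x, y} \<in> \<E> \<longleftrightarrow> R (norm_l1 (x - y))" for x y
    unfolding assms(1) by (auto simp: doubleton_eq_iff norm_l1_commute)
  show "\<exists>x y. e = {x, y} \<and> x \<noteq> y" if "e \<in> \<E>" for e
    using that assms(2)[of 0] unfolding assms(1) by (fastforce simp: norm_l1_def)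
  show "norm_linf (x - y) \<le> int L" if "{x, y} \<in> \<E>" for x y
    using that assms(2) norm_linf_le_l1[of "x - y"] unfolding iff by force
  show "(\<lambda>x. x + z) ` e \<in> \<E>" if e: "e \<in> \<E>" for e z
  proof -
    obtain x y where "e = {x, y}" "R (norm_l1 (x - y))" using e unfolding assms(1) by blast
    then show ?thesis using iff[of "x + z" "y + z"] by simp
  qed
  show "{x, y} \<in> \<E>" if "norm_l1 (x - y) = 1" for x y using assms(3) that by (simp add: iff)
qed (rule assms(4))

theorem theorem1p11:
  fixes \<E> :: "'d::finite edge set"
  assumes edges: "\<E> = nearest_neighbour_edges \<or> (\<exists>L\<ge>1. \<E> = spread_out_edges L)"
    and dim: "CARD('d) > 6"
    and two_point: "two_point_estimate \<E>"
  shows "\<exists>c C :: real. c > 0 \<and> C > 0 \<and>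
           (\<forall>n\<ge>1. c / real n ^ 2 \<le> one_arm \<E> n (p_crit \<E>) \<and>
                   one_arm \<E> n (p_crit \<E>) \<le> C / real n ^ 2)"
proof -
  have zero: "norm_l1 z = 0 \<longleftrightarrow> z = 0" for z :: "int ^ 'd"
    by (simp add: norm_l1_def vec_eq_iff sum_nonneg_eq_0_iff)
  have pos: "0 \<le> norm_l1 z" for z :: "int ^ 'd" by (simp add: norm_l1_def sum_nonneg)
  have "\<exists>L. lattice_percolation \<E> L"
    using edges
  proof
    assume "\<E> = nearest_neighbour_edges"
    then have "lattice_percolation \<E> 1"
      by (intro lattice_percolation_edges[where R = "\<lambda>k. k = 1"]) (auto simp: nearest_neighbour_edges_def)
    then show ?thesis by blast
  next
    assume "\<exists>L\<ge>1. \<E> = spread_out_edges L"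
    then obtain L where L: "1 \<le> L" "\<E> = spread_out_edges L" by blast
    have "x \<noteq> y \<and> norm_l1 (x - y) \<le> int L \<longleftrightarrow> 0 < norm_l1 (x - y) \<and> norm_l1 (x - y) \<le> int L" for x y :: "int ^ 'd"
      using zero[of "x - y"] pos[of "x - y"] by auto
    then have "\<E> = {{x, y} | x y. 0 < norm_l1 (x - y) \<and> norm_l1 (x - y) \<le> int L}" unfolding L(2) spread_out_edges_def by simp
    then have "lattice_percolation \<E> L"
      by (rule lattice_percolation_edges[where R = "\<lambda>k. 0 < k \<and> k \<le> int L"]) (use L(1) in auto)
    then show ?thesis by blast
  qed
  then obtain L where L: "lattice_percolation \<E> L" by blast
  then interpret lattice_percolation \<E> L .
  have powi: "max 1 (real_of_int (norm_linf z)) powi (- (int CARD('d) - 2)) = 1 / jb z ^ (CARD('d) - 2)" for z :: "int ^ 'd"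
  proof -
    have "- (int CARD('d) - 2) = - int (CARD('d) - 2)" using dim by simp
    then show ?thesis unfolding jb_def by (simp only: power_int_minus power_int_of_nat) (simp add: field_simps)
  qed
  obtain a b where ab: "0 < a" "a \<le> b" "\<And>x y. a / jb (x - y) ^ (CARD('d) - 2) \<le> two_point \<E> (p_crit \<E>) x y \<and>
      two_point \<E> (p_crit \<E>) x y \<le> b / jb (x - y) ^ (CARD('d) - 2)"
    using two_point unfolding two_point_estimate_def powi by auto
  interpret critical_percolation \<E> L a b
    by unfold_locales (use dim ab in \<open>simp_all add: two_point_eq_T[OF p_crit_bounds]\<close>)
  show ?thesis by (rule one_arm_critical)
qed

end
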